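(* Let $k$ be a field of arbitrary characteristic, let $Q$ be a finite connected quiver, let $n\ge 2$, and let $A=kQ/k^nQ$ be the truncated quiver algebra. If $Q$ is not a basic cycle, then $$H^0(A)=Z(A),$$ $$\dim_k H^1(A)=\dim_k Z(A)-\sum_{j=0}^{n-1}|(j/\!\!/0)|+\sum_{j=1}^{n-1}|(j/\!\!/1)|,$$ and for every $i\ge 1$ $$\dim_k H^{2i+1}(A)=\sum_{j=1}^{n-1}|(j/\!\!/ni+1)|-\sum_{j=0}^{n-2}\bigl(|(j/\!\!/ni)|-|\{j\text{-extremes}\}|\bigr),$$ $$\dim_k H^{2i}(A)=\sum_{j=1}^{n-1}|\{j\text{-extremes}\}|-|(0/\!\!/n(i-1)+1)|,$$ where $Z(A)$ denotes the center of $A$ and, in the formulas for a given $i$, the $j$-extremes are those defined with respect to the sets $(j/\!\!/ni)$ for that $i$.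
   Context: A quiver $Q=(Q_0,Q_1)$ has vertex set $Q_0$ and arrow set $Q_1$. For a path $p$, $o(p)$, $t(p)$ and $l(p)$ denote its origin, terminus and length. Paths are composed from left to right: $a_1\cdots a_m$ is a path when $t(a_i)=o(a_{i+1})$ for $i=1,\dots,m-1$. Paths of length $0$ are the vertices. $k^nQ$ denotes the ideal of the path algebra $kQ$ generated by all paths of length $\ge n$. An oriented cycle of length $m\ge 1$ is a path $a_1\cdots a_m$ with $t(a_m)=o(a_1)$; it is a basic cycle if it has no self-intersection. "$Q$ is a basic cycle" means that the whole quiver $Q$ consists of such a cycle (a single vertex with one loop is a basic cycle of length $1$). $H^m(A)=\mathrm{Ext}^m_{A^e}(A,A)$ is the $m$-th Hochschild cohomology group, where $A^e=A^{op}\otimes_k A$. For integers $i,j\ge 0$, $(i/\!\!/j)$ denotes the set of pairs $(p,q)$ of paths in $Q$ with $l(p)=i$, $l(q)=j$, $o(p)=o(q)$ and $t(p)=t(q)$. In expressions such as $(j/\!\!/ni+1)$, the two lengths are $j$ and $ni+1$. $j$-extremes. Fix $i\ge 1$, and let $1\le j\le n-2$ and $(p,q)\in(j/\!\!/ni)$. The pair $(p,q)$ starts together (resp. ends together) if the first (resp. last) arrows of $p$ and $q$ coincide. It starts at a source (resp. ends at a sink) if $o(p)=o(q)$ is a source (resp. $t(p)=t(q)$ is a sink) of $Q$. If $(p,q)$ starts together, say $(p,q)=(ap',aq')$ with $a\in Q_1$, and does not end at a sink, then a $+$movement of $(p,q)$ is a pair $(p'b,q'b)$, where $b$ is any arrow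 with $o(b)=t(p)$. If $(p,q)$ does not start together or ends at a sink, then no $+$movement of $(p,q)$ is defined and $(p,q)$ is called a $+$extreme. Analogously, if $(p,q)$ ends together, say $(p,q)=(p'a,q'a)$ with $a\in Q_1$, and does not start at a source, then a $-$movement of $(p,q)$ is a pair $(bp',bq')$, where $b$ is any arrow with $t(b)=o(p)$. If $(p,q)$ does not end together or starts at a source, then $(p,q)$ is called a $-$extreme. Two elements of $(j/\!\!/ni)$ are equivalent if a finite (possibly empty) sequence of $+$ or $-$ movements transforms one into the other. An equivalence class is called a $j$-extreme if all of its $+$extreme elements end at a sink and all of its $-$extreme elements start at a source. $\{j\text{-extremes}\}$ is the set of all $j$-extremes. By convention, $\{0\text{-extremes}\}=\emptyset$ and $\{(n-1)\text{-extremes}\}=(n-1/\!\!/ni)$. *)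

theory Defs
  imports
    "HOL-Algebra.QuotRing"
    "Jordan_Normal_Form.Missing_VectorSpace"
    "Graph_Theory.Graph_Theory"
begin

section \<open>Algebras given by finitely supported functions\<close>

definition finsupp :: "('r, 'c) ring_scheme \<Rightarrow> 'x set \<Rightarrow> ('x \<Rightarrow> 'r) set" where
  "finsupp R X = {f. (\<forall>x. f x \<in> carrier R) \<and> (\<forall>x. x \<notin> X \<longrightarrow> f x = \<zero>\<^bsub>R\<^esub>) \<and>
                     finite {x. f x \<noteq> \<zero>\<^bsub>R\<^esub>}}"

definition basis_elt :: "('r, 'c) ring_scheme \<Rightarrow> 'x \<Rightarrow> 'x \<Rightarrow> 'r" where
  "basis_elt R x = (\<lambda>y. if y = x then \<one>\<^bsub>R\<^esub> else \<zero>\<^bsub>R\<^esub>)"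

text \<open>The algebra with basis \<open>X\<close> whose multiplication extends the partial product \<open>mul\<close>
  bilinearly (\<open>None\<close> meaning that the product is zero) and whose unit is the sum of the basis
  elements in the finite set \<open>E\<close>. It covers both path algebras and monoid algebras. Algebras over
  \<open>K\<close> are records of type \<^typ>\<open>('k, 'a) module\<close>, since these carry a multiplication
  as well as a scalar multiplication; the locale \<^locale>\<open>algebra\<close> itself is unsuitable here
  because it requires commutativity.\<close>

definition conv_algebra ::
    "('k, 'c) ring_scheme \<Rightarrow> 'x set \<Rightarrow> 'x set \<Rightarrow> ('x \<Rightarrow> 'x \<Rightarrow> 'x option) \<Rightarrow> ('k, 'x \<Rightarrow> 'k) module" where
  "conv_algebra K X E mul =
     \<lparr> carrier = finsupp K X,
       monoid.mult = (\<lambda>f g z. finsum K (\<lambda>(x, y). f x \<otimes>\<^bsub>K\<^esub> g y)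
                 {(x, y). f x \<noteq> \<zero>\<^bsub>K\<^esub> \<and> g y \<noteq> \<zero>\<^bsub>K\<^esub> \<and> mul x y = Some z}),
       one = (\<lambda>z. if z \<in> E then \<one>\<^bsub>K\<^esub> else \<zero>\<^bsub>K\<^esub>),
       zero = (\<lambda>z. \<zero>\<^bsub>K\<^esub>),
       add = (\<lambda>f g z. f z \<oplus>\<^bsub>K\<^esub> g z),
       smult = (\<lambda>c f z. c \<otimes>\<^bsub>K\<^esub> f z) \<rparr>"

text \<open>The quotient of an algebra by an ideal, and also the quotient of a vector space by a
  subspace (the multiplicative part being irrelevant in that case).\<close>

definition quot :: "('k, 'a, 'c) module_scheme \<Rightarrow> 'a set \<Rightarrow> ('k, 'a set) module" where
  "quot M I =
     \<lparr> carrier = a_rcosets\<^bsub>M\<^esub> I,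
       monoid.mult = rcoset_mult M I,
       one = I +>\<^bsub>M\<^esub> \<one>\<^bsub>M\<^esub>,
       zero = I,
       add = (<+>\<^bsub>M\<^esub>),
       smult = (\<lambda>c S. \<Union>x\<in>S. I +>\<^bsub>M\<^esub> (c \<odot>\<^bsub>M\<^esub> x)) \<rparr>"

definition center :: "('a, 'c) ring_scheme \<Rightarrow> 'a set" where
  "center A = {z \<in> carrier A. \<forall>x \<in> carrier A. z \<otimes>\<^bsub>A\<^esub> x = x \<otimes>\<^bsub>A\<^esub> z}"

abbreviation center_space :: "('k, 'a, 'c) module_scheme \<Rightarrow> ('k, 'a, 'c) module_scheme" where
  "center_space A \<equiv> A\<lparr>carrier := center A\<rparr>"


section \<open>Tensor products and enveloping algebras\<close>

definition opposite :: "('k, 'a, 'c) module_scheme \<Rightarrow> ('k, 'a, 'c) module_scheme" where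
  "opposite A = A\<lparr>monoid.mult := (\<lambda>x y. y \<otimes>\<^bsub>A\<^esub> x)\<rparr>"

text \<open>\<open>A \<otimes> B\<close> is the free vector space on \<open>A \<times> B\<close> modulo the usual bilinearity relations. The
  free vector space is the monoid algebra of the monoid \<open>A \<times> B\<close>, and the span of the relations
  is closed under multiplication by basis elements, so it coincides with the ideal generated
  by them.\<close>

definition pair_algebra ::
    "('k, 'c) ring_scheme \<Rightarrow> ('k, 'a, 'd) module_scheme \<Rightarrow> ('k, 'b, 'e) module_scheme
      \<Rightarrow> ('k, 'a \<times> 'b \<Rightarrow> 'k) module" where
  "pair_algebra K A B = conv_algebra K (carrier A \<times> carrier B) {(\<one>\<^bsub>A\<^esub>, \<one>\<^bsub>B\<^esub>)}
     (\<lambda>(a, b) (a', b'). Some (a \<otimes>\<^bsub>A\<^esub> a', b \<otimes>\<^bsub>B\<^esub> b'))"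

definition tensor_relations ::
    "('k, 'c) ring_scheme \<Rightarrow> ('k, 'a, 'd) module_scheme \<Rightarrow> ('k, 'b, 'e) module_scheme
      \<Rightarrow> ('a \<times> 'b \<Rightarrow> 'k) set" where
  "tensor_relations K A B =
     (let F = pair_algebra K A B; e = basis_elt K in
       {e (a \<oplus>\<^bsub>A\<^esub> a', b) \<ominus>\<^bsub>F\<^esub> (e (a, b) \<oplus>\<^bsub>F\<^esub> e (a', b)) | a a' b.
          a \<in> carrier A \<and> a' \<in> carrier A \<and> b \<in> carrier B} \<union>
       {e (a, b \<oplus>\<^bsub>B\<^esub> b') \<ominus>\<^bsub>F\<^esub> (e (a, b) \<oplus>\<^bsub>F\<^esub> e (a, b')) | a b b'.
          a \<in> carrier A \<and> b \<in> carrier B \<and> b' \<in> carrier B} \<union>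
       {e (c \<odot>\<^bsub>A\<^esub> a, b) \<ominus>\<^bsub>F\<^esub> c \<odot>\<^bsub>F\<^esub> e (a, b) | c a b.
          c \<in> carrier K \<and> a \<in> carrier A \<and> b \<in> carrier B} \<union>
       {e (a, c \<odot>\<^bsub>B\<^esub> b) \<ominus>\<^bsub>F\<^esub> c \<odot>\<^bsub>F\<^esub> e (a, b) | c a b.
          c \<in> carrier K \<and> a \<in> carrier A \<and> b \<in> carrier B})"

definition tensor_algebra ::
    "('k, 'c) ring_scheme \<Rightarrow> ('k, 'a, 'd) module_scheme \<Rightarrow> ('k, 'b, 'e) module_scheme
      \<Rightarrow> ('k, ('a \<times> 'b \<Rightarrow> 'k) set) module" where
  "tensor_algebra K A B =
     quot (pair_algebra K A B) (genideal (pair_algebra K A B) (tensor_relations K A B))"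

definition enveloping ::
    "('k, 'c) ring_scheme \<Rightarrow> ('k, 'a, 'd) module_scheme \<Rightarrow> ('k, ('a \<times> 'a \<Rightarrow> 'k) set) module" where
  "enveloping K A = tensor_algebra K (opposite A) A"

text \<open>\<open>A\<close> as a left module over its enveloping algebra: \<open>(a \<otimes> b) x = b x a\<close>. This value
  does not depend on the representative of the coset \<open>S\<close>.\<close>

definition regular_bimodule ::
    "('k, 'c) ring_scheme \<Rightarrow> ('k, 'a, 'd) module_scheme \<Rightarrow> (('a \<times> 'a \<Rightarrow> 'k) set, 'a) module" where
  "regular_bimodule K A =
     \<lparr> carrier = carrier A, monoid.mult = monoid.mult A, one = one A, zero = zero A, add = add A,
       smult = (\<lambda>S x. THE y. \<exists>f\<in>S. y =
         finsum A (\<lambda>(a, b). f (a, b) \<odot>\<^bsub>A\<^esub> (b \<otimes>\<^bsub>A\<^esub> x \<otimes>\<^bsub>A\<^esub> a)) {z. f z \<noteq> \<zero>\<^bsub>K\<^esub>}) \<rparr>"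


section \<open>Modules and Ext over noncommutative rings\<close>

text \<open>The locale \<^locale>\<open>module\<close> requires a commutative ring of scalars.\<close>

locale left_module = R?: ring R + M?: abelian_group M
  for R :: "('r, 'c) ring_scheme" (structure) and M :: "('r, 'm, 'd) module_scheme" (structure) +
  assumes lsmult_closed: "\<lbrakk>r \<in> carrier R; x \<in> carrier M\<rbrakk> \<Longrightarrow> r \<odot>\<^bsub>M\<^esub> x \<in> carrier M"
    and lsmult_l_distr: "\<lbrakk>r \<in> carrier R; s \<in> carrier R; x \<in> carrier M\<rbrakk>
      \<Longrightarrow> (r \<oplus>\<^bsub>R\<^esub> s) \<odot>\<^bsub>M\<^esub> x = r \<odot>\<^bsub>M\<^esub> x \<oplus>\<^bsub>M\<^esub> s \<odot>\<^bsub>M\<^esub> x"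
    and lsmult_r_distr: "\<lbrakk>r \<in> carrier R; x \<in> carrier M; y \<in> carrier M\<rbrakk>
      \<Longrightarrow> r \<odot>\<^bsub>M\<^esub> (x \<oplus>\<^bsub>M\<^esub> y) = r \<odot>\<^bsub>M\<^esub> x \<oplus>\<^bsub>M\<^esub> r \<odot>\<^bsub>M\<^esub> y"
    and lsmult_assoc: "\<lbrakk>r \<in> carrier R; s \<in> carrier R; x \<in> carrier M\<rbrakk>
      \<Longrightarrow> (r \<otimes>\<^bsub>R\<^esub> s) \<odot>\<^bsub>M\<^esub> x = r \<odot>\<^bsub>M\<^esub> (s \<odot>\<^bsub>M\<^esub> x)"
    and lsmult_one: "x \<in> carrier M \<Longrightarrow> \<one>\<^bsub>R\<^esub> \<odot>\<^bsub>M\<^esub> x = x"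

definition lin_homs ::
    "('r, 'c) ring_scheme \<Rightarrow> ('r, 'm, 'd) module_scheme \<Rightarrow> ('r, 'n, 'e) module_scheme \<Rightarrow> ('m \<Rightarrow> 'n) set" where
  "lin_homs R M N = {f \<in> carrier M \<rightarrow>\<^sub>E carrier N.
     (\<forall>x \<in> carrier M. \<forall>y \<in> carrier M. f (x \<oplus>\<^bsub>M\<^esub> y) = f x \<oplus>\<^bsub>N\<^esub> f y) \<and>
     (\<forall>r \<in> carrier R. \<forall>x \<in> carrier M. f (r \<odot>\<^bsub>M\<^esub> x) = r \<odot>\<^bsub>N\<^esub> f x)}"

definition free_module :: "('r, 'c) ring_scheme \<Rightarrow> 'x set \<Rightarrow> ('r, 'x \<Rightarrow> 'r) module" where
  "free_module R X =
     \<lparr> carrier = finsupp R X, monoid.mult = undefined, one = undefined,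
       zero = (\<lambda>x. \<zero>\<^bsub>R\<^esub>),
       add = (\<lambda>f g x. f x \<oplus>\<^bsub>R\<^esub> g x),
       smult = (\<lambda>r f x. r \<otimes>\<^bsub>R\<^esub> f x) \<rparr>"

text \<open>A module is projective if it is a direct summand of a free module. Taking the basis \<open>X\<close> in
  the type of the module elements is no restriction, since a projective module is a direct
  summand of the free module on its own carrier.\<close>

definition projective :: "('r, 'c) ring_scheme \<Rightarrow> ('r, 'm, 'd) module_scheme \<Rightarrow> bool" where
  "projective R P \<longleftrightarrow> left_module R P \<and>
     (\<exists>(X :: 'm set) \<iota> \<pi>. \<iota> \<in> lin_homs R P (free_module R X) \<and> \<pi> \<in> lin_homs R (free_module R X) P \<and>
       (\<forall>x \<in> carrier P. \<pi> (\<iota> x) = x))"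

text \<open>\<open>\<dots> \<rightarrow> P 2 \<rightarrow> P 1 \<rightarrow> P 0 \<rightarrow> M \<rightarrow> 0\<close> with differentials \<open>d i : P (i + 1) \<rightarrow> P i\<close> and
  augmentation \<open>\<epsilon> : P 0 \<rightarrow> M\<close>.\<close>

definition projective_resolution ::
    "('r, 'c) ring_scheme \<Rightarrow> ('r, 'm, 'd) module_scheme
      \<Rightarrow> (nat \<Rightarrow> ('r, 'p) module) \<times> (nat \<Rightarrow> 'p \<Rightarrow> 'p) \<times> ('p \<Rightarrow> 'm) \<Rightarrow> bool" where
  "projective_resolution R M = (\<lambda>(P, d, \<epsilon>).
     (\<forall>i. projective R (P i)) \<and>
     (\<forall>i. d i \<in> lin_homs R (P (Suc i)) (P i)) \<and>
     \<epsilon> \<in> lin_homs R (P 0) M \<and>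
     \<epsilon> ` carrier (P 0) = carrier M \<and>
     {x \<in> carrier (P 0). \<epsilon> x = \<zero>\<^bsub>M\<^esub>} = d 0 ` carrier (P 1) \<and>
     (\<forall>i. {x \<in> carrier (P (Suc i)). d i x = \<zero>\<^bsub>P i\<^esub>} = d (Suc i) ` carrier (P (Suc (Suc i)))))"

text \<open>A type that is large enough to index free generators for every step of a resolution of a
  module with elements in \<open>'m\<close> over a ring with elements in \<open>'r\<close>: the generators of degree \<open>0\<close>
  are elements of the module, and those of a higher degree are linear combinations of generators
  of the previous degree.\<close>

datatype ('m, 'r) gen = Gen 'm | Syz "(('m, 'r) gen \<times> 'r) list"

definition resolution ::
    "('r, 'c) ring_scheme \<Rightarrow> ('r, 'm, 'd) module_scheme
      \<Rightarrow> (nat \<Rightarrow> ('r, ('m, 'r) gen \<Rightarrow> 'r) module)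
         \<times> (nat \<Rightarrow> (('m, 'r) gen \<Rightarrow> 'r) \<Rightarrow> (('m, 'r) gen \<Rightarrow> 'r)) \<times> ((('m, 'r) gen \<Rightarrow> 'r) \<Rightarrow> 'm)" where
  "resolution R M = (SOME res. projective_resolution R M res)"

definition res_module where "res_module R M = fst (resolution R M)"
definition res_diff where "res_diff R M = fst (snd (resolution R M))"
definition res_aug where "res_aug R M = snd (snd (resolution R M))"

text \<open>The following facts show that \<^const>\<open>resolution\<close> is a projective resolution of every
  left module: one can take the free resolution whose generators in each degree are the elements
  of the previous kernel.\<close>

lemma (in left_module) lsmult_zero:
  assumes "x \<in> carrier M" shows "\<zero>\<^bsub>R\<^esub> \<odot>\<^bsub>M\<^esub> x = \<zero>\<^bsub>M\<^esub>"
proof -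
  have "\<zero>\<^bsub>R\<^esub> \<odot>\<^bsub>M\<^esub> x \<oplus>\<^bsub>M\<^esub> \<zero>\<^bsub>R\<^esub> \<odot>\<^bsub>M\<^esub> x = \<zero>\<^bsub>R\<^esub> \<odot>\<^bsub>M\<^esub> x"
    using lsmult_l_distr[of "\<zero>\<^bsub>R\<^esub>" "\<zero>\<^bsub>R\<^esub>" x] assms by simp
  thus ?thesis
    by (metis M.add.l_cancel_one' R.zero_closed assms lsmult_closed)
qed

lemma (in left_module) lsmult_finsum:
  assumes "finite S" "r \<in> carrier R" "\<And>x. x \<in> S \<Longrightarrow> g x \<in> carrier M"
  shows "finsum M (\<lambda>x. r \<odot>\<^bsub>M\<^esub> g x) S = r \<odot>\<^bsub>M\<^esub> finsum M g S"
  using assms(1,3)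
proof (induction S)
  case empty
  have "r \<odot>\<^bsub>M\<^esub> \<zero>\<^bsub>M\<^esub> \<oplus>\<^bsub>M\<^esub> r \<odot>\<^bsub>M\<^esub> \<zero>\<^bsub>M\<^esub> = r \<odot>\<^bsub>M\<^esub> \<zero>\<^bsub>M\<^esub>"
    using lsmult_r_distr[of r "\<zero>\<^bsub>M\<^esub>" "\<zero>\<^bsub>M\<^esub>"] assms(2) by simp
  hence "r \<odot>\<^bsub>M\<^esub> \<zero>\<^bsub>M\<^esub> = \<zero>\<^bsub>M\<^esub>"
    by (metis M.add.l_cancel_one' M.zero_closed assms(2) lsmult_closed)
  thus ?case by simp
next
  case (insert x S)
  thus ?case using assms(2)
    by (simp add: Pi_def lsmult_closed lsmult_r_distr M.finsum_closed)
qed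

lemma (in ring) left_module_free: "left_module R (free_module R X)"
proof -
  have ab: "abelian_group (free_module R X)"
  proof (rule abelian_groupI)
    fix f g assume "f \<in> carrier (free_module R X)" "g \<in> carrier (free_module R X)"
    hence fg: "f \<in> finsupp R X" "g \<in> finsupp R X" by (auto simp: free_module_def)
    have "finite ({x. f x \<noteq> \<zero>} \<union> {x. g x \<noteq> \<zero>})" using fg by (auto simp: finsupp_def)
    moreover have "{x. f x \<oplus> g x \<noteq> \<zero>} \<subseteq> {x. f x \<noteq> \<zero>} \<union> {x. g x \<noteq> \<zero>}" by auto
    ultimately have "finite {x. f x \<oplus> g x \<noteq> \<zero>}" using finite_subset by blast
    thus "f \<oplus>\<^bsub>free_module R X\<^esub> g \<in> carrier (free_module R X)"
      using fg by (auto simp: free_module_def finsupp_def)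
  next
    show "\<zero>\<^bsub>free_module R X\<^esub> \<in> carrier (free_module R X)"
      by (auto simp: free_module_def finsupp_def)
  next
    fix f assume "f \<in> carrier (free_module R X)"
    hence f: "f \<in> finsupp R X" by (auto simp: free_module_def)
    let ?g = "\<lambda>x. \<ominus> f x"
    have "{x. ?g x \<noteq> \<zero>} \<subseteq> {x. f x \<noteq> \<zero>}" by auto
    hence "finite {x. ?g x \<noteq> \<zero>}" using f finite_subset by (fastforce simp: finsupp_def)
    hence "?g \<in> finsupp R X" using f by (auto simp: finsupp_def)
    moreover have "(\<lambda>x. ?g x \<oplus> f x) = (\<lambda>x. \<zero>)" using f by (auto simp: finsupp_def l_neg)
    ultimately show "\<exists>y\<in>carrier (free_module R X). y \<oplus>\<^bsub>free_module R X\<^esub> f = \<zero>\<^bsub>free_module R X\<^esub>"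
      by (intro bexI[of _ ?g]) (auto simp: free_module_def)
  qed (auto simp: free_module_def finsupp_def a_ac fun_eq_iff)
  interpret M: abelian_group "free_module R X" by (rule ab)
  show ?thesis
  proof (unfold_locales)
    fix r f assume r: "r \<in> carrier R" and "f \<in> carrier (free_module R X)"
    hence f: "f \<in> finsupp R X" by (auto simp: free_module_def)
    have "{x. r \<otimes> f x \<noteq> \<zero>} \<subseteq> {x. f x \<noteq> \<zero>}" using r by auto
    hence "finite {x. r \<otimes> f x \<noteq> \<zero>}" using f finite_subset by (fastforce simp: finsupp_def)
    thus "r \<odot>\<^bsub>free_module R X\<^esub> f \<in> carrier (free_module R X)"
      using f r by (auto simp: free_module_def finsupp_def)
  qed (auto simp: free_module_def finsupp_def l_distr r_distr m_assoc fun_eq_iff)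
qed

definition ext_map where
  "ext_map R X N \<phi> = (\<lambda>f \<in> finsupp R X. finsum N (\<lambda>x. f x \<odot>\<^bsub>N\<^esub> \<phi> x) {x. f x \<noteq> \<zero>\<^bsub>R\<^esub>})"

lemma (in left_module) ext_map_superset:
  assumes f: "f \<in> finsupp R X" and \<phi>: "\<And>x. x \<in> X \<Longrightarrow> \<phi> x \<in> carrier M"
    and S: "finite S" "{x. f x \<noteq> \<zero>} \<subseteq> S" "S \<subseteq> X"
  shows "ext_map R X M \<phi> f = finsum M (\<lambda>x. f x \<odot>\<^bsub>M\<^esub> \<phi> x) S"
proof -
  have c: "f x \<odot>\<^bsub>M\<^esub> \<phi> x \<in> carrier M" if "x \<in> S" for x
    using that S f \<phi> by (intro lsmult_closed) (auto simp: finsupp_def)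
  have "finsum M (\<lambda>x. f x \<odot>\<^bsub>M\<^esub> \<phi> x) {x. f x \<noteq> \<zero>} = finsum M (\<lambda>x. f x \<odot>\<^bsub>M\<^esub> \<phi> x) S"
    by (rule M.add.finprod_mono_neutral_cong_left) (use S c \<phi> in \<open>auto simp: lsmult_zero subset_iff\<close>)
  thus ?thesis using f by (simp add: ext_map_def)
qed

lemma (in left_module) ext_map_hom:
  assumes \<phi>: "\<And>x. x \<in> X \<Longrightarrow> \<phi> x \<in> carrier M"
  shows "ext_map R X M \<phi> \<in> lin_homs R (free_module R X) M"
proof -
  interpret F: left_module R "free_module R X" by (rule R.left_module_free)
  have car: "carrier (free_module R X) = finsupp R X" by (simp add: free_module_def)
  have supp: "{x. f x \<noteq> \<zero>} \<subseteq> X" "finite {x. f x \<noteq> \<zero>}" if "f \<in> finsupp R X" for f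
    using that by (auto simp: finsupp_def)
  have c: "f x \<odot>\<^bsub>M\<^esub> \<phi> x \<in> carrier M" if "x \<in> X" "f \<in> finsupp R X" for x f
    using that \<phi> by (intro lsmult_closed) (auto simp: finsupp_def)
  show ?thesis unfolding lin_homs_def car
  proof (intro CollectI conjI ballI)
    show "ext_map R X M \<phi> \<in> finsupp R X \<rightarrow>\<^sub>E carrier M"
    proof (rule PiE_I)
      fix f assume f: "f \<in> finsupp R X"
      show "ext_map R X M \<phi> f \<in> carrier M"
        using f supp(1)[OF f] c[OF _ f] by (auto simp: ext_map_def intro!: M.finsum_closed)
    qed (auto simp: ext_map_def)
  next
    fix f g assume f: "f \<in> finsupp R X" and g: "g \<in> finsupp R X"
    let ?S = "{x. f x \<noteq> \<zero>} \<union> {x. g x \<noteq> \<zero>}"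
    have S: "finite ?S" "?S \<subseteq> X" using supp[OF f] supp[OF g] by auto
    have fg: "f \<oplus>\<^bsub>free_module R X\<^esub> g \<in> finsupp R X" using f g F.M.a_closed car by blast
    have eq: "f \<oplus>\<^bsub>free_module R X\<^esub> g = (\<lambda>x. f x \<oplus> g x)" by (simp add: free_module_def)
    have sub: "{x. f x \<oplus> g x \<noteq> \<zero>} \<subseteq> ?S" by auto
    have "ext_map R X M \<phi> (f \<oplus>\<^bsub>free_module R X\<^esub> g)
        = finsum M (\<lambda>x. (f x \<oplus> g x) \<odot>\<^bsub>M\<^esub> \<phi> x) ?S"
      using ext_map_superset[where f = "f \<oplus>\<^bsub>free_module R X\<^esub> g" and X = X and \<phi> = \<phi> and S = ?S,
          OF fg \<phi>] S sub by (simp add: eq)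
    also have "\<dots> = finsum M (\<lambda>x. f x \<odot>\<^bsub>M\<^esub> \<phi> x \<oplus>\<^bsub>M\<^esub> g x \<odot>\<^bsub>M\<^esub> \<phi> x) ?S"
    proof (rule M.finsum_cong')
      fix x assume "x \<in> ?S"
      hence "x \<in> X" using S by blast
      thus "(f x \<oplus> g x) \<odot>\<^bsub>M\<^esub> \<phi> x = f x \<odot>\<^bsub>M\<^esub> \<phi> x \<oplus>\<^bsub>M\<^esub> g x \<odot>\<^bsub>M\<^esub> \<phi> x"
        using f g \<phi> by (intro lsmult_l_distr) (auto simp: finsupp_def)
    next
      show "(\<lambda>x. f x \<odot>\<^bsub>M\<^esub> \<phi> x \<oplus>\<^bsub>M\<^esub> g x \<odot>\<^bsub>M\<^esub> \<phi> x) \<in> ?S \<rightarrow> carrier M"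
        using S(2) c f g by blast
    qed simp
    also have "\<dots> = finsum M (\<lambda>x. f x \<odot>\<^bsub>M\<^esub> \<phi> x) ?S \<oplus>\<^bsub>M\<^esub> finsum M (\<lambda>x. g x \<odot>\<^bsub>M\<^esub> \<phi> x) ?S"
      using S(2) c f g by (intro M.finsum_addf) blast+
    also have "\<dots> = ext_map R X M \<phi> f \<oplus>\<^bsub>M\<^esub> ext_map R X M \<phi> g"
      using ext_map_superset[where f = f and X = X and \<phi> = \<phi> and S = ?S, OF f \<phi>]
        ext_map_superset[where f = g and X = X and \<phi> = \<phi> and S = ?S, OF g \<phi>] S by simp
    finally show "ext_map R X M \<phi> (f \<oplus>\<^bsub>free_module R X\<^esub> g) = ext_map R X M \<phi> f \<oplus>\<^bsub>M\<^esub> ext_map R X M \<phi> g" .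
  next
    fix r f assume r: "r \<in> carrier R" and f: "f \<in> finsupp R X"
    let ?S = "{x. f x \<noteq> \<zero>}"
    have rf: "r \<odot>\<^bsub>free_module R X\<^esub> f \<in> finsupp R X" using f r F.lsmult_closed car by blast
    have eq: "r \<odot>\<^bsub>free_module R X\<^esub> f = (\<lambda>x. r \<otimes> f x)" by (simp add: free_module_def)
    have sub: "{x. r \<otimes> f x \<noteq> \<zero>} \<subseteq> ?S" using r by auto
    have "ext_map R X M \<phi> (r \<odot>\<^bsub>free_module R X\<^esub> f)
        = finsum M (\<lambda>x. (r \<otimes> f x) \<odot>\<^bsub>M\<^esub> \<phi> x) ?S"
      using ext_map_superset[where f = "r \<odot>\<^bsub>free_module R X\<^esub> f" and X = X and \<phi> = \<phi> and S = ?S,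
          OF rf \<phi>] supp[OF f] sub by (simp add: eq)
    also have "\<dots> = finsum M (\<lambda>x. r \<odot>\<^bsub>M\<^esub> (f x \<odot>\<^bsub>M\<^esub> \<phi> x)) ?S"
    proof (rule M.finsum_cong')
      fix x assume "x \<in> ?S"
      hence "x \<in> X" using supp(1)[OF f] by blast
      thus "(r \<otimes> f x) \<odot>\<^bsub>M\<^esub> \<phi> x = r \<odot>\<^bsub>M\<^esub> (f x \<odot>\<^bsub>M\<^esub> \<phi> x)"
        using f r \<phi> by (intro lsmult_assoc) (auto simp: finsupp_def)
    next
      show "(\<lambda>x. r \<odot>\<^bsub>M\<^esub> (f x \<odot>\<^bsub>M\<^esub> \<phi> x)) \<in> ?S \<rightarrow> carrier M"
        using supp(1)[OF f] c f r lsmult_closed by blast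
    qed simp
    also have "\<dots> = r \<odot>\<^bsub>M\<^esub> finsum M (\<lambda>x. f x \<odot>\<^bsub>M\<^esub> \<phi> x) ?S"
      using supp[OF f] r c f by (intro lsmult_finsum) blast+
    finally show "ext_map R X M \<phi> (r \<odot>\<^bsub>free_module R X\<^esub> f) = r \<odot>\<^bsub>M\<^esub> ext_map R X M \<phi> f"
      using f by (simp add: ext_map_def)
  qed
qed

lemma (in ring) basis_elt_finsupp: "x \<in> X \<Longrightarrow> basis_elt R x \<in> finsupp R X"
  using finite_subset[of "{y. basis_elt R x y \<noteq> \<zero>}" "{x}"]
  by (auto simp: finsupp_def basis_elt_def)

lemma (in left_module) ext_map_basis_elt:
  assumes "\<And>x. x \<in> X \<Longrightarrow> \<phi> x \<in> carrier M" "x \<in> X"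
  shows "ext_map R X M \<phi> (basis_elt R x) = \<phi> x"
proof -
  have "ext_map R X M \<phi> (basis_elt R x) = finsum M (\<lambda>y. basis_elt R x y \<odot>\<^bsub>M\<^esub> \<phi> y) {x}"
    using assms by (intro ext_map_superset R.basis_elt_finsupp) (auto simp: basis_elt_def)
  thus ?thesis using assms by (simp add: basis_elt_def lsmult_one)
qed

lemma (in ring) hom_eq_on_free:
  assumes h: "h \<in> lin_homs R (free_module R X) M" and g: "g \<in> lin_homs R (free_module R X) M"
    and eq: "\<And>x. x \<in> X \<Longrightarrow> h (basis_elt R x) = g (basis_elt R x)"
    and M: "left_module R M" and f: "f \<in> finsupp R X"
  shows "h f = g f"
proof -
  interpret M: left_module R M by (rule M)
  interpret F: left_module R "free_module R X" by (rule left_module_free)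
  have car: "carrier (free_module R X) = finsupp R X" by (simp add: free_module_def)
  have fin: "finite {x. f x \<noteq> \<zero>}" using f by (simp add: finsupp_def)
  show ?thesis using f
  proof (induction "card {x. f x \<noteq> \<zero>}" arbitrary: f)
    case 0
    hence "f = (\<lambda>x. \<zero>)" by (auto simp: finsupp_def)
    hence f0: "f = \<zero> \<odot>\<^bsub>free_module R X\<^esub> f" using 0 by (auto simp: free_module_def)
    have "h (\<zero> \<odot>\<^bsub>free_module R X\<^esub> f) = \<zero> \<odot>\<^bsub>M\<^esub> h f" "g (\<zero> \<odot>\<^bsub>free_module R X\<^esub> f) = \<zero> \<odot>\<^bsub>M\<^esub> g f"
      using h g 0(2) by (simp_all add: lin_homs_def car)
    moreover have "h f \<in> carrier M" "g f \<in> carrier M"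
      using h g 0(2) car by (auto simp: lin_homs_def)
    ultimately show ?case using f0 by (simp add: M.lsmult_zero)
  next
    case (Suc k)
    then obtain x where x: "f x \<noteq> \<zero>" by (metis (mono_tags, lifting) Collect_empty_eq card.empty nat.distinct(1))
    hence xX: "x \<in> X" using Suc.prems by (auto simp: finsupp_def)
    let ?f = "f(x := \<zero>)"
    have fin: "finite {x. f x \<noteq> \<zero>}" using Suc.prems by (auto simp: finsupp_def)
    have s: "{y. ?f y \<noteq> \<zero>} = {y. f y \<noteq> \<zero>} - {x}" by auto
    have ff: "?f \<in> finsupp R X" using Suc.prems s by (auto simp: finsupp_def)
    have "k = card {y. ?f y \<noteq> \<zero>}" using Suc(2) x fin unfolding s by simp
    hence IH: "h ?f = g ?f" using Suc(1) ff by blast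
    have fx: "f x \<in> carrier R" using Suc.prems by (auto simp: finsupp_def)
    have dec: "f = ?f \<oplus>\<^bsub>free_module R X\<^esub> f x \<odot>\<^bsub>free_module R X\<^esub> basis_elt R x"
      using Suc.prems by (auto simp: free_module_def basis_elt_def finsupp_def fun_eq_iff)
    have b: "basis_elt R x \<in> finsupp R X" using xX by (rule basis_elt_finsupp)
    have sb: "f x \<odot>\<^bsub>free_module R X\<^esub> basis_elt R x \<in> finsupp R X"
      using F.lsmult_closed fx b car by blast
    have "h (?f \<oplus>\<^bsub>free_module R X\<^esub> f x \<odot>\<^bsub>free_module R X\<^esub> basis_elt R x)
        = h ?f \<oplus>\<^bsub>M\<^esub> f x \<odot>\<^bsub>M\<^esub> h (basis_elt R x)"
      using h ff b sb fx by (simp add: lin_homs_def car)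
    moreover have "g (?f \<oplus>\<^bsub>free_module R X\<^esub> f x \<odot>\<^bsub>free_module R X\<^esub> basis_elt R x)
        = g ?f \<oplus>\<^bsub>M\<^esub> f x \<odot>\<^bsub>M\<^esub> g (basis_elt R x)"
      using g ff b sb fx by (simp add: lin_homs_def car)
    ultimately show ?case using IH eq[OF xX] dec by simp
  qed
qed

lemma (in ring) projective_free: "projective R (free_module R X)"
proof -
  let ?P = "free_module R X" and ?Y = "basis_elt R ` X"
  let ?G = "free_module R ?Y"
  let ?i = "ext_map R X ?G (\<lambda>x. basis_elt R (basis_elt R x))"
  let ?p = "ext_map R ?Y ?P (\<lambda>y. y)"
  let ?c = "\<lambda>f \<in> finsupp R X. ?p (?i f)"
  let ?id = "\<lambda>f \<in> finsupp R X. f"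
  have car: "carrier ?P = finsupp R X" "carrier ?G = finsupp R ?Y" by (simp_all add: free_module_def)
  interpret P: left_module R ?P by (rule left_module_free)
  interpret G: left_module R ?G by (rule left_module_free)
  have y: "y \<in> carrier ?P" if "y \<in> ?Y" for y using that basis_elt_finsupp car by auto
  have x: "basis_elt R (basis_elt R x) \<in> carrier ?G" if "x \<in> X" for x
    using that basis_elt_finsupp[of "basis_elt R x" ?Y] car by auto
  have i: "?i \<in> lin_homs R ?P ?G" by (rule G.ext_map_hom) (rule x)
  have p: "?p \<in> lin_homs R ?G ?P" by (rule P.ext_map_hom) (rule y)
  have ic: "?i f \<in> carrier ?G" if "f \<in> finsupp R X" for f
    using that i car by (auto simp: lin_homs_def)
  have "?c \<in> lin_homs R ?P ?P"
    using i p ic P.M.a_closed P.lsmult_closed unfolding lin_homs_def car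
    by (auto simp: car PiE_iff)
  moreover have "?id \<in> lin_homs R ?P ?P"
    using P.M.a_closed P.lsmult_closed unfolding lin_homs_def car by (auto simp: car)
  moreover have "?c (basis_elt R x) = ?id (basis_elt R x)" if "x \<in> X" for x
    using that G.ext_map_basis_elt[OF x that] P.ext_map_basis_elt[OF y, where x = "basis_elt R x"]
    by (simp add: basis_elt_finsupp)
  ultimately have "?c f = ?id f" if "f \<in> finsupp R X" for f
    using hom_eq_on_free[OF _ _ _ left_module_free that] by blast
  hence "?p (?i f) = f" if "f \<in> carrier ?P" for f using that car by fastforce
  thus ?thesis unfolding projective_def using i p left_module_free by blast
qed

lemma (in left_module) ext_map_image:
  assumes inj: "inj_on code N" and N: "N \<subseteq> carrier M" and zero: "\<zero>\<^bsub>M\<^esub> \<in> N"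
    and add: "\<And>x y. x \<in> N \<Longrightarrow> y \<in> N \<Longrightarrow> x \<oplus>\<^bsub>M\<^esub> y \<in> N"
    and smult: "\<And>r x. r \<in> carrier R \<Longrightarrow> x \<in> N \<Longrightarrow> r \<odot>\<^bsub>M\<^esub> x \<in> N"
  shows "ext_map R (code ` N) M (inv_into N code) \<in> lin_homs R (free_module R (code ` N)) M"
    and "ext_map R (code ` N) M (inv_into N code) ` finsupp R (code ` N) = N"
proof -
  let ?\<phi> = "inv_into N code" and ?X = "code ` N"
  have \<phi>N: "?\<phi> x \<in> N" if "x \<in> ?X" for x using that by (rule inv_into_into)
  hence \<phi>: "?\<phi> x \<in> carrier M" if "x \<in> ?X" for x using that N by blast
  show "ext_map R ?X M ?\<phi> \<in> lin_homs R (free_module R ?X) M" by (rule ext_map_hom) (rule \<phi>)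
  have sum: "finsum M g S \<in> N" if "finite S" "\<And>x. x \<in> S \<Longrightarrow> g x \<in> N" for g S
    using that
  proof (induction S)
    case empty thus ?case using zero by simp
  next
    case (insert x S)
    have "finsum M g (insert x S) = g x \<oplus>\<^bsub>M\<^esub> finsum M g S"
      using insert N by (intro M.finsum_insert) auto
    thus ?case using insert add by simp
  qed
  show "ext_map R ?X M ?\<phi> ` finsupp R ?X = N"
  proof (intro equalityI subsetI)
    fix y assume "y \<in> ext_map R ?X M ?\<phi> ` finsupp R ?X"
    then obtain f where f: "f \<in> finsupp R ?X" "y = ext_map R ?X M ?\<phi> f" by auto
    show "y \<in> N" unfolding f(2) ext_map_def using f(1)
      by (auto simp: finsupp_def intro!: sum smult \<phi>N)
  next
    fix y assume y: "y \<in> N"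
    have "ext_map R ?X M ?\<phi> (basis_elt R (code y)) = ?\<phi> (code y)"
      using y by (intro ext_map_basis_elt \<phi>) auto
    also have "\<dots> = y" using inj y by simp
    finally show "y \<in> ext_map R ?X M ?\<phi> ` finsupp R ?X"
      using y R.basis_elt_finsupp[of "code y" ?X] by (metis imageI)
  qed
qed

definition syz_code :: "('r, 'c) ring_scheme \<Rightarrow> (('m, 'r) gen \<Rightarrow> 'r) \<Rightarrow> ('m, 'r) gen" where
  "syz_code R f = Syz (SOME l. set l = {(x, f x) | x. f x \<noteq> \<zero>\<^bsub>R\<^esub>})"

lemma syz_code_inj: "inj_on (syz_code R) (finsupp R X)"
proof (rule inj_onI)
  fix f g assume f: "f \<in> finsupp R X" and g: "g \<in> finsupp R X" and eq: "syz_code R f = syz_code R g"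
  have ex: "\<exists>l. set l = {(x, h x) | x. h x \<noteq> \<zero>\<^bsub>R\<^esub>}" if "h \<in> finsupp R X" for h
  proof (rule finite_list)
    have "finite ((\<lambda>x. (x, h x)) ` {x. h x \<noteq> \<zero>\<^bsub>R\<^esub>})" using that by (auto simp: finsupp_def)
    thus "finite {(x, h x) | x. h x \<noteq> \<zero>\<^bsub>R\<^esub>}" by (simp add: setcompr_eq_image)
  qed
  have s: "set (SOME l. set l = {(x, h x) | x. h x \<noteq> \<zero>\<^bsub>R\<^esub>}) = {(x, h x) | x. h x \<noteq> \<zero>\<^bsub>R\<^esub>}"
    if "h \<in> finsupp R X" for h by (rule someI_ex[OF ex[OF that]])
  have eq': "(SOME l. set l = {(x, f x) | x. f x \<noteq> \<zero>\<^bsub>R\<^esub>}) = (SOME l. set l = {(x, g x) | x. g x \<noteq> \<zero>\<^bsub>R\<^esub>})"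
    using eq by (simp only: syz_code_def gen.inject)
  have "{(x, f x) | x. f x \<noteq> \<zero>\<^bsub>R\<^esub>} = {(x, g x) | x. g x \<noteq> \<zero>\<^bsub>R\<^esub>}"
    by (rule trans[OF s[OF f, symmetric] trans[OF arg_cong[OF eq', of set] s[OF g]]])
  hence "(x, r) \<in> {(x, f x) | x. f x \<noteq> \<zero>\<^bsub>R\<^esub>} \<longleftrightarrow> (x, r) \<in> {(x, g x) | x. g x \<noteq> \<zero>\<^bsub>R\<^esub>}" for x r
    by (rule eqset_imp_iff)
  hence *: "f x \<noteq> \<zero>\<^bsub>R\<^esub> \<and> r = f x \<longleftrightarrow> g x \<noteq> \<zero>\<^bsub>R\<^esub> \<and> r = g x" for x r
    by auto
  show "f = g"
  proof
    fix x show "f x = g x" using *[of x "f x"] *[of x "g x"] by argo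
  qed
qed

lemma (in left_module) kernel_submodule:
  assumes N: "left_module R N" and h: "h \<in> lin_homs R M N"
  defines "Z \<equiv> {x \<in> carrier M. h x = \<zero>\<^bsub>N\<^esub>}"
  shows "\<zero>\<^bsub>M\<^esub> \<in> Z" "\<And>x y. x \<in> Z \<Longrightarrow> y \<in> Z \<Longrightarrow> x \<oplus>\<^bsub>M\<^esub> y \<in> Z"
    "\<And>r x. r \<in> carrier R \<Longrightarrow> x \<in> Z \<Longrightarrow> r \<odot>\<^bsub>M\<^esub> x \<in> Z"
proof -
  interpret N: left_module R N by (rule N)
  have hc: "h x \<in> carrier N" if "x \<in> carrier M" for x using h that by (auto simp: lin_homs_def)
  have s: "h (r \<odot>\<^bsub>M\<^esub> x) = r \<odot>\<^bsub>N\<^esub> h x" if "r \<in> carrier R" "x \<in> carrier M" for r x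
    using h that by (auto simp: lin_homs_def)
  have "h \<zero>\<^bsub>M\<^esub> = \<zero> \<odot>\<^bsub>N\<^esub> h \<zero>\<^bsub>M\<^esub>" using s[of "\<zero>" "\<zero>\<^bsub>M\<^esub>"] by (simp add: lsmult_zero)
  thus "\<zero>\<^bsub>M\<^esub> \<in> Z" using hc by (simp add: Z_def N.lsmult_zero)
  show "x \<oplus>\<^bsub>M\<^esub> y \<in> Z" if "x \<in> Z" "y \<in> Z" for x y
    using that h by (auto simp: Z_def lin_homs_def)
  have "r \<odot>\<^bsub>N\<^esub> \<zero>\<^bsub>N\<^esub> = \<zero>\<^bsub>N\<^esub>" if "r \<in> carrier R" for r
    using N.lsmult_finsum[of "{}" r "\<lambda>_. \<zero>\<^bsub>N\<^esub>"] that by simp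
  thus "r \<odot>\<^bsub>M\<^esub> x \<in> Z" if "r \<in> carrier R" "x \<in> Z" for r x
    using that s by (auto simp: Z_def lsmult_closed)
qed

theorem projective_resolution_exists:
  fixes R :: "('r, 'c) ring_scheme" and M :: "('r, 'm, 'd) module_scheme"
  assumes "left_module R M"
  shows "projective_resolution R M (resolution R M)"
proof -
  interpret M: left_module R M by (rule assms)
  define X0 :: "('m, 'r) gen set" where "X0 = Gen ` carrier M"
  define aug where "aug = ext_map R X0 M (inv_into (carrier M) Gen)"
  define step :: "('m, 'r) gen set \<times> (('m, 'r) gen \<Rightarrow> 'r) set \<Rightarrow> _" where
    "step = (\<lambda>(X, Z). (syz_code R ` Z,
       {f \<in> finsupp R (syz_code R ` Z).
          ext_map R (syz_code R ` Z) (free_module R X) (inv_into Z (syz_code R)) f = (\<lambda>_. \<zero>\<^bsub>R\<^esub>)}))"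
  define st where "st i = (step ^^ i) (X0, {f \<in> finsupp R X0. aug f = \<zero>\<^bsub>M\<^esub>})" for i
  define X where "X i = fst (st i)" for i
  define Z where "Z i = snd (st i)" for i
  define P where "P i = free_module R (X i)" for i
  define d where "d i = ext_map R (X (Suc i)) (P i) (inv_into (Z i) (syz_code R))" for i
  have car: "carrier (P i) = finsupp R (X i)" for i by (simp add: P_def free_module_def)
  have zP: "\<zero>\<^bsub>P i\<^esub> = (\<lambda>_. \<zero>\<^bsub>R\<^esub>)" for i by (simp add: P_def free_module_def)
  have P: "left_module R (P i)" for i unfolding P_def by (rule M.R.left_module_free)
  have X_0: "X 0 = X0" and Z_0: "Z 0 = {f \<in> carrier (P 0). aug f = \<zero>\<^bsub>M\<^esub>}"
    by (simp_all add: X_def Z_def st_def car)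
  have XS: "X (Suc i) = syz_code R ` Z i" for i
    by (simp add: X_def Z_def st_def step_def split_beta)
  have ZS: "Z (Suc i) = {f \<in> carrier (P (Suc i)). d i f = \<zero>\<^bsub>P i\<^esub>}" for i
    unfolding car zP d_def XS by (simp add: X_def Z_def st_def step_def split_beta P_def)
  have augs: "aug \<in> lin_homs R (P 0) M" "aug ` carrier (P 0) = carrier M"
    unfolding aug_def car unfolding P_def X_0 unfolding X0_def
    by (rule M.ext_map_image; auto simp: M.lsmult_closed inj_on_def)+
  define sub where "sub i \<longleftrightarrow> Z i \<subseteq> carrier (P i) \<and> \<zero>\<^bsub>P i\<^esub> \<in> Z i \<and>
      (\<forall>x\<in>Z i. \<forall>y\<in>Z i. x \<oplus>\<^bsub>P i\<^esub> y \<in> Z i) \<and>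
      (\<forall>r\<in>carrier R. \<forall>x\<in>Z i. r \<odot>\<^bsub>P i\<^esub> x \<in> Z i)" for i
  have d: "d i \<in> lin_homs R (P (Suc i)) (P i)" "d i ` carrier (P (Suc i)) = Z i" if A: "sub i" for i
  proof -
    interpret Pi: left_module R "P i" by (rule P)
    have inj: "inj_on (syz_code R) (Z i)"
      using inj_on_subset[OF syz_code_inj[of R "X i"]] A car by (simp add: sub_def)
    note im = Pi.ext_map_image[OF inj] A[unfolded sub_def]
    show "d i \<in> lin_homs R (P (Suc i)) (P i)"
      unfolding d_def XS P_def[of "Suc i"] by (rule im(1)) (use A in \<open>auto simp: sub_def\<close>)
    show "d i ` carrier (P (Suc i)) = Z i"
      unfolding d_def car XS by (rule im(2)) (use A in \<open>auto simp: sub_def\<close>)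
  qed
  have sub: "sub i" for i
  proof (induction i)
    case 0
    interpret P0: left_module R "P 0" by (rule P)
    show ?case using P0.kernel_submodule[OF assms augs(1)] unfolding sub_def Z_0 by blast
  next
    case (Suc i)
    interpret PS: left_module R "P (Suc i)" by (rule P)
    show ?case using PS.kernel_submodule[OF P d(1)[OF Suc]] unfolding sub_def ZS by blast
  qed
  have proj: "projective R (P i)" for i unfolding P_def by (rule M.R.projective_free)
  have "projective_resolution R M (P, d, aug)"
    unfolding projective_resolution_def using augs d[OF sub] proj Z_0 ZS by auto
  thus ?thesis unfolding resolution_def by (rule someI)
qed

text \<open>For an algebra \<open>R\<close> over \<open>K\<close>, the set of homomorphisms between two \<open>R\<close>-modules is a
  \<open>K\<close>-module, where \<open>K\<close> acts on modules through \<open>c \<mapsto> c \<cdot> 1\<close>.\<close>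

definition hom_space ::
    "('k, 'r, 'c) module_scheme \<Rightarrow> ('r, 'm, 'd) module_scheme \<Rightarrow> ('r, 'n, 'e) module_scheme
      \<Rightarrow> ('k, 'm \<Rightarrow> 'n) module" where
  "hom_space R M N =
     \<lparr> carrier = lin_homs R M N, monoid.mult = undefined, one = undefined,
       zero = (\<lambda>x\<in>carrier M. \<zero>\<^bsub>N\<^esub>),
       add = (\<lambda>f g. \<lambda>x\<in>carrier M. f x \<oplus>\<^bsub>N\<^esub> g x),
       smult = (\<lambda>c f. \<lambda>x\<in>carrier M. (c \<odot>\<^bsub>R\<^esub> \<one>\<^bsub>R\<^esub>) \<odot>\<^bsub>N\<^esub> f x) \<rparr>"

definition cochains where
  "cochains R M N m = hom_space R (res_module R M m) N"

definition codiff where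
  "codiff R M m f = (\<lambda>x \<in> carrier (res_module R M (Suc m)). f (res_diff R M m x))"

definition cocycles where
  "cocycles R M N m = (cochains R M N m)\<lparr>carrier :=
     {f \<in> carrier (cochains R M N m). codiff R M m f = \<zero>\<^bsub>cochains R M N (Suc m)\<^esub>}\<rparr>"

definition coboundaries where
  "coboundaries R M N m = (case m of
       0 \<Rightarrow> {\<zero>\<^bsub>cochains R M N 0\<^esub>}
     | Suc l \<Rightarrow> codiff R M l ` carrier (cochains R M N l))"

definition Ext ::
    "('k, 'r, 'c) module_scheme \<Rightarrow> ('r, 'm, 'd) module_scheme \<Rightarrow> ('r, 'n, 'e) module_scheme \<Rightarrow> nat
      \<Rightarrow> ('k, ((('m, 'r) gen \<Rightarrow> 'r) \<Rightarrow> 'n) set) module" where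
  "Ext R M N m = quot (cocycles R M N m) (coboundaries R M N m)"


section \<open>Hochschild cohomology\<close>

definition HH where
  "HH K A m = Ext (enveloping K A) (regular_bimodule K A) (regular_bimodule K A) m"

text \<open>The canonical map from the center to \<open>HH\<^sup>0\<close>: a central element \<open>z\<close> is sent to the class
  of the cocycle obtained by composing the augmentation with multiplication by \<open>z\<close>.\<close>

definition center_to_HH0 where
  "center_to_HH0 K A z =
     (let R = enveloping K A; M = regular_bimodule K A in
       coboundaries R M M 0 +>\<^bsub>cocycles R M M 0\<^esub>
         (\<lambda>x \<in> carrier (res_module R M 0). z \<otimes>\<^bsub>A\<^esub> res_aug R M x))"


section \<open>Quivers\<close>

text \<open>A quiver is a directed multigraph. A path is a pair of its origin and its list of arrows, so
  that the paths of length zero are the vertices.\<close>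

definition paths :: "('v, 'a) pre_digraph \<Rightarrow> ('v \<times> 'a list) set" where
  "paths Q = {(u, as). \<exists>v. pre_digraph.awalk Q u as v}"

abbreviation origin :: "'v \<times> 'a list \<Rightarrow> 'v" where
  "origin p \<equiv> fst p"

definition terminus :: "('v, 'a) pre_digraph \<Rightarrow> 'v \<times> 'a list \<Rightarrow> 'v" where
  "terminus Q p = last (pre_digraph.awalk_verts Q (fst p) (snd p))"

abbreviation path_length :: "'v \<times> 'a list \<Rightarrow> nat" where
  "path_length p \<equiv> length (snd p)"

definition path_algebra ::
    "('k, 'c) ring_scheme \<Rightarrow> ('v, 'a) pre_digraph \<Rightarrow> ('k, 'v \<times> 'a list \<Rightarrow> 'k) module" where
  "path_algebra K Q = conv_algebra K (paths Q) {p \<in> paths Q. path_length p = 0}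
     (\<lambda>p q. if terminus Q p = origin q then Some (origin p, snd p @ snd q) else None)"

definition truncated_quiver_algebra ::
    "('k, 'c) ring_scheme \<Rightarrow> ('v, 'a) pre_digraph \<Rightarrow> nat \<Rightarrow> ('k, ('v \<times> 'a list \<Rightarrow> 'k) set) module" where
  "truncated_quiver_algebra K Q n = quot (path_algebra K Q)
     (genideal (path_algebra K Q) (basis_elt K ` {p \<in> paths Q. path_length p \<ge> n}))"

definition is_basic_cycle :: "('v, 'a) pre_digraph \<Rightarrow> bool" where
  "is_basic_cycle Q \<longleftrightarrow> (\<exists>c. pre_digraph.cycle Q c \<and> set c = arcs Q \<and>
     set (pre_digraph.awalk_verts Q (tail Q (hd c)) c) = verts Q)"

definition parallel_paths ::
    "('v, 'a) pre_digraph \<Rightarrow> nat \<Rightarrow> nat \<Rightarrow> (('v \<times> 'a list) \<times> ('v \<times> 'a list)) set" where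
  "parallel_paths Q i j = {(p, q). p \<in> paths Q \<and> q \<in> paths Q \<and> path_length p = i \<and>
     path_length q = j \<and> origin p = origin q \<and> terminus Q p = terminus Q q}"


section \<open>Extremes\<close>

definition is_source :: "('v, 'a) pre_digraph \<Rightarrow> 'v \<Rightarrow> bool" where
  "is_source Q v \<longleftrightarrow> v \<in> verts Q \<and> in_arcs Q v = {}"

definition is_sink :: "('v, 'a) pre_digraph \<Rightarrow> 'v \<Rightarrow> bool" where
  "is_sink Q v \<longleftrightarrow> v \<in> verts Q \<and> out_arcs Q v = {}"

definition starts_together :: "('v \<times> 'a list) \<times> ('v \<times> 'a list) \<Rightarrow> bool" where
  "starts_together = (\<lambda>(p, q). snd p \<noteq> [] \<and> snd q \<noteq> [] \<and> hd (snd p) = hd (snd q))"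

definition ends_together :: "('v \<times> 'a list) \<times> ('v \<times> 'a list) \<Rightarrow> bool" where
  "ends_together = (\<lambda>(p, q). snd p \<noteq> [] \<and> snd q \<noteq> [] \<and> last (snd p) = last (snd q))"

definition starts_at_source :: "('v, 'a) pre_digraph \<Rightarrow> ('v \<times> 'a list) \<times> ('v \<times> 'a list) \<Rightarrow> bool" where
  "starts_at_source Q = (\<lambda>(p, q). is_source Q (origin p))"

definition ends_at_sink :: "('v, 'a) pre_digraph \<Rightarrow> ('v \<times> 'a list) \<times> ('v \<times> 'a list) \<Rightarrow> bool" where
  "ends_at_sink Q = (\<lambda>(p, q). is_sink Q (terminus Q p))"

definition plus_extreme :: "('v, 'a) pre_digraph \<Rightarrow> ('v \<times> 'a list) \<times> ('v \<times> 'a list) \<Rightarrow> bool" where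
  "plus_extreme Q x \<longleftrightarrow> \<not> starts_together x \<or> ends_at_sink Q x"

definition minus_extreme :: "('v, 'a) pre_digraph \<Rightarrow> ('v \<times> 'a list) \<times> ('v \<times> 'a list) \<Rightarrow> bool" where
  "minus_extreme Q x \<longleftrightarrow> \<not> ends_together x \<or> starts_at_source Q x"

definition plus_movements ::
    "('v, 'a) pre_digraph \<Rightarrow> ((('v \<times> 'a list) \<times> ('v \<times> 'a list)) \<times> (('v \<times> 'a list) \<times> ('v \<times> 'a list))) set" where
  "plus_movements Q =
     {(((u, a # p), (u, a # q)), ((head Q a, p @ [b]), (head Q a, q @ [b]))) | u a p q b.
        b \<in> out_arcs Q (terminus Q (u, a # p))}"

definition minus_movements ::
    "('v, 'a) pre_digraph \<Rightarrow> ((('v \<times> 'a list) \<times> ('v \<times> 'a list)) \<times> (('v \<times> 'a list) \<times> ('v \<times> 'a list))) set" where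
  "minus_movements Q =
     {(((u, p @ [a]), (u, q @ [a])), ((tail Q b, b # p), (tail Q b, b # q))) | u a p q b.
        b \<in> in_arcs Q u}"

definition movement_equiv ::
    "('v, 'a) pre_digraph \<Rightarrow> nat \<Rightarrow> nat
      \<Rightarrow> ((('v \<times> 'a list) \<times> ('v \<times> 'a list)) \<times> (('v \<times> 'a list) \<times> ('v \<times> 'a list))) set" where
  "movement_equiv Q j l = {(x, y). x \<in> parallel_paths Q j l \<and> y \<in> parallel_paths Q j l \<and>
     (x, y) \<in> (plus_movements Q \<union> minus_movements Q)\<^sup>*}"

text \<open>The \<open>j\<close>-extremes with respect to the sets \<open>(j // n i)\<close>. By convention there are none for
  \<open>j = 0\<close>, and for \<open>j = n - 1\<close> they are all the elements of \<open>(n - 1 // n i)\<close>, which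
  are represented by singletons here.\<close>

definition extremes ::
    "('v, 'a) pre_digraph \<Rightarrow> nat \<Rightarrow> nat \<Rightarrow> nat \<Rightarrow> (('v \<times> 'a list) \<times> ('v \<times> 'a list)) set set" where
  "extremes Q n i j =
     (if j = 0 then {}
      else if j = n - 1 then (\<lambda>x. {x}) ` parallel_paths Q (n - 1) (n * i)
      else {C \<in> parallel_paths Q j (n * i) // movement_equiv Q j (n * i).
              (\<forall>x \<in> C. plus_extreme Q x \<longrightarrow> ends_at_sink Q x) \<and>
              (\<forall>x \<in> C. minus_extreme Q x \<longrightarrow> starts_at_source Q x)})"

end

theory Submission
  imports Defs
begin

text \<open>The truncated algebra has a projective bimodule resolution whose generators in degrees \<open>2i\<close> and \<open>2i + 1\<close>
  are the paths of length \<open>ni\<close> and \<open>ni + 1\<close> (Bardzell). By the comparison theorem it computes \<open>Ext\<close>; its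
  cochains are functions on pairs of parallel paths, so that only the dimensions of the kernels of the
  differentials are needed. A cocycle of degree \<open>2i\<close> is constant on movement classes and vanishes on those that
  are not extremes. On pairs of a vertex and a closed walk every cocycle of positive degree vanishes, because a
  closed walk in a connected quiver that is not a basic cycle meets an arrow off the walk. In degree \<open>0\<close> a
  cocycle is determined by its value at a lift of \<open>1\<close>, which is central.\<close>

text \<open>\<open>Ext\<close> is built on a resolution picked by choice, of which nothing but
  exactness and projectivity is known, so each dimension has to be carried over from a resolution
  with explicit coordinates. Here the basis element
  \<open>\<alpha> \<otimes> \<gamma> \<otimes> \<beta>\<close> is a word with a marked position, and
  the differential changes only the position. The resolution thus splits into one small complex per
  word, and exactness becomes arithmetic of sums over an interval, valid over every field. After
  taking homomorphisms the two parities behave differently. From an even degree the differential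
  compares the two pairs obtained from a longer pair by removing its first or its last arrows, which
  is what a movement does. From an odd degree the outer factors have total length
  \<open>n - 1\<close> and fill a short path completely, so only values at pairs with a vertex in
  front are read. Hence the vanishing of cocycles at such pairs decides both parities. A sum of
  \<open>n\<close> equal values being zero says nothing if the characteristic divides
  \<open>n\<close>; the arrow off the walk serves to produce a second sum with exactly one term
  fewer.\<close>

no_notation vwalk_join (infixr \<open>\<oplus>\<close> 65)

section \<open>Linear maps and quotients\<close>

lemma lin_homs_closed: "f \<in> lin_homs R M N \<Longrightarrow> x \<in> carrier M \<Longrightarrow> f x \<in> carrier N"
  by (auto simp: lin_homs_def)

lemma lin_homs_add:
  "f \<in> lin_homs R M N \<Longrightarrow> x \<in> carrier M \<Longrightarrow> y \<in> carrier M \<Longrightarrow> f (x \<oplus>\<^bsub>M\<^esub> y) = f x \<oplus>\<^bsub>N\<^esub> f y"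
  by (auto simp: lin_homs_def)

lemma lin_homs_smult:
  "f \<in> lin_homs R M N \<Longrightarrow> r \<in> carrier R \<Longrightarrow> x \<in> carrier M \<Longrightarrow> f (r \<odot>\<^bsub>M\<^esub> x) = r \<odot>\<^bsub>N\<^esub> f x"
  by (auto simp: lin_homs_def)

text \<open>Homomorphisms are extensional functions, undefined off the carrier, so agreement on the
  carrier is equality. For the same reason composites and sums of homomorphisms below carry an
  explicit restriction.\<close>

lemma lin_homs_ext:
  assumes "f \<in> lin_homs R M N" "g \<in> lin_homs R M N" "\<And>x. x \<in> carrier M \<Longrightarrow> f x = g x"
  shows "f = g"
  using assms by (auto simp: lin_homs_def intro: PiE_ext)

lemma (in left_module) lin_homsI:
  assumes "\<And>x. x \<in> carrier M \<Longrightarrow> f x \<in> carrier N"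
    and "\<And>x y. x \<in> carrier M \<Longrightarrow> y \<in> carrier M \<Longrightarrow> f (x \<oplus>\<^bsub>M\<^esub> y) = f x \<oplus>\<^bsub>N\<^esub> f y"
    and "\<And>r x. r \<in> carrier R \<Longrightarrow> x \<in> carrier M \<Longrightarrow> f (r \<odot>\<^bsub>M\<^esub> x) = r \<odot>\<^bsub>N\<^esub> f x"
  shows "(\<lambda>x\<in>carrier M. f x) \<in> lin_homs R M N"
  using assms by (auto simp: lin_homs_def lsmult_closed)

lemma lin_homs_compose:
  assumes "left_module R M" "f \<in> lin_homs R M N" "g \<in> lin_homs R N P"
  shows "(\<lambda>x\<in>carrier M. g (f x)) \<in> lin_homs R M P"
  by (rule left_module.lin_homsI[OF assms(1)])
    (use assms(2,3) in \<open>auto simp: lin_homs_closed[OF assms(3)] lin_homs_closed[OF assms(2)]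
      lin_homs_add[OF assms(2)] lin_homs_add[OF assms(3)]
      lin_homs_smult[OF assms(2)] lin_homs_smult[OF assms(3)]\<close>)

lemma lin_homs_zero:
  assumes "left_module R M" "left_module R N" "f \<in> lin_homs R M N"
  shows "f \<zero>\<^bsub>M\<^esub> = \<zero>\<^bsub>N\<^esub>"
proof -
  interpret M: left_module R M by fact
  interpret N: left_module R N by fact
  have "f (\<zero>\<^bsub>R\<^esub> \<odot>\<^bsub>M\<^esub> \<zero>\<^bsub>M\<^esub>) = \<zero>\<^bsub>R\<^esub> \<odot>\<^bsub>N\<^esub> f \<zero>\<^bsub>M\<^esub>" using assms by (simp add: lin_homs_smult)
  thus ?thesis using assms by (simp add: M.lsmult_zero N.lsmult_zero lin_homs_closed)
qed

lemma lin_homs_neg: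
  assumes "left_module R M" "left_module R N" "f \<in> lin_homs R M N" "x \<in> carrier M"
  shows "f (\<ominus>\<^bsub>M\<^esub> x) = \<ominus>\<^bsub>N\<^esub> f x"
proof -
  interpret M: left_module R M by fact
  interpret N: left_module R N by fact
  have "f (\<ominus>\<^bsub>M\<^esub> x) \<oplus>\<^bsub>N\<^esub> f x = f (\<ominus>\<^bsub>M\<^esub> x \<oplus>\<^bsub>M\<^esub> x)"
    using assms by (subst lin_homs_add[OF assms(3)]) auto
  also have "\<dots> = \<zero>\<^bsub>N\<^esub>" using assms by (simp add: M.M.l_neg lin_homs_zero)
  finally show ?thesis using assms by (simp add: N.M.minus_equality lin_homs_closed)
qed

lemma lin_homs_minus:
  assumes "left_module R M" "left_module R N" "f \<in> lin_homs R M N" "x \<in> carrier M" "y \<in> carrier M"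
  shows "f (x \<ominus>\<^bsub>M\<^esub> y) = f x \<ominus>\<^bsub>N\<^esub> f y"
proof -
  interpret M: left_module R M by fact
  show ?thesis using assms
    by (simp add: a_minus_def lin_homs_add[OF assms(3)] lin_homs_neg[OF assms(1-3)])
qed

lemma lin_homs_finsum:
  assumes "left_module R M" "left_module R N" "f \<in> lin_homs R M N"
    and "finite S" "\<And>s. s \<in> S \<Longrightarrow> g s \<in> carrier M"
  shows "f (finsum M g S) = finsum N (\<lambda>s. f (g s)) S"
proof -
  interpret M: left_module R M by fact
  interpret N: left_module R N by fact
  show ?thesis using assms(4,5)
  proof (induction S)
    case empty
    thus ?case using assms by (simp add: lin_homs_zero)
  next
    case (insert s S)
    thus ?case using lin_homs_closed[OF assms(3)]
      by (simp add: Pi_def lin_homs_add[OF assms(3)])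
  qed
qed

text \<open>The module axioms see only the additive structure and the action on the carrier, so
  records that differ elsewhere, such as \<open>conv_algebra\<close> and \<open>free_module\<close>,
  can share one proof.\<close>

lemma left_module_cong:
  assumes M: "left_module R M"
    and "carrier N = carrier M" "zero N = zero M" "add N = add M"
    and sm: "\<And>r x. r \<in> carrier R \<Longrightarrow> x \<in> carrier M \<Longrightarrow> r \<odot>\<^bsub>N\<^esub> x = r \<odot>\<^bsub>M\<^esub> x"
  shows "left_module R N"
proof -
  interpret M: left_module R M by fact
  have "abelian_group N"
    by (rule abelian_groupI) (use assms(2-4) M.M.l_neg in \<open>auto simp: M.M.a_ac intro: bexI[of _ "\<ominus>\<^bsub>M\<^esub> x" for x]\<close>)
  thus ?thesis
    by (intro left_module.intro left_module_axioms.intro)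
      (use assms M.lsmult_closed M.lsmult_l_distr M.lsmult_r_distr M.lsmult_assoc M.lsmult_one M.R.ring_axioms
        in \<open>auto simp: sm M.lsmult_closed\<close>)
qed

lemma ring_cong:
  assumes S: "ring S"
    and "carrier T = carrier S" "zero T = zero S" "add T = add S" "one T = one S"
    and m: "\<And>x y. x \<in> carrier S \<Longrightarrow> y \<in> carrier S \<Longrightarrow> x \<otimes>\<^bsub>T\<^esub> y = x \<otimes>\<^bsub>S\<^esub> y"
  shows "ring T"
proof -
  interpret S: ring S by fact
  show ?thesis
  proof (rule ringI)
    show "abelian_group T"
      by (rule abelian_groupI) (use assms(2-4) S.l_neg in \<open>auto simp: S.a_ac intro: bexI[of _ "\<ominus>\<^bsub>S\<^esub> x" for x]\<close>)
    show "monoid T"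
      by (rule monoidI) (use assms in \<open>auto simp: S.m_assoc\<close>)
  qed (use assms in \<open>auto simp: S.l_distr S.r_distr\<close>)
qed

lemma left_module_imp_vectorspace:
  assumes "field K" "left_module K V" shows "vectorspace K V"
proof -
  interpret K: field K by fact
  interpret V: left_module K V by fact
  show ?thesis
    by unfold_locales (auto simp: V.lsmult_closed V.lsmult_l_distr V.lsmult_r_distr V.lsmult_assoc V.lsmult_one)
qed

section \<open>Submodules and quotient modules\<close>

definition submod :: "('r, 'c) ring_scheme \<Rightarrow> 'm set \<Rightarrow> ('r, 'm, 'd) module_scheme \<Rightarrow> bool" where
  "submod R I M \<longleftrightarrow> I \<subseteq> carrier M \<and> \<zero>\<^bsub>M\<^esub> \<in> I \<and> (\<forall>x\<in>I. \<forall>y\<in>I. x \<oplus>\<^bsub>M\<^esub> y \<in> I) \<and>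
     (\<forall>r\<in>carrier R. \<forall>x\<in>I. r \<odot>\<^bsub>M\<^esub> x \<in> I)"

lemma submodD:
  assumes "submod R I M"
  shows "\<And>x. x \<in> I \<Longrightarrow> x \<in> carrier M" "\<zero>\<^bsub>M\<^esub> \<in> I" "\<And>x y. x \<in> I \<Longrightarrow> y \<in> I \<Longrightarrow> x \<oplus>\<^bsub>M\<^esub> y \<in> I"
    "\<And>r x. r \<in> carrier R \<Longrightarrow> x \<in> I \<Longrightarrow> r \<odot>\<^bsub>M\<^esub> x \<in> I"
  using assms by (auto simp: submod_def)

lemma (in left_module) lsmult_minus_one:
  assumes "x \<in> carrier M" shows "(\<ominus> \<one>) \<odot>\<^bsub>M\<^esub> x = \<ominus>\<^bsub>M\<^esub> x"
proof -
  have "(\<ominus> \<one>) \<odot>\<^bsub>M\<^esub> x \<oplus>\<^bsub>M\<^esub> x = (\<ominus> \<one> \<oplus> \<one>) \<odot>\<^bsub>M\<^esub> x"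
    using assms by (subst lsmult_l_distr) (auto simp: lsmult_one)
  thus ?thesis using assms by (simp add: R.l_neg lsmult_zero lsmult_closed M.minus_equality)
qed

lemma (in left_module) lsmult_r_zero:
  assumes "r \<in> carrier R" shows "r \<odot>\<^bsub>M\<^esub> \<zero>\<^bsub>M\<^esub> = \<zero>\<^bsub>M\<^esub>"
  using lsmult_finsum[of "{}" r "\<lambda>_. \<zero>\<^bsub>M\<^esub>"] assms by simp

text \<open>Negation is the action of -1, which is why \<open>submod\<close> does not ask for
  closure under it.\<close>

lemma (in left_module) submod_neg:
  assumes "submod R I M" "x \<in> I" shows "\<ominus>\<^bsub>M\<^esub> x \<in> I"
  using submodD(4)[OF assms(1) _ assms(2), of "\<ominus> \<one>"] submodD(1)[OF assms]
  by (simp add: lsmult_minus_one)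

lemma (in left_module) submod_module:
  assumes "submod R I M" shows "left_module R (M\<lparr>carrier := I\<rparr>)"
proof -
  note I = submodD[OF assms]
  have "abelian_group (M\<lparr>carrier := I\<rparr>)"
  proof (rule abelian_groupI)
    fix x assume "x \<in> carrier (M\<lparr>carrier := I\<rparr>)"
    thus "\<exists>y\<in>carrier (M\<lparr>carrier := I\<rparr>). y \<oplus>\<^bsub>M\<lparr>carrier := I\<rparr>\<^esub> x = \<zero>\<^bsub>M\<lparr>carrier := I\<rparr>\<^esub>"
      using I submod_neg[OF assms] M.l_neg by (intro bexI[of _ "\<ominus>\<^bsub>M\<^esub> x"]) auto
  qed (use I in \<open>auto simp: M.a_ac\<close>)
  thus ?thesis
    by (intro left_module.intro left_module_axioms.intro)
      (use I in \<open>auto simp: lsmult_l_distr lsmult_r_distr lsmult_assoc lsmult_one R.ring_axioms\<close>)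
qed

lemma (in left_module) submod_abelian_subgroup:
  assumes "submod R I M" shows "abelian_subgroup I M"
proof (rule abelian_subgroupI3)
  note I = submodD[OF assms]
  show "abelian_group M" by (rule M.abelian_group_axioms)
  show "additive_subgroup I M"
    by (rule additive_subgroup.intro, rule subgroup.intro)
      (use I submod_neg[OF assms] in \<open>auto simp: a_inv_def[symmetric]\<close>)
qed

text \<open>All later work with cosets goes through these facts. The scalar action of
  \<open>quot\<close> is a union over the coset; it collapses to a single coset because two
  representatives differ by an element of \<open>I\<close>, and the scalar keeps that difference in
  \<open>I\<close>.\<close>

lemma (in left_module) quot_facts:
  assumes I: "submod R I M"
  shows quot_module: "left_module R (quot M I)"
    and quot_carrier: "carrier (quot M I) = (\<lambda>x. I +>\<^bsub>M\<^esub> x) ` carrier M"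
    and quot_add: "\<And>x y. x \<in> carrier M \<Longrightarrow> y \<in> carrier M \<Longrightarrow>
        (I +>\<^bsub>M\<^esub> x) \<oplus>\<^bsub>quot M I\<^esub> (I +>\<^bsub>M\<^esub> y) = I +>\<^bsub>M\<^esub> (x \<oplus>\<^bsub>M\<^esub> y)"
    and quot_smult: "\<And>r x. r \<in> carrier R \<Longrightarrow> x \<in> carrier M \<Longrightarrow>
        r \<odot>\<^bsub>quot M I\<^esub> (I +>\<^bsub>M\<^esub> x) = I +>\<^bsub>M\<^esub> (r \<odot>\<^bsub>M\<^esub> x)"
    and quot_zero: "\<zero>\<^bsub>quot M I\<^esub> = I"
    and quot_eq: "\<And>x y. x \<in> carrier M \<Longrightarrow> y \<in> carrier M \<Longrightarrow>
        I +>\<^bsub>M\<^esub> x = I +>\<^bsub>M\<^esub> y \<longleftrightarrow> x \<ominus>\<^bsub>M\<^esub> y \<in> I"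
    and quot_eq_zero: "\<And>x. x \<in> carrier M \<Longrightarrow> I +>\<^bsub>M\<^esub> x = I \<longleftrightarrow> x \<in> I"
    and quot_mem: "\<And>x y. x \<in> carrier M \<Longrightarrow> y \<in> I +>\<^bsub>M\<^esub> x \<longleftrightarrow> y \<in> carrier M \<and> I +>\<^bsub>M\<^esub> y = I +>\<^bsub>M\<^esub> x"
proof -
  interpret S: abelian_subgroup I M by (rule submod_abelian_subgroup[OF I])
  note J = submodD[OF I]
  show car: "carrier (quot M I) = (\<lambda>x. I +>\<^bsub>M\<^esub> x) ` carrier M"
    by (auto simp: quot_def A_RCOSETS_def')
  show add: "(I +>\<^bsub>M\<^esub> x) \<oplus>\<^bsub>quot M I\<^esub> (I +>\<^bsub>M\<^esub> y) = I +>\<^bsub>M\<^esub> (x \<oplus>\<^bsub>M\<^esub> y)"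
    if "x \<in> carrier M" "y \<in> carrier M" for x y
    using that by (simp add: quot_def S.a_rcos_sum)
  show zero: "\<zero>\<^bsub>quot M I\<^esub> = I" by (simp add: quot_def)
  have sub: "I \<subseteq> carrier M" using J by blast
  show eq0: "I +>\<^bsub>M\<^esub> x = I \<longleftrightarrow> x \<in> I" if "x \<in> carrier M" for x
    using S.a_rcos_self[OF that] S.a_rcos_const[of x] by metis
  show mem: "y \<in> I +>\<^bsub>M\<^esub> x \<longleftrightarrow> y \<in> carrier M \<and> I +>\<^bsub>M\<^esub> y = I +>\<^bsub>M\<^esub> x" if "x \<in> carrier M" for x y
  proof
    assume y: "y \<in> I +>\<^bsub>M\<^esub> x"
    have "I +>\<^bsub>M\<^esub> x = I +>\<^bsub>M\<^esub> y" by (rule M.a_repr_independence[OF y that S.a_subgroup])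
    thus "y \<in> carrier M \<and> I +>\<^bsub>M\<^esub> y = I +>\<^bsub>M\<^esub> x" using S.a_elemrcos_carrier[OF that y] by simp
  next
    assume "y \<in> carrier M \<and> I +>\<^bsub>M\<^esub> y = I +>\<^bsub>M\<^esub> x"
    thus "y \<in> I +>\<^bsub>M\<^esub> x" using S.a_rcos_self[of y] by simp
  qed
  show eq: "I +>\<^bsub>M\<^esub> x = I +>\<^bsub>M\<^esub> y \<longleftrightarrow> x \<ominus>\<^bsub>M\<^esub> y \<in> I" if "x \<in> carrier M" "y \<in> carrier M" for x y
    using mem[OF that(2), of x] S.a_rcos_module[OF that(2,1)] that(1) unfolding a_minus_def by blast
  show sm: "r \<odot>\<^bsub>quot M I\<^esub> (I +>\<^bsub>M\<^esub> x) = I +>\<^bsub>M\<^esub> (r \<odot>\<^bsub>M\<^esub> x)"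
    if r: "r \<in> carrier R" and x: "x \<in> carrier M" for r x
  proof -
    have "I +>\<^bsub>M\<^esub> (r \<odot>\<^bsub>M\<^esub> y) = I +>\<^bsub>M\<^esub> (r \<odot>\<^bsub>M\<^esub> x)" if "y \<in> I +>\<^bsub>M\<^esub> x" for y
    proof -
      have "y \<in> carrier M \<and> I +>\<^bsub>M\<^esub> y = I +>\<^bsub>M\<^esub> x" using mem[OF x] that by blast
      hence y: "y \<in> carrier M" "y \<ominus>\<^bsub>M\<^esub> x \<in> I" using eq[of y x] x by blast+
      have "r \<odot>\<^bsub>M\<^esub> (y \<ominus>\<^bsub>M\<^esub> x) \<in> I" using J(4) r y by blast
      moreover have "r \<odot>\<^bsub>M\<^esub> (y \<ominus>\<^bsub>M\<^esub> x) = r \<odot>\<^bsub>M\<^esub> y \<ominus>\<^bsub>M\<^esub> r \<odot>\<^bsub>M\<^esub> x"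
      proof -
        have "r \<odot>\<^bsub>M\<^esub> (\<ominus>\<^bsub>M\<^esub> x) \<oplus>\<^bsub>M\<^esub> r \<odot>\<^bsub>M\<^esub> x = \<zero>\<^bsub>M\<^esub>"
          using r x by (subst lsmult_r_distr[symmetric]) (auto simp: M.l_neg lsmult_r_zero)
        hence "r \<odot>\<^bsub>M\<^esub> (\<ominus>\<^bsub>M\<^esub> x) = \<ominus>\<^bsub>M\<^esub> (r \<odot>\<^bsub>M\<^esub> x)"
          using r x by (simp add: M.minus_equality lsmult_closed)
        thus ?thesis using r x y by (simp add: a_minus_def lsmult_r_distr)
      qed
      ultimately show ?thesis using eq[of "r \<odot>\<^bsub>M\<^esub> y" "r \<odot>\<^bsub>M\<^esub> x"] lsmult_closed r x y(1) by metis
    qed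
    moreover have "x \<in> I +>\<^bsub>M\<^esub> x" using S.a_rcos_self x by blast
    ultimately have "(\<Union>y\<in>I +>\<^bsub>M\<^esub> x. I +>\<^bsub>M\<^esub> (r \<odot>\<^bsub>M\<^esub> y)) = I +>\<^bsub>M\<^esub> (r \<odot>\<^bsub>M\<^esub> x)" by blast
    thus ?thesis by (simp add: quot_def)
  qed
  have z: "\<zero>\<^bsub>quot M I\<^esub> = I +>\<^bsub>M\<^esub> \<zero>\<^bsub>M\<^esub>" unfolding zero using eq0[of "\<zero>\<^bsub>M\<^esub>"] J(2) by simp
  have ab: "abelian_group (quot M I)"
  proof (rule abelian_groupI)
    fix S assume "S \<in> carrier (quot M I)"
    then obtain x where x: "x \<in> carrier M" "S = I +>\<^bsub>M\<^esub> x" by (auto simp: car)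
    have "(I +>\<^bsub>M\<^esub> (\<ominus>\<^bsub>M\<^esub> x)) \<oplus>\<^bsub>quot M I\<^esub> S = \<zero>\<^bsub>quot M I\<^esub>"
      unfolding x(2) z using x(1) by (simp add: add M.l_neg)
    thus "\<exists>T\<in>carrier (quot M I). T \<oplus>\<^bsub>quot M I\<^esub> S = \<zero>\<^bsub>quot M I\<^esub>" using x(1) by (auto simp: car)
  qed (auto simp: car add z M.a_ac)
  show "left_module R (quot M I)"
    by (intro left_module.intro left_module_axioms.intro)
      (use ab R.ring_axioms in \<open>auto simp: car sm add lsmult_closed lsmult_l_distr lsmult_r_distr lsmult_assoc lsmult_one\<close>)
qed

lemma linear_mapI:
  assumes K: "field K" and V: "left_module K V" and W: "left_module K W"
    and "\<And>x. x \<in> carrier V \<Longrightarrow> T x \<in> carrier W"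
    and "\<And>x y. x \<in> carrier V \<Longrightarrow> y \<in> carrier V \<Longrightarrow> T (x \<oplus>\<^bsub>V\<^esub> y) = T x \<oplus>\<^bsub>W\<^esub> T y"
    and "\<And>r x. r \<in> carrier K \<Longrightarrow> x \<in> carrier V \<Longrightarrow> T (r \<odot>\<^bsub>V\<^esub> x) = r \<odot>\<^bsub>W\<^esub> T x"
  shows "linear_map K V W T"
  using left_module_imp_vectorspace[OF K V] left_module_imp_vectorspace[OF K W] assms(4-)
  by (auto simp: linear_map_def mod_hom_def mod_hom_axioms_def LinearCombinations.module_hom_def vectorspace_def)

section \<open>Algebras with a multiplicative basis\<close>

text \<open>Induction on the size of the support: deleting one point writes \<open>f\<close> as a
  function with smaller support plus a multiple of a basis element. Additive and homogeneous
  identities therefore need checking on the basis only.\<close>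

lemma (in ring) finsupp_induct [consumes 1, case_names zero add basis]:
  assumes f: "f \<in> finsupp R X"
    and zero: "P (\<lambda>_. \<zero>)"
    and add: "\<And>f g. f \<in> finsupp R X \<Longrightarrow> g \<in> finsupp R X \<Longrightarrow> P f \<Longrightarrow> P g \<Longrightarrow> P (\<lambda>z. f z \<oplus> g z)"
    and basis: "\<And>c x. c \<in> carrier R \<Longrightarrow> x \<in> X \<Longrightarrow> P (\<lambda>z. c \<otimes> basis_elt R x z)"
  shows "P f"
proof -
  interpret F: left_module R "free_module R X" by (rule left_module_free)
  have car: "carrier (free_module R X) = finsupp R X" by (simp add: free_module_def)
  show ?thesis using f
  proof (induction "card {x. f x \<noteq> \<zero>}" arbitrary: f)
    case 0
    hence "f = (\<lambda>_. \<zero>)" by (auto simp: finsupp_def)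
    thus ?case using zero by simp
  next
    case (Suc k)
    then obtain x where x: "f x \<noteq> \<zero>"
      by (metis (mono_tags, lifting) Collect_empty_eq card.empty nat.distinct(1))
    hence xX: "x \<in> X" using Suc.prems by (auto simp: finsupp_def)
    have fx: "f x \<in> carrier R" using Suc.prems by (auto simp: finsupp_def)
    let ?f = "f(x := \<zero>)"
    have fin: "finite {x. f x \<noteq> \<zero>}" using Suc.prems by (auto simp: finsupp_def)
    have s: "{y. ?f y \<noteq> \<zero>} = {y. f y \<noteq> \<zero>} - {x}" by auto
    have ff: "?f \<in> finsupp R X" using Suc.prems s by (auto simp: finsupp_def)
    have "k = card {y. ?f y \<noteq> \<zero>}" using Suc(2) x fin unfolding s by simp
    hence IH: "P ?f" using Suc(1) ff by blast
    have b: "basis_elt R x \<in> finsupp R X" using xX by (rule basis_elt_finsupp)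
    have "f x \<odot>\<^bsub>free_module R X\<^esub> basis_elt R x \<in> finsupp R X"
      using F.lsmult_closed[of "f x" "basis_elt R x"] fx b unfolding car by simp
    hence sb: "(\<lambda>z. f x \<otimes> basis_elt R x z) \<in> finsupp R X" by (simp add: free_module_def)
    have "(\<lambda>z. ?f z \<oplus> f x \<otimes> basis_elt R x z) = f"
      using Suc.prems by (auto simp: basis_elt_def finsupp_def fun_eq_iff)
    thus ?case using add[OF ff sb IH basis[OF fx xX]] by simp
  qed
qed

locale kalgebra = K: field K + A: ring A + KA: left_module K A
  for K :: "('k, 'c) ring_scheme" and A :: "('k, 'a, 'd) module_scheme" +
  assumes smult_mult_l: "\<lbrakk>c \<in> carrier K; x \<in> carrier A; y \<in> carrier A\<rbrakk>
      \<Longrightarrow> (c \<odot>\<^bsub>A\<^esub> x) \<otimes>\<^bsub>A\<^esub> y = c \<odot>\<^bsub>A\<^esub> (x \<otimes>\<^bsub>A\<^esub> y)"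
    and smult_mult_r: "\<lbrakk>c \<in> carrier K; x \<in> carrier A; y \<in> carrier A\<rbrakk>
      \<Longrightarrow> x \<otimes>\<^bsub>A\<^esub> (c \<odot>\<^bsub>A\<^esub> y) = c \<odot>\<^bsub>A\<^esub> (x \<otimes>\<^bsub>A\<^esub> y)"

text \<open>The unit laws say that each basis element is fixed by exactly one member of
  \<open>E\<close> on either side and killed by the others, which makes the sum over
  \<open>E\<close> a unit. The two uses are the monoid \<open>A \<times> A\<close> with a single
  unit and the paths of a quiver with the vertices as local units.\<close>

locale conv_basis = K: field K for K :: "('k, 'c) ring_scheme" (structure) +
  fixes X E :: "'x set" and mul :: "'x \<Rightarrow> 'x \<Rightarrow> 'x option"
  assumes mul_closed: "\<lbrakk>x \<in> X; y \<in> X; mul x y = Some z\<rbrakk> \<Longrightarrow> z \<in> X"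
    and mul_assoc: "\<lbrakk>x \<in> X; y \<in> X; z \<in> X\<rbrakk>
      \<Longrightarrow> Option.bind (mul x y) (\<lambda>u. mul u z) = Option.bind (mul y z) (\<lambda>v. mul x v)"
    and E: "finite E" "E \<subseteq> X"
    and unit_l: "x \<in> X \<Longrightarrow> \<exists>e\<in>E. mul e x = Some x \<and> (\<forall>e'\<in>E. e' \<noteq> e \<longrightarrow> mul e' x = None)"
    and unit_r: "x \<in> X \<Longrightarrow> \<exists>e\<in>E. mul x e = Some x \<and> (\<forall>e'\<in>E. e' \<noteq> e \<longrightarrow> mul x e' = None)"
begin

definition C where "C = conv_algebra K X E mul"

lemma C_simps [simp]:
  "carrier C = finsupp K X" "\<zero>\<^bsub>C\<^esub> = (\<lambda>_. \<zero>)" "f \<oplus>\<^bsub>C\<^esub> g = (\<lambda>z. f z \<oplus> g z)" "c \<odot>\<^bsub>C\<^esub> f = (\<lambda>z. c \<otimes> f z)"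
  "\<one>\<^bsub>C\<^esub> = (\<lambda>z. if z \<in> E then \<one> else \<zero>)"
  by (simp_all add: C_def conv_algebra_def)

lemma C_module: "left_module K C"
  by (rule left_module_cong[OF K.left_module_free[of X]]) (auto simp: free_module_def fun_eq_iff)

sublocale CM: left_module K C by (rule C_module)

text \<open>The defining sum runs over the supports, which change with the arguments. Over a fixed
  rectangle, padded with zero terms, products of sums and of multiples can be compared term by
  term.\<close>

lemma mult_superset:
  assumes f: "f \<in> finsupp K X" and g: "g \<in> finsupp K X"
    and S: "finite S" "{x. f x \<noteq> \<zero>} \<subseteq> S" and T: "finite T" "{x. g x \<noteq> \<zero>} \<subseteq> T"
  shows "(f \<otimes>\<^bsub>C\<^esub> g) z = (\<Oplus>p\<in>S \<times> T. case p of (x, y) \<Rightarrow> if mul x y = Some z then f x \<otimes> g y else \<zero>)"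
proof -
  have c: "f x \<in> carrier K" "g x \<in> carrier K" for x using f g by (auto simp: finsupp_def)
  have "(f \<otimes>\<^bsub>C\<^esub> g) z = finsum K (\<lambda>(x, y). f x \<otimes> g y)
      {(x, y). f x \<noteq> \<zero> \<and> g y \<noteq> \<zero> \<and> mul x y = Some z}"
    by (simp add: C_def conv_algebra_def)
  also have "\<dots> = (\<Oplus>p\<in>S \<times> T. case p of (x, y) \<Rightarrow> if mul x y = Some z then f x \<otimes> g y else \<zero>)"
    by (rule K.add.finprod_mono_neutral_cong_left) (use S T c in \<open>auto split: if_splits\<close>)
  finally show ?thesis .
qed

lemma mult_closed: assumes "f \<in> finsupp K X" "g \<in> finsupp K X" shows "f \<otimes>\<^bsub>C\<^esub> g \<in> finsupp K X"
proof -
  let ?S = "{x. f x \<noteq> \<zero>}" and ?T = "{x. g x \<noteq> \<zero>}"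
  have c: "f x \<in> carrier K" "g x \<in> carrier K" for x using assms by (auto simp: finsupp_def)
  have fin: "finite ?S" "finite ?T" and sub: "?S \<subseteq> X" "?T \<subseteq> X" using assms by (auto simp: finsupp_def)
  have eq: "(f \<otimes>\<^bsub>C\<^esub> g) z = (\<Oplus>p\<in>?S \<times> ?T. case p of (x, y) \<Rightarrow> if mul x y = Some z then f x \<otimes> g y else \<zero>)"
    for z by (rule mult_superset) (use assms fin in auto)
  \<comment> \<open>The support of the product consists of products of points of the two supports,
    so \<open>?Z\<close> bounds it; \<open>?Z\<close> is finite as part of the image of a finite
    rectangle.\<close>
  let ?Z = "{z. \<exists>x\<in>?S. \<exists>y\<in>?T. mul x y = Some z}"
  have "?Z \<subseteq> (\<lambda>(x, y). the (mul x y)) ` (?S \<times> ?T)"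
    by (force intro!: image_eqI[where x = "(x, y)" for x y])
  hence finZ: "finite ?Z" using fin finite_subset by blast
  have zero: "(f \<otimes>\<^bsub>C\<^esub> g) z = \<zero>" if "z \<notin> ?Z" for z
    unfolding eq by (rule K.add.finprod_one_eqI) (use that in \<open>fastforce split: if_splits\<close>)
  have ZX: "?Z \<subseteq> X" using sub mul_closed by blast
  have "{z. (f \<otimes>\<^bsub>C\<^esub> g) z \<noteq> \<zero>} \<subseteq> ?Z" using zero by blast
  hence "finite {z. (f \<otimes>\<^bsub>C\<^esub> g) z \<noteq> \<zero>}" using finZ finite_subset by blast
  moreover have "(f \<otimes>\<^bsub>C\<^esub> g) z \<in> carrier K" for z
    unfolding eq by (rule K.finsum_closed) (use c in auto)
  moreover have "(f \<otimes>\<^bsub>C\<^esub> g) z = \<zero>" if "z \<notin> X" for z using zero[of z] ZX that by blast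
  ultimately show ?thesis by (auto simp: finsupp_def)
qed

lemma mult_distr_l:
  assumes f: "f \<in> finsupp K X" and g: "g \<in> finsupp K X" and h: "h \<in> finsupp K X"
  shows "(f \<oplus>\<^bsub>C\<^esub> g) \<otimes>\<^bsub>C\<^esub> h = (f \<otimes>\<^bsub>C\<^esub> h) \<oplus>\<^bsub>C\<^esub> (g \<otimes>\<^bsub>C\<^esub> h)"
proof
  fix z
  let ?S = "{x. f x \<noteq> \<zero>} \<union> {x. g x \<noteq> \<zero>}" and ?T = "{x. h x \<noteq> \<zero>}"
  have c: "f x \<in> carrier K" "g x \<in> carrier K" "h x \<in> carrier K" for x using assms by (auto simp: finsupp_def)
  have fin: "finite ?S" "finite ?T" using assms by (auto simp: finsupp_def)
  have fg: "f \<oplus>\<^bsub>C\<^esub> g \<in> finsupp K X" using CM.M.a_closed[of f g] f g by simp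
  have "((f \<oplus>\<^bsub>C\<^esub> g) \<otimes>\<^bsub>C\<^esub> h) z =
      (\<Oplus>p\<in>?S \<times> ?T. case p of (x, y) \<Rightarrow> if mul x y = Some z then (f \<oplus>\<^bsub>C\<^esub> g) x \<otimes> h y else \<zero>)"
    by (rule mult_superset) (use fg h fin in auto)
  also have "\<dots> = (\<Oplus>p\<in>?S \<times> ?T. (case p of (x, y) \<Rightarrow> if mul x y = Some z then f x \<otimes> h y else \<zero>)
      \<oplus> (case p of (x, y) \<Rightarrow> if mul x y = Some z then g x \<otimes> h y else \<zero>))"
    by (rule K.finsum_cong') (use c in \<open>auto simp: K.l_distr\<close>)
  also have "\<dots> = (f \<otimes>\<^bsub>C\<^esub> h) z \<oplus> (g \<otimes>\<^bsub>C\<^esub> h) z"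
    by (subst K.finsum_addf) (use c in \<open>auto simp: mult_superset[OF f h fin(1) _ fin(2)] mult_superset[OF g h fin(1) _ fin(2)]\<close>)
  finally show "((f \<oplus>\<^bsub>C\<^esub> g) \<otimes>\<^bsub>C\<^esub> h) z = ((f \<otimes>\<^bsub>C\<^esub> h) \<oplus>\<^bsub>C\<^esub> (g \<otimes>\<^bsub>C\<^esub> h)) z" by simp
qed

lemma mult_distr_r:
  assumes f: "f \<in> finsupp K X" and g: "g \<in> finsupp K X" and h: "h \<in> finsupp K X"
  shows "h \<otimes>\<^bsub>C\<^esub> (f \<oplus>\<^bsub>C\<^esub> g) = (h \<otimes>\<^bsub>C\<^esub> f) \<oplus>\<^bsub>C\<^esub> (h \<otimes>\<^bsub>C\<^esub> g)"
proof
  fix z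
  let ?S = "{x. f x \<noteq> \<zero>} \<union> {x. g x \<noteq> \<zero>}" and ?T = "{x. h x \<noteq> \<zero>}"
  have c: "f x \<in> carrier K" "g x \<in> carrier K" "h x \<in> carrier K" for x using assms by (auto simp: finsupp_def)
  have fin: "finite ?S" "finite ?T" using assms by (auto simp: finsupp_def)
  have fg: "f \<oplus>\<^bsub>C\<^esub> g \<in> finsupp K X" using CM.M.a_closed[of f g] f g by simp
  have "(h \<otimes>\<^bsub>C\<^esub> (f \<oplus>\<^bsub>C\<^esub> g)) z =
      (\<Oplus>p\<in>?T \<times> ?S. case p of (x, y) \<Rightarrow> if mul x y = Some z then h x \<otimes> (f \<oplus>\<^bsub>C\<^esub> g) y else \<zero>)"
    by (rule mult_superset) (use fg h fin in auto)
  also have "\<dots> = (\<Oplus>p\<in>?T \<times> ?S. (case p of (x, y) \<Rightarrow> if mul x y = Some z then h x \<otimes> f y else \<zero>)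
      \<oplus> (case p of (x, y) \<Rightarrow> if mul x y = Some z then h x \<otimes> g y else \<zero>))"
    by (rule K.finsum_cong') (use c in \<open>auto simp: K.r_distr\<close>)
  also have "\<dots> = (h \<otimes>\<^bsub>C\<^esub> f) z \<oplus> (h \<otimes>\<^bsub>C\<^esub> g) z"
    by (subst K.finsum_addf) (use c in \<open>auto simp: mult_superset[OF h f fin(2) _ fin(1)] mult_superset[OF h g fin(2) _ fin(1)]\<close>)
  finally show "(h \<otimes>\<^bsub>C\<^esub> (f \<oplus>\<^bsub>C\<^esub> g)) z = ((h \<otimes>\<^bsub>C\<^esub> f) \<oplus>\<^bsub>C\<^esub> (h \<otimes>\<^bsub>C\<^esub> g)) z" by simp
qed

lemma C_smult:
  assumes f: "f \<in> finsupp K X" and g: "g \<in> finsupp K X" and k: "k \<in> carrier K"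
  shows mult_smult_l: "(k \<odot>\<^bsub>C\<^esub> f) \<otimes>\<^bsub>C\<^esub> g = k \<odot>\<^bsub>C\<^esub> (f \<otimes>\<^bsub>C\<^esub> g)"
    and mult_smult_r: "f \<otimes>\<^bsub>C\<^esub> (k \<odot>\<^bsub>C\<^esub> g) = k \<odot>\<^bsub>C\<^esub> (f \<otimes>\<^bsub>C\<^esub> g)"
proof -
  let ?S = "{x. f x \<noteq> \<zero>}" and ?T = "{x. g x \<noteq> \<zero>}"
  have c: "f x \<in> carrier K" "g x \<in> carrier K" for x using assms by (auto simp: finsupp_def)
  have fin: "finite ?S" "finite ?T" using assms by (auto simp: finsupp_def)
  have kf: "k \<odot>\<^bsub>C\<^esub> f \<in> finsupp K X" "k \<odot>\<^bsub>C\<^esub> g \<in> finsupp K X"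
    using CM.lsmult_closed[of k f] CM.lsmult_closed[of k g] assms by simp_all
  have *: "k \<otimes> (f \<otimes>\<^bsub>C\<^esub> g) z = (\<Oplus>p\<in>?S \<times> ?T. k \<otimes> (case p of (x, y) \<Rightarrow> if mul x y = Some z then f x \<otimes> g y else \<zero>))" for z
    by (subst mult_superset[OF f g fin(1) _ fin(2)]; (rule K.finsum_rdistr)?) (use c k fin in auto)
  show "(k \<odot>\<^bsub>C\<^esub> f) \<otimes>\<^bsub>C\<^esub> g = k \<odot>\<^bsub>C\<^esub> (f \<otimes>\<^bsub>C\<^esub> g)"
  proof
    fix z
    have "((k \<odot>\<^bsub>C\<^esub> f) \<otimes>\<^bsub>C\<^esub> g) z =
        (\<Oplus>p\<in>?S \<times> ?T. case p of (x, y) \<Rightarrow> if mul x y = Some z then (k \<odot>\<^bsub>C\<^esub> f) x \<otimes> g y else \<zero>)"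
      by (rule mult_superset) (use kf g fin k in auto)
    also have "\<dots> = k \<otimes> (f \<otimes>\<^bsub>C\<^esub> g) z"
      unfolding * by (rule K.finsum_cong') (use c k in \<open>auto simp: K.m_assoc\<close>)
    finally show "((k \<odot>\<^bsub>C\<^esub> f) \<otimes>\<^bsub>C\<^esub> g) z = (k \<odot>\<^bsub>C\<^esub> (f \<otimes>\<^bsub>C\<^esub> g)) z" by simp
  qed
  show "f \<otimes>\<^bsub>C\<^esub> (k \<odot>\<^bsub>C\<^esub> g) = k \<odot>\<^bsub>C\<^esub> (f \<otimes>\<^bsub>C\<^esub> g)"
  proof
    fix z
    have "(f \<otimes>\<^bsub>C\<^esub> (k \<odot>\<^bsub>C\<^esub> g)) z =
        (\<Oplus>p\<in>?S \<times> ?T. case p of (x, y) \<Rightarrow> if mul x y = Some z then f x \<otimes> (k \<odot>\<^bsub>C\<^esub> g) y else \<zero>)"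
      by (rule mult_superset) (use kf f fin k in auto)
    also have "\<dots> = k \<otimes> (f \<otimes>\<^bsub>C\<^esub> g) z"
      unfolding * by (rule K.finsum_cong') (use c k in \<open>auto simp: K.m_lcomm\<close>)
    finally show "(f \<otimes>\<^bsub>C\<^esub> (k \<odot>\<^bsub>C\<^esub> g)) z = (k \<odot>\<^bsub>C\<^esub> (f \<otimes>\<^bsub>C\<^esub> g)) z" by simp
  qed
qed

lemma mult_basis:
  assumes "x \<in> X" "y \<in> X"
  shows "basis_elt K x \<otimes>\<^bsub>C\<^esub> basis_elt K y = (case mul x y of None \<Rightarrow> \<zero>\<^bsub>C\<^esub> | Some z \<Rightarrow> basis_elt K z)"
proof
  fix z
  have "(basis_elt K x \<otimes>\<^bsub>C\<^esub> basis_elt K y) z =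
      (\<Oplus>p\<in>{x} \<times> {y}. case p of (u, v) \<Rightarrow> if mul u v = Some z then basis_elt K x u \<otimes> basis_elt K y v else \<zero>)"
    by (rule mult_superset[OF K.basis_elt_finsupp K.basis_elt_finsupp]) (use assms in \<open>auto simp: basis_elt_def\<close>)
  also have "\<dots> = (case mul x y of None \<Rightarrow> \<zero>\<^bsub>C\<^esub> | Some z \<Rightarrow> basis_elt K z) z"
    by (auto simp: basis_elt_def split: option.split)
  finally show "(basis_elt K x \<otimes>\<^bsub>C\<^esub> basis_elt K y) z = (case mul x y of None \<Rightarrow> \<zero>\<^bsub>C\<^esub> | Some z \<Rightarrow> basis_elt K z) z" .
qed

lemma basis_closed: "x \<in> X \<Longrightarrow> basis_elt K x \<in> finsupp K X"
  by (rule K.basis_elt_finsupp)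

lemma C_induct [consumes 1, case_names zero add basis]:
  assumes "f \<in> finsupp K X" "P \<zero>\<^bsub>C\<^esub>"
    and "\<And>f g. f \<in> finsupp K X \<Longrightarrow> g \<in> finsupp K X \<Longrightarrow> P f \<Longrightarrow> P g \<Longrightarrow> P (f \<oplus>\<^bsub>C\<^esub> g)"
    and "\<And>c x. c \<in> carrier K \<Longrightarrow> x \<in> X \<Longrightarrow> P (c \<odot>\<^bsub>C\<^esub> basis_elt K x)"
  shows "P f"
  using assms by (induction rule: K.finsupp_induct) simp_all

lemma mult_zero: "\<zero>\<^bsub>C\<^esub> \<otimes>\<^bsub>C\<^esub> g = \<zero>\<^bsub>C\<^esub>" "g \<otimes>\<^bsub>C\<^esub> \<zero>\<^bsub>C\<^esub> = \<zero>\<^bsub>C\<^esub>"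
  by (simp_all add: C_def conv_algebra_def)

lemma one_closed: "\<one>\<^bsub>C\<^esub> \<in> finsupp K X"
proof -
  have "{z. \<one>\<^bsub>C\<^esub> z \<noteq> \<zero>} \<subseteq> E" by auto
  hence "finite {z. \<one>\<^bsub>C\<^esub> z \<noteq> \<zero>}" using E finite_subset by blast
  thus ?thesis using E by (auto simp: finsupp_def)
qed

lemma one_mult_basis: assumes x: "x \<in> X" shows "\<one>\<^bsub>C\<^esub> \<otimes>\<^bsub>C\<^esub> basis_elt K x = basis_elt K x"
proof
  fix z
  obtain e where e: "e \<in> E" "mul e x = Some x" "\<And>e'. e' \<in> E \<Longrightarrow> e' \<noteq> e \<Longrightarrow> mul e' x = None"
    using unit_l[OF x] by blast
  have e': "a = e" if "a \<in> E" "mul a x = Some b" for a b using e(3)[OF that(1)] that(2) by fastforce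
  have "(\<one>\<^bsub>C\<^esub> \<otimes>\<^bsub>C\<^esub> basis_elt K x) z =
      (\<Oplus>p\<in>E \<times> {x}. case p of (u, v) \<Rightarrow> if mul u v = Some z then \<one>\<^bsub>C\<^esub> u \<otimes> basis_elt K x v else \<zero>)"
    by (rule mult_superset[OF one_closed K.basis_elt_finsupp]) (use x E in \<open>auto simp: basis_elt_def\<close>)
  \<comment> \<open>Of all members of \<open>E\<close> only the local unit of \<open>x\<close>
    contributes.\<close>
  also have "\<dots> = (\<Oplus>p\<in>{(e, x)}. basis_elt K x z)"
    by (rule K.add.finprod_mono_neutral_cong_right)
      (use e(1,2) E in \<open>auto simp: basis_elt_def dest: e' split: if_splits\<close>)
  finally show "(\<one>\<^bsub>C\<^esub> \<otimes>\<^bsub>C\<^esub> basis_elt K x) z = basis_elt K x z" by (simp add: basis_elt_def)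
qed

lemma mult_one_basis: assumes x: "x \<in> X" shows "basis_elt K x \<otimes>\<^bsub>C\<^esub> \<one>\<^bsub>C\<^esub> = basis_elt K x"
proof
  fix z
  obtain e where e: "e \<in> E" "mul x e = Some x" "\<And>e'. e' \<in> E \<Longrightarrow> e' \<noteq> e \<Longrightarrow> mul x e' = None"
    using unit_r[OF x] by blast
  have e': "a = e" if "a \<in> E" "mul x a = Some b" for a b using e(3)[OF that(1)] that(2) by fastforce
  have "(basis_elt K x \<otimes>\<^bsub>C\<^esub> \<one>\<^bsub>C\<^esub>) z =
      (\<Oplus>p\<in>{x} \<times> E. case p of (u, v) \<Rightarrow> if mul u v = Some z then basis_elt K x u \<otimes> \<one>\<^bsub>C\<^esub> v else \<zero>)"
    by (rule mult_superset[OF K.basis_elt_finsupp one_closed]) (use x E in \<open>auto simp: basis_elt_def\<close>)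
  also have "\<dots> = (\<Oplus>p\<in>{(x, e)}. basis_elt K x z)"
    by (rule K.add.finprod_mono_neutral_cong_right)
      (use e(1,2) E in \<open>auto simp: basis_elt_def dest: e' split: if_splits\<close>)
  finally show "(basis_elt K x \<otimes>\<^bsub>C\<^esub> \<one>\<^bsub>C\<^esub>) z = basis_elt K x z" by (simp add: basis_elt_def)
qed

lemma basis_assoc:
  assumes "x \<in> X" "y \<in> X" "z \<in> X"
  shows "(basis_elt K x \<otimes>\<^bsub>C\<^esub> basis_elt K y) \<otimes>\<^bsub>C\<^esub> basis_elt K z =
    basis_elt K x \<otimes>\<^bsub>C\<^esub> (basis_elt K y \<otimes>\<^bsub>C\<^esub> basis_elt K z)"
  using mul_assoc[OF assms] mul_closed[of x y] mul_closed[of y z] assms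
  by (auto simp: mult_basis mult_zero simp del: C_simps(2) split: option.splits)

text \<open>Associativity holds on basis elements and is extended to arbitrary elements one argument
  at a time, from right to left (\<open>a1\<close>, \<open>a2\<close>, \<open>a3\<close>).\<close>

lemma C_algebra: "kalgebra K C"
proof -
  note [simp del] = C_simps(2-)
  note [simp] = mult_closed basis_closed mult_zero mult_smult_l mult_smult_r
  have [simp]: "f \<oplus>\<^bsub>C\<^esub> g \<in> finsupp K X" "c \<odot>\<^bsub>C\<^esub> f \<in> finsupp K X"
    if "f \<in> finsupp K X" "g \<in> finsupp K X" "c \<in> carrier K" for f g c
    using CM.M.a_closed[of f g] CM.lsmult_closed[of c f] that by simp_all
  have add [simp]: "f \<oplus>\<^bsub>C\<^esub> g \<in> finsupp K X" if "f \<in> finsupp K X" "g \<in> finsupp K X" for f g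
    using CM.M.a_closed[of f g] that by simp
  have sm [simp]: "c \<odot>\<^bsub>C\<^esub> f \<in> finsupp K X" if "f \<in> finsupp K X" "c \<in> carrier K" for f c
    using CM.lsmult_closed[of c f] that by simp
  have a1: "(basis_elt K x \<otimes>\<^bsub>C\<^esub> basis_elt K y) \<otimes>\<^bsub>C\<^esub> h = basis_elt K x \<otimes>\<^bsub>C\<^esub> (basis_elt K y \<otimes>\<^bsub>C\<^esub> h)"
    if "x \<in> X" "y \<in> X" "h \<in> finsupp K X" for x y h
    using that(3,1,2) by (induction rule: C_induct) (simp_all add: mult_distr_r basis_assoc)
  have a2: "(basis_elt K x \<otimes>\<^bsub>C\<^esub> g) \<otimes>\<^bsub>C\<^esub> h = basis_elt K x \<otimes>\<^bsub>C\<^esub> (g \<otimes>\<^bsub>C\<^esub> h)"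
    if "x \<in> X" "g \<in> finsupp K X" "h \<in> finsupp K X" for x g h
    using that(2,1,3) by (induction rule: C_induct) (simp_all add: mult_distr_r mult_distr_l a1)
  have a3: "(f \<otimes>\<^bsub>C\<^esub> g) \<otimes>\<^bsub>C\<^esub> h = f \<otimes>\<^bsub>C\<^esub> (g \<otimes>\<^bsub>C\<^esub> h)"
    if "f \<in> finsupp K X" "g \<in> finsupp K X" "h \<in> finsupp K X" for f g h
    using that by (induction rule: C_induct) (simp_all add: mult_distr_l a2)
  have o: "\<one>\<^bsub>C\<^esub> \<otimes>\<^bsub>C\<^esub> f = f \<and> f \<otimes>\<^bsub>C\<^esub> \<one>\<^bsub>C\<^esub> = f" if "f \<in> finsupp K X" for f
    using that by (induction rule: C_induct)
      (simp_all add: mult_distr_l mult_distr_r one_closed one_mult_basis mult_one_basis)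
  have "ring C"
    by (rule ringI[OF CM.M.abelian_group_axioms], rule monoidI)
      (simp_all add: a3 o one_closed mult_distr_l mult_distr_r)
  thus ?thesis
    by (intro kalgebra.intro kalgebra_axioms.intro) (simp_all add: K.field_axioms C_module)
qed

end

section \<open>Quotient algebras\<close>

context kalgebra begin

text \<open>A ring ideal is automatically a subspace, because \<open>r x = (r 1) x\<close>.\<close>

lemma ideal_submod: assumes "ideal I A" shows "submod K I A"
proof -
  interpret I: ideal I A by fact
  have "r \<odot>\<^bsub>A\<^esub> x \<in> I" if "r \<in> carrier K" "x \<in> I" for r x
    using I.I_l_closed[of x "r \<odot>\<^bsub>A\<^esub> \<one>\<^bsub>A\<^esub>"] that smult_mult_l[of r "\<one>\<^bsub>A\<^esub>" x] I.Icarr[of x]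
    by (simp add: KA.lsmult_closed)
  thus ?thesis by (auto simp: submod_def I.Icarr)
qed

lemma quot_algebra:
  assumes I: "ideal I A"
  shows "kalgebra K (quot A I)" and "\<one>\<^bsub>quot A I\<^esub> = I +>\<^bsub>A\<^esub> \<one>\<^bsub>A\<^esub>"
    and "\<And>x y. x \<in> carrier A \<Longrightarrow> y \<in> carrier A \<Longrightarrow>
      (I +>\<^bsub>A\<^esub> x) \<otimes>\<^bsub>quot A I\<^esub> (I +>\<^bsub>A\<^esub> y) = I +>\<^bsub>A\<^esub> (x \<otimes>\<^bsub>A\<^esub> y)"
proof -
  interpret I: ideal I A by fact
  note q = KA.quot_facts[OF ideal_submod[OF I]]
  show one: "\<one>\<^bsub>quot A I\<^esub> = I +>\<^bsub>A\<^esub> \<one>\<^bsub>A\<^esub>" by (simp add: quot_def)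
  show mult: "(I +>\<^bsub>A\<^esub> x) \<otimes>\<^bsub>quot A I\<^esub> (I +>\<^bsub>A\<^esub> y) = I +>\<^bsub>A\<^esub> (x \<otimes>\<^bsub>A\<^esub> y)"
    if "x \<in> carrier A" "y \<in> carrier A" for x y
    using I.rcoset_mult_add[OF that] by (simp add: quot_def)
  have "ring (quot A I)"
    by (rule ring_cong[OF I.quotient_is_ring]) (simp_all add: quot_def FactRing_def)
  moreover have "left_module K (quot A I)" by (rule q(1))
  ultimately show "kalgebra K (quot A I)"
    by (intro kalgebra.intro kalgebra_axioms.intro)
      (auto simp: q(2,4) mult KA.lsmult_closed smult_mult_l smult_mult_r K.field_axioms)
qed

end

section \<open>The enveloping algebra and bimodules\<close>

lemma opposite_simps [simp]:
  "carrier (opposite A) = carrier A" "\<zero>\<^bsub>opposite A\<^esub> = \<zero>\<^bsub>A\<^esub>" "\<one>\<^bsub>opposite A\<^esub> = \<one>\<^bsub>A\<^esub>"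
  "x \<oplus>\<^bsub>opposite A\<^esub> y = x \<oplus>\<^bsub>A\<^esub> y" "c \<odot>\<^bsub>opposite A\<^esub> x = c \<odot>\<^bsub>A\<^esub> x" "x \<otimes>\<^bsub>opposite A\<^esub> y = y \<otimes>\<^bsub>A\<^esub> x"
  by (simp_all add: opposite_def)

locale env_algebra = kalgebra K A
  for K :: "('k, 'c) ring_scheme" and A :: "('k, 'a, 'd) module_scheme"
begin

text \<open>The free vector space underlying the enveloping algebra is the monoid algebra of the
  opposite of \<open>A\<close> times \<open>A\<close>: first components are multiplied in reverse
  order.\<close>

sublocale PF: conv_basis K "carrier A \<times> carrier A" "{(\<one>\<^bsub>A\<^esub>, \<one>\<^bsub>A\<^esub>)}"
    "\<lambda>(a, b) (a', b'). Some (a' \<otimes>\<^bsub>A\<^esub> a, b \<otimes>\<^bsub>A\<^esub> b')"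
  by unfold_locales (auto simp: A.m_assoc)

sublocale PA: kalgebra K PF.C by (rule PF.C_algebra)

lemma pair_algebra_eq: "pair_algebra K (opposite A) A = PF.C"
  by (simp add: pair_algebra_def PF.C_def)

section \<open>Pure tensors\<close>

definition tens_ideal where
  "tens_ideal = genideal PF.C (tensor_relations K (opposite A) A)"

definition tens where "tens a b = tens_ideal +>\<^bsub>PF.C\<^esub> basis_elt K (a, b)"

abbreviation Env where "Env \<equiv> enveloping K A"

lemma Env_eq: "Env = quot PF.C tens_ideal"
  by (simp add: enveloping_def tensor_algebra_def pair_algebra_eq tens_ideal_def)

lemma tens_basis_closed: "a \<in> carrier A \<Longrightarrow> b \<in> carrier A \<Longrightarrow> basis_elt K (a, b) \<in> carrier PF.C"
  by (simp add: PF.basis_closed)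

lemma tensor_relations_closed: "tensor_relations K (opposite A) A \<subseteq> carrier PF.C"
  unfolding tensor_relations_def pair_algebra_eq Let_def opposite_simps
  by (auto simp del: PF.C_simps
      intro!: PF.CM.M.minus_closed PF.CM.M.a_closed PF.CM.lsmult_closed tens_basis_closed KA.lsmult_closed)

lemma tens_ideal: "ideal tens_ideal PF.C"
  unfolding tens_ideal_def by (rule PA.A.genideal_ideal[OF tensor_relations_closed])

lemmas Env_facts = PF.CM.quot_facts[OF PA.ideal_submod[OF tens_ideal], folded Env_eq]
lemmas Env_algebra = PA.quot_algebra[OF tens_ideal, folded Env_eq]

sublocale Env: kalgebra K Env by (rule Env_algebra(1))

lemma tens_closed: "a \<in> carrier A \<Longrightarrow> b \<in> carrier A \<Longrightarrow> tens a b \<in> carrier Env"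
  unfolding Env_facts(2) tens_def using tens_basis_closed by blast

lemma tens_rel: "r \<in> tensor_relations K (opposite A) A \<Longrightarrow> r \<in> tens_ideal"
  unfolding tens_ideal_def using PA.A.genideal_self[OF tensor_relations_closed] by blast

lemma tens_add_l:
  assumes "a \<in> carrier A" "a' \<in> carrier A" "b \<in> carrier A"
  shows "tens (a \<oplus>\<^bsub>A\<^esub> a') b = tens a b \<oplus>\<^bsub>Env\<^esub> tens a' b"
proof -
  have "basis_elt K (a \<oplus>\<^bsub>A\<^esub> a', b) \<ominus>\<^bsub>PF.C\<^esub> (basis_elt K (a, b) \<oplus>\<^bsub>PF.C\<^esub> basis_elt K (a', b)) \<in> tens_ideal"
    by (rule tens_rel) (use assms in \<open>unfold tensor_relations_def pair_algebra_eq Let_def opposite_simps, blast\<close>)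
  thus ?thesis unfolding tens_def
    using assms by (simp add: Env_facts(3,6) tens_basis_closed del: PF.C_simps)
qed

lemma tens_add_r:
  assumes "a \<in> carrier A" "b \<in> carrier A" "b' \<in> carrier A"
  shows "tens a (b \<oplus>\<^bsub>A\<^esub> b') = tens a b \<oplus>\<^bsub>Env\<^esub> tens a b'"
proof -
  have "basis_elt K (a, b \<oplus>\<^bsub>A\<^esub> b') \<ominus>\<^bsub>PF.C\<^esub> (basis_elt K (a, b) \<oplus>\<^bsub>PF.C\<^esub> basis_elt K (a, b')) \<in> tens_ideal"
    by (rule tens_rel) (use assms in \<open>unfold tensor_relations_def pair_algebra_eq Let_def opposite_simps, blast\<close>)
  thus ?thesis unfolding tens_def
    using assms by (simp add: Env_facts(3,6) tens_basis_closed del: PF.C_simps)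
qed

lemma tens_smult_l:
  assumes "c \<in> carrier K" "a \<in> carrier A" "b \<in> carrier A"
  shows "tens (c \<odot>\<^bsub>A\<^esub> a) b = c \<odot>\<^bsub>Env\<^esub> tens a b"
proof -
  have "basis_elt K (c \<odot>\<^bsub>A\<^esub> a, b) \<ominus>\<^bsub>PF.C\<^esub> (c \<odot>\<^bsub>PF.C\<^esub> basis_elt K (a, b)) \<in> tens_ideal"
    by (rule tens_rel) (use assms in \<open>unfold tensor_relations_def pair_algebra_eq Let_def opposite_simps, blast\<close>)
  thus ?thesis unfolding tens_def
    using assms by (simp add: Env_facts(4,6) tens_basis_closed KA.lsmult_closed PF.CM.lsmult_closed del: PF.C_simps)
qed

lemma tens_smult_r:
  assumes "c \<in> carrier K" "a \<in> carrier A" "b \<in> carrier A"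
  shows "tens a (c \<odot>\<^bsub>A\<^esub> b) = c \<odot>\<^bsub>Env\<^esub> tens a b"
proof -
  have "basis_elt K (a, c \<odot>\<^bsub>A\<^esub> b) \<ominus>\<^bsub>PF.C\<^esub> (c \<odot>\<^bsub>PF.C\<^esub> basis_elt K (a, b)) \<in> tens_ideal"
    by (rule tens_rel) (use assms in \<open>unfold tensor_relations_def pair_algebra_eq Let_def opposite_simps, blast\<close>)
  thus ?thesis unfolding tens_def
    using assms by (simp add: Env_facts(4,6) tens_basis_closed KA.lsmult_closed PF.CM.lsmult_closed del: PF.C_simps)
qed

lemma tens_mult:
  assumes "a \<in> carrier A" "b \<in> carrier A" "a' \<in> carrier A" "b' \<in> carrier A"
  shows "tens a b \<otimes>\<^bsub>Env\<^esub> tens a' b' = tens (a' \<otimes>\<^bsub>A\<^esub> a) (b \<otimes>\<^bsub>A\<^esub> b')"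
  unfolding tens_def
  using assms by (simp add: Env_algebra(3) tens_basis_closed PF.mult_basis del: PF.C_simps)

lemma tens_one: "\<one>\<^bsub>Env\<^esub> = tens \<one>\<^bsub>A\<^esub> \<one>\<^bsub>A\<^esub>"
proof -
  have "\<one>\<^bsub>PF.C\<^esub> = basis_elt K (\<one>\<^bsub>A\<^esub>, \<one>\<^bsub>A\<^esub>)" by (auto simp: basis_elt_def)
  thus ?thesis by (simp add: Env_algebra(2) tens_def del: PF.C_simps)
qed

text \<open>A scalar can be absorbed into the second factor, so every element is a plain sum of pure
  tensors and the induction has no case for multiples.\<close>

lemma Env_induct [consumes 1, case_names zero add tens]:
  assumes S: "S \<in> carrier Env" and z: "P \<zero>\<^bsub>Env\<^esub>"
    and add: "\<And>S T. S \<in> carrier Env \<Longrightarrow> T \<in> carrier Env \<Longrightarrow> P S \<Longrightarrow> P T \<Longrightarrow> P (S \<oplus>\<^bsub>Env\<^esub> T)"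
    and tens: "\<And>a b. a \<in> carrier A \<Longrightarrow> b \<in> carrier A \<Longrightarrow> P (tens a b)"
  shows "P S"
proof -
  obtain f where f: "f \<in> carrier PF.C" "S = tens_ideal +>\<^bsub>PF.C\<^esub> f" using S unfolding Env_facts(2) by blast
  have cl: "tens_ideal +>\<^bsub>PF.C\<^esub> f \<in> carrier Env" if "f \<in> carrier PF.C" for f
    using that unfolding Env_facts(2) by blast
  have "f \<in> finsupp K (carrier A \<times> carrier A)" using f by simp
  hence "P (tens_ideal +>\<^bsub>PF.C\<^esub> f)"
  proof (induction rule: PF.C_induct)
    case zero
    have "tens_ideal +>\<^bsub>PF.C\<^esub> \<zero>\<^bsub>PF.C\<^esub> = \<zero>\<^bsub>Env\<^esub>"
      using Env_facts(7)[of "\<zero>\<^bsub>PF.C\<^esub>"] submodD(2)[OF PA.ideal_submod[OF tens_ideal]]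
      by (simp add: Env_facts(5) del: PF.C_simps)
    thus ?case using z by simp
  next
    case (add f g)
    hence c: "f \<in> carrier PF.C" "g \<in> carrier PF.C" by simp_all
    show ?case unfolding Env_facts(3)[OF c, symmetric]
      by (rule assms(3)[OF cl[OF c(1)] cl[OF c(2)] add.IH])
  next
    case (basis c z)
    then obtain a b where ab: "z = (a, b)" "a \<in> carrier A" "b \<in> carrier A" by auto
    have "tens_ideal +>\<^bsub>PF.C\<^esub> (c \<odot>\<^bsub>PF.C\<^esub> basis_elt K (a, b)) = tens a (c \<odot>\<^bsub>A\<^esub> b)"
      using ab basis Env_facts(4)[of c "basis_elt K (a, b)"] tens_smult_r[of c a b] tens_basis_closed[of a b]
      by (simp add: tens_def del: PF.C_simps)
    thus ?case using tens[of a "c \<odot>\<^bsub>A\<^esub> b"] ab basis by (simp add: KA.lsmult_closed)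
  qed
  thus ?thesis using f by simp
qed

lemma Env_scalar:
  assumes "c \<in> carrier K" shows "c \<odot>\<^bsub>Env\<^esub> \<one>\<^bsub>Env\<^esub> = tens \<one>\<^bsub>A\<^esub> (c \<odot>\<^bsub>A\<^esub> \<one>\<^bsub>A\<^esub>)"
  using assms by (simp add: tens_one tens_smult_r)

end

text \<open>An \<open>A\<close>-bimodule \<open>N\<close> is given by the map \<open>act b x a = b x a\<close>.\<close>

definition env_module ::
    "('k, 'c) ring_scheme \<Rightarrow> ('k, 'n, 'd) module_scheme \<Rightarrow> ('a \<Rightarrow> 'n \<Rightarrow> 'a \<Rightarrow> 'n)
      \<Rightarrow> (('a \<times> 'a \<Rightarrow> 'k) set, 'n) module" where
  "env_module K N act =
     \<lparr> carrier = carrier N, monoid.mult = monoid.mult N, one = one N, zero = zero N, add = add N,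
       smult = (\<lambda>S x. THE y. \<exists>f\<in>S. y =
         finsum N (\<lambda>(a, b). f (a, b) \<odot>\<^bsub>N\<^esub> act b x a) {z. f z \<noteq> \<zero>\<^bsub>K\<^esub>}) \<rparr>"

lemma env_module_simps [simp]:
  "carrier (env_module K N act) = carrier N" "\<zero>\<^bsub>env_module K N act\<^esub> = \<zero>\<^bsub>N\<^esub>"
  "x \<oplus>\<^bsub>env_module K N act\<^esub> y = x \<oplus>\<^bsub>N\<^esub> y"
  by (simp_all add: env_module_def)

lemma regular_bimodule_eq:
  "regular_bimodule K A = env_module K A (\<lambda>b x a. b \<otimes>\<^bsub>A\<^esub> x \<otimes>\<^bsub>A\<^esub> a)"
  by (simp add: regular_bimodule_def env_module_def)

section \<open>Two-sided actions as modules over the enveloping algebra\<close>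

locale bimodule = env_algebra K A + N: left_module K N
  for K :: "('k, 'c) ring_scheme" and A :: "('k, 'a, 'd) module_scheme"
    and N :: "('k, 'n, 'e) module_scheme" +
  fixes act :: "'a \<Rightarrow> 'n \<Rightarrow> 'a \<Rightarrow> 'n"
  assumes act_closed: "\<lbrakk>b \<in> carrier A; x \<in> carrier N; a \<in> carrier A\<rbrakk> \<Longrightarrow> act b x a \<in> carrier N"
    and act_add_l: "\<lbrakk>b \<in> carrier A; b' \<in> carrier A; x \<in> carrier N; a \<in> carrier A\<rbrakk>
      \<Longrightarrow> act (b \<oplus>\<^bsub>A\<^esub> b') x a = act b x a \<oplus>\<^bsub>N\<^esub> act b' x a"
    and act_add_m: "\<lbrakk>b \<in> carrier A; x \<in> carrier N; y \<in> carrier N; a \<in> carrier A\<rbrakk>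
      \<Longrightarrow> act b (x \<oplus>\<^bsub>N\<^esub> y) a = act b x a \<oplus>\<^bsub>N\<^esub> act b y a"
    and act_add_r: "\<lbrakk>b \<in> carrier A; x \<in> carrier N; a \<in> carrier A; a' \<in> carrier A\<rbrakk>
      \<Longrightarrow> act b x (a \<oplus>\<^bsub>A\<^esub> a') = act b x a \<oplus>\<^bsub>N\<^esub> act b x a'"
    and act_smult_l: "\<lbrakk>c \<in> carrier K; b \<in> carrier A; x \<in> carrier N; a \<in> carrier A\<rbrakk>
      \<Longrightarrow> act (c \<odot>\<^bsub>A\<^esub> b) x a = c \<odot>\<^bsub>N\<^esub> act b x a"
    and act_smult_m: "\<lbrakk>c \<in> carrier K; b \<in> carrier A; x \<in> carrier N; a \<in> carrier A\<rbrakk>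
      \<Longrightarrow> act b (c \<odot>\<^bsub>N\<^esub> x) a = c \<odot>\<^bsub>N\<^esub> act b x a"
    and act_smult_r: "\<lbrakk>c \<in> carrier K; b \<in> carrier A; x \<in> carrier N; a \<in> carrier A\<rbrakk>
      \<Longrightarrow> act b x (c \<odot>\<^bsub>A\<^esub> a) = c \<odot>\<^bsub>N\<^esub> act b x a"
    and act_act: "\<lbrakk>b \<in> carrier A; b' \<in> carrier A; x \<in> carrier N; a \<in> carrier A; a' \<in> carrier A\<rbrakk>
      \<Longrightarrow> act b (act b' x a') a = act (b \<otimes>\<^bsub>A\<^esub> b') x (a' \<otimes>\<^bsub>A\<^esub> a)"
    and act_one: "x \<in> carrier N \<Longrightarrow> act \<one>\<^bsub>A\<^esub> x \<one>\<^bsub>A\<^esub> = x"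
begin

abbreviation M where "M \<equiv> env_module K N act"

text \<open>The action of the free vector space, before tensors are formed. Written as an
  \<open>ext_map\<close> it is linear in the function from the start; what remains is that it
  descends to the quotient by the tensor ideal.\<close>

definition ev where "ev x = ext_map K (carrier A \<times> carrier A) N (\<lambda>(a, b). act b x a)"

lemma ev_hom: "x \<in> carrier N \<Longrightarrow> ev x \<in> lin_homs K PF.C N"
  using N.ext_map_hom[of "carrier A \<times> carrier A" "\<lambda>(a, b). act b x a"] act_closed
  by (auto simp: ev_def lin_homs_def free_module_def)

lemma ev_closed: "x \<in> carrier N \<Longrightarrow> f \<in> carrier PF.C \<Longrightarrow> ev x f \<in> carrier N"
  using lin_homs_closed[OF ev_hom] .

lemma ev_zero: "x \<in> carrier N \<Longrightarrow> ev x \<zero>\<^bsub>PF.C\<^esub> = \<zero>\<^bsub>N\<^esub>"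
  using lin_homs_zero[OF PF.C_module N.left_module_axioms ev_hom] .

lemma ev_basis: "x \<in> carrier N \<Longrightarrow> a \<in> carrier A \<Longrightarrow> b \<in> carrier A \<Longrightarrow> ev x (basis_elt K (a, b)) = act b x a"
  unfolding ev_def using act_closed by (subst N.ext_map_basis_elt) auto

lemma act_zero: "b \<in> carrier A \<Longrightarrow> a \<in> carrier A \<Longrightarrow> act b \<zero>\<^bsub>N\<^esub> a = \<zero>\<^bsub>N\<^esub>"
  using act_smult_m[of "\<zero>\<^bsub>K\<^esub>" b "\<zero>\<^bsub>N\<^esub>" a] by (simp add: N.lsmult_zero act_closed)

lemma ev_mult_basis:
  assumes "g \<in> finsupp K (carrier A \<times> carrier A)" "x \<in> carrier N" "a \<in> carrier A" "b \<in> carrier A"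
  shows "ev x (basis_elt K (a, b) \<otimes>\<^bsub>PF.C\<^esub> g) = act b (ev x g) a"
  using assms
proof (induction rule: PF.C_induct)
  case zero
  thus ?case by (simp add: PF.mult_zero act_zero ev_zero del: PF.C_simps)
next
  case (add f g)
  have c: "f \<in> carrier PF.C" "g \<in> carrier PF.C" "basis_elt K (a, b) \<in> carrier PF.C"
    using add tens_basis_closed by simp_all
  thus ?case using add
    by (simp add: PA.A.r_distr lin_homs_add[OF ev_hom] ev_closed act_add_m PA.A.m_closed del: PF.C_simps)
next
  case (basis c z)
  then obtain a' b' where z: "z = (a', b')" "a' \<in> carrier A" "b' \<in> carrier A" by auto
  show ?case using basis z
    by (simp add: PA.smult_mult_r tens_basis_closed lin_homs_smult[OF ev_hom] ev_basis act_smult_m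
        act_closed PF.mult_basis act_act del: PF.C_simps)
qed

lemma ev_add_m:
  assumes f: "f \<in> finsupp K (carrier A \<times> carrier A)" and x: "x \<in> carrier N" "y \<in> carrier N"
  shows "ev (x \<oplus>\<^bsub>N\<^esub> y) f = ev x f \<oplus>\<^bsub>N\<^esub> ev y f"
  using f
proof (induction rule: PF.C_induct)
  case zero
  thus ?case using x by (simp add: ev_zero del: PF.C_simps)
next
  case (add f g)
  hence c: "f \<in> carrier PF.C" "g \<in> carrier PF.C" by simp_all
  thus ?case using x add
    by (simp add: lin_homs_add[OF ev_hom] ev_closed N.M.a_ac del: PF.C_simps)
next
  case (basis c z)
  thus ?case using x
    by (auto simp: lin_homs_smult[OF ev_hom] tens_basis_closed ev_basis act_add_m act_closed N.lsmult_r_distr simp del: PF.C_simps)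
qed

text \<open>This is the associativity law of the module at the level of the free vector space, and
  it also makes the common annihilator in \<open>ev_ideal\<close> closed under multiplication from
  both sides.\<close>

lemma ev_mult:
  assumes f: "f \<in> finsupp K (carrier A \<times> carrier A)" and g: "g \<in> finsupp K (carrier A \<times> carrier A)"
    and x: "x \<in> carrier N"
  shows "ev x (f \<otimes>\<^bsub>PF.C\<^esub> g) = ev (ev x g) f"
  using f
proof (induction rule: PF.C_induct)
  case zero
  have "g \<in> carrier PF.C" using g by simp
  thus ?case using x by (simp add: PF.mult_zero ev_zero ev_closed del: PF.C_simps)
next
  case (add f h)
  have c: "f \<in> carrier PF.C" "g \<in> carrier PF.C" "h \<in> carrier PF.C"
    using add g by simp_all
  thus ?case using add x
    by (simp add: PA.A.l_distr lin_homs_add[OF ev_hom] ev_closed PA.A.m_closed del: PF.C_simps)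
next
  case (basis c z)
  then obtain a' b' where z: "z = (a', b')" "a' \<in> carrier A" "b' \<in> carrier A" by auto
  have c: "g \<in> carrier PF.C" using g by simp
  show ?case using basis z x c g
    by (simp add: PA.smult_mult_l tens_basis_closed lin_homs_smult[OF ev_hom] ev_basis
        ev_closed PA.A.m_closed ev_mult_basis del: PF.C_simps)
qed

text \<open>The functions that act as zero on all of \<open>N\<close> form a two-sided ideal, the
  tensor relations lie in it because \<open>act\<close> is linear in each outer argument, and the
  tensor ideal is the smallest ideal containing them. Quantifying over all of \<open>N\<close>, not
  a single \<open>x\<close>, is what gives closure under multiplication on the right.\<close>

lemma ev_ideal:
  assumes "f \<in> tens_ideal" "x \<in> carrier N" shows "ev x f = \<zero>\<^bsub>N\<^esub>"
proof -
  let ?I = "{f \<in> carrier PF.C. \<forall>x\<in>carrier N. ev x f = \<zero>\<^bsub>N\<^esub>}"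
  have sub: "submod K ?I PF.C"
    unfolding submod_def
    by (auto simp: ev_zero lin_homs_add[OF ev_hom] lin_homs_smult[OF ev_hom] N.lsmult_r_zero
        PF.CM.lsmult_closed simp del: PF.C_simps)
  \<comment> \<open>Required for left multiples: \<open>g f\<close> acts on \<open>x\<close> as
    \<open>g\<close> acts on \<open>f x\<close>, which is zero.\<close>
  have ev0: "ev \<zero>\<^bsub>N\<^esub> f = \<zero>\<^bsub>N\<^esub>" if "f \<in> carrier PF.C" for f
  proof -
    have "ev (\<zero>\<^bsub>N\<^esub> \<oplus>\<^bsub>N\<^esub> \<zero>\<^bsub>N\<^esub>) f = ev \<zero>\<^bsub>N\<^esub> f \<oplus>\<^bsub>N\<^esub> ev \<zero>\<^bsub>N\<^esub> f"
      using that by (intro ev_add_m) simp_all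
    thus ?thesis using that ev_closed[of "\<zero>\<^bsub>N\<^esub>" f] by simp
  qed
  have "ideal ?I PF.C"
  proof (rule idealI)
    show "subgroup ?I (add_monoid PF.C)"
      by (rule additive_subgroup.a_subgroup, rule abelian_subgroup.axioms(1),
          rule PF.CM.submod_abelian_subgroup[OF sub])
  next
    fix f g assume f: "f \<in> ?I" and g: "g \<in> carrier PF.C"
    have m: "ev x (f \<otimes>\<^bsub>PF.C\<^esub> g) = ev (ev x g) f" "ev x (g \<otimes>\<^bsub>PF.C\<^esub> f) = ev (ev x f) g"
      if "x \<in> carrier N" for x using ev_mult[of f g x] ev_mult[of g f x] f g that by auto
    show "g \<otimes>\<^bsub>PF.C\<^esub> f \<in> ?I" using f g m ev0 by (auto simp del: PF.C_simps)
    show "f \<otimes>\<^bsub>PF.C\<^esub> g \<in> ?I" using f g m ev_closed by (auto simp del: PF.C_simps)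
  qed (rule PA.A.ring_axioms)
  moreover have "tensor_relations K (opposite A) A \<subseteq> ?I"
  proof
    have [simp]: "ev y (f \<ominus>\<^bsub>PF.C\<^esub> g) = \<zero>\<^bsub>N\<^esub> \<longleftrightarrow> ev y f = ev y g"
      if "f \<in> carrier PF.C" "g \<in> carrier PF.C" "y \<in> carrier N" for f g y
      using that lin_homs_minus[OF PF.C_module N.left_module_axioms ev_hom, of y f g] ev_closed
      by (simp del: PF.C_simps)
    fix r assume r: "r \<in> tensor_relations K (opposite A) A"
    have "ev x r = \<zero>\<^bsub>N\<^esub>" if x: "x \<in> carrier N" for x
      using r x unfolding tensor_relations_def pair_algebra_eq Let_def opposite_simps
      by (auto simp: lin_homs_add[OF ev_hom] lin_homs_smult[OF ev_hom] tens_basis_closed ev_basis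
          act_add_l act_add_r act_smult_l act_smult_r KA.lsmult_closed PF.CM.lsmult_closed simp del: PF.C_simps)
    thus "r \<in> ?I" using r tensor_relations_closed by blast
  qed
  ultimately have "tens_ideal \<subseteq> ?I" unfolding tens_ideal_def by (rule PA.A.genideal_minimal)
  thus ?thesis using assms by blast
qed

text \<open>The description operator in \<open>env_module\<close> denotes a value because all
  representatives of a coset act alike, their differences lying in the tensor ideal.\<close>

lemma env_smult:
  assumes f: "f \<in> carrier PF.C" and x: "x \<in> carrier N"
  shows "(tens_ideal +>\<^bsub>PF.C\<^esub> f) \<odot>\<^bsub>M\<^esub> x = ev x f"
proof -
  have *: "finsum N (\<lambda>(a, b). g (a, b) \<odot>\<^bsub>N\<^esub> act b x a) {z. g z \<noteq> \<zero>\<^bsub>K\<^esub>} = ev x f"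
    if "g \<in> tens_ideal +>\<^bsub>PF.C\<^esub> f" for g
  proof -
    have g: "g \<in> carrier PF.C" "tens_ideal +>\<^bsub>PF.C\<^esub> g = tens_ideal +>\<^bsub>PF.C\<^esub> f"
      using that Env_facts(8)[OF f, of g] by blast+
    hence "g \<ominus>\<^bsub>PF.C\<^esub> f \<in> tens_ideal" using Env_facts(6)[OF g(1) f] by blast
    hence "ev x (g \<ominus>\<^bsub>PF.C\<^esub> f) = \<zero>\<^bsub>N\<^esub>" using x by (rule ev_ideal)
    hence "ev x g = ev x f"
      using lin_homs_minus[OF PF.C_module N.left_module_axioms ev_hom[OF x] g(1) f]
        ev_closed[OF x] g(1) f by simp
    moreover have "ev x g = finsum N (\<lambda>(a, b). g (a, b) \<odot>\<^bsub>N\<^esub> act b x a) {z. g z \<noteq> \<zero>\<^bsub>K\<^esub>}"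
    proof -
      have "(\<lambda>z. g z \<odot>\<^bsub>N\<^esub> (case z of (a, b) \<Rightarrow> act b x a)) = (\<lambda>(a, b). g (a, b) \<odot>\<^bsub>N\<^esub> act b x a)"
        by (simp add: fun_eq_iff)
      thus ?thesis using g(1) by (simp add: ev_def ext_map_def)
    qed
    ultimately show ?thesis by simp
  qed
  have "f \<in> tens_ideal +>\<^bsub>PF.C\<^esub> f" using f Env_facts(8)[OF f, of f] by blast
  thus ?thesis unfolding env_module_def by (simp, intro the_equality) (use * in auto)
qed

lemma tens_act: "a \<in> carrier A \<Longrightarrow> b \<in> carrier A \<Longrightarrow> x \<in> carrier N \<Longrightarrow> tens a b \<odot>\<^bsub>M\<^esub> x = act b x a"
  unfolding tens_def by (simp add: env_smult tens_basis_closed ev_basis del: PF.C_simps)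

lemma env_left_module: "left_module Env M"
proof -
  have ab: "abelian_group M"
    by (rule abelian_groupI) (use N.M.l_neg in \<open>auto simp: N.M.a_ac intro: bexI[of _ "\<ominus>\<^bsub>N\<^esub> x" for x]\<close>)
  show ?thesis
  proof (intro left_module.intro left_module_axioms.intro)
    fix S T x y
    assume S: "S \<in> carrier Env" and xy: "x \<in> carrier M" "y \<in> carrier M"
    from S obtain f where f: "f \<in> carrier PF.C" "S = tens_ideal +>\<^bsub>PF.C\<^esub> f" unfolding Env_facts(2) by blast
    have x: "x \<in> carrier N" and y: "y \<in> carrier N" using xy by simp_all
    show "S \<odot>\<^bsub>M\<^esub> x \<in> carrier M" using f x by (simp add: env_smult ev_closed del: PF.C_simps)
    show "S \<odot>\<^bsub>M\<^esub> (x \<oplus>\<^bsub>M\<^esub> y) = S \<odot>\<^bsub>M\<^esub> x \<oplus>\<^bsub>M\<^esub> S \<odot>\<^bsub>M\<^esub> y"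
      using f x y ev_add_m[of f x y] by (simp add: env_smult)
    assume T: "T \<in> carrier Env"
    from T obtain g where g: "g \<in> carrier PF.C" "T = tens_ideal +>\<^bsub>PF.C\<^esub> g" unfolding Env_facts(2) by blast
    show "(S \<oplus>\<^bsub>Env\<^esub> T) \<odot>\<^bsub>M\<^esub> x = S \<odot>\<^bsub>M\<^esub> x \<oplus>\<^bsub>M\<^esub> T \<odot>\<^bsub>M\<^esub> x"
      unfolding f(2) g(2) using f(1) g(1) x
      by (simp add: Env_facts(3) env_smult lin_homs_add[OF ev_hom] PF.CM.M.a_closed del: PF.C_simps)
    have "ev x (f \<otimes>\<^bsub>PF.C\<^esub> g) = ev (ev x g) f" using f(1) g(1) x by (intro ev_mult) simp_all
    thus "(S \<otimes>\<^bsub>Env\<^esub> T) \<odot>\<^bsub>M\<^esub> x = S \<odot>\<^bsub>M\<^esub> (T \<odot>\<^bsub>M\<^esub> x)"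
      unfolding f(2) g(2) using f(1) g(1) x
      by (simp add: Env_algebra(3) env_smult ev_closed PA.A.m_closed del: PF.C_simps)
  next
    fix x assume "x \<in> carrier M"
    thus "\<one>\<^bsub>Env\<^esub> \<odot>\<^bsub>M\<^esub> x = x" by (simp add: tens_one tens_act act_one)
  qed (auto simp: Env.A.ring_axioms ab)
qed

lemma env_scalar: "c \<in> carrier K \<Longrightarrow> x \<in> carrier N \<Longrightarrow> (c \<odot>\<^bsub>Env\<^esub> \<one>\<^bsub>Env\<^esub>) \<odot>\<^bsub>M\<^esub> x = c \<odot>\<^bsub>N\<^esub> x"
  by (simp add: Env_scalar tens_act KA.lsmult_closed act_smult_l act_one)

text \<open>Pure tensors generate the enveloping algebra as an additive group, so additivity and
  compatibility with them already give linearity; scalars are covered, being carried by the tensor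
  factors.\<close>

lemma env_lin_homsI:
  assumes N': "left_module Env N'"
    and cl: "\<And>x. x \<in> carrier N \<Longrightarrow> h x \<in> carrier N'"
    and add: "\<And>x y. x \<in> carrier N \<Longrightarrow> y \<in> carrier N \<Longrightarrow> h (x \<oplus>\<^bsub>N\<^esub> y) = h x \<oplus>\<^bsub>N'\<^esub> h y"
    and act: "\<And>a b x. a \<in> carrier A \<Longrightarrow> b \<in> carrier A \<Longrightarrow> x \<in> carrier N \<Longrightarrow> h (act b x a) = tens a b \<odot>\<^bsub>N'\<^esub> h x"
  shows "(\<lambda>x\<in>carrier N. h x) \<in> lin_homs Env M N'"
proof -
  interpret M: left_module Env M by (rule env_left_module)
  interpret N': left_module Env N' by (rule N')
  have "h \<zero>\<^bsub>N\<^esub> \<oplus>\<^bsub>N'\<^esub> h \<zero>\<^bsub>N\<^esub> = h \<zero>\<^bsub>N\<^esub>" using add[of "\<zero>\<^bsub>N\<^esub>" "\<zero>\<^bsub>N\<^esub>"] by simp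
  hence h0: "h \<zero>\<^bsub>N\<^esub> = \<zero>\<^bsub>N'\<^esub>" using cl[of "\<zero>\<^bsub>N\<^esub>"] by simp
  have sm: "h (S \<odot>\<^bsub>M\<^esub> x) = S \<odot>\<^bsub>N'\<^esub> h x" if S: "S \<in> carrier Env" and x: "x \<in> carrier N" for S x
    using S
  proof (induction rule: Env_induct)
    case zero
    thus ?case using M.lsmult_zero[of x] x by (simp add: N'.lsmult_zero h0 cl)
  next
    case (add S T)
    have "S \<odot>\<^bsub>M\<^esub> x \<in> carrier N" "T \<odot>\<^bsub>M\<^esub> x \<in> carrier N"
      using M.lsmult_closed add x by auto
    thus ?case using M.lsmult_l_distr[of S T x] N'.lsmult_l_distr[of S T "h x"] add x assms(3) cl by simp
  next
    case (tens a b)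
    thus ?case using x by (simp add: tens_act act)
  qed
  show ?thesis using M.lin_homsI[of h N'] cl add sm by simp
qed

end

context env_algebra begin

lemma regular_bimodule: "bimodule K A A (\<lambda>b x a. b \<otimes>\<^bsub>A\<^esub> x \<otimes>\<^bsub>A\<^esub> a)"
  by unfold_locales
    (simp_all add: KA.lsmult_closed smult_mult_l smult_mult_r A.l_distr A.r_distr A.m_assoc)

end

section \<open>Comparison of projective resolutions\<close>

text \<open>In place of surjectivity of \<open>g\<close> only the image of \<open>f\<close> is
  required to lie in that of \<open>g\<close>, so kernels never have to be made into modules.
  Preimages are chosen on the generators of a free module that has \<open>P\<close> as a
  summand.\<close>

lemma projective_lift:
  fixes P :: "('r, 'p, 'd) module_scheme"
  assumes P: "projective R P" and N: "left_module R N" and N': "left_module R N'"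
    and f: "f \<in> lin_homs R P N'" and g: "g \<in> lin_homs R N N'"
    and im: "\<And>x. x \<in> carrier P \<Longrightarrow> f x \<in> g ` carrier N"
  shows "\<exists>h\<in>lin_homs R P N. \<forall>x\<in>carrier P. g (h x) = f x"
proof -
  obtain X :: "'p set" and \<iota> \<pi> where \<iota>: "\<iota> \<in> lin_homs R P (free_module R X)" and \<pi>: "\<pi> \<in> lin_homs R (free_module R X) P"
    and id: "\<And>x. x \<in> carrier P \<Longrightarrow> \<pi> (\<iota> x) = x" and PM: "left_module R P"
    using P unfolding projective_def by blast
  interpret P: left_module R P by (rule PM)
  interpret N: left_module R N by (rule N)
  let ?F = "free_module R X"
  have F: "left_module R ?F" by (rule P.R.left_module_free)
  have car: "carrier ?F = finsupp R X" by (simp add: free_module_def)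
  have e: "basis_elt R x \<in> carrier ?F" if "x \<in> X" for x using that car P.R.basis_elt_finsupp by simp
  have "\<forall>x\<in>X. \<exists>y. y \<in> carrier N \<and> g y = f (\<pi> (basis_elt R x))"
    using im[OF lin_homs_closed[OF \<pi> e]] by (metis imageE)
  then obtain n where n: "\<And>x. x \<in> X \<Longrightarrow> n x \<in> carrier N" "\<And>x. x \<in> X \<Longrightarrow> g (n x) = f (\<pi> (basis_elt R x))"
    by metis
  let ?k = "ext_map R X N n"
  have k: "?k \<in> lin_homs R ?F N" by (rule N.ext_map_hom) (rule n(1))
  have eq: "g (?k y) = f (\<pi> y)" if y: "y \<in> carrier ?F" for y
  proof -
    have "(\<lambda>y\<in>carrier ?F. g (?k y)) y = (\<lambda>y\<in>carrier ?F. f (\<pi> y)) y"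
      by (rule P.R.hom_eq_on_free[OF lin_homs_compose[OF F k g] lin_homs_compose[OF F \<pi> f] _ N'])
        (use y car e n N.ext_map_basis_elt[of X n] in auto)
    thus ?thesis using y by simp
  qed
  let ?h = "\<lambda>x\<in>carrier P. ?k (\<iota> x)"
  have "?h \<in> lin_homs R P N" by (rule lin_homs_compose[OF PM \<iota> k])
  moreover have "g (?h x) = f x" if "x \<in> carrier P" for x
    using that eq[OF lin_homs_closed[OF \<iota> that]] id by simp
  ultimately show ?thesis by blast
qed

lemma lsmult_minus:
  assumes "left_module R N" "r \<in> carrier R" "x \<in> carrier N" "y \<in> carrier N"
  shows "r \<odot>\<^bsub>N\<^esub> (x \<ominus>\<^bsub>N\<^esub> y) = r \<odot>\<^bsub>N\<^esub> x \<ominus>\<^bsub>N\<^esub> r \<odot>\<^bsub>N\<^esub> y"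
proof -
  interpret N: left_module R N by fact
  have "r \<odot>\<^bsub>N\<^esub> (\<ominus>\<^bsub>N\<^esub> y) \<oplus>\<^bsub>N\<^esub> r \<odot>\<^bsub>N\<^esub> y = \<zero>\<^bsub>N\<^esub>"
    using assms by (subst N.lsmult_r_distr[symmetric]) (auto simp: N.M.l_neg N.lsmult_r_zero)
  hence "r \<odot>\<^bsub>N\<^esub> (\<ominus>\<^bsub>N\<^esub> y) = \<ominus>\<^bsub>N\<^esub> (r \<odot>\<^bsub>N\<^esub> y)" using assms by (simp add: N.M.minus_equality N.lsmult_closed)
  thus ?thesis using assms by (simp add: a_minus_def N.lsmult_r_distr)
qed

lemma (in abelian_group) minus_plus: "x \<in> carrier G \<Longrightarrow> y \<in> carrier G \<Longrightarrow> (x \<ominus> y) \<oplus> y = x"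
  by (simp add: a_minus_def a_assoc l_neg)

lemma (in left_module) minus_self: "x \<in> carrier M \<Longrightarrow> x \<ominus>\<^bsub>M\<^esub> x = \<zero>\<^bsub>M\<^esub>"
  by (simp add: a_minus_def M.r_neg)

lemma lin_homs_diff:
  assumes M: "left_module R M" and N: "left_module R N" and f: "f \<in> lin_homs R M N" and g: "g \<in> lin_homs R M N"
  shows "(\<lambda>x\<in>carrier M. f x \<ominus>\<^bsub>N\<^esub> g x) \<in> lin_homs R M N"
proof -
  interpret M: left_module R M by fact
  interpret N: left_module R N by fact
  note [simp] = lin_homs_closed[OF f] lin_homs_closed[OF g]
  show ?thesis
    by (rule M.lin_homsI)
      (simp_all add: lin_homs_add[OF f] lin_homs_add[OF g] lin_homs_smult[OF f] lin_homs_smult[OF g]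
        lsmult_minus[OF N] a_minus_def[of N] N.M.minus_add N.M.a_ac lsmult_minus[OF N, unfolded a_minus_def])
qed

lemma lin_homs_sum:
  assumes M: "left_module R M" and N: "left_module R N" and f: "f \<in> lin_homs R M N" and g: "g \<in> lin_homs R M N"
  shows "(\<lambda>x\<in>carrier M. f x \<oplus>\<^bsub>N\<^esub> g x) \<in> lin_homs R M N"
proof -
  interpret M: left_module R M by fact
  interpret N: left_module R N by fact
  note [simp] = lin_homs_closed[OF f] lin_homs_closed[OF g]
  show ?thesis
    by (rule M.lin_homsI)
      (simp_all add: lin_homs_add[OF f] lin_homs_add[OF g] lin_homs_smult[OF f] lin_homs_smult[OF g]
        N.lsmult_r_distr N.M.a_ac)
qed

section \<open>Homotopies and chain maps\<close>

locale proj_res = M: left_module R M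
  for R :: "('r, 'c) ring_scheme" and M :: "('r, 'm, 'd) module_scheme" +
  fixes P :: "nat \<Rightarrow> ('r, 'p) module" and d :: "nat \<Rightarrow> 'p \<Rightarrow> 'p" and \<epsilon> :: "'p \<Rightarrow> 'm"
  assumes res: "projective_resolution R M (P, d, \<epsilon>)"
begin

lemma proj: "projective R (P i)" using res by (simp add: projective_resolution_def)
lemma P_module: "left_module R (P i)" using proj by (simp add: projective_def)
lemma d_hom: "d i \<in> lin_homs R (P (Suc i)) (P i)" using res by (simp add: projective_resolution_def)
lemma aug_hom: "\<epsilon> \<in> lin_homs R (P 0) M" using res by (simp add: projective_resolution_def)
lemma aug_surj: "\<epsilon> ` carrier (P 0) = carrier M" using res by (simp add: projective_resolution_def)

text \<open>With the augmentation in the role of the differential in degree 0, exactness reads the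
  same in all degrees (\<open>cyc_eq\<close>).\<close>

definition cyc where
  "cyc n = {x \<in> carrier (P n). case n of 0 \<Rightarrow> \<epsilon> x = \<zero>\<^bsub>M\<^esub> | Suc k \<Rightarrow> d k x = \<zero>\<^bsub>P k\<^esub>}"

lemma cyc_eq: "cyc n = d n ` carrier (P (Suc n))"
  using res by (cases n) (simp_all add: cyc_def projective_resolution_def)

lemma d_closed: "x \<in> carrier (P (Suc n)) \<Longrightarrow> d n x \<in> carrier (P n)"
  by (rule lin_homs_closed[OF d_hom])

lemma d_cyc: "x \<in> carrier (P (Suc n)) \<Longrightarrow> d n x \<in> cyc n"
  unfolding cyc_eq by blast

lemma d_d: "x \<in> carrier (P (Suc (Suc n))) \<Longrightarrow> d n (d (Suc n) x) = \<zero>\<^bsub>P n\<^esub>"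
  using d_cyc[of x "Suc n"] by (simp add: cyc_def)

text \<open>Each \<open>h\<close> lifts the map \<open>g - h d\<close> of its degree through the
  next differential. The lift exists because that map lands in the cycles, so this property is the
  invariant of the recursive choice.\<close>

lemma homotopy_exists:
  assumes g: "\<And>n. g n \<in> lin_homs R (P n) (P n)"
    and g0: "\<And>x. x \<in> carrier (P 0) \<Longrightarrow> \<epsilon> (g 0 x) = \<zero>\<^bsub>M\<^esub>"
    and gd: "\<And>n x. x \<in> carrier (P (Suc n)) \<Longrightarrow> d n (g (Suc n) x) = g n (d n x)"
  shows "\<exists>h. (\<forall>n. h n \<in> lin_homs R (P n) (P (Suc n))) \<and>
    (\<forall>x\<in>carrier (P 0). d 0 (h 0 x) = g 0 x) \<and>
    (\<forall>n. \<forall>x\<in>carrier (P (Suc n)). d (Suc n) (h (Suc n) x) = g (Suc n) x \<ominus>\<^bsub>P (Suc n)\<^esub> h n (d n x))"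
proof -
  \<comment> \<open>The second clause keeps the next step solvable; the third carries the equation
    of degree 0, where there is no earlier map.\<close>
  let ?P = "\<lambda>n h. h \<in> lin_homs R (P n) (P (Suc n)) \<and>
    (\<forall>x\<in>carrier (P (Suc n)). d n (g (Suc n) x \<ominus>\<^bsub>P (Suc n)\<^esub> h (d n x)) = \<zero>\<^bsub>P n\<^esub>) \<and>
    (n = 0 \<longrightarrow> (\<forall>x\<in>carrier (P 0). d 0 (h x) = g 0 x))"
  let ?Q = "\<lambda>n h h'. \<forall>x\<in>carrier (P (Suc n)). d (Suc n) (h' x) = g (Suc n) x \<ominus>\<^bsub>P (Suc n)\<^esub> h (d n x)"
  have gc: "g n x \<in> carrier (P n)" if "x \<in> carrier (P n)" for n x by (rule lin_homs_closed[OF g that])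
  have "\<exists>f. \<forall>n. ?P n (f n) \<and> ?Q n (f n) (f (Suc n))"
  proof (rule dependent_nat_choice)
    have im: "g 0 x \<in> d 0 ` carrier (P (Suc 0))" if "x \<in> carrier (P 0)" for x
      unfolding cyc_eq[symmetric] cyc_def using g0[OF that] gc[OF that] by simp
    then obtain h where h: "h \<in> lin_homs R (P 0) (P (Suc 0))" "\<And>x. x \<in> carrier (P 0) \<Longrightarrow> d 0 (h x) = g 0 x"
      using projective_lift[OF proj P_module P_module g d_hom im] by blast
    interpret P0: left_module R "P 0" by (rule P_module)
    have "d 0 (g (Suc 0) x \<ominus>\<^bsub>P (Suc 0)\<^esub> h (d 0 x)) = \<zero>\<^bsub>P 0\<^esub>" if "x \<in> carrier (P (Suc 0))" for x
      using that h(2)[OF d_closed[OF that]] gc[OF that] gc[OF d_closed[OF that]] lin_homs_closed[OF h(1) d_closed[OF that]]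
      by (simp add: lin_homs_minus[OF P_module P_module d_hom] gd)
    thus "\<exists>h. ?P 0 h" using h by blast
  next
    fix h n assume h: "?P n h"
    interpret Pn: left_module R "P n" by (rule P_module)
    interpret PS: left_module R "P (Suc n)" by (rule P_module)
    have hom: "h \<in> lin_homs R (P n) (P (Suc n))" using h by blast
    let ?u = "\<lambda>x\<in>carrier (P (Suc n)). g (Suc n) x \<ominus>\<^bsub>P (Suc n)\<^esub> (\<lambda>x\<in>carrier (P (Suc n)). h (d n x)) x"
    have u: "?u \<in> lin_homs R (P (Suc n)) (P (Suc n))"
      by (rule lin_homs_diff[OF P_module P_module g lin_homs_compose[OF P_module d_hom hom]])
    have hc: "h (d n x) \<in> carrier (P (Suc n))" if "x \<in> carrier (P (Suc n))" for x
      by (rule lin_homs_closed[OF hom d_closed[OF that]])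
    have im: "?u x \<in> d (Suc n) ` carrier (P (Suc (Suc n)))" if "x \<in> carrier (P (Suc n))" for x
      unfolding cyc_eq[symmetric] cyc_def using that h gc[OF that] hc[OF that] by simp
    then obtain h' where h': "h' \<in> lin_homs R (P (Suc n)) (P (Suc (Suc n)))"
      "\<And>x. x \<in> carrier (P (Suc n)) \<Longrightarrow> d (Suc n) (h' x) = ?u x"
      using projective_lift[OF proj P_module P_module u d_hom im] by blast
    have q: "d (Suc n) (h' x) = g (Suc n) x \<ominus>\<^bsub>P (Suc n)\<^esub> h (d n x)" if "x \<in> carrier (P (Suc n))" for x
      using h'(2)[OF that] that by simp
    \<comment> \<open>By the equation for \<open>h'\<close> and \<open>d d = 0\<close>,
      \<open>d h' d = g d\<close>, and this equals \<open>d g\<close> since \<open>g\<close> is a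
      chain map.\<close>
    have "d (Suc n) (g (Suc (Suc n)) x \<ominus>\<^bsub>P (Suc (Suc n))\<^esub> h' (d (Suc n) x)) = \<zero>\<^bsub>P (Suc n)\<^esub>"
      if x: "x \<in> carrier (P (Suc (Suc n)))" for x
    proof -
      have "h \<zero>\<^bsub>P n\<^esub> = \<zero>\<^bsub>P (Suc n)\<^esub>" by (rule lin_homs_zero[OF P_module P_module hom])
      hence "d (Suc n) (h' (d (Suc n) x)) = g (Suc n) (d (Suc n) x)"
        using x q[OF d_closed[OF x]] gc[OF d_closed[OF x]] by (simp add: d_d a_minus_def)
      thus ?thesis
        using x gc[OF x] gc[OF d_closed[OF x]] lin_homs_closed[OF h'(1) d_closed[OF x]]
        by (simp add: lin_homs_minus[OF P_module P_module d_hom] gd PS.minus_self)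
    qed
    thus "\<exists>h'. ?P (Suc n) h' \<and> ?Q n h h'" using h' q by blast
  qed
  then obtain h where "\<forall>n. ?P n (h n) \<and> ?Q n (h n) (h (Suc n))" by blast
  thus ?thesis by (intro exI[of _ h]) blast
qed

end

text \<open>Carrying cycles to cycles is the invariant that permits the next lift; in degree 0 it
  follows from compatibility with the augmentations, later from the square just completed.\<close>

lemma chain_map_exists:
  assumes "proj_res R M P d \<epsilon>" "proj_res R M P' d' \<epsilon>'"
  shows "\<exists>\<psi>. (\<forall>n. \<psi> n \<in> lin_homs R (P n) (P' n)) \<and>
    (\<forall>x\<in>carrier (P 0). \<epsilon>' (\<psi> 0 x) = \<epsilon> x) \<and>
    (\<forall>n. \<forall>x\<in>carrier (P (Suc n)). d' n (\<psi> (Suc n) x) = \<psi> n (d n x))"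
proof -
  interpret P: proj_res R M P d \<epsilon> by fact
  interpret P': proj_res R M P' d' \<epsilon>' by fact
  let ?P = "\<lambda>n \<psi>. \<psi> \<in> lin_homs R (P n) (P' n) \<and> (\<forall>x\<in>P.cyc n. \<psi> x \<in> P'.cyc n) \<and>
    (n = 0 \<longrightarrow> (\<forall>x\<in>carrier (P 0). \<epsilon>' (\<psi> x) = \<epsilon> x))"
  let ?Q = "\<lambda>n \<psi> \<psi>'. \<forall>x\<in>carrier (P (Suc n)). d' n (\<psi>' x) = \<psi> (d n x)"
  have "\<exists>f. \<forall>n. ?P n (f n) \<and> ?Q n (f n) (f (Suc n))"
  proof (rule dependent_nat_choice)
    have im: "\<epsilon> x \<in> \<epsilon>' ` carrier (P' 0)" if "x \<in> carrier (P 0)" for x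
      unfolding P'.aug_surj by (rule lin_homs_closed[OF P.aug_hom that])
    then obtain \<psi> where "\<psi> \<in> lin_homs R (P 0) (P' 0)" "\<And>x. x \<in> carrier (P 0) \<Longrightarrow> \<epsilon>' (\<psi> x) = \<epsilon> x"
      using projective_lift[OF P.proj P'.P_module P.M.left_module_axioms P.aug_hom P'.aug_hom im] by blast
    thus "\<exists>\<psi>. ?P 0 \<psi>"
      by (intro exI[of _ \<psi>]) (auto simp: P.cyc_def P'.cyc_def lin_homs_closed)
  next
    fix \<psi> n assume \<psi>: "?P n \<psi>"
    hence hom: "\<psi> \<in> lin_homs R (P n) (P' n)" by blast
    have im: "(\<lambda>x\<in>carrier (P (Suc n)). \<psi> (d n x)) x \<in> d' n ` carrier (P' (Suc n))" if "x \<in> carrier (P (Suc n))" for x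
      unfolding P'.cyc_eq[symmetric] using \<psi> P.d_cyc[OF that] that by simp
    then obtain \<psi>' where \<psi>': "\<psi>' \<in> lin_homs R (P (Suc n)) (P' (Suc n))"
      "\<And>x. x \<in> carrier (P (Suc n)) \<Longrightarrow> d' n (\<psi>' x) = (\<lambda>x\<in>carrier (P (Suc n)). \<psi> (d n x)) x"
      using projective_lift[OF P.proj P'.P_module P'.P_module lin_homs_compose[OF P.P_module P.d_hom hom] P'.d_hom im] by blast
    have "\<psi>' x \<in> P'.cyc (Suc n)" if "x \<in> P.cyc (Suc n)" for x
      using that \<psi>'(2)[of x] lin_homs_closed[OF \<psi>'(1), of x] lin_homs_zero[OF P.P_module P'.P_module hom]
      by (simp add: P.cyc_def P'.cyc_def)
    thus "\<exists>\<psi>'. ?P (Suc n) \<psi>' \<and> ?Q n \<psi> \<psi>'" using \<psi>' by (intro exI[of _ \<psi>']) simp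
  qed
  then obtain \<psi> where "\<forall>n. ?P n (\<psi> n) \<and> ?Q n (\<psi> n) (\<psi> (Suc n))" by blast
  thus ?thesis by (intro exI[of _ \<psi>]) blast
qed

text \<open>Stated for arbitrary functions and tested on the carrier only, so that it applies to
  unrestricted expressions such as a cocycle minus a pulled back one.\<close>

definition cobd where
  "cobd R P d N n f = (case n of 0 \<Rightarrow> \<forall>x\<in>carrier (P 0). f x = \<zero>\<^bsub>N\<^esub>
     | Suc l \<Rightarrow> \<exists>g\<in>lin_homs R (P l) N. \<forall>x\<in>carrier (P (Suc l)). f x = g (d l x))"

lemma (in left_module) id_lin_homs: "(\<lambda>x\<in>carrier M. x) \<in> lin_homs R M M"
  by (rule lin_homsI) auto

text \<open>With chain maps \<open>\<psi>\<close>, \<open>\<phi>\<close> in both directions and homotopies \<open>id - \<phi> \<psi> = d h + h d\<close>, a cocycle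
  \<open>f\<close> agrees with \<open>(f \<phi>) \<psi>\<close> up to the coboundary of \<open>f h\<close>.\<close>

lemma comparison:
  assumes "proj_res R M P d \<epsilon>" "proj_res R M P' d' \<epsilon>'" and N: "left_module R N"
  obtains \<psi> where "\<And>n. \<psi> n \<in> lin_homs R (P n) (P' n)"
    and "\<And>n x. x \<in> carrier (P (Suc n)) \<Longrightarrow> d' n (\<psi> (Suc n) x) = \<psi> n (d n x)"
    and "\<And>n f. f \<in> lin_homs R (P n) N \<Longrightarrow> (\<And>x. x \<in> carrier (P (Suc n)) \<Longrightarrow> f (d n x) = \<zero>\<^bsub>N\<^esub>) \<Longrightarrow>
      \<exists>z\<in>lin_homs R (P' n) N. (\<forall>x\<in>carrier (P' (Suc n)). z (d' n x) = \<zero>\<^bsub>N\<^esub>) \<and>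
        cobd R P d N n (\<lambda>x. f x \<ominus>\<^bsub>N\<^esub> z (\<psi> n x))"
    and "\<And>n z. z \<in> lin_homs R (P' n) N \<Longrightarrow> (\<And>x. x \<in> carrier (P' (Suc n)) \<Longrightarrow> z (d' n x) = \<zero>\<^bsub>N\<^esub>) \<Longrightarrow>
      cobd R P d N n (\<lambda>x. z (\<psi> n x)) \<Longrightarrow> cobd R P' d' N n z"
proof -
  interpret P: proj_res R M P d \<epsilon> by fact
  interpret P': proj_res R M P' d' \<epsilon>' by fact
  interpret N: left_module R N by fact
  obtain \<psi> where \<psi>: "\<And>n. \<psi> n \<in> lin_homs R (P n) (P' n)" "\<And>x. x \<in> carrier (P 0) \<Longrightarrow> \<epsilon>' (\<psi> 0 x) = \<epsilon> x"
    "\<And>n x. x \<in> carrier (P (Suc n)) \<Longrightarrow> d' n (\<psi> (Suc n) x) = \<psi> n (d n x)"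
    using chain_map_exists[OF assms(1,2)] by blast
  obtain \<phi> where \<phi>: "\<And>n. \<phi> n \<in> lin_homs R (P' n) (P n)" "\<And>x. x \<in> carrier (P' 0) \<Longrightarrow> \<epsilon> (\<phi> 0 x) = \<epsilon>' x"
    "\<And>n x. x \<in> carrier (P' (Suc n)) \<Longrightarrow> d n (\<phi> (Suc n) x) = \<phi> n (d' n x)"
    using chain_map_exists[OF assms(2,1)] by blast
  have \<psi>c: "\<psi> n x \<in> carrier (P' n)" if "x \<in> carrier (P n)" for n x by (rule lin_homs_closed[OF \<psi>(1) that])
  have \<phi>c: "\<phi> n x \<in> carrier (P n)" if "x \<in> carrier (P' n)" for n x by (rule lin_homs_closed[OF \<phi>(1) that])
  let ?g = "\<lambda>n. \<lambda>x\<in>carrier (P n). (\<lambda>x\<in>carrier (P n). x) x \<ominus>\<^bsub>P n\<^esub> (\<lambda>x\<in>carrier (P n). \<phi> n (\<psi> n x)) x"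
  have "\<exists>h. (\<forall>n. h n \<in> lin_homs R (P n) (P (Suc n))) \<and>
    (\<forall>x\<in>carrier (P 0). d 0 (h 0 x) = ?g 0 x) \<and>
    (\<forall>n. \<forall>x\<in>carrier (P (Suc n)). d (Suc n) (h (Suc n) x) = ?g (Suc n) x \<ominus>\<^bsub>P (Suc n)\<^esub> h n (d n x))"
  proof (rule P.homotopy_exists)
    show "?g n \<in> lin_homs R (P n) (P n)" for n
      by (intro lin_homs_diff P.P_module left_module.id_lin_homs lin_homs_compose[OF _ \<psi>(1) \<phi>(1)])
    show "\<epsilon> (?g 0 x) = \<zero>\<^bsub>M\<^esub>" if "x \<in> carrier (P 0)" for x
      using that by (simp add: lin_homs_minus[OF P.P_module P.M.left_module_axioms P.aug_hom] \<phi>(2) \<psi>(2) \<phi>c \<psi>c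
          P.M.minus_self lin_homs_closed[OF P.aug_hom])
    show "d n (?g (Suc n) x) = ?g n (d n x)" if "x \<in> carrier (P (Suc n))" for n x
      using that by (simp add: lin_homs_minus[OF P.P_module P.P_module P.d_hom] \<phi>(3) \<psi>(3) \<phi>c \<psi>c P.d_closed)
  qed
  then obtain h where h: "\<And>n. h n \<in> lin_homs R (P n) (P (Suc n))"
    "\<And>x. x \<in> carrier (P 0) \<Longrightarrow> d 0 (h 0 x) = ?g 0 x"
    "\<And>n x. x \<in> carrier (P (Suc n)) \<Longrightarrow> d (Suc n) (h (Suc n) x) = ?g (Suc n) x \<ominus>\<^bsub>P (Suc n)\<^esub> h n (d n x)" by blast
  let ?g' = "\<lambda>n. \<lambda>x\<in>carrier (P' n). (\<lambda>x\<in>carrier (P' n). x) x \<ominus>\<^bsub>P' n\<^esub> (\<lambda>x\<in>carrier (P' n). \<psi> n (\<phi> n x)) x"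
  have "\<exists>h. (\<forall>n. h n \<in> lin_homs R (P' n) (P' (Suc n))) \<and>
    (\<forall>x\<in>carrier (P' 0). d' 0 (h 0 x) = ?g' 0 x) \<and>
    (\<forall>n. \<forall>x\<in>carrier (P' (Suc n)). d' (Suc n) (h (Suc n) x) = ?g' (Suc n) x \<ominus>\<^bsub>P' (Suc n)\<^esub> h n (d' n x))"
  proof (rule P'.homotopy_exists)
    show "?g' n \<in> lin_homs R (P' n) (P' n)" for n
      by (intro lin_homs_diff P'.P_module left_module.id_lin_homs lin_homs_compose[OF _ \<phi>(1) \<psi>(1)])
    show "\<epsilon>' (?g' 0 x) = \<zero>\<^bsub>M\<^esub>" if "x \<in> carrier (P' 0)" for x
      using that by (simp add: lin_homs_minus[OF P'.P_module P.M.left_module_axioms P'.aug_hom] \<phi>(2) \<psi>(2) \<phi>c \<psi>c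
          P.M.minus_self lin_homs_closed[OF P'.aug_hom])
    show "d' n (?g' (Suc n) x) = ?g' n (d' n x)" if "x \<in> carrier (P' (Suc n))" for n x
      using that by (simp add: lin_homs_minus[OF P'.P_module P'.P_module P'.d_hom] \<phi>(3) \<psi>(3) \<phi>c \<psi>c P'.d_closed)
  qed
  then obtain h' where h': "\<And>n. h' n \<in> lin_homs R (P' n) (P' (Suc n))"
    "\<And>x. x \<in> carrier (P' 0) \<Longrightarrow> d' 0 (h' 0 x) = ?g' 0 x"
    "\<And>n x. x \<in> carrier (P' (Suc n)) \<Longrightarrow> d' (Suc n) (h' (Suc n) x) = ?g' (Suc n) x \<ominus>\<^bsub>P' (Suc n)\<^esub> h' n (d' n x)" by blast
  show ?thesis
  proof (rule that[OF \<psi>(1,3)])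
    fix n f assume f: "f \<in> lin_homs R (P n) N" and fd: "\<And>x. x \<in> carrier (P (Suc n)) \<Longrightarrow> f (d n x) = \<zero>\<^bsub>N\<^esub>"
    let ?z = "\<lambda>x\<in>carrier (P' n). f (\<phi> n x)"
    have z: "?z \<in> lin_homs R (P' n) N" by (rule lin_homs_compose[OF P'.P_module \<phi>(1) f])
    have zd: "?z (d' n x) = \<zero>\<^bsub>N\<^esub>" if "x \<in> carrier (P' (Suc n))" for x
      using that P'.d_closed[OF that] fd[OF \<phi>c[OF that]] by (simp add: \<phi>(3))
    have diff: "f x \<ominus>\<^bsub>N\<^esub> ?z (\<psi> n x) = f (x \<ominus>\<^bsub>P n\<^esub> \<phi> n (\<psi> n x))" if "x \<in> carrier (P n)" for x
      using that by (simp add: \<psi>c \<phi>c lin_homs_minus[OF P.P_module N f])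
    have hc: "h n x \<in> carrier (P (Suc n))" if "x \<in> carrier (P n)" for n x by (rule lin_homs_closed[OF h(1) that])
    have "cobd R P d N n (\<lambda>x. f x \<ominus>\<^bsub>N\<^esub> ?z (\<psi> n x))"
    proof (cases n)
      case 0
      have "f (x \<ominus>\<^bsub>P 0\<^esub> \<phi> 0 (\<psi> 0 x)) = \<zero>\<^bsub>N\<^esub>" if "x \<in> carrier (P 0)" for x
        using h(2)[OF that] fd[of "h 0 x"] hc[OF that] that 0 by simp
      thus ?thesis using 0 diff by (simp add: cobd_def)
    next
      case (Suc l)
      interpret Pn: left_module R "P n" by (rule P.P_module)
      have fh: "(\<lambda>x\<in>carrier (P l). f (h l x)) \<in> lin_homs R (P l) N"
        using lin_homs_compose[OF P.P_module h(1) f[unfolded Suc]] .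
      have "f (x \<ominus>\<^bsub>P n\<^esub> \<phi> n (\<psi> n x)) = f (h l (d l x))" if x: "x \<in> carrier (P n)" for x
      proof -
        have x': "x \<in> carrier (P (Suc l))" using x Suc by simp
        have c: "h l (d l x) \<in> carrier (P n)" using hc[OF P.d_closed[OF x']] Suc by simp
        have u: "x \<ominus>\<^bsub>P n\<^esub> \<phi> n (\<psi> n x) \<in> carrier (P n)" using x \<phi>c \<psi>c by simp
        have "f (d n (h n x)) = \<zero>\<^bsub>N\<^esub>" by (rule fd[OF hc[OF x]])
        moreover have "d n (h n x) = (x \<ominus>\<^bsub>P n\<^esub> \<phi> n (\<psi> n x)) \<ominus>\<^bsub>P n\<^esub> h l (d l x)"
          using h(3)[OF x'] x Suc by simp
        ultimately have "f (x \<ominus>\<^bsub>P n\<^esub> \<phi> n (\<psi> n x)) \<ominus>\<^bsub>N\<^esub> f (h l (d l x)) = \<zero>\<^bsub>N\<^esub>"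
          using lin_homs_minus[OF P.P_module N f u c] by simp
        thus ?thesis using lin_homs_closed[OF f u] lin_homs_closed[OF f c] by simp
      qed
      thus ?thesis unfolding cobd_def Suc using fh diff Suc P.d_closed
        by (auto intro!: bexI[OF _ fh])
    qed
    thus "\<exists>z\<in>lin_homs R (P' n) N. (\<forall>x\<in>carrier (P' (Suc n)). z (d' n x) = \<zero>\<^bsub>N\<^esub>) \<and>
        cobd R P d N n (\<lambda>x. f x \<ominus>\<^bsub>N\<^esub> z (\<psi> n x))" using z zd by blast
  next
    fix n z assume z: "z \<in> lin_homs R (P' n) N" and zd: "\<And>x. x \<in> carrier (P' (Suc n)) \<Longrightarrow> z (d' n x) = \<zero>\<^bsub>N\<^esub>"
      and cb: "cobd R P d N n (\<lambda>x. z (\<psi> n x))"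
    have hc: "h' n x \<in> carrier (P' (Suc n))" if "x \<in> carrier (P' n)" for n x by (rule lin_homs_closed[OF h'(1) that])
    have zc: "z x \<in> carrier N" if "x \<in> carrier (P' n)" for x by (rule lin_homs_closed[OF z that])
    have diff: "z (x \<ominus>\<^bsub>P' n\<^esub> \<psi> n (\<phi> n x)) = z x \<ominus>\<^bsub>N\<^esub> z (\<psi> n (\<phi> n x))" if "x \<in> carrier (P' n)" for x
      using that by (simp add: \<psi>c \<phi>c lin_homs_minus[OF P'.P_module N z])
    show "cobd R P' d' N n z"
    proof (cases n)
      case 0
      have "z x = \<zero>\<^bsub>N\<^esub>" if x: "x \<in> carrier (P' 0)" for x
      proof -
        have "z (\<psi> 0 (\<phi> 0 x)) = \<zero>\<^bsub>N\<^esub>" using cb \<phi>c[OF x] 0 by (simp add: cobd_def)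
        moreover have "z (x \<ominus>\<^bsub>P' 0\<^esub> \<psi> 0 (\<phi> 0 x)) = \<zero>\<^bsub>N\<^esub>"
          using h'(2)[OF x] zd[of "h' 0 x"] hc[OF x] x 0 by simp
        ultimately show ?thesis using diff[of x] x 0 zc[of x] N.M.minus_plus[of "z x" "\<zero>\<^bsub>N\<^esub>"] by simp
      qed
      thus ?thesis using 0 by (simp add: cobd_def)
    next
      case (Suc l)
      interpret Pn: left_module R "P' n" by (rule P'.P_module)
      obtain g where g: "g \<in> lin_homs R (P l) N" "\<And>x. x \<in> carrier (P (Suc l)) \<Longrightarrow> z (\<psi> n x) = g (d l x)"
        using cb unfolding cobd_def Suc by auto
      \<comment> \<open>From \<open>z \<psi> = g d\<close>,
        \<open>id - \<psi> \<phi> = d' h' + h' d'\<close> and \<open>z d' = 0\<close> one obtains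
        \<open>z = (z h' + g \<phi>) d'\<close>.\<close>
      let ?G = "\<lambda>x\<in>carrier (P' l). (\<lambda>x\<in>carrier (P' l). z (h' l x)) x \<oplus>\<^bsub>N\<^esub> (\<lambda>x\<in>carrier (P' l). g (\<phi> l x)) x"
      have G: "?G \<in> lin_homs R (P' l) N"
        by (rule lin_homs_sum[OF P'.P_module N lin_homs_compose[OF P'.P_module h'(1) z[unfolded Suc]]
              lin_homs_compose[OF P'.P_module \<phi>(1) g(1)]])
      have "z x = ?G (d' l x)" if x: "x \<in> carrier (P' n)" for x
      proof -
        have x': "x \<in> carrier (P' (Suc l))" using x Suc by simp
        note dx = P'.d_closed[OF x']
        have c: "h' l (d' l x) \<in> carrier (P' n)" using hc[OF dx] Suc by simp
        have u: "x \<ominus>\<^bsub>P' n\<^esub> \<psi> n (\<phi> n x) \<in> carrier (P' n)" using x \<phi>c \<psi>c by simp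
        have "z (d' n (h' n x)) = \<zero>\<^bsub>N\<^esub>" by (rule zd[OF hc[OF x]])
        moreover have "d' n (h' n x) = (x \<ominus>\<^bsub>P' n\<^esub> \<psi> n (\<phi> n x)) \<ominus>\<^bsub>P' n\<^esub> h' l (d' l x)"
          using h'(3)[OF x'] x Suc by simp
        ultimately have "z (x \<ominus>\<^bsub>P' n\<^esub> \<psi> n (\<phi> n x)) \<ominus>\<^bsub>N\<^esub> z (h' l (d' l x)) = \<zero>\<^bsub>N\<^esub>"
          using lin_homs_minus[OF P'.P_module N z u c] by simp
        hence "z x \<ominus>\<^bsub>N\<^esub> z (\<psi> n (\<phi> n x)) = z (h' l (d' l x))"
          using zc[OF u] zc[OF c] diff[OF x] by simp
        moreover have "z (\<psi> n (\<phi> n x)) = g (\<phi> l (d' l x))"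
          using g(2)[of "\<phi> n x"] \<phi>c[OF x] \<phi>(3)[OF x'] Suc by simp
        moreover have "g (\<phi> l (d' l x)) \<in> carrier N" by (rule lin_homs_closed[OF g(1) \<phi>c[OF dx]])
        ultimately have "z x = z (h' l (d' l x)) \<oplus>\<^bsub>N\<^esub> g (\<phi> l (d' l x))"
          using zc[OF x] by (metis N.M.minus_plus)
        thus ?thesis using dx by simp
      qed
      thus ?thesis unfolding cobd_def Suc using G Suc by (auto intro!: bexI[OF _ G])
    qed
  qed
qed

section \<open>Dimensions\<close>

text \<open>Sets independent in \<open>W\<close> are independent in the whole space, which bounds
  their size; a maximal one therefore exists, and it generates \<open>W\<close>.\<close>

lemma (in vectorspace) subspace_fin_dim:
  assumes W: "VectorSpace.subspace K W V" and fd: "fin_dim"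
  shows "vectorspace.fin_dim K (vs W)"
proof -
  interpret W: vectorspace K "vs W" by (rule subspace_is_vs[OF W])
  have sub: "submodule K W V" "W \<subseteq> carrier V" using W by (auto simp: VectorSpace.subspace_def submodule_def)
  have small: "finite A \<and> card A \<le> dim" if "A \<subseteq> W \<and> W.lin_indpt A" for A
  proof -
    have "lin_indpt A" using that span_li_not_depend(2)[of A W] sub(1) by simp
    thus ?thesis using li_le_dim[OF fd, of A] that sub(2) by blast
  qed
  have "\<exists>A. finite A \<and> maximal A (\<lambda>S. S \<subseteq> carrier (vs W) \<and> W.lin_indpt S)"
  proof (rule maximal_exists[where N = dim and B = "{}"])
    show "finite S \<and> card S \<le> dim" if "S \<subseteq> carrier (vs W) \<and> W.lin_indpt S" for S
      using small[of S] that by simp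
    show "{} \<subseteq> carrier (vs W) \<and> W.lin_indpt {}" by (simp add: W.lin_dep_def)
  qed
  then obtain A where A: "finite A" "maximal A (\<lambda>S. S \<subseteq> carrier (vs W) \<and> W.lin_indpt S)" by blast
  thus ?thesis using W.max_li_is_gen[OF A(2)] unfolding W.fin_dim_def maximal_def by blast
qed

lemma finsum_free_module_apply:
  assumes "ring R" "finite S" "\<And>s. s \<in> S \<Longrightarrow> g s \<in> finsupp R X"
  shows "finsum (free_module R X) g S x = finsum R (\<lambda>s. g s x) S"
proof -
  interpret ring R by fact
  interpret F: left_module R "free_module R X" by (rule left_module_free)
  have car: "carrier (free_module R X) = finsupp R X" by (simp add: free_module_def)
  have zero: "\<zero>\<^bsub>free_module R X\<^esub> x = \<zero>\<^bsub>R\<^esub>"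
    and add: "(f \<oplus>\<^bsub>free_module R X\<^esub> f') x = f x \<oplus>\<^bsub>R\<^esub> f' x" for f f'
    by (simp_all add: free_module_def)
  have "finsum (free_module R X) g S x = finsum R (\<lambda>s. g s x) S"
    if "finite S" "\<forall>s\<in>S. g s \<in> finsupp R X" for S
    using that
  proof (induction rule: finite_induct)
    case empty
    show ?case using zero by simp
  next
    case (insert s S)
    hence c: "g \<in> S \<rightarrow> carrier (free_module R X)" "g s \<in> carrier (free_module R X)"
      "(\<lambda>s. g s x) \<in> S \<rightarrow> carrier R" "g s x \<in> carrier R"
      unfolding car by (auto simp: finsupp_def)
    have "finsum (free_module R X) g S x = finsum R (\<lambda>s. g s x) S" using insert by blast
    thus ?case
      using F.M.finsum_insert[OF insert(1,2) c(1,2)] finsum_insert[OF insert(1,2) c(3,4)] add by simp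
  qed
  thus ?thesis using assms by blast
qed

lemma free_module_fin_dim:
  assumes K: "field K" and X: "finite X"
  shows "vectorspace.fin_dim K (free_module K X)" and "vectorspace.dim K (free_module K X) = card X"
proof -
  interpret K: field K by fact
  interpret F: left_module K "free_module K X" by (rule K.left_module_free)
  interpret V: vectorspace K "free_module K X" by (rule left_module_imp_vectorspace[OF K F.left_module_axioms])
  let ?V = "free_module K X" and ?B = "basis_elt K ` X"
  have car: "carrier ?V = finsupp K X" by (simp add: free_module_def)
  have B: "?B \<subseteq> carrier ?V" "finite ?B" using K.basis_elt_finsupp X by (auto simp: car)
  have inj: "inj_on (basis_elt K) X"
  proof (rule inj_onI)
    fix x y assume "basis_elt K x = basis_elt K y"
    hence "basis_elt K x x = basis_elt K y x" by simp
    thus "x = y" by (simp add: basis_elt_def split: if_splits)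
  qed
  have "V.lin_indpt ?B"
  proof (rule V.finite_lin_indpt2[OF B(2,1)])
    fix a assume a: "a \<in> ?B \<rightarrow> carrier K" and z: "V.lincomb a ?B = \<zero>\<^bsub>?V\<^esub>"
    have ac: "a (basis_elt K y) \<in> carrier K" if "y \<in> X" for y using a that by blast
    have b: "basis_elt K y z = (if z = y then \<one>\<^bsub>K\<^esub> else \<zero>\<^bsub>K\<^esub>)" for y z by (simp add: basis_elt_def)
    have "a (basis_elt K x) = \<zero>\<^bsub>K\<^esub>" if x: "x \<in> X" for x
    proof -
      have "V.lincomb a ?B = finsum ?V (\<lambda>y. a (basis_elt K y) \<odot>\<^bsub>?V\<^esub> basis_elt K y) X"
        unfolding V.lincomb_def by (rule F.M.finsum_reindex[OF _ inj]) (use a B in auto)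
      hence "\<zero>\<^bsub>K\<^esub> = finsum ?V (\<lambda>y. a (basis_elt K y) \<odot>\<^bsub>?V\<^esub> basis_elt K y) X x"
        using z by (simp add: free_module_def)
      also have "\<dots> = finsum K (\<lambda>y. (a (basis_elt K y) \<odot>\<^bsub>?V\<^esub> basis_elt K y) x) X"
        by (rule finsum_free_module_apply[OF K.ring_axioms X])
          (use a B car F.lsmult_closed in blast)
      also have "\<dots> = finsum K (\<lambda>y. if x = y then a (basis_elt K y) else \<zero>\<^bsub>K\<^esub>) X"
        by (rule K.finsum_cong') (use ac in \<open>auto simp: free_module_def b\<close>)
      also have "\<dots> = a (basis_elt K x)"
        by (rule K.add.finprod_singleton[OF x X]) (use ac in auto)
      finally show ?thesis by simp
    qed
    thus "\<forall>v\<in>?B. a v = \<zero>\<^bsub>K\<^esub>" by blast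
  qed
  moreover have gen: "V.gen_set ?B"
  proof
    show "V.span ?B \<subseteq> carrier ?V" using V.span_is_subset2 B by blast
    have S: "submodule K (V.span ?B) ?V" by (rule V.span_is_submodule[OF B(1)])
    show "carrier ?V \<subseteq> V.span ?B"
    proof
      fix f assume "f \<in> carrier ?V"
      hence "f \<in> finsupp K X" by (simp add: car)
      thus "f \<in> V.span ?B"
      proof (induction rule: K.finsupp_induct)
        case zero
        thus ?case using submodule.zero_closed[OF S] by (simp add: free_module_def)
      next
        case (add f g)
        thus ?case using submodule.m_closed[OF S, of f g] by (simp add: free_module_def)
      next
        case (basis c x)
        hence "basis_elt K x \<in> V.span ?B" using V.in_own_span[OF B(1)] by blast
        thus ?case using submodule.smult_closed[OF S basis(1), of "basis_elt K x"] by (simp add: free_module_def)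
      qed
    qed
  qed
  ultimately have "V.basis ?B" using B by (simp add: V.basis_def)
  thus "V.dim = card X" using V.dim_basis[OF B(2)] card_image[OF inj] by simp
  show "V.fin_dim" using B gen by (auto simp: V.fin_dim_def)
qed

text \<open>Both kernels computed later have this shape, with singletons as classes in odd degree
  and the extremes in even degree. Spreading a function on \<open>E\<close> over the classes is an
  isomorphism onto \<open>S\<close>.\<close>

lemma dim_class_functions:
  assumes K: "field K" and X: "finite X" and E: "\<And>C. C \<in> E \<Longrightarrow> C \<subseteq> X \<and> C \<noteq> {}"
    and dis: "\<And>C D x. C \<in> E \<Longrightarrow> D \<in> E \<Longrightarrow> x \<in> C \<Longrightarrow> x \<in> D \<Longrightarrow> C = D"
  defines "S \<equiv> {c \<in> finsupp K X. (\<forall>C\<in>E. \<forall>x\<in>C. \<forall>y\<in>C. c x = c y) \<and> (\<forall>x. x \<notin> \<Union>E \<longrightarrow> c x = \<zero>\<^bsub>K\<^esub>)}"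
  shows "vectorspace.dim K ((free_module K X)\<lparr>carrier := S\<rparr>) = card E"
proof -
  interpret K: field K by fact
  interpret FX: left_module K "free_module K X" by (rule K.left_module_free)
  interpret FE: left_module K "free_module K E" by (rule K.left_module_free)
  have finE: "finite E" using E X by (intro finite_subset[of E "Pow X"]) auto
  have "submod K S (free_module K X)"
  proof -
    have "finsupp K X = carrier (free_module K X)" by (simp add: free_module_def)
    hence cl: "(\<lambda>x. f x \<oplus>\<^bsub>K\<^esub> g x) \<in> finsupp K X" "(\<lambda>x. r \<otimes>\<^bsub>K\<^esub> f x) \<in> finsupp K X" "(\<lambda>x. \<zero>\<^bsub>K\<^esub>) \<in> finsupp K X"
      if "f \<in> finsupp K X" "g \<in> finsupp K X" "r \<in> carrier K" for f g r
      using FX.M.a_closed[of f g] FX.lsmult_closed[of r f] FX.M.zero_closed that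
      by (simp_all add: free_module_def)
    have "(\<lambda>x. \<zero>\<^bsub>K\<^esub>) \<in> S" by (simp add: S_def finsupp_def)
    moreover have "(\<lambda>x. f x \<oplus>\<^bsub>K\<^esub> g x) \<in> S" if f: "f \<in> S" and g: "g \<in> S" for f g
    proof -
      have "f x \<oplus>\<^bsub>K\<^esub> g x = f y \<oplus>\<^bsub>K\<^esub> g y" if "C \<in> E" "x \<in> C" "y \<in> C" for C x y
      proof -
        have "f x = f y" "g x = g y" using f g that unfolding S_def by blast+
        thus ?thesis by simp
      qed
      moreover have "f x \<oplus>\<^bsub>K\<^esub> g x = \<zero>\<^bsub>K\<^esub>" if "x \<notin> \<Union>E" for x using f g that by (simp add: S_def)
      moreover have "(\<lambda>x. f x \<oplus>\<^bsub>K\<^esub> g x) \<in> finsupp K X"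
        by (rule cl(1)[of f g "\<zero>\<^bsub>K\<^esub>"]) (use f g in \<open>simp_all add: S_def\<close>)
      ultimately show ?thesis unfolding S_def by blast
    qed
    moreover have "(\<lambda>x. r \<otimes>\<^bsub>K\<^esub> f x) \<in> S" if r: "r \<in> carrier K" and f: "f \<in> S" for r f
    proof -
      have "r \<otimes>\<^bsub>K\<^esub> f x = r \<otimes>\<^bsub>K\<^esub> f y" if "C \<in> E" "x \<in> C" "y \<in> C" for C x y
      proof -
        have "f x = f y" using f that unfolding S_def by blast
        thus ?thesis by simp
      qed
      moreover have "r \<otimes>\<^bsub>K\<^esub> f x = \<zero>\<^bsub>K\<^esub>" if "x \<notin> \<Union>E" for x using f r that by (simp add: S_def)
      moreover have "(\<lambda>x. r \<otimes>\<^bsub>K\<^esub> f x) \<in> finsupp K X"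
        by (rule cl(2)[of f f r]) (use f r in \<open>simp_all add: S_def\<close>)
      ultimately show ?thesis unfolding S_def by blast
    qed
    moreover have "S \<subseteq> finsupp K X" by (auto simp: S_def)
    ultimately show ?thesis unfolding submod_def by (simp add: free_module_def)
  qed
  hence SM: "left_module K ((free_module K X)\<lparr>carrier := S\<rparr>)" by (rule FX.submod_module)
  define cls where "cls x = (THE C. C \<in> E \<and> x \<in> C)" for x
  have cls: "cls x = C" if "C \<in> E" "x \<in> C" for x C
    unfolding cls_def by (rule the_equality) (use that dis in blast)+
  define T where "T g = (\<lambda>x. if x \<in> \<Union>E then g (cls x) else \<zero>\<^bsub>K\<^esub>)" for g
  have TS: "T g \<in> S" if "g \<in> finsupp K E" for g
  proof -
    have "\<Union>E \<subseteq> X" using E by blast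
    moreover have "finite {x. T g x \<noteq> \<zero>\<^bsub>K\<^esub>}"
      by (rule finite_subset[OF _ X]) (use \<open>\<Union>E \<subseteq> X\<close> in \<open>auto simp: T_def split: if_splits\<close>)
    moreover have "T g x = T g y" if "C \<in> E" "x \<in> C" "y \<in> C" for C x y
      using cls[OF that(1,2)] cls[OF that(1,3)] that by (auto simp: T_def)
    moreover have "T g x \<in> carrier K" for x using that by (simp add: T_def finsupp_def)
    moreover have "T g x = \<zero>\<^bsub>K\<^esub>" if "x \<notin> \<Union>E" for x using that by (simp add: T_def)
    moreover have "T g x = \<zero>\<^bsub>K\<^esub>" if "x \<notin> X" for x
      using \<open>\<Union>E \<subseteq> X\<close> that by (auto simp: T_def)
    moreover have "T g \<in> finsupp K X" using calculation(2,4,6) by (simp add: finsupp_def)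
    ultimately show ?thesis unfolding S_def by blast
  qed
  have lin: "linear_map K (free_module K E) ((free_module K X)\<lparr>carrier := S\<rparr>) T"
    by (rule linear_mapI[OF K FE.left_module_axioms SM])
      (use TS in \<open>auto simp: free_module_def T_def fun_eq_iff\<close>)
  interpret T: linear_map K "free_module K E" "(free_module K X)\<lparr>carrier := S\<rparr>" T by (rule lin)
  have "inj_on T (carrier (free_module K E))"
  proof (rule inj_onI)
    fix f g assume f: "f \<in> carrier (free_module K E)" and g: "g \<in> carrier (free_module K E)" and eq: "T f = T g"
    show "f = g"
    proof
      fix C
      show "f C = g C"
      proof (cases "C \<in> E")
        case True
        then obtain x where x: "x \<in> C" using E by blast
        have "T f x = T g x" using eq by simp
        moreover have "x \<in> \<Union>E" using x True by blast
        ultimately show ?thesis using cls[OF True x] by (simp add: T_def)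
      next
        case False
        thus ?thesis using f g by (auto simp: free_module_def finsupp_def)
      qed
    qed
  qed
  moreover have "T ` carrier (free_module K E) = S"
  proof
    show "T ` carrier (free_module K E) \<subseteq> S" using TS by (auto simp: free_module_def)
    show "S \<subseteq> T ` carrier (free_module K E)"
    proof
      fix c assume c: "c \<in> S"
      \<comment> \<open>The value at a chosen representative; \<open>c\<close> is constant on each
        class, so the choice has no influence.\<close>
      define g where "g C = (if C \<in> E then c (SOME x. x \<in> C) else \<zero>\<^bsub>K\<^esub>)" for C
      have "finite {C. g C \<noteq> \<zero>\<^bsub>K\<^esub>}" by (rule finite_subset[OF _ finE]) (auto simp: g_def)
      hence "g \<in> finsupp K E" using c by (auto simp: g_def S_def finsupp_def)
      moreover have "T g = c"
      proof
        fix x show "T g x = c x"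
        proof (cases "x \<in> \<Union>E")
          case True
          then obtain C where C: "C \<in> E" "x \<in> C" by blast
          hence "(SOME x. x \<in> C) \<in> C" by (metis someI)
          hence "c (SOME x. x \<in> C) = c x" using C c unfolding S_def by blast
          thus ?thesis using True C cls[OF C] by (simp add: T_def g_def)
        next
          case False
          thus ?thesis using c by (auto simp: T_def S_def)
        qed
      qed
      ultimately show "c \<in> T ` carrier (free_module K E)" by (auto simp: free_module_def)
    qed
  qed
  ultimately have "vectorspace.dim K (free_module K E) = vectorspace.dim K ((free_module K X)\<lparr>carrier := S\<rparr>)"
    using T.dim_eq[OF free_module_fin_dim(1)[OF K finE]] by simp
  thus ?thesis using free_module_fin_dim(2)[OF K finE] by simp
qed

section \<open>Ext from an arbitrary projective resolution\<close>

context kalgebra begin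

definition scal where "scal c = c \<odot>\<^bsub>A\<^esub> \<one>\<^bsub>A\<^esub>"

lemma scal_closed: "c \<in> carrier K \<Longrightarrow> scal c \<in> carrier A"
  by (simp add: scal_def KA.lsmult_closed)

lemma scal_add: "c \<in> carrier K \<Longrightarrow> c' \<in> carrier K \<Longrightarrow> scal (c \<oplus>\<^bsub>K\<^esub> c') = scal c \<oplus>\<^bsub>A\<^esub> scal c'"
  by (simp add: scal_def KA.lsmult_l_distr)

lemma scal_mult: "c \<in> carrier K \<Longrightarrow> c' \<in> carrier K \<Longrightarrow> scal (c \<otimes>\<^bsub>K\<^esub> c') = scal c \<otimes>\<^bsub>A\<^esub> scal c'"
  by (simp add: scal_def KA.lsmult_assoc smult_mult_l KA.lsmult_closed)

lemma scal_one: "scal \<one>\<^bsub>K\<^esub> = \<one>\<^bsub>A\<^esub>"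
  by (simp add: scal_def KA.lsmult_one)

lemma scal_commute: "c \<in> carrier K \<Longrightarrow> r \<in> carrier A \<Longrightarrow> scal c \<otimes>\<^bsub>A\<^esub> r = r \<otimes>\<^bsub>A\<^esub> scal c"
  by (simp add: scal_def smult_mult_l smult_mult_r)

text \<open>Over a noncommutative ring a multiple of a homomorphism is one again only because the
  scalar acts through the central element \<open>c 1\<close> (\<open>scal_commute\<close>).\<close>

lemma hom_space_module:
  assumes M: "left_module A M" and N: "left_module A N"
  shows "left_module K (hom_space A M N)"
proof -
  interpret M: left_module A M by fact
  interpret N: left_module A N by fact
  let ?H = "hom_space A M N"
  have car: "carrier ?H = lin_homs A M N" by (simp add: hom_space_def)
  have z: "(\<lambda>x\<in>carrier M. \<zero>\<^bsub>N\<^esub>) \<in> lin_homs A M N"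
    by (rule M.lin_homsI) (auto simp: N.lsmult_r_zero)
  have add: "f \<oplus>\<^bsub>?H\<^esub> g \<in> lin_homs A M N" if "f \<in> lin_homs A M N" "g \<in> lin_homs A M N" for f g
    using lin_homs_sum[OF M N that] by (simp add: hom_space_def)
  have sm: "c \<odot>\<^bsub>?H\<^esub> f \<in> lin_homs A M N" if c: "c \<in> carrier K" and f: "f \<in> lin_homs A M N" for c f
  proof -
    note [simp] = lin_homs_closed[OF f] scal_closed[OF c]
    have "(\<lambda>x\<in>carrier M. scal c \<odot>\<^bsub>N\<^esub> f x) \<in> lin_homs A M N"
      by (rule M.lin_homsI)
        (use c in \<open>auto simp: N.lsmult_closed lin_homs_add[OF f] lin_homs_smult[OF f] N.lsmult_r_distr
          N.lsmult_assoc[symmetric] scal_commute\<close>)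
    thus ?thesis by (simp add: hom_space_def scal_def)
  qed
  have ext: "f = g" if "f \<in> lin_homs A M N" "g \<in> lin_homs A M N" "\<And>x. x \<in> carrier M \<Longrightarrow> f x = g x" for f g
    using lin_homs_ext that by blast
  have neg: "(\<lambda>x\<in>carrier M. \<ominus>\<^bsub>N\<^esub> f x) \<in> lin_homs A M N" if f: "f \<in> lin_homs A M N" for f
  proof -
    have "(\<lambda>x\<in>carrier M. (\<lambda>x\<in>carrier M. \<zero>\<^bsub>N\<^esub>) x \<ominus>\<^bsub>N\<^esub> f x) \<in> lin_homs A M N"
      by (rule lin_homs_diff[OF M N z f])
    moreover have "(\<lambda>x\<in>carrier M. (\<lambda>x\<in>carrier M. \<zero>\<^bsub>N\<^esub>) x \<ominus>\<^bsub>N\<^esub> f x) = (\<lambda>x\<in>carrier M. \<ominus>\<^bsub>N\<^esub> f x)"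
      by (auto simp: fun_eq_iff restrict_def a_minus_def lin_homs_closed[OF f])
    ultimately show ?thesis by simp
  qed
  have ab: "abelian_group ?H"
  proof (rule abelian_groupI)
    fix f assume "f \<in> carrier ?H"
    hence f: "f \<in> lin_homs A M N" by (simp add: car)
    have "(\<lambda>x\<in>carrier M. \<ominus>\<^bsub>N\<^esub> f x) \<oplus>\<^bsub>?H\<^esub> f = \<zero>\<^bsub>?H\<^esub>"
      by (auto simp: hom_space_def restrict_def fun_eq_iff lin_homs_closed[OF f] N.M.l_neg)
    thus "\<exists>g\<in>carrier ?H. g \<oplus>\<^bsub>?H\<^esub> f = \<zero>\<^bsub>?H\<^esub>" using neg[OF f] car by blast
  next
    fix f assume "f \<in> carrier ?H"
    hence f: "f \<in> lin_homs A M N" by (simp add: car)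
    have "\<zero>\<^bsub>?H\<^esub> \<in> lin_homs A M N" using z by (simp add: hom_space_def)
    thus "\<zero>\<^bsub>?H\<^esub> \<oplus>\<^bsub>?H\<^esub> f = f"
      by (intro ext[OF add[OF _ f] f]) (use f in \<open>auto simp: hom_space_def lin_homs_closed\<close>)
  qed (use add z in \<open>auto simp: car hom_space_def fun_eq_iff restrict_def lin_homs_closed N.M.a_ac\<close>)
  show ?thesis
  proof (intro left_module.intro left_module_axioms.intro)
    fix f assume "f \<in> carrier ?H"
    hence f: "f \<in> lin_homs A M N" by (simp add: car)
    have "\<one>\<^bsub>K\<^esub> \<odot>\<^bsub>?H\<^esub> f \<in> lin_homs A M N" by (rule sm[OF _ f]) simp
    thus "\<one>\<^bsub>K\<^esub> \<odot>\<^bsub>?H\<^esub> f = f"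
      by (rule ext[OF _ f]) (use f in \<open>simp add: hom_space_def scal_def[symmetric] scal_one N.lsmult_one lin_homs_closed\<close>)
  qed (use ab sm in \<open>auto simp: car K.ring_axioms hom_space_def fun_eq_iff restrict_def scal_def[symmetric]
        scal_add scal_mult scal_closed lin_homs_closed N.lsmult_l_distr N.lsmult_r_distr N.lsmult_assoc
        N.lsmult_closed\<close>)
qed

end

section \<open>Cocycles and coboundaries of any projective resolution\<close>

definition cocyc where
  "cocyc R P d N m = {z \<in> lin_homs R (P m) N. \<forall>x\<in>carrier (P (Suc m)). z (d m x) = \<zero>\<^bsub>N\<^esub>}"

definition cobdry where
  "cobdry R P d N m = {z \<in> lin_homs R (P m) N. cobd R P d N m z}"

lemma proj_res_resolution:
  assumes "left_module R M"
  shows "proj_res R M (res_module R M) (res_diff R M) (res_aug R M)"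
  using projective_resolution_exists[OF assms] assms
  by (simp add: proj_res_def proj_res_axioms_def res_module_def res_diff_def res_aug_def)

locale ext_algebra = R: kalgebra K R + M: left_module R M + N: left_module R N
  for K :: "('k, 'c) ring_scheme" and R :: "('k, 'r, 'd) module_scheme"
    and M :: "('r, 'm, 'e) module_scheme" and N :: "('r, 'n, 'f) module_scheme"
begin

sublocale res: proj_res R M "res_module R M" "res_diff R M" "res_aug R M"
  by (rule proj_res_resolution) unfold_locales

lemma cocyc_submod:
  assumes "proj_res R M P d \<epsilon>"
  shows "submod K (cocyc R P d N m) (hom_space R (P m) N)"
proof -
  interpret P: proj_res R M P d \<epsilon> by fact
  interpret H: left_module K "hom_space R (P m) N" by (rule R.hom_space_module[OF P.P_module]) unfold_locales
  have car: "carrier (hom_space R (P m) N) = lin_homs R (P m) N" by (simp add: hom_space_def)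
  note cl = H.M.zero_closed H.M.a_closed H.lsmult_closed
  show ?thesis unfolding submod_def cocyc_def using cl unfolding car
    by (auto simp: P.d_closed hom_space_def N.lsmult_r_zero R.scal_def[symmetric] R.scal_closed)
qed

lemma cobdry_submod:
  assumes "proj_res R M P d \<epsilon>"
  shows "submod K (cobdry R P d N m) (hom_space R (P m) N)" "cobdry R P d N m \<subseteq> cocyc R P d N m"
proof -
  interpret P: proj_res R M P d \<epsilon> by fact
  have NM: "left_module R N" by unfold_locales
  interpret H: left_module K "hom_space R (P m) N" by (rule R.hom_space_module[OF P.P_module NM])
  have H': "left_module K (hom_space R (P l) N)" for l by (rule R.hom_space_module[OF P.P_module NM])
  have car: "carrier (hom_space R (P l) N) = lin_homs R (P l) N" for l by (simp add: hom_space_def)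
  have zero: "\<zero>\<^bsub>hom_space R (P l) N\<^esub> \<in> lin_homs R (P l) N" for l
    using abelian_monoid.zero_closed[OF abelian_group.axioms(1)[OF left_module.axioms(2)[OF H']]] car by blast
  have add: "f \<oplus>\<^bsub>hom_space R (P l) N\<^esub> g \<in> lin_homs R (P l) N" if "f \<in> lin_homs R (P l) N" "g \<in> lin_homs R (P l) N" for f g l
    using abelian_monoid.a_closed[OF abelian_group.axioms(1)[OF left_module.axioms(2)[OF H']]] car that by blast
  have sm: "c \<odot>\<^bsub>hom_space R (P l) N\<^esub> g \<in> lin_homs R (P l) N" if "c \<in> carrier K" "g \<in> lin_homs R (P l) N" for c g l
    using left_module.lsmult_closed[OF H'] car that by blast
  show "submod K (cobdry R P d N m) (hom_space R (P m) N)"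
  proof (cases m)
    case 0
    show ?thesis unfolding submod_def cobdry_def 0 using zero add sm unfolding car
      by (auto simp: cobd_def hom_space_def N.lsmult_r_zero R.scal_def[symmetric] R.scal_closed)
  next
    case (Suc l)
    show ?thesis unfolding submod_def
    proof (intro conjI ballI)
      show "cobdry R P d N m \<subseteq> carrier (hom_space R (P m) N)" by (auto simp: cobdry_def car)
      have "\<forall>x\<in>carrier (P (Suc l)). \<zero>\<^bsub>hom_space R (P m) N\<^esub> x = \<zero>\<^bsub>hom_space R (P l) N\<^esub> (d l x)"
        by (simp add: hom_space_def Suc P.d_closed)
      thus "\<zero>\<^bsub>hom_space R (P m) N\<^esub> \<in> cobdry R P d N m"
        using zero unfolding cobdry_def cobd_def Suc by auto
    next
      fix f f' assume "f \<in> cobdry R P d N m" "f' \<in> cobdry R P d N m"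
      then obtain g g' where f: "f \<in> lin_homs R (P m) N" "f' \<in> lin_homs R (P m) N"
        and g: "g \<in> lin_homs R (P l) N" "g' \<in> lin_homs R (P l) N"
        "\<And>x. x \<in> carrier (P m) \<Longrightarrow> f x = g (d l x)" "\<And>x. x \<in> carrier (P m) \<Longrightarrow> f' x = g' (d l x)"
        unfolding cobdry_def cobd_def Suc by auto
      have "\<forall>x\<in>carrier (P (Suc l)). (f \<oplus>\<^bsub>hom_space R (P m) N\<^esub> f') x = (g \<oplus>\<^bsub>hom_space R (P l) N\<^esub> g') (d l x)"
        using g(3,4) by (simp add: hom_space_def Suc P.d_closed)
      thus "f \<oplus>\<^bsub>hom_space R (P m) N\<^esub> f' \<in> cobdry R P d N m"
        using add[OF f] add[OF g(1,2)] unfolding cobdry_def cobd_def Suc by auto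
    next
      fix c f assume c: "c \<in> carrier K" and "f \<in> cobdry R P d N m"
      then obtain g where f: "f \<in> lin_homs R (P m) N" and g: "g \<in> lin_homs R (P l) N"
        "\<And>x. x \<in> carrier (P m) \<Longrightarrow> f x = g (d l x)"
        unfolding cobdry_def cobd_def Suc by auto
      have "\<forall>x\<in>carrier (P (Suc l)). (c \<odot>\<^bsub>hom_space R (P m) N\<^esub> f) x = (c \<odot>\<^bsub>hom_space R (P l) N\<^esub> g) (d l x)"
        using g(2) by (simp add: hom_space_def Suc P.d_closed)
      thus "c \<odot>\<^bsub>hom_space R (P m) N\<^esub> f \<in> cobdry R P d N m"
        using sm[OF c f] sm[OF c g(1)] unfolding cobdry_def cobd_def Suc by auto
    qed
  qed
  show "cobdry R P d N m \<subseteq> cocyc R P d N m"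
  proof (cases m)
    case 0
    thus ?thesis by (auto simp: cobdry_def cocyc_def cobd_def P.d_closed)
  next
    case (Suc l)
    have "g (d l (d m x)) = \<zero>\<^bsub>N\<^esub>" if "g \<in> lin_homs R (P l) N" "x \<in> carrier (P (Suc m))" for g x
      using P.d_d[of x l] that Suc lin_homs_zero[OF P.P_module NM that(1)] by simp
    thus ?thesis using Suc by (auto simp: cobdry_def cocyc_def cobd_def P.d_closed)
  qed
qed

lemma cocycles_eq:
  "cocycles R M N m = (hom_space R (res_module R M m) N)\<lparr>carrier := cocyc R (res_module R M) (res_diff R M) N m\<rparr>"
proof -
  have "codiff R M m f = \<zero>\<^bsub>cochains R M N (Suc m)\<^esub> \<longleftrightarrow>
      (\<forall>x\<in>carrier (res_module R M (Suc m)). f (res_diff R M m x) = \<zero>\<^bsub>N\<^esub>)" for f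
    by (auto simp: codiff_def cochains_def hom_space_def fun_eq_iff restrict_def)
  thus ?thesis by (simp add: cocycles_def cocyc_def) (simp add: cochains_def hom_space_def)
qed

lemma coboundaries_eq: "coboundaries R M N m = cobdry R (res_module R M) (res_diff R M) N m"
proof (cases m)
  case 0
  have NM: "left_module R N" by unfold_locales
  interpret H: left_module K "hom_space R (res_module R M 0) N" by (rule R.hom_space_module[OF res.P_module NM])
  let ?z = "\<lambda>x\<in>carrier (res_module R M 0). \<zero>\<^bsub>N\<^esub>"
  have z: "?z \<in> lin_homs R (res_module R M 0) N"
    using H.M.zero_closed by (simp add: hom_space_def)
  have e0: "f = ?z"
    if "f \<in> lin_homs R (res_module R M 0) N" "\<forall>x\<in>carrier (res_module R M 0). f x = \<zero>\<^bsub>N\<^esub>" for f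
    by (rule lin_homs_ext[OF that(1) z]) (use that in simp)
  have "cobdry R (res_module R M) (res_diff R M) N 0 = {?z}"
  proof (intro equalityI subsetI)
    fix f assume "f \<in> cobdry R (res_module R M) (res_diff R M) N 0"
    thus "f \<in> {?z}" using e0[of f] unfolding cobdry_def cobd_def nat.case by blast
  next
    fix f assume "f \<in> {?z}"
    thus "f \<in> cobdry R (res_module R M) (res_diff R M) N 0" using z by (simp add: cobdry_def cobd_def)
  qed
  thus ?thesis by (simp add: 0 coboundaries_def cochains_def hom_space_def)
next
  case (Suc l)
  have cl: "codiff R M l g \<in> lin_homs R (res_module R M (Suc l)) N" if "g \<in> lin_homs R (res_module R M l) N" for g
    unfolding codiff_def by (rule lin_homs_compose[OF res.P_module res.d_hom that])
  have app: "codiff R M l g x = g (res_diff R M l x)" if "x \<in> carrier (res_module R M (Suc l))"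
    for g :: "_ \<Rightarrow> 'n" and x
    using that by (simp add: codiff_def)
  have eq: "f = codiff R M l g"
    if "f \<in> lin_homs R (res_module R M (Suc l)) N" "g \<in> lin_homs R (res_module R M l) N"
      "\<forall>x\<in>carrier (res_module R M (Suc l)). f x = g (res_diff R M l x)" for f g
    by (rule lin_homs_ext[OF that(1) cl[OF that(2)]]) (simp add: app that(3))
  have "coboundaries R M N m = codiff R M l ` lin_homs R (res_module R M l) N"
    by (simp add: Suc coboundaries_def cochains_def hom_space_def)
  also have "\<dots> = cobdry R (res_module R M) (res_diff R M) N m"
  proof (intro equalityI subsetI)
    fix f assume "f \<in> codiff R M l ` lin_homs R (res_module R M l) N"
    then obtain g where "g \<in> lin_homs R (res_module R M l) N" "f = codiff R M l g" by blast
    thus "f \<in> cobdry R (res_module R M) (res_diff R M) N m"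
      using cl[of g] app[of _ g] unfolding cobdry_def cobd_def Suc nat.case by blast
  next
    fix f assume "f \<in> cobdry R (res_module R M) (res_diff R M) N m"
    then obtain g where "f \<in> lin_homs R (res_module R M (Suc l)) N" "g \<in> lin_homs R (res_module R M l) N"
      "\<forall>x\<in>carrier (res_module R M (Suc l)). f x = g (res_diff R M l x)"
      unfolding cobdry_def cobd_def Suc nat.case by blast
    thus "f \<in> codiff R M l ` lin_homs R (res_module R M l) N" using eq by blast
  qed
  finally show ?thesis .
qed

lemma coboundaries_submod: "submod K (coboundaries R M N m) (cocycles R M N m)"
  unfolding coboundaries_eq cocycles_eq
  using cobdry_submod[OF res.proj_res_axioms, of m] by (auto simp: submod_def)

lemma cocycles_module: "left_module K (cocycles R M N m)"
  unfolding cocycles_eq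
  by (rule left_module.submod_module[OF R.hom_space_module[OF res.P_module] cocyc_submod[OF res.proj_res_axioms]]) unfold_locales

lemmas Ext_facts = left_module.quot_facts[OF cocycles_module coboundaries_submod, folded Ext_def]

text \<open>The target is tied to the chosen resolution, the source to any other. A surjection
  together with its kernel, rather than an isomorphism of quotients, is the form in which
  rank-nullity can use the comparison.\<close>

lemma Ext_of_resolution:
  assumes P': "proj_res R M P' d' \<epsilon>'"
  shows "\<exists>T. linear_map K ((hom_space R (P' m) N)\<lparr>carrier := cocyc R P' d' N m\<rparr>) (Ext R M N m) T \<and>
    T ` cocyc R P' d' N m = carrier (Ext R M N m) \<and>
    {z \<in> cocyc R P' d' N m. T z = \<zero>\<^bsub>Ext R M N m\<^esub>} = cobdry R P' d' N m"
proof -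
  interpret P': proj_res R M P' d' \<epsilon>' by fact
  have NM: "left_module R N" by unfold_locales
  let ?P = "res_module R M" and ?d = "res_diff R M"
  obtain \<psi> where \<psi>: "\<And>n. \<psi> n \<in> lin_homs R (?P n) (P' n)"
    "\<And>n x. x \<in> carrier (?P (Suc n)) \<Longrightarrow> d' n (\<psi> (Suc n) x) = \<psi> n (?d n x)"
    and sur: "\<And>n f. f \<in> lin_homs R (?P n) N \<Longrightarrow> (\<And>x. x \<in> carrier (?P (Suc n)) \<Longrightarrow> f (?d n x) = \<zero>\<^bsub>N\<^esub>) \<Longrightarrow>
      \<exists>z\<in>lin_homs R (P' n) N. (\<forall>x\<in>carrier (P' (Suc n)). z (d' n x) = \<zero>\<^bsub>N\<^esub>) \<and>
        cobd R ?P ?d N n (\<lambda>x. f x \<ominus>\<^bsub>N\<^esub> z (\<psi> n x))"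
    and inj: "\<And>n z. z \<in> lin_homs R (P' n) N \<Longrightarrow> (\<And>x. x \<in> carrier (P' (Suc n)) \<Longrightarrow> z (d' n x) = \<zero>\<^bsub>N\<^esub>) \<Longrightarrow>
      cobd R ?P ?d N n (\<lambda>x. z (\<psi> n x)) \<Longrightarrow> cobd R P' d' N n z"
    by (rule comparison[OF res.proj_res_axioms P' NM]) blast
  let ?Z = "cocyc R P' d' N m" and ?C = "cocycles R M N m" and ?B = "coboundaries R M N m"
  let ?H = "hom_space R (P' m) N"
  \<comment> \<open>\<open>\<psi>\<close> runs from the chosen resolution to \<open>P'\<close>, so
    cocycles on \<open>P'\<close> are pulled back along it.\<close>
  define pull where "pull z = (\<lambda>x\<in>carrier (?P m). (z (\<psi> m x) :: 'n))" for z
  have \<psi>c: "\<psi> n x \<in> carrier (P' n)" if "x \<in> carrier (?P n)" for n x by (rule lin_homs_closed[OF \<psi>(1) that])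
  have carC: "carrier ?C = cocyc R ?P ?d N m" by (simp add: cocycles_eq)
  have pullC: "pull z \<in> carrier ?C" if "z \<in> ?Z" for z
  proof -
    have z: "z \<in> lin_homs R (P' m) N" "\<And>x. x \<in> carrier (P' (Suc m)) \<Longrightarrow> z (d' m x) = \<zero>\<^bsub>N\<^esub>"
      using that by (auto simp: cocyc_def)
    have "pull z \<in> lin_homs R (?P m) N" unfolding pull_def by (rule lin_homs_compose[OF res.P_module \<psi>(1) z(1)])
    moreover have "pull z (?d m x) = \<zero>\<^bsub>N\<^esub>" if "x \<in> carrier (?P (Suc m))" for x
      using that by (simp add: pull_def res.d_closed \<psi>(2)[symmetric] z(2) \<psi>c)
    ultimately show ?thesis by (simp add: carC cocyc_def)
  qed
  have padd: "pull (z \<oplus>\<^bsub>?H\<^esub> z') = pull z \<oplus>\<^bsub>?C\<^esub> pull z'" for z z'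
    by (auto simp: pull_def cocycles_eq hom_space_def \<psi>c fun_eq_iff restrict_def)
  have psm: "pull (c \<odot>\<^bsub>?H\<^esub> z) = c \<odot>\<^bsub>?C\<^esub> pull z" for c z
    by (auto simp: pull_def cocycles_eq hom_space_def \<psi>c fun_eq_iff restrict_def)
  define T where "T z = ?B +>\<^bsub>?C\<^esub> pull z" for z
  have VZ: "left_module K (?H\<lparr>carrier := ?Z\<rparr>)"
    by (rule left_module.submod_module[OF R.hom_space_module[OF P'.P_module NM] cocyc_submod[OF P']])
  have "linear_map K (?H\<lparr>carrier := ?Z\<rparr>) (Ext R M N m) T"
    by (rule linear_mapI[OF R.K.field_axioms VZ Ext_facts(1)])
      (use pullC in \<open>auto simp: T_def Ext_facts padd psm\<close>)
  moreover have "T ` ?Z = carrier (Ext R M N m)"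
  proof
    show "T ` ?Z \<subseteq> carrier (Ext R M N m)" using pullC by (auto simp: T_def Ext_facts)
    show "carrier (Ext R M N m) \<subseteq> T ` ?Z"
    proof
      fix S assume "S \<in> carrier (Ext R M N m)"
      then obtain f where f: "f \<in> carrier ?C" "S = ?B +>\<^bsub>?C\<^esub> f" by (auto simp: Ext_facts)
      hence "f \<in> lin_homs R (?P m) N" "\<And>x. x \<in> carrier (?P (Suc m)) \<Longrightarrow> f (?d m x) = \<zero>\<^bsub>N\<^esub>"
        by (auto simp: carC cocyc_def)
      then obtain z where z: "z \<in> lin_homs R (P' m) N" "\<forall>x\<in>carrier (P' (Suc m)). z (d' m x) = \<zero>\<^bsub>N\<^esub>"
        "cobd R ?P ?d N m (\<lambda>x. f x \<ominus>\<^bsub>N\<^esub> z (\<psi> m x))" using sur by blast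
      hence zZ: "z \<in> ?Z" by (simp add: cocyc_def)
      interpret C: left_module K ?C by (rule cocycles_module)
      have fp: "f \<ominus>\<^bsub>?C\<^esub> pull z \<in> carrier ?C" using f(1) pullC[OF zZ] by simp
      have "(f \<ominus>\<^bsub>?C\<^esub> pull z) x = f x \<ominus>\<^bsub>N\<^esub> z (\<psi> m x)" if x: "x \<in> carrier (?P m)" for x
      proof -
        have "(f \<ominus>\<^bsub>?C\<^esub> pull z) \<oplus>\<^bsub>?C\<^esub> pull z = f" using f(1) pullC[OF zZ] by (rule C.M.minus_plus)
        hence "((f \<ominus>\<^bsub>?C\<^esub> pull z) \<oplus>\<^bsub>?C\<^esub> pull z) x = f x" by simp
        hence "(f \<ominus>\<^bsub>?C\<^esub> pull z) x \<oplus>\<^bsub>N\<^esub> z (\<psi> m x) = f x"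
          using x by (simp add: cocycles_eq hom_space_def pull_def)
        moreover have "(f \<ominus>\<^bsub>?C\<^esub> pull z) x \<in> carrier N" "z (\<psi> m x) \<in> carrier N"
          using fp x lin_homs_closed[OF z(1) \<psi>c[OF x]] by (auto simp: carC cocyc_def lin_homs_closed)
        ultimately show ?thesis
          by (metis N.M.add.m_assoc N.M.a_inv_closed N.M.minus_eq N.M.r_neg N.M.r_zero)
      qed
      hence "cobd R ?P ?d N m (f \<ominus>\<^bsub>?C\<^esub> pull z)"
        using z(3) by (auto simp: cobd_def split: nat.splits)
      hence "f \<ominus>\<^bsub>?C\<^esub> pull z \<in> ?B" using fp by (simp add: coboundaries_eq cobdry_def carC cocyc_def)
      hence "S = T z" unfolding T_def f(2) using Ext_facts(6)[OF f(1) pullC[OF zZ]] by simp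
      thus "S \<in> T ` ?Z" using zZ by blast
    qed
  qed
  moreover have "{z \<in> ?Z. T z = \<zero>\<^bsub>Ext R M N m\<^esub>} = cobdry R P' d' N m"
  proof -
    have "T z = \<zero>\<^bsub>Ext R M N m\<^esub> \<longleftrightarrow> cobd R P' d' N m z" if zZ: "z \<in> ?Z" for z
    proof -
      have z: "z \<in> lin_homs R (P' m) N" "\<And>x. x \<in> carrier (P' (Suc m)) \<Longrightarrow> z (d' m x) = \<zero>\<^bsub>N\<^esub>"
        using zZ by (auto simp: cocyc_def)
      have "T z = \<zero>\<^bsub>Ext R M N m\<^esub> \<longleftrightarrow> pull z \<in> ?B"
        unfolding T_def Ext_facts(5) by (rule Ext_facts(7)[OF pullC[OF zZ]])
      also have "\<dots> \<longleftrightarrow> cobd R ?P ?d N m (pull z)"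
        using pullC[OF zZ] by (simp add: coboundaries_eq cobdry_def carC cocyc_def)
      also have "\<dots> \<longleftrightarrow> cobd R ?P ?d N m (\<lambda>x. z (\<psi> m x))"
        by (auto simp: cobd_def pull_def split: nat.splits)
      also have "\<dots> \<longleftrightarrow> cobd R P' d' N m z"
      proof
        assume "cobd R ?P ?d N m (\<lambda>x. z (\<psi> m x))"
        thus "cobd R P' d' N m z" using inj z by blast
      next
        assume c: "cobd R P' d' N m z"
        show "cobd R ?P ?d N m (\<lambda>x. z (\<psi> m x))"
        proof (cases m)
          case 0
          thus ?thesis using c \<psi>c by (auto simp: cobd_def)
        next
          case (Suc l)
          then obtain g where g: "g \<in> lin_homs R (P' l) N" "\<And>x. x \<in> carrier (P' (Suc l)) \<Longrightarrow> z x = g (d' l x)"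
            using c by (auto simp: cobd_def)
          have "(\<lambda>x\<in>carrier (?P l). g (\<psi> l x)) \<in> lin_homs R (?P l) N"
            by (rule lin_homs_compose[OF res.P_module \<psi>(1) g(1)])
          moreover have "\<forall>x\<in>carrier (?P (Suc l)). z (\<psi> m x) = (\<lambda>x\<in>carrier (?P l). g (\<psi> l x)) (?d l x)"
            using g(2) \<psi>c Suc by (simp add: \<psi>(2)[symmetric] res.d_closed)
          ultimately show ?thesis unfolding cobd_def Suc nat.case by blast
        qed
      qed
      finally show ?thesis .
    qed
    thus ?thesis using cobdry_submod(2)[OF P', of m] by (auto simp: cobdry_def cocyc_def)
  qed
  ultimately show ?thesis by blast
qed

text \<open>Rank-nullity in two consecutive degrees: the dimension of \<open>Ext\<close> is that of
  a kernel minus the rank of the incoming differential, and that rank is \<open>card (X m)\<close>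
  minus the dimension of its own kernel. So the kernels alone have to be known. The equation is kept
  additive to avoid truncated subtraction.\<close>

lemma Ext_dim:
  fixes X :: "nat \<Rightarrow> 'x set" and \<delta> :: "nat \<Rightarrow> ('x \<Rightarrow> 'k) \<Rightarrow> 'x \<Rightarrow> 'k" and \<Phi> :: "nat \<Rightarrow> ('x \<Rightarrow> 'k) \<Rightarrow> 'p \<Rightarrow> 'n"
  assumes P': "proj_res R M P' d' \<epsilon>'" and X: "\<And>m. finite (X m)"
    and \<delta>: "\<And>m c. c \<in> finsupp K (X m) \<Longrightarrow> \<delta> m c \<in> finsupp K (X (Suc m))"
    and \<Phi>: "\<And>m. bij_betw (\<Phi> m) (finsupp K (X m)) (lin_homs R (P' m) N)"
    and \<Phi>_add: "\<And>m c c' x. c \<in> finsupp K (X m) \<Longrightarrow> c' \<in> finsupp K (X m) \<Longrightarrow> x \<in> carrier (P' m) \<Longrightarrow>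
      \<Phi> m (\<lambda>z. c z \<oplus>\<^bsub>K\<^esub> c' z) x = \<Phi> m c x \<oplus>\<^bsub>N\<^esub> \<Phi> m c' x"
    and \<Phi>_smult: "\<And>m c k x. c \<in> finsupp K (X m) \<Longrightarrow> k \<in> carrier K \<Longrightarrow> x \<in> carrier (P' m) \<Longrightarrow>
      \<Phi> m (\<lambda>z. k \<otimes>\<^bsub>K\<^esub> c z) x = (k \<odot>\<^bsub>R\<^esub> \<one>\<^bsub>R\<^esub>) \<odot>\<^bsub>N\<^esub> \<Phi> m c x"
    and \<Phi>\<delta>: "\<And>m c x. c \<in> finsupp K (X m) \<Longrightarrow> x \<in> carrier (P' (Suc m)) \<Longrightarrow> \<Phi> (Suc m) (\<delta> m c) x = \<Phi> m c (d' m x)"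
  defines "ker_dim m \<equiv> vectorspace.dim K ((free_module K (X m))\<lparr>carrier := {c \<in> finsupp K (X m). \<delta> m c = (\<lambda>_. \<zero>\<^bsub>K\<^esub>)}\<rparr>)"
  shows "vectorspace K (Ext R M N m)" and "vectorspace.fin_dim K (Ext R M N m)"
    and "vectorspace.dim K (Ext R M N 0) = ker_dim 0"
    and "vectorspace.dim K (Ext R M N (Suc m)) + card (X m) = ker_dim (Suc m) + ker_dim m"
proof -
  interpret P': proj_res R M P' d' \<epsilon>' by fact
  have NM: "left_module R N" by unfold_locales
  have K: "field K" by (rule R.K.field_axioms)
  let ?F = "\<lambda>m. free_module K (X m)"
  have F: "left_module K (?F m)" for m by (rule R.K.left_module_free)
  have carF: "carrier (?F m) = finsupp K (X m)" and zF: "\<zero>\<^bsub>?F m\<^esub> = (\<lambda>_. \<zero>\<^bsub>K\<^esub>)"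
    and aF: "c \<oplus>\<^bsub>?F m\<^esub> c' = (\<lambda>z. c z \<oplus>\<^bsub>K\<^esub> c' z)" and sF: "k \<odot>\<^bsub>?F m\<^esub> c = (\<lambda>z. k \<otimes>\<^bsub>K\<^esub> c z)" for m c c' k
    by (simp_all add: free_module_def)
  have F0: "(\<lambda>_. \<zero>\<^bsub>K\<^esub>) \<in> finsupp K (X m)" for m by (simp add: finsupp_def)
  have Fa: "(\<lambda>z. c z \<oplus>\<^bsub>K\<^esub> c' z) \<in> finsupp K (X m)" if "c \<in> finsupp K (X m)" "c' \<in> finsupp K (X m)" for c c' m
    using abelian_monoid.a_closed[OF abelian_group.axioms(1)[OF left_module.axioms(2)[OF F[of m]]], of c c'] that
    by (simp add: carF aF)
  have Fs: "(\<lambda>z. k \<otimes>\<^bsub>K\<^esub> c z) \<in> finsupp K (X m)" if "k \<in> carrier K" "c \<in> finsupp K (X m)" for k c m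
    using left_module.lsmult_closed[OF F[of m], of k c] that by (simp add: carF sF)
  have \<Phi>h: "\<Phi> m c \<in> lin_homs R (P' m) N" if "c \<in> finsupp K (X m)" for m c
    using bij_betwE[OF \<Phi>[of m]] that by blast
  have \<Phi>eq: "c = c'" if "c \<in> finsupp K (X m)" "c' \<in> finsupp K (X m)"
    "\<And>x. x \<in> carrier (P' m) \<Longrightarrow> \<Phi> m c x = \<Phi> m c' x" for m c c'
  proof -
    have "\<Phi> m c = \<Phi> m c'" by (rule lin_homs_ext[OF \<Phi>h[OF that(1)] \<Phi>h[OF that(2)] that(3)])
    thus ?thesis using bij_betw_imp_inj_on[OF \<Phi>[of m]] that(1,2) by (simp add: inj_on_def)
  qed
  have \<Phi>0: "\<Phi> m (\<lambda>_. \<zero>\<^bsub>K\<^esub>) x = \<zero>\<^bsub>N\<^esub>" if "x \<in> carrier (P' m)" for m x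
  proof -
    have "\<Phi> m (\<lambda>z. \<zero>\<^bsub>K\<^esub> \<otimes>\<^bsub>K\<^esub> \<zero>\<^bsub>K\<^esub>) x = (\<zero>\<^bsub>K\<^esub> \<odot>\<^bsub>R\<^esub> \<one>\<^bsub>R\<^esub>) \<odot>\<^bsub>N\<^esub> \<Phi> m (\<lambda>_. \<zero>\<^bsub>K\<^esub>) x"
      using \<Phi>_smult[OF F0, of "\<zero>\<^bsub>K\<^esub>"] that by simp
    thus ?thesis using lin_homs_closed[OF \<Phi>h[OF F0] that] by (simp add: R.KA.lsmult_zero N.lsmult_zero)
  qed
  \<comment> \<open>Linearity of \<open>\<delta>\<close> is read off through the injective
    coordinates \<open>\<Phi>\<close>, which turn it into composition with
    \<open>d'\<close>.\<close>
  have \<delta>lin: "linear_map K (?F m) (?F (Suc m)) (\<delta> m)" for m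
  proof (rule linear_mapI[OF K F F])
    show "\<delta> m c \<in> carrier (?F (Suc m))" if "c \<in> carrier (?F m)" for c using \<delta> that carF by simp
    show "\<delta> m (c \<oplus>\<^bsub>?F m\<^esub> c') = \<delta> m c \<oplus>\<^bsub>?F (Suc m)\<^esub> \<delta> m c'" if "c \<in> carrier (?F m)" "c' \<in> carrier (?F m)" for c c'
      unfolding aF using that unfolding carF
      by (intro \<Phi>eq[of _ "Suc m"]) (simp_all add: \<delta> Fa \<Phi>\<delta> \<Phi>_add P'.d_closed)
    show "\<delta> m (k \<odot>\<^bsub>?F m\<^esub> c) = k \<odot>\<^bsub>?F (Suc m)\<^esub> \<delta> m c" if "k \<in> carrier K" "c \<in> carrier (?F m)" for c k
      unfolding sF using that unfolding carF
      by (intro \<Phi>eq[of _ "Suc m"]) (simp_all add: \<delta> Fs \<Phi>\<delta> \<Phi>_smult P'.d_closed)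
  qed
  define Z where "Z m = {c \<in> finsupp K (X m). \<delta> m c = (\<lambda>_. \<zero>\<^bsub>K\<^esub>)}" for m
  have ker_dim: "ker_dim m = vectorspace.dim K ((?F m)\<lparr>carrier := Z m\<rparr>)" for m by (simp add: ker_dim_def Z_def)
  have sub: "VectorSpace.subspace K (Z m) (?F m)" for m
  proof -
    interpret D: linear_map K "?F m" "?F (Suc m)" "\<delta> m" by (rule \<delta>lin)
    have "D.kerT = Z m" by (auto simp: D.ker_def Z_def carF zF)
    thus ?thesis using D.kerT_is_subspace by simp
  qed
  have VF: "vectorspace K (?F m)" for m by (rule left_module_imp_vectorspace[OF K F])
  have VZ: "vectorspace K ((?F m)\<lparr>carrier := Z m\<rparr>)" for m by (rule vectorspace.subspace_is_vs[OF VF sub])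
  have fdZ: "vectorspace.fin_dim K ((?F m)\<lparr>carrier := Z m\<rparr>)" for m
    by (rule vectorspace.subspace_fin_dim[OF VF sub free_module_fin_dim(1)[OF K X]])
  have mem: "c \<in> Z m \<longleftrightarrow> \<Phi> m c \<in> cocyc R P' d' N m" if c: "c \<in> finsupp K (X m)" for c m
  proof -
    have "\<delta> m c = (\<lambda>_. \<zero>\<^bsub>K\<^esub>) \<longleftrightarrow> (\<forall>x\<in>carrier (P' (Suc m)). \<Phi> m c (d' m x) = \<zero>\<^bsub>N\<^esub>)"
    proof
      assume "\<delta> m c = (\<lambda>_. \<zero>\<^bsub>K\<^esub>)"
      thus "\<forall>x\<in>carrier (P' (Suc m)). \<Phi> m c (d' m x) = \<zero>\<^bsub>N\<^esub>" using \<Phi>\<delta>[OF c] \<Phi>0[of _ "Suc m"] by simp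
    next
      assume "\<forall>x\<in>carrier (P' (Suc m)). \<Phi> m c (d' m x) = \<zero>\<^bsub>N\<^esub>"
      thus "\<delta> m c = (\<lambda>_. \<zero>\<^bsub>K\<^esub>)" by (intro \<Phi>eq[of _ "Suc m"]) (simp_all add: \<delta> c F0 \<Phi>0 \<Phi>\<delta>)
    qed
    thus ?thesis using c \<Phi>h by (simp add: Z_def cocyc_def)
  qed
  have main: "vectorspace K (Ext R M N m) \<and> vectorspace.fin_dim K (Ext R M N m) \<and>
    vectorspace.dim K (Ext R M N m) +
      vectorspace.dim K ((?F m)\<lparr>carrier := {c \<in> Z m. cobd R P' d' N m (\<Phi> m c)}\<rparr>) = ker_dim m" for m
  proof -
    obtain T where T: "linear_map K ((hom_space R (P' m) N)\<lparr>carrier := cocyc R P' d' N m\<rparr>) (Ext R M N m) T"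
      "T ` cocyc R P' d' N m = carrier (Ext R M N m)"
      "{z \<in> cocyc R P' d' N m. T z = \<zero>\<^bsub>Ext R M N m\<^esub>} = cobdry R P' d' N m"
      using Ext_of_resolution[OF P', of m] by blast
    interpret T: linear_map K "(hom_space R (P' m) N)\<lparr>carrier := cocyc R P' d' N m\<rparr>" "Ext R M N m" T by (rule T(1))
    have E: "left_module K (Ext R M N m)" by (rule Ext_facts(1))
    have ZM: "left_module K ((?F m)\<lparr>carrier := Z m\<rparr>)"
      using sub[of m] unfolding VectorSpace.subspace_def submodule_def
      by (intro left_module.submod_module[OF F]) (simp add: submod_def)
    have \<Phi>a: "\<Phi> m (\<lambda>z. c z \<oplus>\<^bsub>K\<^esub> c' z) = \<Phi> m c \<oplus>\<^bsub>hom_space R (P' m) N\<^esub> \<Phi> m c'"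
      if "c \<in> finsupp K (X m)" "c' \<in> finsupp K (X m)" for c c'
    proof (rule lin_homs_ext[OF \<Phi>h[OF Fa[OF that]]])
      have "(\<lambda>x\<in>carrier (P' m). \<Phi> m c x \<oplus>\<^bsub>N\<^esub> \<Phi> m c' x) \<in> lin_homs R (P' m) N"
        by (rule lin_homs_sum[OF P'.P_module NM \<Phi>h[OF that(1)] \<Phi>h[OF that(2)]])
      thus "\<Phi> m c \<oplus>\<^bsub>hom_space R (P' m) N\<^esub> \<Phi> m c' \<in> lin_homs R (P' m) N" by (simp add: hom_space_def)
    qed (simp add: hom_space_def \<Phi>_add that)
    have \<Phi>s: "\<Phi> m (\<lambda>z. k \<otimes>\<^bsub>K\<^esub> c z) = k \<odot>\<^bsub>hom_space R (P' m) N\<^esub> \<Phi> m c"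
      if "k \<in> carrier K" "c \<in> finsupp K (X m)" for c k
    proof (rule lin_homs_ext[OF \<Phi>h[OF Fs[OF that]]])
      show "k \<odot>\<^bsub>hom_space R (P' m) N\<^esub> \<Phi> m c \<in> lin_homs R (P' m) N"
        using left_module.lsmult_closed[OF R.hom_space_module[OF P'.P_module NM], of k "\<Phi> m c" m] that \<Phi>h
        by (simp add: hom_space_def)
    qed (simp add: hom_space_def \<Phi>_smult that)
    have Zf: "c \<in> finsupp K (X m)" if "c \<in> Z m" for c using that by (simp add: Z_def)
    have Zc: "\<Phi> m c \<in> cocyc R P' d' N m" if "c \<in> Z m" for c using mem[OF Zf[OF that]] that by simp
    have Tc: "T z \<in> carrier (Ext R M N m)" if "z \<in> cocyc R P' d' N m" for z using T(2) that by blast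
    have lin: "linear_map K ((?F m)\<lparr>carrier := Z m\<rparr>) (Ext R M N m) (\<lambda>c. T (\<Phi> m c))"
    proof (rule linear_mapI[OF K ZM E])
      show "T (\<Phi> m c) \<in> carrier (Ext R M N m)" if "c \<in> carrier ((?F m)\<lparr>carrier := Z m\<rparr>)" for c
        using that Tc Zc by simp
      show "T (\<Phi> m (c \<oplus>\<^bsub>(?F m)\<lparr>carrier := Z m\<rparr>\<^esub> c')) = T (\<Phi> m c) \<oplus>\<^bsub>Ext R M N m\<^esub> T (\<Phi> m c')"
        if "c \<in> carrier ((?F m)\<lparr>carrier := Z m\<rparr>)" "c' \<in> carrier ((?F m)\<lparr>carrier := Z m\<rparr>)" for c c'
        using that T.f_add[of "\<Phi> m c" "\<Phi> m c'"] by (simp add: aF \<Phi>a Zf Zc)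
      show "T (\<Phi> m (k \<odot>\<^bsub>(?F m)\<lparr>carrier := Z m\<rparr>\<^esub> c)) = k \<odot>\<^bsub>Ext R M N m\<^esub> T (\<Phi> m c)"
        if "k \<in> carrier K" "c \<in> carrier ((?F m)\<lparr>carrier := Z m\<rparr>)" for c k
        using that T.f_smult[of k "\<Phi> m c"] by (simp add: sF \<Phi>s Zf Zc)
    qed
    interpret S: linear_map K "(?F m)\<lparr>carrier := Z m\<rparr>" "Ext R M N m" "\<lambda>c. T (\<Phi> m c)" by (rule lin)
    have "\<Phi> m ` Z m = cocyc R P' d' N m"
    proof (intro equalityI subsetI)
      fix z assume z: "z \<in> cocyc R P' d' N m"
      hence "z \<in> \<Phi> m ` finsupp K (X m)"
        using bij_betw_imp_surj_on[OF \<Phi>[of m]] by (simp add: cocyc_def)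
      then obtain c where "c \<in> finsupp K (X m)" "z = \<Phi> m c" by blast
      thus "z \<in> \<Phi> m ` Z m" using mem[of c m] z by blast
    qed (use Zc in blast)
    hence sur: "(\<lambda>c. T (\<Phi> m c)) ` carrier ((?F m)\<lparr>carrier := Z m\<rparr>) = carrier (Ext R M N m)"
      using T(2) by (simp add: image_image[symmetric])
    have kr: "S.kerT = {c \<in> Z m. cobd R P' d' N m (\<Phi> m c)}"
    proof -
      have "T (\<Phi> m c) = \<zero>\<^bsub>Ext R M N m\<^esub> \<longleftrightarrow> cobd R P' d' N m (\<Phi> m c)" if "c \<in> Z m" for c
        using T(3) Zc[OF that] \<Phi>h[OF Zf[OF that]] unfolding cobdry_def by blast
      thus ?thesis by (auto simp: S.ker_def)
    qed
    have im: "S.imT = carrier (Ext R M N m)" using sur by (simp add: S.im_def)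
    have "vectorspace.dim K ((Ext R M N m)\<lparr>carrier := S.imT\<rparr>) +
        vectorspace.dim K (((?F m)\<lparr>carrier := Z m\<rparr>)\<lparr>carrier := S.kerT\<rparr>) = vectorspace.dim K ((?F m)\<lparr>carrier := Z m\<rparr>)"
      by (rule S.rank_nullity[OF fdZ])
    hence r: "vectorspace.dim K (Ext R M N m) +
        vectorspace.dim K ((?F m)\<lparr>carrier := {c \<in> Z m. cobd R P' d' N m (\<Phi> m c)}\<rparr>) = ker_dim m"
      unfolding kr im ker_dim by simp
    have fd: "vectorspace.fin_dim K (Ext R M N m)" by (rule S.rank_nullity_main(2)[OF fdZ sur])
    show ?thesis using r fd T.W.vectorspace_axioms by blast
  qed
  show "vectorspace K (Ext R M N m)" "vectorspace.fin_dim K (Ext R M N m)" using main[of m] by blast+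
  \<comment> \<open>In degree 0 the only coboundary is zero; that space is the free module on the
    empty set, of dimension 0.\<close>
  have "{c \<in> Z 0. cobd R P' d' N 0 (\<Phi> 0 c)} = finsupp K {}"
  proof -
    have e0: "c = (\<lambda>_. \<zero>\<^bsub>K\<^esub>)" if "c \<in> Z 0" "cobd R P' d' N 0 (\<Phi> 0 c)" for c
      by (rule \<Phi>eq[of _ 0]) (use that F0 \<Phi>0 in \<open>simp_all add: Z_def cobd_def\<close>)
    have "\<delta> 0 (\<lambda>_. \<zero>\<^bsub>K\<^esub>) = (\<lambda>_. \<zero>\<^bsub>K\<^esub>)"
      by (rule \<Phi>eq[of _ "Suc 0"]) (simp_all add: \<delta> F0 \<Phi>0 \<Phi>\<delta> P'.d_closed)
    hence z: "(\<lambda>_. \<zero>\<^bsub>K\<^esub>) \<in> {c \<in> Z 0. cobd R P' d' N 0 (\<Phi> 0 c)}"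
      using F0[of 0] \<Phi>0[of _ 0] by (simp add: Z_def cobd_def)
    have f: "finsupp K ({} :: 'x set) = {\<lambda>_. \<zero>\<^bsub>K\<^esub>}" by (auto simp: finsupp_def)
    show ?thesis unfolding f
    proof (intro equalityI subsetI)
      fix c assume "c \<in> {c \<in> Z 0. cobd R P' d' N 0 (\<Phi> 0 c)}"
      hence "c \<in> Z 0" "cobd R P' d' N 0 (\<Phi> 0 c)" by simp_all
      hence "c = (\<lambda>_. \<zero>\<^bsub>K\<^esub>)" by (rule e0)
      thus "c \<in> {\<lambda>_. \<zero>\<^bsub>K\<^esub>}" by simp
    next
      fix c :: "'x \<Rightarrow> 'k" assume "c \<in> {\<lambda>_. \<zero>\<^bsub>K\<^esub>}"
      hence "c = (\<lambda>_. \<zero>\<^bsub>K\<^esub>)" by (rule singletonD)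
      thus "c \<in> {c \<in> Z 0. cobd R P' d' N 0 (\<Phi> 0 c)}" using z by (simp only:)
    qed
  qed
  moreover have "(?F 0)\<lparr>carrier := finsupp K {}\<rparr> = free_module K {}" by (simp add: free_module_def)
  ultimately show "vectorspace.dim K (Ext R M N 0) = ker_dim 0"
    using main[of 0] free_module_fin_dim(2)[OF K, of "{} :: 'x set"] by simp
  interpret D: linear_map K "?F m" "?F (Suc m)" "\<delta> m" by (rule \<delta>lin)
  have "{c \<in> Z (Suc m). cobd R P' d' N (Suc m) (\<Phi> (Suc m) c)} = \<delta> m ` finsupp K (X m)"
  proof (intro equalityI subsetI)
    fix c assume c: "c \<in> {c \<in> Z (Suc m). cobd R P' d' N (Suc m) (\<Phi> (Suc m) c)}"
    then obtain g where g: "g \<in> lin_homs R (P' m) N"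
      "\<And>x. x \<in> carrier (P' (Suc m)) \<Longrightarrow> \<Phi> (Suc m) c x = g (d' m x)"
      unfolding cobd_def nat.case by blast
    obtain b where b: "b \<in> finsupp K (X m)" "g = \<Phi> m b"
      using bij_betw_imp_surj_on[OF \<Phi>[of m]] g(1) by blast
    have "c = \<delta> m b"
      by (rule \<Phi>eq[of _ "Suc m"]) (use c b g in \<open>simp_all add: Z_def \<delta> \<Phi>\<delta>\<close>)
    thus "c \<in> \<delta> m ` finsupp K (X m)" using b by blast
  next
    fix c assume "c \<in> \<delta> m ` finsupp K (X m)"
    then obtain b where b: "b \<in> finsupp K (X m)" "c = \<delta> m b" by blast
    have cochain_of_hom: "c \<in> finsupp K (X (Suc m))" using b \<delta> by simp
    have cb: "cobd R P' d' N (Suc m) (\<Phi> (Suc m) c)"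
      unfolding cobd_def nat.case using \<Phi>h[OF b(1)] \<Phi>\<delta>[OF b(1)] b(2) by blast
    hence "\<Phi> (Suc m) c \<in> cobdry R P' d' N (Suc m)" using \<Phi>h[OF cochain_of_hom] by (simp add: cobdry_def)
    hence "\<Phi> (Suc m) c \<in> cocyc R P' d' N (Suc m)" using cobdry_submod(2)[OF P'] by blast
    thus "c \<in> {c \<in> Z (Suc m). cobd R P' d' N (Suc m) (\<Phi> (Suc m) c)}" using mem[OF cochain_of_hom] cb by blast
  qed
  hence "vectorspace.dim K (Ext R M N (Suc m)) +
      vectorspace.dim K ((?F (Suc m))\<lparr>carrier := \<delta> m ` finsupp K (X m)\<rparr>) = ker_dim (Suc m)"
    using main[of "Suc m"] by simp
  moreover have "D.imT = \<delta> m ` finsupp K (X m)" "D.kerT = Z m"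
    by (auto simp: D.im_def D.ker_def Z_def carF zF)
  hence "vectorspace.dim K ((?F (Suc m))\<lparr>carrier := \<delta> m ` finsupp K (X m)\<rparr>) + ker_dim m = card (X m)"
    using D.rank_nullity[OF free_module_fin_dim(1)[OF K X]] free_module_fin_dim(2)[OF K X, of m] ker_dim[of m] by simp
  ultimately show "vectorspace.dim K (Ext R M N (Suc m)) + card (X m) = ker_dim (Suc m) + ker_dim m" by simp
qed

end

section \<open>Bimodules with a multiplicative basis\<close>

text \<open>An algebra with a finite basis \<open>path_elt ` S\<close>, coordinates \<open>co\<close> and a partial product \<open>pm\<close> on \<open>S\<close>.\<close>

locale based_algebra = env_algebra K A
  for K :: "('k, 'c) ring_scheme" and A :: "('k, 'a, 'd) module_scheme" +
  fixes S E :: "'p set" and pm :: "'p \<Rightarrow> 'p \<Rightarrow> 'p option" and path_elt :: "'p \<Rightarrow> 'a" and co :: "'a \<Rightarrow> 'p \<Rightarrow> 'k"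
  assumes S: "finite S" and E: "E \<subseteq> S"
    and pm_closed: "\<lbrakk>p \<in> S; q \<in> S; pm p q = Some r\<rbrakk> \<Longrightarrow> r \<in> S"
    and path_elt_closed: "p \<in> S \<Longrightarrow> path_elt p \<in> carrier A"
    and co_bij: "bij_betw co (carrier A) (finsupp K S)"
    and co_add: "\<lbrakk>a \<in> carrier A; b \<in> carrier A\<rbrakk> \<Longrightarrow> co (a \<oplus>\<^bsub>A\<^esub> b) = (\<lambda>p. co a p \<oplus>\<^bsub>K\<^esub> co b p)"
    and co_smult: "\<lbrakk>c \<in> carrier K; a \<in> carrier A\<rbrakk> \<Longrightarrow> co (c \<odot>\<^bsub>A\<^esub> a) = (\<lambda>p. c \<otimes>\<^bsub>K\<^esub> co a p)"
    and co_path_elt: "p \<in> S \<Longrightarrow> co (path_elt p) = basis_elt K p"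
    and path_elt_mult: "\<lbrakk>p \<in> S; q \<in> S\<rbrakk> \<Longrightarrow> path_elt p \<otimes>\<^bsub>A\<^esub> path_elt q = (case pm p q of None \<Rightarrow> \<zero>\<^bsub>A\<^esub> | Some r \<Rightarrow> path_elt r)"
    and co_one: "co \<one>\<^bsub>A\<^esub> = (\<lambda>p. if p \<in> E then \<one>\<^bsub>K\<^esub> else \<zero>\<^bsub>K\<^esub>)"
begin

lemma co_closed: "a \<in> carrier A \<Longrightarrow> co a \<in> finsupp K S"
  using bij_betwE[OF co_bij] by blast

lemma co_carrier: "a \<in> carrier A \<Longrightarrow> co a p \<in> carrier K"
  using co_closed by (auto simp: finsupp_def)

lemma co_eq: "a \<in> carrier A \<Longrightarrow> b \<in> carrier A \<Longrightarrow> co a = co b \<Longrightarrow> a = b"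
  using bij_betw_imp_inj_on[OF co_bij] by (simp add: inj_on_def)

lemma co_zero: "co \<zero>\<^bsub>A\<^esub> = (\<lambda>_. \<zero>\<^bsub>K\<^esub>)"
  using co_smult[of "\<zero>\<^bsub>K\<^esub>" "\<zero>\<^bsub>A\<^esub>"] by (simp add: KA.lsmult_zero co_carrier)

lemma A_induct [consumes 1, case_names zero add basis]:
  assumes a: "a \<in> carrier A" and z: "P \<zero>\<^bsub>A\<^esub>"
    and add: "\<And>a b. a \<in> carrier A \<Longrightarrow> b \<in> carrier A \<Longrightarrow> P a \<Longrightarrow> P b \<Longrightarrow> P (a \<oplus>\<^bsub>A\<^esub> b)"
    and basis: "\<And>c p. c \<in> carrier K \<Longrightarrow> p \<in> S \<Longrightarrow> P (c \<odot>\<^bsub>A\<^esub> path_elt p)"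
  shows "P a"
proof -
  have "\<exists>b\<in>carrier A. co b = co a \<and> P b"
    using co_closed[OF a]
  proof (induction rule: K.finsupp_induct)
    case zero
    show ?case using z co_zero by blast
  next
    case (add f g)
    then obtain x y where "x \<in> carrier A" "co x = f" "P x" "y \<in> carrier A" "co y = g" "P y" by blast
    thus ?case using assms(3) co_add by (intro bexI[of _ "x \<oplus>\<^bsub>A\<^esub> y"]) auto
  next
    case (basis c p)
    thus ?case using assms(4) co_smult[OF basis(1) path_elt_closed[OF basis(2)]] co_path_elt
      by (intro bexI[of _ "c \<odot>\<^bsub>A\<^esub> path_elt p"]) (auto simp: KA.lsmult_closed path_elt_closed)
  qed
  thus ?thesis using co_eq a by blast
qed

lemma tens_zero: "a \<in> carrier A \<Longrightarrow> tens a \<zero>\<^bsub>A\<^esub> = \<zero>\<^bsub>Env\<^esub>" "a \<in> carrier A \<Longrightarrow> tens \<zero>\<^bsub>A\<^esub> a = \<zero>\<^bsub>Env\<^esub>"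
  using tens_smult_r[of "\<zero>\<^bsub>K\<^esub>" a "\<zero>\<^bsub>A\<^esub>"] tens_smult_l[of "\<zero>\<^bsub>K\<^esub>" "\<zero>\<^bsub>A\<^esub>" a]
  by (simp_all add: KA.lsmult_zero Env.KA.lsmult_zero tens_closed)

end

text \<open>A bimodule with basis \<open>B\<close> that is a direct sum of modules \<open>A e \<otimes> e' A\<close>: the basis element \<open>y\<close> is
  \<open>lf y \<cdot> gen (g y) \<cdot> rt y\<close>, where \<open>gen \<gamma> = el \<gamma> \<cdot> gen \<gamma> \<cdot> er \<gamma>\<close> are the generators.\<close>

locale based_bimodule = based_algebra K A S E pm path_elt co
  for K :: "('k, 'c) ring_scheme" and A :: "('k, 'a, 'd) module_scheme"
    and S E :: "'p set" and pm path_elt co +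
  fixes B :: "'y set" and pact :: "'p \<Rightarrow> 'y \<Rightarrow> 'p \<Rightarrow> 'y option"
    and \<Gamma> :: "'g set" and gen :: "'g \<Rightarrow> 'y" and el er :: "'g \<Rightarrow> 'p"
    and lf rt :: "'y \<Rightarrow> 'p" and g :: "'y \<Rightarrow> 'g"
  assumes B: "finite B"
    and pact_closed: "\<lbrakk>p \<in> S; y \<in> B; q \<in> S; pact p y q = Some z\<rbrakk> \<Longrightarrow> z \<in> B"
    and pact_None: "\<lbrakk>p \<in> S; y \<in> B; q \<in> S; pact p y q = None\<rbrakk> \<Longrightarrow> pm p (lf y) = None \<or> pm (rt y) q = None"
    and pact_Some: "\<lbrakk>p \<in> S; y \<in> B; q \<in> S; pact p y q = Some z\<rbrakk>
      \<Longrightarrow> pm p (lf y) = Some (lf z) \<and> pm (rt y) q = Some (rt z) \<and> g z = g y"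
    and basis_eqI: "\<lbrakk>y \<in> B; z \<in> B; lf y = lf z; rt y = rt z; g y = g z\<rbrakk> \<Longrightarrow> y = z"
    and parts: "y \<in> B \<Longrightarrow> lf y \<in> S \<and> rt y \<in> S \<and> g y \<in> \<Gamma>"
    and gen: "\<gamma> \<in> \<Gamma> \<Longrightarrow> gen \<gamma> \<in> B \<and> lf (gen \<gamma>) = el \<gamma> \<and> rt (gen \<gamma>) = er \<gamma> \<and> g (gen \<gamma>) = \<gamma>"
    and gen_parts: "y \<in> B \<Longrightarrow> pm (lf y) (el (g y)) = Some (lf y) \<and> pm (er (g y)) (rt y) = Some (rt y)"
    and pm_assoc: "\<lbrakk>p \<in> S; q \<in> S; r \<in> S\<rbrakk> \<Longrightarrow> Option.bind (pm p q) (\<lambda>u. pm u r) = Option.bind (pm q r) (\<lambda>v. pm p v)"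
    and unit: "p \<in> S \<Longrightarrow> \<exists>e\<in>E. \<exists>e'\<in>E. pm e p = Some p \<and> pm p e' = Some p \<and>
      (\<forall>f\<in>E. f \<noteq> e \<longrightarrow> pm f p = None) \<and> (\<forall>f\<in>E. f \<noteq> e' \<longrightarrow> pm p f = None)"
begin

abbreviation V where "V \<equiv> free_module K B"

lemma carV: "carrier V = finsupp K B" by (simp add: free_module_def)

lemma opsV: "\<zero>\<^bsub>V\<^esub> = (\<lambda>_. \<zero>\<^bsub>K\<^esub>)" "f \<oplus>\<^bsub>V\<^esub> f' = (\<lambda>z. f z \<oplus>\<^bsub>K\<^esub> f' z)" "c \<odot>\<^bsub>V\<^esub> f = (\<lambda>z. c \<otimes>\<^bsub>K\<^esub> f z)"
  by (simp_all add: free_module_def)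

lemma V_module: "left_module K V" by (rule K.left_module_free)

lemma V_induct [consumes 1, case_names zero add basis]:
  assumes "f \<in> carrier V" "P \<zero>\<^bsub>V\<^esub>"
    and "\<And>f f'. f \<in> carrier V \<Longrightarrow> f' \<in> carrier V \<Longrightarrow> P f \<Longrightarrow> P f' \<Longrightarrow> P (f \<oplus>\<^bsub>V\<^esub> f')"
    and "\<And>c y. c \<in> carrier K \<Longrightarrow> y \<in> B \<Longrightarrow> P (c \<odot>\<^bsub>V\<^esub> basis_elt K y)"
  shows "P f"
  using assms unfolding carV opsV by (rule K.finsupp_induct)

lemma basisV: "y \<in> B \<Longrightarrow> basis_elt K y \<in> carrier V" by (simp add: carV K.basis_elt_finsupp)

text \<open>The push-forward of a weight function along the partial action. Since \<open>act\<close>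
  is a push-forward of products of coordinates, its linearity in each argument reduces to adding and
  scaling weights.\<close>

definition wsum where
  "wsum w = (\<lambda>z. finsum K (\<lambda>t. if (case t of (p, y, q) \<Rightarrow> pact p y q) = Some z then w t else \<zero>\<^bsub>K\<^esub>) (S \<times> B \<times> S))"

definition act where "act b x a = wsum (\<lambda>(p, y, q). co b p \<otimes>\<^bsub>K\<^esub> x y \<otimes>\<^bsub>K\<^esub> co a q)"

lemma wsum_add:
  assumes "\<And>t. w t \<in> carrier K" "\<And>t. w' t \<in> carrier K"
  shows "wsum (\<lambda>t. w t \<oplus>\<^bsub>K\<^esub> w' t) = (\<lambda>z. wsum w z \<oplus>\<^bsub>K\<^esub> wsum w' z)"
proof
  fix z
  have "wsum (\<lambda>t. w t \<oplus>\<^bsub>K\<^esub> w' t) z = finsum K (\<lambda>t. (if (case t of (p, y, q) \<Rightarrow> pact p y q) = Some z then w t else \<zero>\<^bsub>K\<^esub>)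
      \<oplus>\<^bsub>K\<^esub> (if (case t of (p, y, q) \<Rightarrow> pact p y q) = Some z then w' t else \<zero>\<^bsub>K\<^esub>)) (S \<times> B \<times> S)"
    unfolding wsum_def by (rule K.finsum_cong') (use assms in auto)
  also have "\<dots> = wsum w z \<oplus>\<^bsub>K\<^esub> wsum w' z"
    unfolding wsum_def by (rule K.finsum_addf) (use assms in auto)
  finally show "wsum (\<lambda>t. w t \<oplus>\<^bsub>K\<^esub> w' t) z = wsum w z \<oplus>\<^bsub>K\<^esub> wsum w' z" .
qed

lemma wsum_smult:
  assumes "\<And>t. w t \<in> carrier K" "c \<in> carrier K"
  shows "wsum (\<lambda>t. c \<otimes>\<^bsub>K\<^esub> w t) = (\<lambda>z. c \<otimes>\<^bsub>K\<^esub> wsum w z)"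
proof
  fix z
  have "c \<otimes>\<^bsub>K\<^esub> wsum w z = finsum K (\<lambda>t. c \<otimes>\<^bsub>K\<^esub> (if (case t of (p, y, q) \<Rightarrow> pact p y q) = Some z then w t else \<zero>\<^bsub>K\<^esub>)) (S \<times> B \<times> S)"
    unfolding wsum_def by (rule K.finsum_rdistr) (use assms S B in auto)
  also have "\<dots> = wsum (\<lambda>t. c \<otimes>\<^bsub>K\<^esub> w t) z"
    unfolding wsum_def by (rule K.finsum_cong') (use assms in auto)
  finally show "wsum (\<lambda>t. c \<otimes>\<^bsub>K\<^esub> w t) z = c \<otimes>\<^bsub>K\<^esub> wsum w z" by simp
qed

lemma wsum_closed: assumes "\<And>t. w t \<in> carrier K" shows "wsum w \<in> finsupp K B"
proof -
  have "wsum w z \<in> carrier K" for z unfolding wsum_def by (rule K.finsum_closed) (use assms in auto)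
  moreover have z: "wsum w z = \<zero>\<^bsub>K\<^esub>" if "z \<notin> B" for z
    unfolding wsum_def by (rule K.add.finprod_one_eqI) (use pact_closed that in auto)
  moreover have "finite {z. wsum w z \<noteq> \<zero>\<^bsub>K\<^esub>}" by (rule finite_subset[OF _ B]) (use z in blast)
  ultimately show ?thesis by (simp add: finsupp_def)
qed

lemma wcoeff:
  "b \<in> carrier A \<Longrightarrow> x \<in> carrier V \<Longrightarrow> a \<in> carrier A \<Longrightarrow>
    (case t of (p, y, q) \<Rightarrow> co b p \<otimes>\<^bsub>K\<^esub> x y \<otimes>\<^bsub>K\<^esub> co a q) \<in> carrier K"
  using co_carrier by (auto simp: carV finsupp_def split: prod.split)

lemma act_linear:
  assumes b: "b \<in> carrier A" "b' \<in> carrier A" and x: "x \<in> carrier V" "x' \<in> carrier V"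
    and a: "a \<in> carrier A" "a' \<in> carrier A" and c: "c \<in> carrier K"
  shows "act b x a \<in> carrier V"
    and "act (b \<oplus>\<^bsub>A\<^esub> b') x a = act b x a \<oplus>\<^bsub>V\<^esub> act b' x a"
    and "act b (x \<oplus>\<^bsub>V\<^esub> x') a = act b x a \<oplus>\<^bsub>V\<^esub> act b x' a"
    and "act b x (a \<oplus>\<^bsub>A\<^esub> a') = act b x a \<oplus>\<^bsub>V\<^esub> act b x a'"
    and "act (c \<odot>\<^bsub>A\<^esub> b) x a = c \<odot>\<^bsub>V\<^esub> act b x a"
    and "act b (c \<odot>\<^bsub>V\<^esub> x) a = c \<odot>\<^bsub>V\<^esub> act b x a"
    and "act b x (c \<odot>\<^bsub>A\<^esub> a) = c \<odot>\<^bsub>V\<^esub> act b x a"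
proof -
  have k: "x y \<in> carrier K" "x' y \<in> carrier K" for y using x by (auto simp: carV finsupp_def)
  note [simp] = k co_carrier
  show "act b x a \<in> carrier V" unfolding act_def carV by (rule wsum_closed) (rule wcoeff[OF b(1) x(1) a(1)])
  have add: "wsum (\<lambda>(p, y, q). co b p \<otimes>\<^bsub>K\<^esub> x y \<otimes>\<^bsub>K\<^esub> co a q) \<oplus>\<^bsub>V\<^esub> wsum (\<lambda>(p, y, q). co b' p \<otimes>\<^bsub>K\<^esub> x' y \<otimes>\<^bsub>K\<^esub> co a' q)
      = wsum (\<lambda>t. (case t of (p, y, q) \<Rightarrow> co b p \<otimes>\<^bsub>K\<^esub> x y \<otimes>\<^bsub>K\<^esub> co a q)
          \<oplus>\<^bsub>K\<^esub> (case t of (p, y, q) \<Rightarrow> co b' p \<otimes>\<^bsub>K\<^esub> x' y \<otimes>\<^bsub>K\<^esub> co a' q))"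
    if "b \<in> carrier A" "b' \<in> carrier A" "x \<in> carrier V" "x' \<in> carrier V" "a \<in> carrier A" "a' \<in> carrier A" for b b' x x' a a'
    unfolding opsV by (rule wsum_add[symmetric]) (use that wcoeff in blast)+
  have sm: "c \<odot>\<^bsub>V\<^esub> wsum (\<lambda>(p, y, q). co b p \<otimes>\<^bsub>K\<^esub> x y \<otimes>\<^bsub>K\<^esub> co a q)
      = wsum (\<lambda>t. c \<otimes>\<^bsub>K\<^esub> (case t of (p, y, q) \<Rightarrow> co b p \<otimes>\<^bsub>K\<^esub> x y \<otimes>\<^bsub>K\<^esub> co a q))"
    unfolding opsV by (rule wsum_smult[symmetric]) (use b x a c wcoeff in blast)+
  show "act (b \<oplus>\<^bsub>A\<^esub> b') x a = act b x a \<oplus>\<^bsub>V\<^esub> act b' x a"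
    unfolding act_def add[OF b x(1,1) a(1,1)]
    by (rule arg_cong[of _ _ wsum]) (use b a in \<open>auto simp: fun_eq_iff co_add K.l_distr\<close>)
  show "act b (x \<oplus>\<^bsub>V\<^esub> x') a = act b x a \<oplus>\<^bsub>V\<^esub> act b x' a"
    unfolding act_def add[OF b(1,1) x a(1,1)]
    by (rule arg_cong[of _ _ wsum]) (use b a in \<open>auto simp: fun_eq_iff opsV K.l_distr K.r_distr\<close>)
  show "act b x (a \<oplus>\<^bsub>A\<^esub> a') = act b x a \<oplus>\<^bsub>V\<^esub> act b x a'"
    unfolding act_def add[OF b(1,1) x(1,1) a]
    by (rule arg_cong[of _ _ wsum]) (use b a in \<open>auto simp: fun_eq_iff co_add K.r_distr\<close>)
  show "act (c \<odot>\<^bsub>A\<^esub> b) x a = c \<odot>\<^bsub>V\<^esub> act b x a"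
    unfolding act_def sm
    by (rule arg_cong[of _ _ wsum]) (use b a c in \<open>auto simp: fun_eq_iff co_smult K.m_assoc\<close>)
  show "act b (c \<odot>\<^bsub>V\<^esub> x) a = c \<odot>\<^bsub>V\<^esub> act b x a"
    unfolding act_def sm
    by (rule arg_cong[of _ _ wsum]) (use b a c in \<open>auto simp: fun_eq_iff opsV K.m_ac\<close>)
  show "act b x (c \<odot>\<^bsub>A\<^esub> a) = c \<odot>\<^bsub>V\<^esub> act b x a"
    unfolding act_def sm
    by (rule arg_cong[of _ _ wsum]) (use b a c in \<open>auto simp: fun_eq_iff co_smult K.m_ac\<close>)
qed

definition ob where "ob o' = (case o' of None \<Rightarrow> \<zero>\<^bsub>V\<^esub> | Some z \<Rightarrow> basis_elt K z)"

lemma act_basis: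
  assumes "p \<in> S" "y \<in> B" "q \<in> S"
  shows "act (path_elt p) (basis_elt K y) (path_elt q) = ob (pact p y q)"
proof
  fix z
  have "act (path_elt p) (basis_elt K y) (path_elt q) z = finsum K (\<lambda>t. ob (pact p y q) z) {(p, y, q)}"
    unfolding act_def wsum_def
    by (rule K.add.finprod_mono_neutral_cong_right)
      (use assms S B in \<open>auto simp: co_path_elt basis_elt_def ob_def opsV split: option.splits if_splits\<close>)
  also have "\<dots> = ob (pact p y q) z" by (simp add: ob_def basis_elt_def opsV split: option.split)
  finally show "act (path_elt p) (basis_elt K y) (path_elt q) z = ob (pact p y q) z" .
qed

text \<open>The unit of \<open>A\<close> is the sum of the local units; of all pairs of them exactly
  one acts on \<open>y\<close> without killing it.\<close>

lemma act_one_basis: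
  assumes y: "y \<in> B"
  shows "act \<one>\<^bsub>A\<^esub> (basis_elt K y) \<one>\<^bsub>A\<^esub> = basis_elt K y"
proof
  fix z
  note P = parts[OF y]
  obtain e where e: "e \<in> E" "pm e (lf y) = Some (lf y)" "\<And>f. f \<in> E \<Longrightarrow> f \<noteq> e \<Longrightarrow> pm f (lf y) = None"
    using unit[of "lf y"] P by blast
  obtain e' where e': "e' \<in> E" "pm (rt y) e' = Some (rt y)" "\<And>f. f \<in> E \<Longrightarrow> f \<noteq> e' \<Longrightarrow> pm (rt y) f = None"
    using unit[of "rt y"] P by blast
  have eS: "e \<in> S" "e' \<in> S" using e e' E by auto
  have pe: "pact e y e' = Some y"
  proof (cases "pact e y e'")
    case None
    thus ?thesis using pact_None[OF eS(1) y eS(2)] e e' by simp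
  next
    case (Some z)
    thus ?thesis using pact_Some[OF eS(1) y eS(2) Some] e e' basis_eqI[of z y] y pact_closed[OF eS(1) y eS(2) Some] by simp
  qed
  have uniq: "f = e \<and> f' = e'" if "f \<in> E" "f' \<in> E" "pact f y f' = Some z" for f f' z
  proof -
    have "pm f (lf y) \<noteq> None" "pm (rt y) f' \<noteq> None" using pact_Some[of f y f' z] that E y by auto
    thus ?thesis using e(3)[OF that(1)] e'(3)[OF that(2)] by metis
  qed
  have "act \<one>\<^bsub>A\<^esub> (basis_elt K y) \<one>\<^bsub>A\<^esub> z = finsum K (\<lambda>t. basis_elt K y z) {(e, y, e')}"
    unfolding act_def wsum_def
    by (rule K.add.finprod_mono_neutral_cong_right)
      (use eS y S B e(1) e'(1) pe in \<open>auto simp: co_one basis_elt_def dest: uniq split: if_splits\<close>)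
  thus "act \<one>\<^bsub>A\<^esub> (basis_elt K y) \<one>\<^bsub>A\<^esub> z = basis_elt K y z" by (simp add: basis_elt_def)
qed

lemma act_zeros:
  shows "x \<in> carrier V \<Longrightarrow> a \<in> carrier A \<Longrightarrow> act \<zero>\<^bsub>A\<^esub> x a = \<zero>\<^bsub>V\<^esub>"
    and "b \<in> carrier A \<Longrightarrow> a \<in> carrier A \<Longrightarrow> act b \<zero>\<^bsub>V\<^esub> a = \<zero>\<^bsub>V\<^esub>"
    and "b \<in> carrier A \<Longrightarrow> x \<in> carrier V \<Longrightarrow> act b x \<zero>\<^bsub>A\<^esub> = \<zero>\<^bsub>V\<^esub>"
proof -
  interpret V: left_module K V by (rule V_module)
  note cl = act_linear(1)[OF _ _ _ _ _ _ K.zero_closed]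
  show "act \<zero>\<^bsub>A\<^esub> x a = \<zero>\<^bsub>V\<^esub>" if "x \<in> carrier V" "a \<in> carrier A"
    using act_linear(5)[of "\<zero>\<^bsub>A\<^esub>" "\<zero>\<^bsub>A\<^esub>" x x a a "\<zero>\<^bsub>K\<^esub>"] cl[of "\<zero>\<^bsub>A\<^esub>" "\<zero>\<^bsub>A\<^esub>" x x a a] that
    by (simp add: KA.lsmult_zero V.lsmult_zero)
  show "act b \<zero>\<^bsub>V\<^esub> a = \<zero>\<^bsub>V\<^esub>" if "b \<in> carrier A" "a \<in> carrier A"
    using act_linear(6)[of b b "\<zero>\<^bsub>V\<^esub>" "\<zero>\<^bsub>V\<^esub>" a a "\<zero>\<^bsub>K\<^esub>"] cl[of b b "\<zero>\<^bsub>V\<^esub>" "\<zero>\<^bsub>V\<^esub>" a a] that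
    by (simp add: V.lsmult_zero)
  show "act b x \<zero>\<^bsub>A\<^esub> = \<zero>\<^bsub>V\<^esub>" if "b \<in> carrier A" "x \<in> carrier V"
    using act_linear(7)[of b b x x "\<zero>\<^bsub>A\<^esub>" "\<zero>\<^bsub>A\<^esub>" "\<zero>\<^bsub>K\<^esub>"] cl[of b b x x "\<zero>\<^bsub>A\<^esub>" "\<zero>\<^bsub>A\<^esub>"] that
    by (simp add: KA.lsmult_zero V.lsmult_zero)
qed

text \<open>A basis element is determined by its left part, its right part and its generator
  (\<open>basis_eqI\<close>). The generator never changes, so associativity can be checked on the
  two sides separately, inside \<open>S\<close>.\<close>

lemma pact_assoc:
  assumes "p \<in> S" "p' \<in> S" "y \<in> B" "q \<in> S" "q' \<in> S"
  shows "Option.bind (pact p' y q') (\<lambda>z. pact p z q) =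
    Option.bind (pm p p') (\<lambda>u. Option.bind (pm q' q) (\<lambda>v. pact u y v))"
proof -
  note P = parts[OF assms(3)]
  have A1: "Option.bind (pm p p') (\<lambda>u. pm u (lf y)) = Option.bind (pm p' (lf y)) (\<lambda>v. pm p v)"
    using pm_assoc assms P by blast
  have A2: "Option.bind (pm (rt y) q') (\<lambda>u. pm u q) = Option.bind (pm q' q) (\<lambda>v. pm (rt y) v)"
    using pm_assoc assms P by blast
  show ?thesis
  proof (cases "Option.bind (pact p' y q') (\<lambda>z. pact p z q)")
    case (Some z)
    then obtain z' where z': "pact p' y q' = Some z'" "pact p z' q = Some z"
      by (cases "pact p' y q'") auto
    have zB: "z' \<in> B" "z \<in> B" using pact_closed z' assms by blast+
    have s1: "pm p' (lf y) = Some (lf z')" "pm (rt y) q' = Some (rt z')" "g z' = g y"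
      using pact_Some[OF assms(2,3,5) z'(1)] by auto
    have s2: "pm p (lf z') = Some (lf z)" "pm (rt z') q = Some (rt z)" "g z = g z'"
      using pact_Some[OF assms(1) zB(1) assms(4) z'(2)] by auto
    obtain u where u: "pm p p' = Some u" "pm u (lf y) = Some (lf z)"
      using A1 s1 s2 by (cases "pm p p'") auto
    obtain v where v: "pm q' q = Some v" "pm (rt y) v = Some (rt z)"
      using A2 s1 s2 by (cases "pm q' q") auto
    have uv: "u \<in> S" "v \<in> S" using pm_closed u v assms by blast+
    obtain z'' where z'': "pact u y v = Some z''"
      using pact_None[OF uv(1) assms(3) uv(2)] u v by (cases "pact u y v") auto
    have "z'' = z"
      using pact_Some[OF uv(1) assms(3) uv(2) z''] u v s1 s2 basis_eqI[of z'' z] zB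
        pact_closed[OF uv(1) assms(3) uv(2) z''] by simp
    thus ?thesis using Some u v z'' by simp
  next
    case None
    have "Option.bind (pm p p') (\<lambda>u. Option.bind (pm q' q) (\<lambda>v. pact u y v)) = None"
    proof (rule ccontr)
      assume "Option.bind (pm p p') (\<lambda>u. Option.bind (pm q' q) (\<lambda>v. pact u y v)) \<noteq> None"
      then obtain u v z where z: "pm p p' = Some u" "pm q' q = Some v" "pact u y v = Some z"
        by (cases "pm p p'"; cases "pm q' q") auto
      have uv: "u \<in> S" "v \<in> S" using pm_closed z assms by blast+
      have s: "pm u (lf y) = Some (lf z)" "pm (rt y) v = Some (rt z)"
        using pact_Some[OF uv(1) assms(3) uv(2) z(3)] by auto
      obtain l where l: "pm p' (lf y) = Some l" "pm p l = Some (lf z)" using A1 z s by (cases "pm p' (lf y)") auto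
      obtain r where r: "pm (rt y) q' = Some r" "pm r q = Some (rt z)" using A2 z s by (cases "pm (rt y) q'") auto
      obtain z' where z': "pact p' y q' = Some z'"
        using pact_None[OF assms(2,3,5)] l r by (cases "pact p' y q'") auto
      have zB: "z' \<in> B" using pact_closed z' assms by blast
      have "lf z' = l" "rt z' = r" using pact_Some[OF assms(2,3,5) z'] l r by auto
      hence "pact p z' q \<noteq> None" using pact_None[OF assms(1) zB assms(4)] l r by auto
      thus False using None z' by simp
    qed
    thus ?thesis using None by simp
  qed
qed

lemma act_act_basis:
  assumes "p \<in> S" "p' \<in> S" "y \<in> B" "q \<in> S" "q' \<in> S"
  shows "act (path_elt p) (act (path_elt p') (basis_elt K y) (path_elt q')) (path_elt q) =
    act (path_elt p \<otimes>\<^bsub>A\<^esub> path_elt p') (basis_elt K y) (path_elt q' \<otimes>\<^bsub>A\<^esub> path_elt q)"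
proof -
  have L: "act (path_elt p) (act (path_elt p') (basis_elt K y) (path_elt q')) (path_elt q) = ob (Option.bind (pact p' y q') (\<lambda>z. pact p z q))"
    using assms pact_closed[OF assms(2,3,5)]
    by (cases "pact p' y q'") (auto simp: act_basis ob_def act_zeros(2) path_elt_closed)
  have "act (path_elt p \<otimes>\<^bsub>A\<^esub> path_elt p') (basis_elt K y) (path_elt q' \<otimes>\<^bsub>A\<^esub> path_elt q) =
      ob (Option.bind (pm p p') (\<lambda>u. Option.bind (pm q' q) (\<lambda>v. pact u y v)))"
    using assms pm_closed[OF assms(1,2)] pm_closed[OF assms(5,4)]
    by (cases "pm p p'"; cases "pm q' q")
      (auto simp: path_elt_mult act_basis ob_def act_zeros basisV path_elt_closed)
  thus ?thesis using L pact_assoc[OF assms] by simp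
qed

text \<open>The law for two successive actions is linear in five arguments; facts \<open>1\<close>
  to \<open>5\<close> release them from the basis one after another, the outer right factor first
  and the outer left factor last.\<close>

lemma based_bimodule: "bimodule K A V act"
proof -
  interpret V: left_module K V by (rule V_module)
  have cl [simp]: "act b x a \<in> carrier V" if "b \<in> carrier A" "x \<in> carrier V" "a \<in> carrier A" for b x a
    using act_linear(1)[OF that(1,1,2,2,3,3) K.zero_closed] .
  have [simp]: "act (b \<oplus>\<^bsub>A\<^esub> b') x a = act b x a \<oplus>\<^bsub>V\<^esub> act b' x a"
    if "b \<in> carrier A" "b' \<in> carrier A" "x \<in> carrier V" "a \<in> carrier A" for b b' x a
    using act_linear(2)[OF that(1,2,3,3,4,4) K.zero_closed] .
  have [simp]: "act b (x \<oplus>\<^bsub>V\<^esub> y) a = act b x a \<oplus>\<^bsub>V\<^esub> act b y a"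
    if "b \<in> carrier A" "x \<in> carrier V" "y \<in> carrier V" "a \<in> carrier A" for b x y a
    using act_linear(3)[OF that(1,1,2,3,4,4) K.zero_closed] .
  have [simp]: "act b x (a \<oplus>\<^bsub>A\<^esub> a') = act b x a \<oplus>\<^bsub>V\<^esub> act b x a'"
    if "b \<in> carrier A" "x \<in> carrier V" "a \<in> carrier A" "a' \<in> carrier A" for b x a a'
    using act_linear(4)[OF that(1,1,2,2,3,4) K.zero_closed] .
  have [simp]: "act (c \<odot>\<^bsub>A\<^esub> b) x a = c \<odot>\<^bsub>V\<^esub> act b x a" "act b (c \<odot>\<^bsub>V\<^esub> x) a = c \<odot>\<^bsub>V\<^esub> act b x a"
    "act b x (c \<odot>\<^bsub>A\<^esub> a) = c \<odot>\<^bsub>V\<^esub> act b x a"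
    if "c \<in> carrier K" "b \<in> carrier A" "x \<in> carrier V" "a \<in> carrier A" for c b x a
    using act_linear(5-7)[OF that(2,2,3,3,4,4,1)] by simp_all
  note [simp] = basisV path_elt_closed KA.lsmult_closed V.lsmult_closed smult_mult_l smult_mult_r A.l_distr A.r_distr act_zeros
  note [simp] = V.lsmult_r_zero
  have 1: "act (path_elt p) (act (path_elt p') (basis_elt K y) (path_elt q')) a =
      act (path_elt p \<otimes>\<^bsub>A\<^esub> path_elt p') (basis_elt K y) (path_elt q' \<otimes>\<^bsub>A\<^esub> a)"
    if "a \<in> carrier A" "p \<in> S" "p' \<in> S" "y \<in> B" "q' \<in> S" for a p p' y q'
    using that by (induction rule: A_induct) (simp_all add: act_act_basis)
  have 2: "act (path_elt p) (act (path_elt p') (basis_elt K y) a') a =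
      act (path_elt p \<otimes>\<^bsub>A\<^esub> path_elt p') (basis_elt K y) (a' \<otimes>\<^bsub>A\<^esub> a)"
    if "a' \<in> carrier A" "a \<in> carrier A" "p \<in> S" "p' \<in> S" "y \<in> B" for a a' p p' y
    using that by (induction rule: A_induct) (simp_all add: 1)
  have 3: "act (path_elt p) (act (path_elt p') x a') a = act (path_elt p \<otimes>\<^bsub>A\<^esub> path_elt p') x (a' \<otimes>\<^bsub>A\<^esub> a)"
    if "x \<in> carrier V" "a' \<in> carrier A" "a \<in> carrier A" "p \<in> S" "p' \<in> S" for a a' p p' x
    using that by (induction rule: V_induct) (simp_all add: 2)
  have 4: "act (path_elt p) (act b' x a') a = act (path_elt p \<otimes>\<^bsub>A\<^esub> b') x (a' \<otimes>\<^bsub>A\<^esub> a)"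
    if "b' \<in> carrier A" "x \<in> carrier V" "a' \<in> carrier A" "a \<in> carrier A" "p \<in> S" for a a' p b' x
    using that by (induction rule: A_induct) (simp_all add: 3)
  have 5: "act b (act b' x a') a = act (b \<otimes>\<^bsub>A\<^esub> b') x (a' \<otimes>\<^bsub>A\<^esub> a)"
    if "b \<in> carrier A" "b' \<in> carrier A" "x \<in> carrier V" "a' \<in> carrier A" "a \<in> carrier A" for a a' b b' x
    using that by (induction rule: A_induct) (simp_all add: 4)
  have 6: "act \<one>\<^bsub>A\<^esub> x \<one>\<^bsub>A\<^esub> = x" if "x \<in> carrier V" for x
    using that by (induction rule: V_induct) (simp_all add: act_one_basis)
  show ?thesis
    by (intro bimodule.intro bimodule_axioms.intro env_algebra_axioms V_module) (simp_all add: 5 6)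
qed

sublocale BM: bimodule K A V act by (rule based_bimodule)

lemma basis_gen:
  assumes y: "y \<in> B"
  shows "act (path_elt (lf y)) (basis_elt K (gen (g y))) (path_elt (rt y)) = basis_elt K y"
proof -
  note P = parts[OF y] and G = gen[of "g y"] and L = gen_parts[OF y]
  have "pact (lf y) (gen (g y)) (rt y) = Some y"
  proof (cases "pact (lf y) (gen (g y)) (rt y)")
    case None
    thus ?thesis using pact_None[of "lf y" "gen (g y)" "rt y"] P G L by auto
  next
    case (Some z)
    hence zB: "z \<in> B" using pact_closed P G by blast
    have "lf z = lf y" "rt z = rt y" "g z = g y"
      using pact_Some[of "lf y" "gen (g y)" "rt y" z] Some P G L by auto
    thus ?thesis using Some basis_eqI[of z y] zB y by simp
  qed
  thus ?thesis using P G by (simp add: act_basis ob_def)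
qed

section \<open>Homomorphisms out of a based bimodule, and projectivity\<close>

abbreviation P where "P \<equiv> env_module K V act"

text \<open>The coefficient \<open>x y\<close> is moved into a tensor factor, as \<open>N\<close>
  has an action of \<open>Env\<close> only. The values \<open>n\<close> need not be fixed by the
  local units: the generator of \<open>\<gamma>\<close> goes to \<open>n \<gamma>\<close> multiplied
  by \<open>el \<gamma>\<close> and \<open>er \<gamma>\<close>.\<close>

definition from_gens where
  "from_gens N n = (\<lambda>x\<in>carrier V. finsum N (\<lambda>y. tens (x y \<odot>\<^bsub>A\<^esub> path_elt (rt y)) (path_elt (lf y)) \<odot>\<^bsub>N\<^esub> n (g y)) B)"

lemma from_gens:
  assumes N: "left_module Env N" and n: "\<And>\<gamma>. \<gamma> \<in> \<Gamma> \<Longrightarrow> n \<gamma> \<in> carrier N"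
  shows from_gens_hom: "from_gens N n \<in> lin_homs Env P N"
    and from_gens_basis: "\<And>y. y \<in> B \<Longrightarrow> from_gens N n (basis_elt K y) = tens (path_elt (rt y)) (path_elt (lf y)) \<odot>\<^bsub>N\<^esub> n (g y)"
proof -
  interpret N: left_module Env N by (rule N)
  interpret V: left_module K V by (rule V_module)
  let ?F = "\<lambda>x. finsum N (\<lambda>y. tens (x y \<odot>\<^bsub>A\<^esub> path_elt (rt y)) (path_elt (lf y)) \<odot>\<^bsub>N\<^esub> n (g y)) B"
  have xk: "x y \<in> carrier K" if "x \<in> carrier V" for x y using that by (auto simp: carV finsupp_def)
  have tc: "tens (c \<odot>\<^bsub>A\<^esub> path_elt (rt y)) (path_elt (lf y)) \<in> carrier Env" if "c \<in> carrier K" "y \<in> B" for c y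
    using that parts by (simp add: tens_closed KA.lsmult_closed path_elt_closed)
  have tn: "tens (c \<odot>\<^bsub>A\<^esub> path_elt (rt y)) (path_elt (lf y)) \<odot>\<^bsub>N\<^esub> n (g y) \<in> carrier N" if "c \<in> carrier K" "y \<in> B" for c y
    using tc[OF that] n parts[OF that(2)] by (simp add: N.lsmult_closed)
  have Fc: "?F x \<in> carrier N" if "x \<in> carrier V" for x
    by (rule N.M.finsum_closed) (use tn xk[OF that] in auto)
  have Fadd: "?F (x \<oplus>\<^bsub>V\<^esub> x') = ?F x \<oplus>\<^bsub>N\<^esub> ?F x'" if x: "x \<in> carrier V" "x' \<in> carrier V" for x x'
  proof -
    have "?F (x \<oplus>\<^bsub>V\<^esub> x') = finsum N (\<lambda>y. tens (x y \<odot>\<^bsub>A\<^esub> path_elt (rt y)) (path_elt (lf y)) \<odot>\<^bsub>N\<^esub> n (g y)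
        \<oplus>\<^bsub>N\<^esub> tens (x' y \<odot>\<^bsub>A\<^esub> path_elt (rt y)) (path_elt (lf y)) \<odot>\<^bsub>N\<^esub> n (g y)) B"
    proof (rule N.M.finsum_cong')
      fix y assume y: "y \<in> B"
      have "tens ((x \<oplus>\<^bsub>V\<^esub> x') y \<odot>\<^bsub>A\<^esub> path_elt (rt y)) (path_elt (lf y)) =
          tens (x y \<odot>\<^bsub>A\<^esub> path_elt (rt y)) (path_elt (lf y)) \<oplus>\<^bsub>Env\<^esub> tens (x' y \<odot>\<^bsub>A\<^esub> path_elt (rt y)) (path_elt (lf y))"
        using parts[OF y] xk[OF x(1)] xk[OF x(2)]
        by (simp add: opsV KA.lsmult_l_distr tens_add_l path_elt_closed KA.lsmult_closed)
      thus "tens ((x \<oplus>\<^bsub>V\<^esub> x') y \<odot>\<^bsub>A\<^esub> path_elt (rt y)) (path_elt (lf y)) \<odot>\<^bsub>N\<^esub> n (g y) =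
          tens (x y \<odot>\<^bsub>A\<^esub> path_elt (rt y)) (path_elt (lf y)) \<odot>\<^bsub>N\<^esub> n (g y)
          \<oplus>\<^bsub>N\<^esub> tens (x' y \<odot>\<^bsub>A\<^esub> path_elt (rt y)) (path_elt (lf y)) \<odot>\<^bsub>N\<^esub> n (g y)"
        using N.lsmult_l_distr[OF tc[OF xk[OF x(1)] y] tc[OF xk[OF x(2)] y]] n parts[OF y] by simp
    qed (use tn xk[OF x(1)] xk[OF x(2)] in auto)
    also have "\<dots> = ?F x \<oplus>\<^bsub>N\<^esub> ?F x'"
      by (rule N.M.finsum_addf) (use tn xk[OF x(1)] xk[OF x(2)] in auto)
    finally show ?thesis .
  qed
  have Fsm: "?F (c \<odot>\<^bsub>V\<^esub> x) = (c \<odot>\<^bsub>Env\<^esub> \<one>\<^bsub>Env\<^esub>) \<odot>\<^bsub>N\<^esub> ?F x" if x: "x \<in> carrier V" and c: "c \<in> carrier K" for x c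
  proof -
    have cE: "c \<odot>\<^bsub>Env\<^esub> \<one>\<^bsub>Env\<^esub> \<in> carrier Env" using c by (simp add: Env.KA.lsmult_closed)
    have "?F (c \<odot>\<^bsub>V\<^esub> x) = finsum N (\<lambda>y. (c \<odot>\<^bsub>Env\<^esub> \<one>\<^bsub>Env\<^esub>) \<odot>\<^bsub>N\<^esub>
        (tens (x y \<odot>\<^bsub>A\<^esub> path_elt (rt y)) (path_elt (lf y)) \<odot>\<^bsub>N\<^esub> n (g y))) B"
    proof (rule N.M.finsum_cong')
      fix y assume y: "y \<in> B"
      have "tens ((c \<odot>\<^bsub>V\<^esub> x) y \<odot>\<^bsub>A\<^esub> path_elt (rt y)) (path_elt (lf y)) =
          (c \<odot>\<^bsub>Env\<^esub> \<one>\<^bsub>Env\<^esub>) \<otimes>\<^bsub>Env\<^esub> tens (x y \<odot>\<^bsub>A\<^esub> path_elt (rt y)) (path_elt (lf y))"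
        using parts[OF y] xk[OF x] c tc[OF xk[OF x] y]
        by (simp add: opsV KA.lsmult_assoc tens_smult_l path_elt_closed KA.lsmult_closed Env.smult_mult_l)
      thus "tens ((c \<odot>\<^bsub>V\<^esub> x) y \<odot>\<^bsub>A\<^esub> path_elt (rt y)) (path_elt (lf y)) \<odot>\<^bsub>N\<^esub> n (g y) = (c \<odot>\<^bsub>Env\<^esub> \<one>\<^bsub>Env\<^esub>) \<odot>\<^bsub>N\<^esub>
          (tens (x y \<odot>\<^bsub>A\<^esub> path_elt (rt y)) (path_elt (lf y)) \<odot>\<^bsub>N\<^esub> n (g y))"
        using N.lsmult_assoc[OF cE tc[OF xk[OF x] y]] n parts[OF y] by simp
    qed (use tn xk[OF x] cE N.lsmult_closed in auto)
    also have "\<dots> = (c \<odot>\<^bsub>Env\<^esub> \<one>\<^bsub>Env\<^esub>) \<odot>\<^bsub>N\<^esub> ?F x"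
      by (rule N.lsmult_finsum[OF B cE]) (use tn xk[OF x] in auto)
    finally show ?thesis .
  qed
  have Fb: "?F (basis_elt K y) = tens (path_elt (rt y)) (path_elt (lf y)) \<odot>\<^bsub>N\<^esub> n (g y)" if y: "y \<in> B" for y
  proof -
    have "?F (basis_elt K y) = finsum N (\<lambda>z. tens (path_elt (rt y)) (path_elt (lf y)) \<odot>\<^bsub>N\<^esub> n (g y)) {y}"
    proof (rule N.M.add.finprod_mono_neutral_cong_right)
      fix i assume "i \<in> B - {y}"
      thus "tens (basis_elt K y i \<odot>\<^bsub>A\<^esub> path_elt (rt i)) (path_elt (lf i)) \<odot>\<^bsub>N\<^esub> n (g i) = \<zero>\<^bsub>N\<^esub>"
        using parts[of i] n by (simp add: basis_elt_def KA.lsmult_zero path_elt_closed tens_zero N.lsmult_zero)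
    qed (use y B parts in \<open>auto simp: basis_elt_def KA.lsmult_one path_elt_closed intro!: tn\<close>)
    thus ?thesis using tn[of "\<one>\<^bsub>K\<^esub>" y] y parts[OF y] by (simp add: KA.lsmult_one path_elt_closed)
  qed
  \<comment> \<open>Where the partial action is undefined, one of the two outer products vanishes in
    \<open>A\<close>, and the tensor on the right-hand side vanishes with it.\<close>
  have Fact_basis: "?F (act (path_elt p) (basis_elt K y) (path_elt q)) = tens (path_elt q) (path_elt p) \<odot>\<^bsub>N\<^esub> ?F (basis_elt K y)"
    if p: "p \<in> S" and y: "y \<in> B" and q: "q \<in> S" for p y q
  proof -
    note Py = parts[OF y]
    have ng: "n (g y) \<in> carrier N" using n Py by simp
    have R: "tens (path_elt q) (path_elt p) \<odot>\<^bsub>N\<^esub> ?F (basis_elt K y) =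
        tens (path_elt (rt y) \<otimes>\<^bsub>A\<^esub> path_elt q) (path_elt p \<otimes>\<^bsub>A\<^esub> path_elt (lf y)) \<odot>\<^bsub>N\<^esub> n (g y)"
      unfolding Fb[OF y] using N.lsmult_assoc[of "tens (path_elt q) (path_elt p)" "tens (path_elt (rt y)) (path_elt (lf y))" "n (g y)"]
        Py p q ng by (simp add: tens_closed path_elt_closed tens_mult)
    show ?thesis
    proof (cases "pact p y q")
      case None
      have "?F (act (path_elt p) (basis_elt K y) (path_elt q)) = ?F (\<zero>\<^bsub>K\<^esub> \<odot>\<^bsub>V\<^esub> \<zero>\<^bsub>V\<^esub>)"
        using None by (simp add: act_basis[OF p y q] ob_def BM.N.lsmult_zero)
      also have "\<dots> = \<zero>\<^bsub>N\<^esub>"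
        using Fsm[of "\<zero>\<^bsub>V\<^esub>" "\<zero>\<^bsub>K\<^esub>"] Fc[of "\<zero>\<^bsub>V\<^esub>"] by (simp add: Env.KA.lsmult_zero N.lsmult_zero)
      also have "\<dots> = tens (path_elt q) (path_elt p) \<odot>\<^bsub>N\<^esub> ?F (basis_elt K y)"
      proof -
        have "path_elt p \<otimes>\<^bsub>A\<^esub> path_elt (lf y) = \<zero>\<^bsub>A\<^esub> \<or> path_elt (rt y) \<otimes>\<^bsub>A\<^esub> path_elt q = \<zero>\<^bsub>A\<^esub>"
          using pact_None[OF p y q None] Py p q by (auto simp: path_elt_mult)
        thus ?thesis unfolding R using Py p q ng
          by (elim disjE) (simp_all add: tens_zero N.lsmult_zero path_elt_closed)
      qed
      finally show ?thesis .
    next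
      case (Some z)
      have z: "z \<in> B" using pact_closed[OF p y q Some] .
      show ?thesis unfolding R using Some pact_Some[OF p y q Some] Py p q
        by (simp add: act_basis[OF p y q] ob_def Fb[OF z] path_elt_mult)
    qed
  qed
  have acl: "act b x a \<in> carrier V" if "b \<in> carrier A" "x \<in> carrier V" "a \<in> carrier A" for b x a
    using BM.act_closed[OF that] .
  have scal: "r \<odot>\<^bsub>N\<^esub> ((c \<odot>\<^bsub>Env\<^esub> \<one>\<^bsub>Env\<^esub>) \<odot>\<^bsub>N\<^esub> v) = (c \<odot>\<^bsub>Env\<^esub> \<one>\<^bsub>Env\<^esub>) \<odot>\<^bsub>N\<^esub> (r \<odot>\<^bsub>N\<^esub> v)"
    "(c \<odot>\<^bsub>Env\<^esub> r) \<odot>\<^bsub>N\<^esub> v = (c \<odot>\<^bsub>Env\<^esub> \<one>\<^bsub>Env\<^esub>) \<odot>\<^bsub>N\<^esub> (r \<odot>\<^bsub>N\<^esub> v)"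
    if "c \<in> carrier K" "r \<in> carrier Env" "v \<in> carrier N" for c r v
    using that by (simp_all add: N.lsmult_assoc[symmetric] Env.KA.lsmult_closed Env.smult_mult_l Env.smult_mult_r)
  have F0: "?F \<zero>\<^bsub>V\<^esub> = \<zero>\<^bsub>N\<^esub>"
    using Fsm[of "\<zero>\<^bsub>V\<^esub>" "\<zero>\<^bsub>K\<^esub>"] Fc[of "\<zero>\<^bsub>V\<^esub>"]
    by (simp add: Env.KA.lsmult_zero N.lsmult_zero BM.N.lsmult_zero)
  \<comment> \<open>The law on basis elements is extended to the right factor, then the left factor,
    then the module element.\<close>
  have 1: "?F (act (path_elt p) (basis_elt K y) a) = tens a (path_elt p) \<odot>\<^bsub>N\<^esub> ?F (basis_elt K y)"
    if "a \<in> carrier A" "p \<in> S" "y \<in> B" for a p y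
    using that
  proof (induction rule: A_induct)
    case zero
    thus ?case using Fc[OF basisV[OF zero(2)]] F0
      by (simp add: act_zeros(3) basisV path_elt_closed tens_zero N.lsmult_zero)
  next
    case (add a a')
    thus ?case using Fc[OF basisV[OF add.prems(2)]]
      by (simp add: BM.act_add_r basisV path_elt_closed Fadd acl tens_add_l N.lsmult_l_distr tens_closed)
  next
    case (basis c q)
    thus ?case using Fc[OF basisV[OF basis(4)]]
      by (simp add: BM.act_smult_r basisV path_elt_closed Fsm acl tens_smult_l tens_closed Fact_basis scal)
  qed
  have 2: "?F (act b (basis_elt K y) a) = tens a b \<odot>\<^bsub>N\<^esub> ?F (basis_elt K y)"
    if "b \<in> carrier A" "a \<in> carrier A" "y \<in> B" for a b y
    using that
  proof (induction rule: A_induct)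
    case zero
    thus ?case using Fc[OF basisV[OF zero(2)]] F0
      by (simp add: act_zeros(1) basisV path_elt_closed tens_zero N.lsmult_zero)
  next
    case (add b b')
    thus ?case using Fc[OF basisV[OF add.prems(2)]]
      by (simp add: BM.act_add_l basisV path_elt_closed Fadd acl tens_add_r N.lsmult_l_distr tens_closed)
  next
    case (basis c q)
    thus ?case using Fc[OF basisV[OF basis(4)]]
      by (simp add: BM.act_smult_l basisV path_elt_closed Fsm acl tens_smult_r tens_closed 1 scal)
  qed
  have 3: "?F (act b x a) = tens a b \<odot>\<^bsub>N\<^esub> ?F x"
    if "x \<in> carrier V" "b \<in> carrier A" "a \<in> carrier A" for a b x
    using that
  proof (induction rule: V_induct)
    case zero
    thus ?case using F0 by (simp add: BM.act_zero N.lsmult_r_zero tens_closed)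
  next
    case (add x x')
    thus ?case using Fc by (simp add: BM.act_add_m Fadd acl N.lsmult_r_distr tens_closed)
  next
    case (basis c y)
    thus ?case using Fc[OF basisV[OF basis(2)]]
      by (simp add: BM.act_smult_m basisV Fsm acl tens_closed 2 scal(1))
  qed
  show "from_gens N n \<in> lin_homs Env P N"
    unfolding from_gens_def by (rule BM.env_lin_homsI[OF N Fc Fadd 3])
  show "from_gens N n (basis_elt K y) = tens (path_elt (rt y)) (path_elt (lf y)) \<odot>\<^bsub>N\<^esub> n (g y)" if "y \<in> B" for y
    using Fb[OF that] basisV[OF that] by (simp add: from_gens_def)
qed

lemma P_module: "left_module Env P" by (rule BM.env_left_module)

lemma hom_scal:
  assumes "f \<in> lin_homs Env P N" "c \<in> carrier K" "x \<in> carrier V"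
  shows "f (c \<odot>\<^bsub>V\<^esub> x) = (c \<odot>\<^bsub>Env\<^esub> \<one>\<^bsub>Env\<^esub>) \<odot>\<^bsub>N\<^esub> f x"
proof -
  have "f ((c \<odot>\<^bsub>Env\<^esub> \<one>\<^bsub>Env\<^esub>) \<odot>\<^bsub>P\<^esub> x) = (c \<odot>\<^bsub>Env\<^esub> \<one>\<^bsub>Env\<^esub>) \<odot>\<^bsub>N\<^esub> f x"
    by (rule lin_homs_smult[OF assms(1)]) (use assms in \<open>simp_all add: Env.KA.lsmult_closed\<close>)
  thus ?thesis using assms by (simp add: BM.env_scalar)
qed

lemma hom_basis:
  assumes "f \<in> lin_homs Env P N" "y \<in> B"
  shows "f (basis_elt K y) = tens (path_elt (rt y)) (path_elt (lf y)) \<odot>\<^bsub>N\<^esub> f (basis_elt K (gen (g y)))"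
proof -
  note P = parts[OF assms(2)] and G = gen[of "g y"]
  have c: "basis_elt K (gen (g y)) \<in> carrier V" using P G basisV by blast
  have "f (tens (path_elt (rt y)) (path_elt (lf y)) \<odot>\<^bsub>P\<^esub> basis_elt K (gen (g y))) =
      tens (path_elt (rt y)) (path_elt (lf y)) \<odot>\<^bsub>N\<^esub> f (basis_elt K (gen (g y)))"
    by (rule lin_homs_smult[OF assms(1)]) (use P c in \<open>simp_all add: tens_closed path_elt_closed\<close>)
  thus ?thesis using P c by (simp add: BM.tens_act path_elt_closed basis_gen[OF assms(2)])
qed

lemma hom_eqI:
  assumes N: "left_module Env N" and f: "f \<in> lin_homs Env P N" and h: "h \<in> lin_homs Env P N"
    and eq: "\<And>\<gamma>. \<gamma> \<in> \<Gamma> \<Longrightarrow> f (basis_elt K (gen \<gamma>)) = h (basis_elt K (gen \<gamma>))"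
  shows "f = h"
proof (rule lin_homs_ext[OF f h])
  fix x assume "x \<in> carrier P"
  hence "x \<in> carrier V" by simp
  thus "f x = h x"
  proof (induction rule: V_induct)
    case zero
    show ?case using lin_homs_zero[OF P_module N f] lin_homs_zero[OF P_module N h] by simp
  next
    case (add x x')
    thus ?case using lin_homs_add[OF f, of x x'] lin_homs_add[OF h, of x x'] by simp
  next
    case (basis c y)
    thus ?case using hom_scal[OF f, of c "basis_elt K y"] hom_scal[OF h, of c "basis_elt K y"]
        hom_basis[OF f, of y] hom_basis[OF h, of y] eq[of "g y"] parts[of y] by (simp add: basisV)
  qed
qed

text \<open>\<open>P\<close> is the summand of the free module on the generators that is cut out by
  the local units: the embedding multiplies a free generator by \<open>el \<gamma>\<close> and
  \<open>er \<gamma>\<close>, and these act trivially again after the projection.\<close>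

lemma P_projective: "projective Env P"
proof -
  let ?b = "\<lambda>\<gamma>. basis_elt K (gen \<gamma>)"
  \<comment> \<open>\<open>projective\<close> takes its index set in the type of the module's
    elements, so the generators are represented by their basis vectors.\<close>
  let ?X = "?b ` \<Gamma>"
  let ?F = "free_module Env ?X"
  have F: "left_module Env ?F" by (rule Env.A.left_module_free)
  interpret F: left_module Env ?F by (rule F)
  interpret P: left_module Env P by (rule P_module)
  have carF: "carrier ?F = finsupp Env ?X" by (simp add: free_module_def)
  have bc: "?b \<gamma> \<in> carrier P" if "\<gamma> \<in> \<Gamma>" for \<gamma> using gen[OF that] basisV by simp
  have Xc: "x \<in> carrier P" if "x \<in> ?X" for x using that bc by blast
  let ?n = "\<lambda>\<gamma>. basis_elt Env (?b \<gamma>)"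
  have n: "?n \<gamma> \<in> carrier ?F" if "\<gamma> \<in> \<Gamma>" for \<gamma> using that Env.A.basis_elt_finsupp[of "?b \<gamma>" ?X] by (simp add: carF)
  let ?\<iota> = "from_gens ?F ?n" and ?\<pi> = "ext_map Env ?X P (\<lambda>x. x)"
  have \<iota>: "?\<iota> \<in> lin_homs Env P ?F" by (rule from_gens_hom[OF F n])
  have \<pi>: "?\<pi> \<in> lin_homs Env ?F P" by (rule P.ext_map_hom) (rule Xc)
  have "(\<lambda>x\<in>carrier P. ?\<pi> (?\<iota> x)) = (\<lambda>x\<in>carrier P. x)"
  proof (rule hom_eqI[OF P_module lin_homs_compose[OF P_module \<iota> \<pi>] P.id_lin_homs])
    fix \<gamma> assume \<gamma>: "\<gamma> \<in> \<Gamma>"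
    note G = gen[OF \<gamma>]
    have E: "el \<gamma> \<in> S" "er \<gamma> \<in> S" using G parts[of "gen \<gamma>"] by auto
    have t: "tens (path_elt (er \<gamma>)) (path_elt (el \<gamma>)) \<in> carrier Env" using E by (simp add: tens_closed path_elt_closed)
    have "?\<pi> (?\<iota> (?b \<gamma>)) = ?\<pi> (tens (path_elt (er \<gamma>)) (path_elt (el \<gamma>)) \<odot>\<^bsub>?F\<^esub> ?n \<gamma>)"
      using from_gens_basis[OF F n, where y = "gen \<gamma>"] G by simp
    also have "\<dots> = tens (path_elt (er \<gamma>)) (path_elt (el \<gamma>)) \<odot>\<^bsub>P\<^esub> ?\<pi> (?n \<gamma>)"
      by (rule lin_homs_smult[OF \<pi> t n[OF \<gamma>]])
    also have "?\<pi> (?n \<gamma>) = ?b \<gamma>" using P.ext_map_basis_elt[of ?X "\<lambda>x. x" "?b \<gamma>"] Xc \<gamma> by simp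
    also have "tens (path_elt (er \<gamma>)) (path_elt (el \<gamma>)) \<odot>\<^bsub>P\<^esub> ?b \<gamma> = ?b \<gamma>"
      using basis_gen[of "gen \<gamma>"] G E bc[OF \<gamma>] by (simp add: BM.tens_act path_elt_closed)
    finally show "(\<lambda>x\<in>carrier P. ?\<pi> (?\<iota> x)) (?b \<gamma>) = (\<lambda>x\<in>carrier P. x) (?b \<gamma>)" using bc[OF \<gamma>] by simp
  qed
  note eq = this
  have "?\<pi> (?\<iota> x) = x" if "x \<in> carrier P" for x using fun_cong[OF eq, of x] that by simp
  thus ?thesis unfolding projective_def using P_module \<iota> \<pi> by blast
qed

end

section \<open>Truncated quiver algebras\<close>

declare split_paired_All [simp del] split_paired_Ex [simp del]

locale truncated_quiver = Q: fin_digraph Q + K: field K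
  for Q :: "('v, 'e) pre_digraph" and K :: "('k, 'c) ring_scheme" +
  fixes n :: nat
  assumes n2: "2 \<le> n"
begin

abbreviation trm where "trm \<equiv> terminus Q"

definition pcat :: "'v \<times> 'e list \<Rightarrow> 'v \<times> 'e list \<Rightarrow> 'v \<times> 'e list" where
  "pcat p q = (fst p, snd p @ snd q)"

definition ptake where "ptake i w = (fst w, take i (snd w))"

text \<open>A path stores its origin, hence the remainder has to be given the vertex at which the
  removed part ends.\<close>

definition pdrop where "pdrop i w = (trm (ptake i w), drop i (snd w))"

lemma pcat_simps [simp]: "fst (pcat p q) = fst p" "snd (pcat p q) = snd p @ snd q"
  by (simp_all add: pcat_def)

lemma ptake_simps [simp]: "fst (ptake i w) = fst w" "snd (ptake i w) = take i (snd w)"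
  by (simp_all add: ptake_def)

lemma pdrop_simps [simp]: "fst (pdrop i w) = trm (ptake i w)" "snd (pdrop i w) = drop i (snd w)"
  by (simp_all add: pdrop_def)

lemma paths_iff: "p \<in> paths Q \<longleftrightarrow> Q.awalk (fst p) (snd p) (trm p)"
  by (cases p) (auto simp: paths_def terminus_def)

lemma trm_Nil [simp]: "trm (u, []) = u"
  by (simp add: terminus_def)

lemma trm_append: "trm (u, as @ bs) = trm (trm (u, as), bs)"
  unfolding terminus_def
  by (induction as arbitrary: u) (auto simp: Q.awalk_verts_conv split: if_splits)

lemma paths_append: "(u, as @ bs) \<in> paths Q \<longleftrightarrow> (u, as) \<in> paths Q \<and> (trm (u, as), bs) \<in> paths Q"
  unfolding paths_iff by (simp add: trm_append) (auto simp: terminus_def Q.awalk_append_iff)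

lemma trm_pcat: "trm p = fst q \<Longrightarrow> trm (pcat p q) = trm q"
  by (cases p; cases q) (simp add: pcat_def trm_append)

lemma paths_pcat: "p \<in> paths Q \<Longrightarrow> q \<in> paths Q \<Longrightarrow> trm p = fst q \<Longrightarrow> pcat p q \<in> paths Q"
  by (cases p; cases q) (simp add: pcat_def paths_append)

lemma ptake_paths: "w \<in> paths Q \<Longrightarrow> ptake i w \<in> paths Q"
  and pdrop_paths: "w \<in> paths Q \<Longrightarrow> pdrop i w \<in> paths Q"
  using paths_append[of "fst w" "take i (snd w)" "drop i (snd w)"] by (simp_all add: ptake_def pdrop_def)

lemma trm_pdrop [simp]: "trm (pdrop i w) = trm w"
  using trm_append[of "fst w" "take i (snd w)" "drop i (snd w)"] by (simp add: ptake_def pdrop_def)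

lemma vertex_paths: "w \<in> paths Q \<Longrightarrow> (fst w, []) \<in> paths Q" "w \<in> paths Q \<Longrightarrow> (trm w, []) \<in> paths Q"
  unfolding paths_iff by (auto simp: Q.awalk_Nil_iff Q.awalk_hd_in_verts Q.awalk_last_in_verts)

lemma finite_paths: "finite {p \<in> paths Q. path_length p \<le> N}"
proof -
  have "{p \<in> paths Q. path_length p \<le> N} \<subseteq> verts Q \<times> {as. set as \<subseteq> arcs Q \<and> length as \<le> N}"
    by (auto simp: paths_def Q.awalk_def)
  thus ?thesis
    using finite_subset finite_lists_length_le[OF Q.finite_arcs] Q.finite_verts by blast
qed

definition short_paths where "short_paths = {p \<in> paths Q. path_length p < n}"
definition trivial_paths where "trivial_paths = {p \<in> paths Q. path_length p = 0}"

lemma finite_short_paths: "finite short_paths"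
  by (rule finite_subset[OF _ finite_paths[of n]]) (auto simp: short_paths_def)

lemma finite_trivial_paths: "finite trivial_paths" "trivial_paths \<subseteq> short_paths"
proof -
  show "trivial_paths \<subseteq> short_paths" using n2 by (auto simp: short_paths_def trivial_paths_def)
  thus "finite trivial_paths" using finite_short_paths by (rule finite_subset)
qed

sublocale PQ: conv_basis K "paths Q" trivial_paths
  "\<lambda>p q. if terminus Q p = origin q then Some (origin p, snd p @ snd q) else None"
proof
  fix x assume x: "x \<in> paths Q"
  show "\<exists>e\<in>trivial_paths. (if trm e = fst x then Some (fst e, snd e @ snd x) else None) = Some x \<and>
      (\<forall>e'\<in>trivial_paths. e' \<noteq> e \<longrightarrow> (if trm e' = fst x then Some (fst e', snd e' @ snd x) else None) = None)"
    by (rule bexI[of _ "(fst x, [])"]) (use vertex_paths[OF x] in \<open>auto simp: trivial_paths_def\<close>)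
  show "\<exists>e\<in>trivial_paths. (if trm x = fst e then Some (fst x, snd x @ snd e) else None) = Some x \<and>
      (\<forall>e'\<in>trivial_paths. e' \<noteq> e \<longrightarrow> (if trm x = fst e' then Some (fst x, snd x @ snd e') else None) = None)"
    by (rule bexI[of _ "(trm x, [])"]) (use vertex_paths[OF x] in \<open>auto simp: trivial_paths_def\<close>)
next
  fix x y z assume "x \<in> paths Q" "y \<in> paths Q" "(if trm x = fst y then Some (fst x, snd x @ snd y) else None) = Some z"
  thus "z \<in> paths Q" using paths_pcat[of x y] by (auto simp: pcat_def split: if_splits)
next
  fix x y z :: "'v \<times> 'e list"
  show "Option.bind (if trm x = fst y then Some (fst x, snd x @ snd y) else None)
        (\<lambda>u. if trm u = fst z then Some (fst u, snd u @ snd z) else None) =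
      Option.bind (if trm y = fst z then Some (fst y, snd y @ snd z) else None)
        (\<lambda>v. if trm x = fst v then Some (fst x, snd x @ snd v) else None)"
    using trm_pcat[of x y] by (auto simp: pcat_def)
qed (use finite_trivial_paths in \<open>auto simp: trivial_paths_def\<close>)

sublocale PA: kalgebra K PQ.C by (rule PQ.C_algebra)

lemma path_algebra_eq: "path_algebra K Q = PQ.C"
  unfolding path_algebra_def PQ.C_def unfolding trivial_paths_def by (rule refl)

section \<open>The truncation ideal and coordinates on the quotient\<close>

definition I where "I = {f \<in> finsupp K (paths Q). \<forall>p. path_length p < n \<longrightarrow> f p = \<zero>\<^bsub>K\<^esub>}"

abbreviation A where "A \<equiv> truncated_quiver_algebra K Q n"

lemma I_ideal: "ideal I PQ.C"
proof (rule idealI)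
  have sub: "submod K I PQ.C"
    using PQ.CM.M.a_closed PQ.CM.lsmult_closed PQ.CM.M.zero_closed
    by (auto simp: submod_def I_def)
  show "subgroup I (add_monoid PQ.C)"
    by (rule additive_subgroup.a_subgroup, rule abelian_subgroup.axioms(1),
        rule PQ.CM.submod_abelian_subgroup[OF sub])
next
  fix f h assume f: "f \<in> I" and h: "h \<in> carrier PQ.C"
  hence c: "h \<otimes>\<^bsub>PQ.C\<^esub> f \<in> finsupp K (paths Q)" "f \<otimes>\<^bsub>PQ.C\<^esub> h \<in> finsupp K (paths Q)"
    using PQ.mult_closed by (auto simp: I_def)
  have z: "f p = \<zero>\<^bsub>K\<^esub>" if "path_length p < n" for p using f that by (simp add: I_def)
  have hc: "h p \<in> carrier K" "f p \<in> carrier K" for p using h f by (auto simp: finsupp_def I_def)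
  have sup: "finite {p. f p \<noteq> \<zero>\<^bsub>K\<^esub>}" "finite {p. h p \<noteq> \<zero>\<^bsub>K\<^esub>}" using f h by (auto simp: finsupp_def I_def)
  have fh: "f \<in> finsupp K (paths Q)" "h \<in> finsupp K (paths Q)" using f h by (auto simp: I_def)
  \<comment> \<open>A factor of a path of length below \<open>n\<close> has length below
    \<open>n\<close> too, so each term of the sum contains a vanishing coefficient of
    \<open>f\<close>.\<close>
  have "(h \<otimes>\<^bsub>PQ.C\<^esub> f) p = \<zero>\<^bsub>K\<^esub>" if "path_length p < n" for p
    unfolding PQ.mult_superset[OF fh(2,1) sup(2) subset_refl sup(1) subset_refl]
    by (rule K.add.finprod_one_eqI) (use that z hc in \<open>auto split: if_splits\<close>)
  thus "h \<otimes>\<^bsub>PQ.C\<^esub> f \<in> I" using c by (simp add: I_def)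
  have "(f \<otimes>\<^bsub>PQ.C\<^esub> h) p = \<zero>\<^bsub>K\<^esub>" if "path_length p < n" for p
    unfolding PQ.mult_superset[OF fh sup(1) subset_refl sup(2) subset_refl]
    by (rule K.add.finprod_one_eqI) (use that z hc in \<open>auto split: if_splits\<close>)
  thus "f \<otimes>\<^bsub>PQ.C\<^esub> h \<in> I" using c by (simp add: I_def)
qed (rule PA.A.ring_axioms)

text \<open>An abstractly generated ideal is replaced by a condition on coefficients. For the harder
  inclusion, an element of \<open>I\<close> is a finite combination of the generating long paths
  themselves.\<close>

lemma genideal_eq: "genideal PQ.C (basis_elt K ` {p \<in> paths Q. path_length p \<ge> n}) = I" (is "genideal _ ?G = I")
proof
  have G: "?G \<subseteq> carrier PQ.C" using PQ.basis_closed by auto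
  have "?G \<subseteq> I" using PQ.basis_closed by (auto simp: I_def basis_elt_def)
  thus "genideal PQ.C ?G \<subseteq> I" by (rule PA.A.genideal_minimal[OF I_ideal])
  have J: "submod K (genideal PQ.C ?G) PQ.C" by (rule PA.ideal_submod[OF PA.A.genideal_ideal[OF G]])
  show "I \<subseteq> genideal PQ.C ?G"
  proof
    fix f assume f: "f \<in> I"
    have "f \<in> finsupp K {p \<in> paths Q. path_length p \<ge> n}" using f by (auto simp: I_def finsupp_def)
    thus "f \<in> genideal PQ.C ?G"
    proof (induction rule: K.finsupp_induct)
      case zero
      thus ?case using submodD(2)[OF J] by simp
    next
      case (add f h)
      thus ?case using submodD(3)[OF J, of f h] by simp
    next
      case (basis c p)
      hence "basis_elt K p \<in> genideal PQ.C ?G" using PA.A.genideal_self[OF G] by blast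
      thus ?case using submodD(4)[OF J basis(1)] by simp
    qed
  qed
qed

lemma A_eq: "A = quot PQ.C I"
  unfolding truncated_quiver_algebra_def path_algebra_eq genideal_eq by (rule refl)

lemmas A_facts = PQ.CM.quot_facts[OF PA.ideal_submod[OF I_ideal], folded A_eq]
lemmas A_algebra = PA.quot_algebra[OF I_ideal, folded A_eq]

definition path_elt where "path_elt p = I +>\<^bsub>PQ.C\<^esub> basis_elt K p"
definition tr where "tr f = (\<lambda>p. if p \<in> short_paths then f p else \<zero>\<^bsub>K\<^esub>)"
definition co where "co a = tr (SOME f. f \<in> a)"
definition pm where "pm p q = (if trm p = fst q \<and> path_length p + path_length q < n then Some (pcat p q) else None)"

text \<open>Two representatives differ by an element of \<open>I\<close>, which has no coefficients
  at short paths; hence the choice inside \<open>co\<close> is immaterial.\<close>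

lemma co_coset: assumes f: "f \<in> carrier PQ.C" shows "co (I +>\<^bsub>PQ.C\<^esub> f) = tr f"
proof -
  let ?h = "SOME h. h \<in> I +>\<^bsub>PQ.C\<^esub> f"
  have "f \<in> I +>\<^bsub>PQ.C\<^esub> f" using A_facts(8)[OF f, of f] f by simp
  hence "?h \<in> I +>\<^bsub>PQ.C\<^esub> f" by (rule someI[of "\<lambda>h. h \<in> I +>\<^bsub>PQ.C\<^esub> f"])
  hence h: "?h \<in> carrier PQ.C" "I +>\<^bsub>PQ.C\<^esub> ?h = I +>\<^bsub>PQ.C\<^esub> f" using A_facts(8)[OF f, of ?h] by blast+
  hence d: "?h \<ominus>\<^bsub>PQ.C\<^esub> f \<in> I" using A_facts(6)[OF h(1) f] by blast
  have X: "(?h \<ominus>\<^bsub>PQ.C\<^esub> f) \<oplus>\<^bsub>PQ.C\<^esub> f = ?h" by (rule PQ.CM.M.minus_plus[OF h(1) f])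
  have e: "?h p = (?h \<ominus>\<^bsub>PQ.C\<^esub> f) p \<oplus>\<^bsub>K\<^esub> f p" for p using fun_cong[OF X[unfolded PQ.C_simps(3)], of p] by (rule sym)
  have "?h p = f p" if "path_length p < n" for p
  proof -
    have "(?h \<ominus>\<^bsub>PQ.C\<^esub> f) p = \<zero>\<^bsub>K\<^esub>" using d that by (simp add: I_def)
    moreover have "f p \<in> carrier K" using f by (simp add: finsupp_def)
    ultimately show ?thesis using e[of p] by simp
  qed
  thus ?thesis by (auto simp: co_def tr_def short_paths_def fun_eq_iff)
qed

lemma tr_closed: "f \<in> carrier PQ.C \<Longrightarrow> tr f \<in> finsupp K short_paths"
proof -
  assume f: "f \<in> carrier PQ.C"
  have "finite {p. tr f p \<noteq> \<zero>\<^bsub>K\<^esub>}" by (rule finite_subset[OF _ finite_short_paths]) (auto simp: tr_def)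
  thus ?thesis using f by (auto simp: finsupp_def tr_def)
qed

lemma short_paths_subset: "finsupp K short_paths \<subseteq> carrier PQ.C"
  by (auto simp: finsupp_def short_paths_def)

lemma A_algebra': "kalgebra K A" by (rule A_algebra(1))

lemma A_env: "env_algebra K A"
  by (rule env_algebra.intro[OF A_algebra'])

lemma A_coset: "a \<in> carrier A \<Longrightarrow> \<exists>f\<in>carrier PQ.C. a = I +>\<^bsub>PQ.C\<^esub> f"
  by (simp only: A_facts(2) image_iff)

lemma based: "based_algebra K A short_paths trivial_paths pm path_elt co"
proof (intro based_algebra.intro based_algebra_axioms.intro A_env finite_short_paths finite_trivial_paths)
  interpret AA: kalgebra K A by (rule A_algebra')
  show "r \<in> short_paths" if "p \<in> short_paths" "q \<in> short_paths" "pm p q = Some r" for p q r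
    using that paths_pcat[of p q] by (auto simp: pm_def short_paths_def split: if_splits)
  have bc: "basis_elt K p \<in> carrier PQ.C" if "p \<in> paths Q" for p using PQ.basis_closed[OF that] by simp
  show "path_elt p \<in> carrier A" if "p \<in> short_paths" for p
    unfolding A_facts(2) path_elt_def by (rule imageI[OF bc]) (use that in \<open>simp add: short_paths_def\<close>)
  show "bij_betw co (carrier A) (finsupp K short_paths)"
    unfolding bij_betw_def
  proof
    show "inj_on co (carrier A)"
    proof (rule inj_onI)
      fix a b assume ab: "a \<in> carrier A" "b \<in> carrier A" and eq: "co a = co b"
      obtain f where f: "f \<in> carrier PQ.C" "a = I +>\<^bsub>PQ.C\<^esub> f" by (rule bexE[OF A_coset[OF ab(1)]])
      obtain h where h: "h \<in> carrier PQ.C" "b = I +>\<^bsub>PQ.C\<^esub> h" by (rule bexE[OF A_coset[OF ab(2)]])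
      have trE: "tr f = tr h" using eq co_coset[OF f(1)] co_coset[OF h(1)] unfolding f(2) h(2) by simp
      have e: "f p = h p" if "p \<in> short_paths" for p using fun_cong[OF trE, of p] that by (simp add: tr_def)
      have dc: "f \<ominus>\<^bsub>PQ.C\<^esub> h \<in> carrier PQ.C" using f h by (intro PQ.CM.M.minus_closed)
      have "(f \<ominus>\<^bsub>PQ.C\<^esub> h) p = \<zero>\<^bsub>K\<^esub>" if p: "path_length p < n" for p
      proof (cases "p \<in> paths Q")
        case True
        have X: "(f \<ominus>\<^bsub>PQ.C\<^esub> h) \<oplus>\<^bsub>PQ.C\<^esub> h = f" by (rule PQ.CM.M.minus_plus[OF f(1) h(1)])
        have "(f \<ominus>\<^bsub>PQ.C\<^esub> h) p \<oplus>\<^bsub>K\<^esub> h p = f p" using fun_cong[OF X[unfolded PQ.C_simps(3)], of p] .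
        moreover have "f p = h p" using e True p by (simp add: short_paths_def)
        moreover have "(f \<ominus>\<^bsub>PQ.C\<^esub> h) p \<in> carrier K" "h p \<in> carrier K" using dc h by (auto simp: finsupp_def)
        ultimately show ?thesis by simp
      next
        case False
        thus ?thesis using dc by (simp add: finsupp_def)
      qed
      hence "f \<ominus>\<^bsub>PQ.C\<^esub> h \<in> I" using dc by (simp add: I_def)
      thus "a = b" using A_facts(6)[OF f(1) h(1)] f h by simp
    qed
    show "co ` carrier A = finsupp K short_paths"
    proof (intro equalityI subsetI)
      fix f assume "f \<in> co ` carrier A"
      then obtain a where a: "a \<in> carrier A" "f = co a" by (rule imageE)
      obtain h where h': "h \<in> carrier PQ.C" "a = I +>\<^bsub>PQ.C\<^esub> h" by (rule bexE[OF A_coset[OF a(1)]])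
      show "f \<in> finsupp K short_paths" unfolding a(2) h'(2) co_coset[OF h'(1)] by (rule tr_closed[OF h'(1)])
    next
      fix f assume f: "f \<in> finsupp K short_paths"
      hence fC: "f \<in> carrier PQ.C" using short_paths_subset by blast
      have "f p = tr f p" for p using f by (simp add: tr_def finsupp_def)
      hence "f = tr f" by (rule ext)
      also have "\<dots> = co (I +>\<^bsub>PQ.C\<^esub> f)" by (rule co_coset[OF fC, symmetric])
      finally show "f \<in> co ` carrier A"
        by (rule image_eqI) (unfold A_facts(2), rule imageI[OF fC])
    qed
  qed
  show "co (a \<oplus>\<^bsub>A\<^esub> b) = (\<lambda>p. co a p \<oplus>\<^bsub>K\<^esub> co b p)" if ab: "a \<in> carrier A" "b \<in> carrier A" for a b
  proof -
    obtain f where f: "f \<in> carrier PQ.C" "a = I +>\<^bsub>PQ.C\<^esub> f" by (rule bexE[OF A_coset[OF ab(1)]])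
    obtain h where h: "h \<in> carrier PQ.C" "b = I +>\<^bsub>PQ.C\<^esub> h" by (rule bexE[OF A_coset[OF ab(2)]])
    have "co (a \<oplus>\<^bsub>A\<^esub> b) = tr (f \<oplus>\<^bsub>PQ.C\<^esub> h)"
      unfolding f(2) h(2) A_facts(3)[OF f(1) h(1)] by (rule co_coset[OF PQ.CM.M.a_closed[OF f(1) h(1)]])
    also have "\<dots> = (\<lambda>p. tr f p \<oplus>\<^bsub>K\<^esub> tr h p)" by (auto simp: tr_def)
    finally show ?thesis unfolding f(2) h(2) co_coset[OF f(1)] co_coset[OF h(1)] .
  qed
  show "co (c \<odot>\<^bsub>A\<^esub> a) = (\<lambda>p. c \<otimes>\<^bsub>K\<^esub> co a p)" if ca: "c \<in> carrier K" "a \<in> carrier A" for c a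
  proof -
    obtain f where f: "f \<in> carrier PQ.C" "a = I +>\<^bsub>PQ.C\<^esub> f" by (rule bexE[OF A_coset[OF ca(2)]])
    have "co (c \<odot>\<^bsub>A\<^esub> a) = tr (c \<odot>\<^bsub>PQ.C\<^esub> f)"
      unfolding f(2) A_facts(4)[OF ca(1) f(1)] by (rule co_coset[OF PQ.CM.lsmult_closed[OF ca(1) f(1)]])
    also have "\<dots> = (\<lambda>p. c \<otimes>\<^bsub>K\<^esub> tr f p)" using ca(1) by (auto simp: tr_def)
    finally show ?thesis unfolding f(2) co_coset[OF f(1)] .
  qed
  show "co (path_elt p) = basis_elt K p" if "p \<in> short_paths" for p
  proof -
    have "co (path_elt p) = tr (basis_elt K p)" unfolding path_elt_def by (rule co_coset[OF bc]) (use that in \<open>simp add: short_paths_def\<close>)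
    also have "\<dots> = basis_elt K p" using that by (auto simp: tr_def basis_elt_def)
    finally show ?thesis .
  qed
  show "path_elt p \<otimes>\<^bsub>A\<^esub> path_elt q = (case pm p q of None \<Rightarrow> \<zero>\<^bsub>A\<^esub> | Some r \<Rightarrow> path_elt r)" if "p \<in> short_paths" "q \<in> short_paths" for p q
  proof -
    have pq: "p \<in> paths Q" "q \<in> paths Q" using that by (auto simp: short_paths_def)
    have "path_elt p \<otimes>\<^bsub>A\<^esub> path_elt q = I +>\<^bsub>PQ.C\<^esub> (basis_elt K p \<otimes>\<^bsub>PQ.C\<^esub> basis_elt K q)"
      unfolding path_elt_def by (rule A_algebra(3)[OF bc[OF pq(1)] bc[OF pq(2)]])
    also have "\<dots> = (case pm p q of None \<Rightarrow> \<zero>\<^bsub>A\<^esub> | Some r \<Rightarrow> path_elt r)"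
    proof (cases "trm p = fst q")
      case True
      have e: "basis_elt K p \<otimes>\<^bsub>PQ.C\<^esub> basis_elt K q = basis_elt K (pcat p q)"
        using True by (simp add: PQ.mult_basis[OF pq] pcat_def)
      have c: "pcat p q \<in> paths Q" using paths_pcat pq True by blast
      show ?thesis
      proof (cases "path_length p + path_length q < n")
        case False
        hence "basis_elt K (pcat p q) \<in> I" using PQ.basis_closed[OF c] by (auto simp: I_def basis_elt_def)
        thus ?thesis using False A_facts(7)[OF bc[OF c]] by (simp add: e pm_def A_facts(5))
      qed (use True in \<open>simp add: e pm_def path_elt_def\<close>)
    next
      case False
      have "I +>\<^bsub>PQ.C\<^esub> \<zero>\<^bsub>PQ.C\<^esub> = I"
        using A_facts(7)[OF PQ.CM.M.zero_closed] submodD(2)[OF PA.ideal_submod[OF I_ideal]] by simp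
      thus ?thesis using False by (simp add: PQ.mult_basis[OF pq] pm_def A_facts(5))
    qed
    finally show ?thesis .
  qed
  have "co \<one>\<^bsub>A\<^esub> = tr \<one>\<^bsub>PQ.C\<^esub>" unfolding A_algebra(2) by (rule co_coset) (rule PA.A.one_closed)
  also have "\<dots> = (\<lambda>p. if p \<in> trivial_paths then \<one>\<^bsub>K\<^esub> else \<zero>\<^bsub>K\<^esub>)"
    using finite_trivial_paths(2) by (auto simp: tr_def fun_eq_iff)
  finally show "co \<one>\<^bsub>A\<^esub> = (\<lambda>p. if p \<in> trivial_paths then \<one>\<^bsub>K\<^esub> else \<zero>\<^bsub>K\<^esub>)" .
qed

sublocale BA: based_algebra K A short_paths trivial_paths pm path_elt co by (rule based)

section \<open>The bimodules of the Bardzell resolution\<close>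

definition gen_length :: "nat \<Rightarrow> nat" where "gen_length m = n * (m div 2) + m mod 2"

text \<open>The basis element \<open>\<alpha> \<otimes> \<gamma> \<otimes> \<beta>\<close> is encoded by the length of \<open>\<alpha>\<close> and the path \<open>\<alpha> \<gamma> \<beta>\<close>.\<close>

definition res_basis :: "nat \<Rightarrow> (nat \<times> 'v \<times> 'e list) set" where
  "res_basis m = {(s, w). w \<in> paths Q \<and> s < n \<and> gen_length m + s \<le> path_length w \<and> path_length w < gen_length m + s + n}"

definition res_gens where "res_gens m = {w \<in> paths Q. path_length w = gen_length m}"

text \<open>For \<open>\<alpha> \<otimes> \<gamma> \<otimes> \<beta>\<close> with
  \<open>\<alpha>\<close> of length \<open>s\<close>, the two bounds say that neither
  \<open>p \<alpha>\<close> nor \<open>\<beta> q\<close> reaches length \<open>n\<close>, that is,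
  neither vanishes in the truncated algebra.\<close>

definition pct where
  "pct m p y q = (case y of (s, w) \<Rightarrow>
     if trm p = fst w \<and> trm w = fst q \<and> path_length p + s < n \<and> path_length w + path_length q < gen_length m + s + n
     then Some (path_length p + s, pcat p (pcat w q)) else None)"

definition lft where "lft y = ptake (fst y) (snd y)"
definition rgt where "rgt m y = pdrop (fst y + gen_length m) (snd y)"
definition mid where "mid m y = ptake (gen_length m) (pdrop (fst y) (snd y))"

lemma finite_res_basis: "finite (res_basis m)"
proof -
  have "res_basis m \<subseteq> {..<n} \<times> {w \<in> paths Q. path_length w \<le> gen_length m + 2 * n}" by (auto simp: res_basis_def)
  thus ?thesis using finite_subset finite_paths by blast
qed

lemma ptake_pcat: "trm p = fst q \<Longrightarrow> trm (fst p, snd p @ take j (snd q)) = trm (ptake j q)"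
  by (simp add: trm_append ptake_def)

lemma path_eqI: "fst p = fst q \<Longrightarrow> snd p = snd q \<Longrightarrow> p = q"
  by (simp add: prod_eq_iff)

text \<open>Multiplication from outside lengthens the word and shifts the left cut by the length of
  \<open>p\<close>, leaving the middle piece as it was. The three pieces determine the pair, as the
  word is their concatenation and the cut is the length of the first.\<close>

lemma res_basis_bimodule:
  "based_bimodule K A short_paths trivial_paths pm path_elt co (res_basis m) (pct m) (res_gens m) (\<lambda>w. (0, w)) (\<lambda>w. (fst w, [])) (\<lambda>w. (trm w, []))
    lft (rgt m) (mid m)"
proof (intro based_bimodule.intro based_bimodule_axioms.intro based finite_res_basis)
  show "z \<in> res_basis m" if h: "p \<in> short_paths" "y \<in> res_basis m" "q \<in> short_paths" "pct m p y q = Some z" for p y q z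
  proof -
    obtain s w where y: "y = (s, w)" by (cases y)
    have "trm p = fst w" "trm w = fst q" "p \<in> paths Q" "q \<in> paths Q" "w \<in> paths Q"
      using h y by (auto simp: pct_def short_paths_def res_basis_def split: if_splits)
    hence "pcat p (pcat w q) \<in> paths Q" using paths_pcat[of w q] paths_pcat[of p "pcat w q"] by simp
    thus ?thesis using h y by (auto simp: pct_def res_basis_def split: if_splits)
  qed
  show "pm p (lft y) = None \<or> pm (rgt m y) q = None"
    if "p \<in> short_paths" "y \<in> res_basis m" "q \<in> short_paths" "pct m p y q = None" for p y q
    using that by (auto simp: pct_def pm_def lft_def rgt_def res_basis_def split: if_splits)
  show "pm p (lft y) = Some (lft z) \<and> pm (rgt m y) q = Some (rgt m z) \<and> mid m z = mid m y"
    if h: "p \<in> short_paths" "y \<in> res_basis m" "q \<in> short_paths" "pct m p y q = Some z" for p y q z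
  proof -
    obtain s w where y: "y = (s, w)" by (cases y)
    have z: "trm p = fst w" "trm w = fst q" "path_length p + s < n" "path_length w + path_length q < gen_length m + s + n"
      "z = (path_length p + s, pcat p (pcat w q))"
      using h(4) by (auto simp: pct_def y split: if_splits)
    have b: "gen_length m + s \<le> path_length w" "s < n" using h(2) by (auto simp: res_basis_def y)
    \<comment> \<open>Prefixing \<open>p\<close> shifts a cut inside \<open>w\<close> but not the
      vertex it passes through; the pieces starting at that cut keep their origin.\<close>
    have t: "trm (ptake (path_length p + j) (pcat p (pcat w q))) = trm (ptake j w)" if "j \<le> path_length w" for j
      using that z(1) ptake_pcat[of p w j] by (simp add: ptake_def[of _ "pcat _ _"])
    have "lft z = pcat p (lft y)" by (rule path_eqI) (use b in \<open>simp_all add: lft_def z y\<close>)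
    moreover have "rgt m z = pcat (rgt m y) q"
      by (rule path_eqI) (use b t[of "s + gen_length m"] in \<open>simp_all add: rgt_def z y add.assoc\<close>)
    moreover have "mid m z = mid m y"
      by (rule path_eqI) (use b t[of s] in \<open>simp_all add: mid_def z y\<close>)
    ultimately show ?thesis using z b by (simp add: pm_def lft_def rgt_def y)
  qed
  show "y = z" if h: "y \<in> res_basis m" "z \<in> res_basis m" "lft y = lft z" "rgt m y = rgt m z" "mid m y = mid m z" for y z
  proof -
    have dec: "snd (snd y) = snd (lft y) @ snd (mid m y) @ snd (rgt m y)" "fst (snd y) = fst (lft y)"
      "fst y = length (snd (lft y))" if "y \<in> res_basis m" for y
    proof -
      show "fst (snd y) = fst (lft y)" "fst y = length (snd (lft y))" using that by (auto simp: lft_def res_basis_def)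
      have "snd (snd y) = take (fst y) (snd (snd y)) @ drop (fst y) (snd (snd y))" by simp
      also have "drop (fst y) (snd (snd y)) = take (gen_length m) (drop (fst y) (snd (snd y))) @ drop (gen_length m) (drop (fst y) (snd (snd y)))"
        by (simp only: append_take_drop_id)
      finally show "snd (snd y) = snd (lft y) @ snd (mid m y) @ snd (rgt m y)"
        by (simp add: lft_def mid_def rgt_def add.commute)
    qed
    show ?thesis by (intro prod_eqI) (use dec[OF h(1)] dec[OF h(2)] h in simp_all)
  qed
  show "lft y \<in> short_paths \<and> rgt m y \<in> short_paths \<and> mid m y \<in> res_gens m" if "y \<in> res_basis m" for y
    using that by (auto simp: lft_def rgt_def mid_def short_paths_def res_gens_def res_basis_def ptake_paths pdrop_paths)
  show "(0, \<gamma>) \<in> res_basis m \<and> lft (0, \<gamma>) = (fst \<gamma>, []) \<and> rgt m (0, \<gamma>) = (trm \<gamma>, []) \<and> mid m (0, \<gamma>) = \<gamma>"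
    if "\<gamma> \<in> res_gens m" for \<gamma>
    using that n2 by (cases \<gamma>) (auto simp: res_basis_def res_gens_def lft_def rgt_def mid_def ptake_def pdrop_def)
  show "pm (lft y) (fst (mid m y), []) = Some (lft y) \<and> pm (trm (mid m y), []) (rgt m y) = Some (rgt m y)"
    if "y \<in> res_basis m" for y
  proof -
    obtain s w where y: "y = (s, w)" by (cases y)
    have "trm (mid m y) = fst (rgt m y)"
      using trm_append[of "fst w" "take s (snd w)" "take (gen_length m) (drop s (snd w))"]
      by (simp add: mid_def rgt_def y ptake_def pdrop_def take_add)
    thus ?thesis using that by (auto simp: pm_def res_basis_def lft_def rgt_def mid_def y pcat_def prod_eq_iff)
  qed
  show "Option.bind (pm p q) (\<lambda>u. pm u r) = Option.bind (pm q r) (\<lambda>v. pm p v)" for p q r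
    using trm_pcat[of p q] by (auto simp: pm_def pcat_def)
  show "\<exists>e\<in>trivial_paths. \<exists>e'\<in>trivial_paths. pm e p = Some p \<and> pm p e' = Some p \<and>
      (\<forall>f\<in>trivial_paths. f \<noteq> e \<longrightarrow> pm f p = None) \<and> (\<forall>f\<in>trivial_paths. f \<noteq> e' \<longrightarrow> pm p f = None)" if p: "p \<in> short_paths" for p
    by (rule bexI[of _ "(fst p, [])"], rule bexI[of _ "(trm p, [])"])
      (use p vertex_paths[of p] in \<open>auto simp: pm_def trivial_paths_def short_paths_def pcat_def prod_eq_iff\<close>)
qed

end

text \<open>Partial sums undo backward differences up to sign, with zero in place of the missing
  term before position 0. This is what makes \<open>diff_coeff_diff_coeff_odd\<close> and
  \<open>aug_diff_coeff\<close> work.\<close>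

lemma (in ring) finsum_telescope:
  fixes x :: "nat \<Rightarrow> 'a"
  assumes x: "\<And>s. x s \<in> carrier R"
  shows "(\<Oplus>s\<in>{..t}. (if s = 0 then \<zero> else x (s - 1)) \<ominus> x s) = \<ominus> x t"
proof (induction t)
  case 0
  thus ?case using x by (simp add: a_minus_def)
next
  case (Suc t)
  have "(\<Oplus>s\<in>{..Suc t}. (if s = 0 then \<zero> else x (s - 1)) \<ominus> x s) =
      (x t \<ominus> x (Suc t)) \<oplus> (\<Oplus>s\<in>{..t}. (if s = 0 then \<zero> else x (s - 1)) \<ominus> x s)"
    unfolding atMost_Suc using x by (subst finsum_insert) auto
  also have "\<dots> = (x t \<ominus> x (Suc t)) \<oplus> \<ominus> x t" using Suc by simp
  also have "\<dots> = \<ominus> x (Suc t)" using x by (simp add: a_minus_def a_ac r_neg1 r_neg2)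
  finally show ?case .
qed

context truncated_quiver begin

sublocale BB: based_bimodule K A short_paths trivial_paths pm path_elt co "res_basis m" "pct m" "res_gens m" "\<lambda>w. (0, w)"
  "\<lambda>w. (fst w, [])" "\<lambda>w. (trm w, [])" lft "rgt m" "mid m" for m
  by (rule res_basis_bimodule)

abbreviation Env where "Env \<equiv> enveloping K A"

section \<open>The Bardzell differential\<close>

lemma res_basis_iff: "(s, w) \<in> res_basis m \<longleftrightarrow>
    w \<in> paths Q \<and> s < n \<and> gen_length m + s \<le> path_length w \<and> path_length w < gen_length m + s + n"
  by (simp add: res_basis_def)

lemma gen_length_even: "even m \<Longrightarrow> gen_length (Suc m) = gen_length m + 1"
  by (auto simp: gen_length_def elim!: evenE)

lemma gen_length_odd: "odd m \<Longrightarrow> gen_length (Suc m) = gen_length m + n - 1"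
  using n2 by (auto simp: gen_length_def elim!: oddE)

text \<open>As long as the middle piece fits into the word, a pair outside \<open>res_basis\<close>
  has an outer factor of length at least \<open>n\<close>, and zero is then the correct value of the
  tensor.\<close>

definition basis_vec :: "nat \<Rightarrow> nat \<times> 'v \<times> 'e list \<Rightarrow> (nat \<times> 'v \<times> 'e list \<Rightarrow> 'k)" where
  "basis_vec m y = (if y \<in> res_basis m then basis_elt K y else (\<lambda>_. \<zero>\<^bsub>K\<^esub>))"

lemma basis_vec_closed: "basis_vec m y \<in> carrier (BB.V m)"
  using BB.basisV[of y m] left_module.axioms(2)[OF BB.V_module[of m]]
  by (auto simp: basis_vec_def BB.carV finsupp_def)

lemma basis_vec_apply: "basis_vec m y z = (if z = y \<and> y \<in> res_basis m then \<one>\<^bsub>K\<^esub> else \<zero>\<^bsub>K\<^esub>)"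
  by (simp add: basis_vec_def basis_elt_def)

text \<open>The bound \<open>le\<close> ensures that the middle piece fits, so that a zero vector
  can only come from an outer factor that is too long; multiplying by \<open>p\<close> and
  \<open>q\<close> leaves it too long.\<close>

lemma act_basis_vec:
  assumes p: "p \<in> short_paths" and q: "q \<in> short_paths" and w: "w \<in> paths Q" and le: "gen_length m + t \<le> path_length w"
    and c: "trm p = fst w" "trm w = fst q"
  shows "BB.act m (path_elt p) (basis_vec m (t, w)) (path_elt q) = basis_vec m (path_length p + t, pcat p (pcat w q))"
proof (cases "(t, w) \<in> res_basis m")
  case True
  have periodic_walk: "pcat p (pcat w q) \<in> paths Q"
    using paths_pcat[of w q] paths_pcat[of p "pcat w q"] p q w c by (simp add: short_paths_def)
  have "BB.act m (path_elt p) (basis_vec m (t, w)) (path_elt q) = BB.ob m (pct m p (t, w) q)"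
    using BB.act_basis[OF p True q] True by (simp add: basis_vec_def)
  also have "\<dots> = basis_vec m (path_length p + t, pcat p (pcat w q))"
    using c periodic_walk le by (auto simp: BB.ob_def pct_def basis_vec_def res_basis_iff BB.opsV)
  finally show ?thesis .
next
  case False
  have "(path_length p + t, pcat p (pcat w q)) \<notin> res_basis m" using False w le by (auto simp: res_basis_iff)
  moreover have "BB.act m (path_elt p) \<zero>\<^bsub>BB.V m\<^esub> (path_elt q) = \<zero>\<^bsub>BB.V m\<^esub>"
    by (rule BB.act_zeros(2)[OF BA.path_elt_closed[OF p] BA.path_elt_closed[OF q]])
  ultimately show ?thesis using False by (simp add: basis_vec_def BB.opsV)
qed

text \<open>Bardzell's formulas. Into an even degree a path
  \<open>\<gamma> = a \<gamma>' = \<gamma>'' b\<close> goes to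
  \<open>a \<otimes> \<gamma>' - \<gamma>'' \<otimes> b\<close>, which are the positions 1 and 0 of
  the shorter generator. Into an odd degree the generator is shorter by \<open>n - 1\<close> arrows,
  and the sum runs over its \<open>n\<close> positions.\<close>

definition gen_diff where
  "gen_diff m y = (if even m then basis_vec m (Suc (fst y), snd y) \<ominus>\<^bsub>BB.V m\<^esub> basis_vec m y
     else finsum (BB.V m) (\<lambda>j. basis_vec m (fst y + j, snd y)) {..<n})"

lemma gen_diff_closed: "gen_diff m y \<in> carrier (BB.V m)"
proof -
  have "finsum (BB.V m) (\<lambda>j. basis_vec m (fst y + j, snd y)) {..<n} \<in> carrier (BB.V m)"
    by (rule BB.BM.N.M.finsum_closed) (simp add: basis_vec_closed)
  thus ?thesis unfolding gen_diff_def using basis_vec_closed BB.BM.N.M.minus_closed by simp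
qed

lemma act_hom:
  assumes "a \<in> carrier A" "b \<in> carrier A"
  shows "(\<lambda>x\<in>carrier (BB.V m). BB.act m b x a) \<in> lin_homs K (BB.V m) (BB.V m)"
  by (rule left_module.lin_homsI[OF BB.V_module])
    (use assms in \<open>simp_all add: BB.BM.act_closed BB.BM.act_add_m BB.BM.act_smult_m\<close>)

lemma act_gen_diff:
  assumes p: "p \<in> short_paths" and q: "q \<in> short_paths" and w: "w \<in> paths Q" and le: "gen_length (Suc m) + t \<le> path_length w"
    and c: "trm p = fst w" "trm w = fst q"
  shows "BB.act m (path_elt p) (gen_diff m (t, w)) (path_elt q) = gen_diff m (path_length p + t, pcat p (pcat w q))"
proof -
  let ?h = "\<lambda>x\<in>carrier (BB.V m). BB.act m (path_elt p) x (path_elt q)"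
  have h: "?h \<in> lin_homs K (BB.V m) (BB.V m)"
    by (rule act_hom[OF BA.path_elt_closed[OF q] BA.path_elt_closed[OF p]])
  have e: "?h (basis_vec m (s, w)) = basis_vec m (path_length p + s, pcat p (pcat w q))" if "gen_length m + s \<le> path_length w" for s
    using act_basis_vec[OF p q w that c] basis_vec_closed by simp
  have "?h (gen_diff m (t, w)) = gen_diff m (path_length p + t, pcat p (pcat w q))"
  proof (cases "even m")
    case True
    thus ?thesis using lin_homs_minus[OF BB.V_module BB.V_module h basis_vec_closed basis_vec_closed]
        e[of t] e[of "Suc t"] le by (simp add: gen_diff_def gen_length_even)
  next
    case False
    have "?h (finsum (BB.V m) (\<lambda>j. basis_vec m (t + j, w)) {..<n}) = finsum (BB.V m) (\<lambda>j. ?h (basis_vec m (t + j, w))) {..<n}"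
      by (rule lin_homs_finsum[OF BB.V_module BB.V_module h]) (simp_all add: basis_vec_closed)
    also have "\<dots> = finsum (BB.V m) (\<lambda>j. basis_vec m (path_length p + (t + j), pcat p (pcat w q))) {..<n}"
      by (rule BB.BM.N.M.finsum_cong') (use e le n2 False basis_vec_closed in \<open>auto simp: gen_length_odd\<close>)
    finally show ?thesis using False by (simp add: gen_diff_def add.assoc)
  qed
  thus ?thesis using gen_diff_closed by simp
qed

definition bardzell_diff where "bardzell_diff m = BB.from_gens (Suc m) (BB.P m) (\<lambda>\<gamma>. gen_diff m (0, \<gamma>))"

lemma bardzell_diff_hom: "bardzell_diff m \<in> lin_homs Env (BB.P (Suc m)) (BB.P m)"
  unfolding bardzell_diff_def by (rule BB.from_gens_hom[OF BB.P_module]) (use gen_diff_closed in simp)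

lemma res_basis_decomp:
  assumes y: "(s, w) \<in> res_basis m"
  shows "pcat (lft (s, w)) (pcat (mid m (s, w)) (rgt m (s, w))) = w" and "trm (lft (s, w)) = fst (mid m (s, w))"
    and "trm (mid m (s, w)) = fst (rgt m (s, w))" and "path_length (lft (s, w)) = s"
    and "lft (s, w) \<in> short_paths" "rgt m (s, w) \<in> short_paths" "mid m (s, w) \<in> paths Q" "path_length (mid m (s, w)) = gen_length m"
proof -
  show "lft (s, w) \<in> short_paths" "rgt m (s, w) \<in> short_paths" using BB.parts[OF y] by auto
  show "mid m (s, w) \<in> paths Q" "path_length (mid m (s, w)) = gen_length m" using BB.parts[OF y] by (auto simp: res_gens_def)
  show "trm (lft (s, w)) = fst (mid m (s, w))" by (simp add: lft_def mid_def)
  show "trm (mid m (s, w)) = fst (rgt m (s, w))"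
    using trm_append[of "fst w" "take s (snd w)" "take (gen_length m) (drop s (snd w))"]
    by (simp add: mid_def rgt_def ptake_def pdrop_def take_add)
  show "path_length (lft (s, w)) = s" using y by (simp add: lft_def res_basis_def)
  have "snd w = take s (snd w) @ take (gen_length m) (drop s (snd w)) @ drop (gen_length m) (drop s (snd w))"
    by (simp only: append_take_drop_id)
  thus "pcat (lft (s, w)) (pcat (mid m (s, w)) (rgt m (s, w))) = w"
    by (intro path_eqI) (simp_all add: lft_def mid_def rgt_def add.commute)
qed

text \<open>The differential is prescribed on generators, but shifting positions commutes with outer
  multiplication, so the same formula holds on every basis element.\<close>

lemma bardzell_diff_basis:
  assumes y: "(s, w) \<in> res_basis (Suc m)"
  shows "bardzell_diff m (basis_elt K (s, w)) = gen_diff m (s, w)"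
proof -
  note D = res_basis_decomp[OF y]
  have "bardzell_diff m (basis_elt K (s, w)) =
      BA.tens (path_elt (rgt (Suc m) (s, w))) (path_elt (lft (s, w))) \<odot>\<^bsub>BB.P m\<^esub> gen_diff m (0, mid (Suc m) (s, w))"
    unfolding bardzell_diff_def by (rule BB.from_gens_basis[OF BB.P_module _ y]) (use gen_diff_closed in simp)
  also have "\<dots> = BB.act m (path_elt (lft (s, w))) (gen_diff m (0, mid (Suc m) (s, w))) (path_elt (rgt (Suc m) (s, w)))"
    by (rule BB.BM.tens_act[OF BA.path_elt_closed[OF D(6)] BA.path_elt_closed[OF D(5)] gen_diff_closed])
  also have "\<dots> = gen_diff m (s, w)"
    using act_gen_diff[OF D(5,6,7) _ D(2,3), of m 0] D(1,4,8) by simp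
  finally show ?thesis .
qed

text \<open>For a fixed path \<open>w\<close> an element of the resolution is a sequence indexed by the length of the left factor,
  and the differentials become backward differences and partial sums.\<close>

definition diff_coeff where
  "diff_coeff m x = (\<lambda>(t, w). if (t, w) \<in> res_basis m
     then (if even m then (if t = 0 then \<zero>\<^bsub>K\<^esub> else x (t - 1, w)) \<ominus>\<^bsub>K\<^esub> x (t, w)
           else (\<Oplus>\<^bsub>K\<^esub>s\<in>{..t}. x (s, w)))
     else \<zero>\<^bsub>K\<^esub>)"

lemma minus_free_module: "f \<in> finsupp K X \<Longrightarrow> h \<in> finsupp K X \<Longrightarrow> (f \<ominus>\<^bsub>free_module K X\<^esub> h) z = f z \<ominus>\<^bsub>K\<^esub> h z"
proof -
  assume f: "f \<in> finsupp K X" and h: "h \<in> finsupp K X"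
  interpret F: left_module K "free_module K X" by (rule K.left_module_free)
  have car: "carrier (free_module K X) = finsupp K X" by (simp add: free_module_def)
  have c: "f \<ominus>\<^bsub>free_module K X\<^esub> h \<in> finsupp K X" using F.M.minus_closed[of f h] f h by (simp add: car)
  have "(f \<ominus>\<^bsub>free_module K X\<^esub> h) \<oplus>\<^bsub>free_module K X\<^esub> h = f" using F.M.minus_plus[of f h] f h by (simp add: car)
  hence "((f \<ominus>\<^bsub>free_module K X\<^esub> h) \<oplus>\<^bsub>free_module K X\<^esub> h) z = f z" by simp
  hence "(f \<ominus>\<^bsub>free_module K X\<^esub> h) z \<oplus>\<^bsub>K\<^esub> h z = f z" by (simp add: free_module_def)
  moreover have "(f \<ominus>\<^bsub>free_module K X\<^esub> h) z \<in> carrier K" "h z \<in> carrier K" using c h by (auto simp: finsupp_def)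
  ultimately show ?thesis by (metis K.add.m_assoc K.a_inv_closed K.minus_eq K.r_neg K.r_zero)
qed

lemma diff_coeff_basis:
  assumes y: "(s, w) \<in> res_basis (Suc m)"
  shows "diff_coeff m (basis_elt K (s, w)) = gen_diff m (s, w)"
proof
  fix z :: "nat \<times> 'v \<times> 'e list"
  obtain t w' where z: "z = (t, w')" by (cases z)
  have cl: "basis_vec m y \<in> finsupp K (res_basis m)" for y using basis_vec_closed[of m y] by (simp add: BB.carV)
  show "diff_coeff m (basis_elt K (s, w)) z = gen_diff m (s, w) z"
  proof (cases "even m")
    case True
    have "gen_diff m (s, w) z = basis_vec m (Suc s, w) z \<ominus>\<^bsub>K\<^esub> basis_vec m (s, w) z"
      using True minus_free_module[OF cl cl] by (simp add: gen_diff_def)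
    thus ?thesis using True
      by (cases t) (auto simp: diff_coeff_def z basis_vec_apply basis_elt_def a_minus_def)
  next
    case False
    have "gen_diff m (s, w) z = finsum K (\<lambda>j. basis_vec m (s + j, w) z) {..<n}"
      using False finsum_free_module_apply[OF K.ring_axioms, of "{..<n}" "\<lambda>j. basis_vec m (s + j, w)" "res_basis m" z] cl
      by (simp add: gen_diff_def)
    \<comment> \<open>Position \<open>t\<close> is reached by \<open>j = t - s\<close> alone, and
      \<open>j < n\<close> is automatic because positions in \<open>res_basis\<close> are below
      \<open>n\<close>.\<close>
    also have "\<dots> = (if z \<in> res_basis m \<and> w' = w \<and> s \<le> t then \<one>\<^bsub>K\<^esub> else \<zero>\<^bsub>K\<^esub>)"
    proof (cases "z \<in> res_basis m \<and> w' = w \<and> s \<le> t")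
      case True
      hence t: "t < n" by (simp add: z res_basis_def)
      have "finsum K (\<lambda>j. basis_vec m (s + j, w) z) {..<n} = finsum K (\<lambda>j. if t - s = j then \<one>\<^bsub>K\<^esub> else \<zero>\<^bsub>K\<^esub>) {..<n}"
        by (rule K.finsum_cong') (use True in \<open>auto simp: z basis_vec_apply\<close>)
      also have "\<dots> = \<one>\<^bsub>K\<^esub>" by (rule K.add.finprod_singleton) (use t in auto)
      finally show ?thesis using True by simp
    next
      case F: False
      have "finsum K (\<lambda>j. basis_vec m (s + j, w) z) {..<n} = \<zero>\<^bsub>K\<^esub>"
        by (rule K.add.finprod_one_eqI) (use F in \<open>auto simp: z basis_vec_apply\<close>)
      thus ?thesis using F by simp
    qed
    also have "\<dots> = diff_coeff m (basis_elt K (s, w)) z"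
    proof (cases "z \<in> res_basis m")
      case True
      have "(\<Oplus>\<^bsub>K\<^esub>r\<in>{..t}. basis_elt K (s, w) (r, w')) = (if w' = w \<and> s \<le> t then \<one>\<^bsub>K\<^esub> else \<zero>\<^bsub>K\<^esub>)"
      proof (cases "w' = w \<and> s \<le> t")
        case c: True
        have "(\<Oplus>\<^bsub>K\<^esub>r\<in>{..t}. basis_elt K (s, w) (r, w')) = (\<Oplus>\<^bsub>K\<^esub>r\<in>{..t}. if s = r then \<one>\<^bsub>K\<^esub> else \<zero>\<^bsub>K\<^esub>)"
          by (rule K.finsum_cong') (use c in \<open>auto simp: basis_elt_def\<close>)
        also have "\<dots> = \<one>\<^bsub>K\<^esub>" by (rule K.add.finprod_singleton) (use c in auto)
        finally show ?thesis using c by simp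
      next
        case c: False
        have "(\<Oplus>\<^bsub>K\<^esub>r\<in>{..t}. basis_elt K (s, w) (r, w')) = \<zero>\<^bsub>K\<^esub>"
          by (rule K.add.finprod_one_eqI) (use c in \<open>auto simp: basis_elt_def\<close>)
        thus ?thesis using c by simp
      qed
      thus ?thesis using True False by (simp add: diff_coeff_def z)
    qed (simp add: diff_coeff_def z)
    finally show ?thesis by simp
  qed
qed

lemma diff_coeff_add:
  assumes "x \<in> carrier (BB.V k)" "x' \<in> carrier (BB.V k)"
  shows "diff_coeff m (x \<oplus>\<^bsub>BB.V k\<^esub> x') z = diff_coeff m x z \<oplus>\<^bsub>K\<^esub> diff_coeff m x' z"
proof -
  have c: "x y \<in> carrier K" "x' y \<in> carrier K" for y using assms by (auto simp: BB.carV finsupp_def)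
  obtain t w where z: "z = (t, w)" by (cases z)
  have "(\<Oplus>\<^bsub>K\<^esub>s\<in>{..t}. x (s, w) \<oplus>\<^bsub>K\<^esub> x' (s, w)) = (\<Oplus>\<^bsub>K\<^esub>s\<in>{..t}. x (s, w)) \<oplus>\<^bsub>K\<^esub> (\<Oplus>\<^bsub>K\<^esub>s\<in>{..t}. x' (s, w))"
    by (rule K.finsum_addf) (use c in auto)
  moreover have "(u \<oplus>\<^bsub>K\<^esub> u') \<ominus>\<^bsub>K\<^esub> (v \<oplus>\<^bsub>K\<^esub> v') = (u \<ominus>\<^bsub>K\<^esub> v) \<oplus>\<^bsub>K\<^esub> (u' \<ominus>\<^bsub>K\<^esub> v')"
    if "u \<in> carrier K" "u' \<in> carrier K" "v \<in> carrier K" "v' \<in> carrier K" for u u' v v'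
    using that by (simp add: a_minus_def K.minus_add K.a_ac)
  ultimately show ?thesis using c by (simp add: diff_coeff_def z BB.opsV K.minus_add a_minus_def K.a_ac)
qed

lemma diff_coeff_smult:
  assumes "x \<in> carrier (BB.V k)" "c \<in> carrier K"
  shows "diff_coeff m (c \<odot>\<^bsub>BB.V k\<^esub> x) z = c \<otimes>\<^bsub>K\<^esub> diff_coeff m x z"
proof -
  have xc: "x y \<in> carrier K" for y using assms by (auto simp: BB.carV finsupp_def)
  obtain t w where z: "z = (t, w)" by (cases z)
  have "c \<otimes>\<^bsub>K\<^esub> (\<Oplus>\<^bsub>K\<^esub>s\<in>{..t}. x (s, w)) = (\<Oplus>\<^bsub>K\<^esub>s\<in>{..t}. c \<otimes>\<^bsub>K\<^esub> x (s, w))"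
    by (rule K.finsum_rdistr) (use xc assms in auto)
  thus ?thesis using xc assms(2) by (simp add: diff_coeff_def z BB.opsV K.r_distr a_minus_def K.r_minus)
qed

lemma bardzell_diff_eq: assumes "x \<in> carrier (BB.V (Suc m))" shows "bardzell_diff m x = diff_coeff m x"
  using assms
proof (induction rule: BB.V_induct)
  case zero
  have "bardzell_diff m \<zero>\<^bsub>BB.V (Suc m)\<^esub> = \<zero>\<^bsub>BB.V m\<^esub>"
    using lin_homs_zero[OF BB.P_module BB.P_module bardzell_diff_hom] by simp
  thus ?case by (auto simp: fun_eq_iff diff_coeff_def BB.opsV a_minus_def split: prod.split)
next
  case (add f f')
  have "bardzell_diff m (f \<oplus>\<^bsub>BB.V (Suc m)\<^esub> f') = bardzell_diff m f \<oplus>\<^bsub>BB.V m\<^esub> bardzell_diff m f'"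
    using lin_homs_add[OF bardzell_diff_hom, of f m f'] add by simp
  also have "\<dots> = diff_coeff m (f \<oplus>\<^bsub>BB.V (Suc m)\<^esub> f')"
    by (rule ext) (simp add: diff_coeff_add[OF add(1,2)] add(3,4), simp add: BB.opsV)
  finally show ?case .
next
  case (basis c y)
  have b: "basis_elt K y \<in> carrier (BB.V (Suc m))" using BB.basisV basis by blast
  have "bardzell_diff m (c \<odot>\<^bsub>BB.V (Suc m)\<^esub> basis_elt K y) = (c \<odot>\<^bsub>Env\<^esub> \<one>\<^bsub>Env\<^esub>) \<odot>\<^bsub>BB.P m\<^esub> bardzell_diff m (basis_elt K y)"
    by (rule BB.hom_scal[OF bardzell_diff_hom basis(1) b])
  also have "\<dots> = c \<odot>\<^bsub>BB.V m\<^esub> bardzell_diff m (basis_elt K y)"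
    by (rule BB.BM.env_scalar[OF basis(1)]) (use lin_homs_closed[OF bardzell_diff_hom, of "basis_elt K y" m] b in simp)
  also have "bardzell_diff m (basis_elt K y) = diff_coeff m (basis_elt K y)"
    using bardzell_diff_basis[of "fst y" "snd y" m] diff_coeff_basis[of "fst y" "snd y" m] basis(2) by simp
  also have "c \<odot>\<^bsub>BB.V m\<^esub> diff_coeff m (basis_elt K y) = diff_coeff m (c \<odot>\<^bsub>BB.V (Suc m)\<^esub> basis_elt K y)"
    by (rule ext) (simp add: diff_coeff_smult[OF b basis(1)], simp add: BB.opsV)
  finally show ?case .
qed

section \<open>Exactness\<close>

lemma V_closedI:
  assumes "\<And>y. x y \<in> carrier K" "\<And>y. y \<notin> res_basis m \<Longrightarrow> x y = \<zero>\<^bsub>K\<^esub>"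
  shows "x \<in> carrier (BB.V m)"
proof -
  have "finite {y. x y \<noteq> \<zero>\<^bsub>K\<^esub>}" by (rule finite_subset[OF _ finite_res_basis[of m]]) (use assms(2) in blast)
  thus ?thesis using assms by (simp add: BB.carV finsupp_def)
qed

lemma V_D:
  assumes "x \<in> carrier (BB.V m)"
  shows "x y \<in> carrier K" "y \<notin> res_basis m \<Longrightarrow> x y = \<zero>\<^bsub>K\<^esub>"
  using assms by (auto simp: BB.carV finsupp_def)

text \<open>Preimages under the two kinds of differential: tail sums invert backward differences
  once the total is zero, and one value at position 0 is spread by partial sums to a sequence
  constant in the position. The result is a preimage of cycles only.\<close>

definition contraction where
  "contraction m x = (\<lambda>(t, w). if (t, w) \<in> res_basis (Suc m)
     then (if even m then (\<Oplus>\<^bsub>K\<^esub>s\<in>{t<..<n}. x (s, w)) else if t = 0 then x (n - 1, w) else \<zero>\<^bsub>K\<^esub>)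
     else \<zero>\<^bsub>K\<^esub>)"

lemma contraction_closed: assumes x: "x \<in> carrier (BB.V m)" shows "contraction m x \<in> carrier (BB.V (Suc m))"
proof (rule V_closedI)
  fix y :: "nat \<times> 'v \<times> 'e list"
  obtain t w where y: "y = (t, w)" by (cases y)
  have "(\<Oplus>\<^bsub>K\<^esub>s\<in>{t<..<n}. x (s, w)) \<in> carrier K" by (rule K.finsum_closed) (use V_D(1)[OF x] in auto)
  thus "contraction m x y \<in> carrier K" using V_D(1)[OF x] by (simp add: contraction_def y)
qed (auto simp: contraction_def)

text \<open>The difference of consecutive tail sums is the term between them. At position 0 there is
  no earlier tail sum, and the remaining \<open>\<ominus> T 0\<close> equals \<open>x (0, w)\<close>
  precisely because the total sum is zero.\<close>

lemma even_exact:
  assumes m: "even m" and x: "x \<in> carrier (BB.V m)"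
    and z: "\<And>w. (0, w) \<in> res_basis m \<Longrightarrow> (\<Oplus>\<^bsub>K\<^esub>s\<in>{..<n}. x (s, w)) = \<zero>\<^bsub>K\<^esub>"
  shows "diff_coeff m (contraction m x) = x"
proof
  fix y :: "nat \<times> 'v \<times> 'e list"
  obtain t w where y: "y = (t, w)" by (cases y)
  note c = V_D(1)[OF x] and c0 = V_D(2)[OF x]
  define T where "T t = (\<Oplus>\<^bsub>K\<^esub>s\<in>{t<..<n}. x (s, w))" for t
  have Tc: "T t \<in> carrier K" for t unfolding T_def by (rule K.finsum_closed) (use c in auto)
  show "diff_coeff m (contraction m x) y = x y"
  proof (cases "(t, w) \<in> res_basis m")
    case B: True
    hence b: "w \<in> paths Q" "t < n" "gen_length m + t \<le> path_length w" "path_length w < gen_length m + t + n" by (simp_all add: res_basis_iff)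
    have h: "contraction m x (t, w) = T t"
    proof (cases "(t, w) \<in> res_basis (Suc m)")
      case False
      \<comment> \<open>The word has no room for the longer generator at \<open>t\<close>. No
        position after \<open>t\<close> can then carry a coefficient, so the value zero of
        \<open>contraction\<close> is still the tail sum.\<close>
      hence "path_length w = gen_length m + t" using b by (auto simp: res_basis_iff gen_length_even[OF m])
      hence "x (s, w) = \<zero>\<^bsub>K\<^esub>" if "t < s" for s by (intro c0) (use that in \<open>simp add: res_basis_iff\<close>)
      hence "T t = \<zero>\<^bsub>K\<^esub>" unfolding T_def by (intro K.add.finprod_one_eqI) auto
      thus ?thesis using False by (simp add: contraction_def)
    qed (use m in \<open>simp add: contraction_def T_def\<close>)
    show ?thesis
    proof (cases t)
      case 0
      have "{..<n} = insert 0 {0<..<n}" using n2 by auto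
      hence "(\<Oplus>\<^bsub>K\<^esub>s\<in>{..<n}. x (s, w)) = x (0, w) \<oplus>\<^bsub>K\<^esub> T 0"
        using c by (simp add: T_def)
      hence "x (0, w) \<oplus>\<^bsub>K\<^esub> T 0 = \<zero>\<^bsub>K\<^esub>" using z[of w] B 0 by simp
      hence "\<ominus>\<^bsub>K\<^esub> T 0 = x (0, w)" using c Tc by (simp add: K.minus_equality)
      thus ?thesis using B h m Tc 0 c by (simp add: y diff_coeff_def a_minus_def)
    next
      case (Suc r)
      have "(r, w) \<in> res_basis (Suc m)" using b Suc by (simp add: res_basis_iff gen_length_even[OF m])
      hence "contraction m x (r, w) = T r" using m by (simp add: contraction_def T_def)
      moreover have "{r<..<n} = insert t {t<..<n}" using Suc b by auto
      hence "T r = x (t, w) \<oplus>\<^bsub>K\<^esub> T t" unfolding T_def using c by simp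
      moreover have "(x (t, w) \<oplus>\<^bsub>K\<^esub> T t) \<ominus>\<^bsub>K\<^esub> T t = x (t, w)"
        using c Tc by (simp add: a_minus_def K.a_assoc K.r_neg)
      ultimately show ?thesis using B h m Suc by (simp add: y diff_coeff_def)
    qed
  next
    case False
    thus ?thesis using c0[of y] by (simp add: y diff_coeff_def)
  qed
qed

text \<open>The partial sum at the last position \<open>n - 1\<close> is the total sum, and its
  vanishing is the hypothesis of \<open>even_exact\<close>.\<close>

lemma exact_odd_index:
  assumes k: "odd k" and x: "x \<in> carrier (BB.V (Suc k))" and z: "\<And>y. diff_coeff k x y = \<zero>\<^bsub>K\<^esub>"
  shows "diff_coeff (Suc k) (contraction (Suc k) x) = x"
proof (rule even_exact[OF _ x])
  fix w assume "(0, w) \<in> res_basis (Suc k)"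
  hence "(n - 1, w) \<in> res_basis k" using n2 k by (auto simp: res_basis_iff gen_length_odd)
  hence "(\<Oplus>\<^bsub>K\<^esub>s\<in>{..n - 1}. x (s, w)) = \<zero>\<^bsub>K\<^esub>" using z[of "(n - 1, w)"] k by (simp add: diff_coeff_def)
  moreover have "{..n - 1} = {..<n}" using n2 by auto
  ultimately show "(\<Oplus>\<^bsub>K\<^esub>s\<in>{..<n}. x (s, w)) = \<zero>\<^bsub>K\<^esub>" by simp
qed (use k in simp)

text \<open>Vanishing differences make \<open>x\<close> constant in the position from
  \<open>t\<close> on, so it equals its value at \<open>n - 1\<close>; the contraction puts this
  value at position 0, and partial sums carry it to every \<open>t\<close>.\<close>

lemma exact_even_index:
  assumes k: "even k" and x: "x \<in> carrier (BB.V (Suc k))" and z: "\<And>y. diff_coeff k x y = \<zero>\<^bsub>K\<^esub>"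
  shows "diff_coeff (Suc k) (contraction (Suc k) x) = x"
proof
  fix y :: "nat \<times> 'v \<times> 'e list"
  obtain t w where y: "y = (t, w)" by (cases y)
  note c = V_D(1)[OF x] and c0 = V_D(2)[OF x]
  show "diff_coeff (Suc k) (contraction (Suc k) x) y = x y"
  proof (cases "(t, w) \<in> res_basis (Suc k)")
    case B: True
    hence b: "w \<in> paths Q" "t < n" "gen_length k + 1 + t \<le> path_length w" "path_length w < gen_length k + 1 + t + n"
      using k by (simp_all add: res_basis_iff gen_length_even)
    \<comment> \<open>If the pair is outside \<open>res_basis k\<close>, the word is too short to
      carry the longer generator at \<open>s - 1\<close> or at \<open>s\<close>, and both values are
      zero.\<close>
    have step: "x (s - 1, w) = x (s, w)" if s: "t < s" "s < n" for s
    proof (cases "(s, w) \<in> res_basis k")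
      case True
      have "x (s - 1, w) \<ominus>\<^bsub>K\<^esub> x (s, w) = \<zero>\<^bsub>K\<^esub>" using z[of "(s, w)"] True s k by (simp add: diff_coeff_def)
      thus ?thesis using c by simp
    next
      case False
      hence "(s, w) \<notin> res_basis (Suc k)" "(s - 1, w) \<notin> res_basis (Suc k)" using s b k by (auto simp: res_basis_iff gen_length_even)
      thus ?thesis using c0 by simp
    qed
    have "x (t + j, w) = x (t, w)" if "t + j < n" for j
      using that
    proof (induction j)
      case (Suc j)
      thus ?case using step[of "Suc (t + j)"] by simp
    qed simp
    from this[of "n - 1 - t"] have xt: "x (n - 1, w) = x (t, w)" using b by simp
    have g2: "gen_length (Suc (Suc k)) = gen_length k + n" using gen_length_odd[of "Suc k"] gen_length_even[OF k] k by simp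
    have "diff_coeff (Suc k) (contraction (Suc k) x) y = (\<Oplus>\<^bsub>K\<^esub>s\<in>{..t}. contraction (Suc k) x (s, w))"
      using B k by (simp add: y diff_coeff_def)
    also have "\<dots> = (\<Oplus>\<^bsub>K\<^esub>s\<in>{..t}. if 0 = s then contraction (Suc k) x (0, w) else \<zero>\<^bsub>K\<^esub>)"
      by (rule K.finsum_cong') (use k c V_D(1)[OF contraction_closed[OF x]] in \<open>auto simp: contraction_def\<close>)
    also have "\<dots> = contraction (Suc k) x (0, w)"
      by (rule K.add.finprod_singleton) (use V_D(1)[OF contraction_closed[OF x]] in auto)
    also have "\<dots> = x (n - 1, w)"
    proof (cases "(0, w) \<in> res_basis (Suc (Suc k))")
      case False
      \<comment> \<open>The generator of degree \<open>k + 2\<close> at position 0 ends where that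
        of degree \<open>k + 1\<close> at position \<open>n - 1\<close> does, so the two fail to fit
        together.\<close>
      hence "(n - 1, w) \<notin> res_basis (Suc k)" using b n2 k by (auto simp: res_basis_iff gen_length_even g2)
      thus ?thesis using False c0 by (simp add: contraction_def)
    qed (use k in \<open>simp add: contraction_def\<close>)
    finally show ?thesis using xt y by simp
  next
    case False
    thus ?thesis using c0[of y] by (simp add: y diff_coeff_def)
  qed
qed

text \<open>The backward difference of partial sums is \<open>- x\<close> at the same position.
  There \<open>x\<close> has no coefficient: a word in range for degree \<open>m\<close> at
  \<open>t\<close> is shorter than \<open>gen_length m + n + t\<close>, the least length required in
  degree \<open>m + 2\<close>.\<close>

lemma diff_coeff_diff_coeff_even:
  assumes m: "even m" and x: "x \<in> carrier (BB.V (Suc (Suc m)))"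
  shows "diff_coeff m (diff_coeff (Suc m) x) y = \<zero>\<^bsub>K\<^esub>"
proof -
  obtain t w where y: "y = (t, w)" by (cases y)
  note c = V_D(1)[OF x] and c0 = V_D(2)[OF x]
  have g2: "gen_length (Suc (Suc m)) = gen_length m + n" using gen_length_odd[of "Suc m"] gen_length_even[OF m] m by simp
  define U where "U t = (\<Oplus>\<^bsub>K\<^esub>s\<in>{..t}. x (s, w))" for t
  have Uc: "U t \<in> carrier K" for t unfolding U_def by (rule K.finsum_closed) (use c in auto)
  show ?thesis
  proof (cases "(t, w) \<in> res_basis m")
    case B: True
    hence b: "w \<in> paths Q" "t < n" "gen_length m + t \<le> path_length w" "path_length w < gen_length m + t + n" by (simp_all add: res_basis_iff)
    have h: "diff_coeff (Suc m) x (t, w) = U t"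
    proof (cases "(t, w) \<in> res_basis (Suc m)")
      case False
      hence "path_length w = gen_length m + t" using b m by (auto simp: res_basis_iff gen_length_even)
      hence "x (s, w) = \<zero>\<^bsub>K\<^esub>" for s by (intro c0) (use b in \<open>simp add: res_basis_iff g2\<close>)
      hence "U t = \<zero>\<^bsub>K\<^esub>" unfolding U_def by (intro K.add.finprod_one_eqI) auto
      thus ?thesis using False by (simp add: diff_coeff_def)
    qed (use m in \<open>simp add: diff_coeff_def U_def\<close>)
    have xt: "x (t, w) = \<zero>\<^bsub>K\<^esub>" by (rule c0) (use b in \<open>simp add: res_basis_iff g2\<close>)
    show ?thesis
    proof (cases t)
      case 0
      hence "U t = \<zero>\<^bsub>K\<^esub>" using xt by (simp add: U_def)
      thus ?thesis using B h m 0 by (simp add: y diff_coeff_def[of m] a_minus_def)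
    next
      case (Suc r)
      have "(r, w) \<in> res_basis (Suc m)" using b Suc m by (simp add: res_basis_iff gen_length_even)
      hence "diff_coeff (Suc m) x (r, w) = U r" using m by (simp add: diff_coeff_def U_def)
      moreover have "U t = x (t, w) \<oplus>\<^bsub>K\<^esub> U r"
        unfolding U_def Suc atMost_Suc using c by (intro K.finsum_insert) auto
      ultimately show ?thesis using B h m Suc xt Uc by (simp add: y diff_coeff_def[of m])
    qed
  next
    case False
    thus ?thesis by (simp add: y diff_coeff_def[of m])
  qed
qed

text \<open>Now the partial sums come second and telescope; the surviving coefficient is absent by
  the same bound on lengths.\<close>

lemma diff_coeff_diff_coeff_odd:
  assumes m: "odd m" and x: "x \<in> carrier (BB.V (Suc (Suc m)))"
  shows "diff_coeff m (diff_coeff (Suc m) x) y = \<zero>\<^bsub>K\<^esub>"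
proof -
  obtain t w where y: "y = (t, w)" by (cases y)
  note c = V_D(1)[OF x] and c0 = V_D(2)[OF x]
  have g1: "gen_length (Suc m) = gen_length m + n - 1" "gen_length (Suc (Suc m)) = gen_length m + n"
    using gen_length_even[of "Suc m"] gen_length_odd[OF m] m n2 by auto
  show ?thesis
  proof (cases "(t, w) \<in> res_basis m")
    case B: True
    hence b: "w \<in> paths Q" "t < n" "gen_length m + t \<le> path_length w" "path_length w < gen_length m + t + n" by (simp_all add: res_basis_iff)
    have h: "diff_coeff (Suc m) x (s, w) = (if s = 0 then \<zero>\<^bsub>K\<^esub> else x (s - 1, w)) \<ominus>\<^bsub>K\<^esub> x (s, w)" if s: "s \<le> t" for s
    proof (cases "(s, w) \<in> res_basis (Suc m)")
      case True
      thus ?thesis using m by (simp add: diff_coeff_def)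
    next
      case False
      have "x (s, w) = \<zero>\<^bsub>K\<^esub>" by (rule c0) (use False s b n2 in \<open>auto simp: res_basis_iff g1\<close>)
      moreover have "x (s - 1, w) = \<zero>\<^bsub>K\<^esub>" if "s \<noteq> 0"
        by (rule c0) (use that False s b n2 in \<open>auto simp: res_basis_iff g1\<close>)
      ultimately show ?thesis using False by (simp add: diff_coeff_def a_minus_def)
    qed
    have "diff_coeff m (diff_coeff (Suc m) x) y = (\<Oplus>\<^bsub>K\<^esub>s\<in>{..t}. diff_coeff (Suc m) x (s, w))"
      using B m by (simp add: y diff_coeff_def[of m])
    also have "\<dots> = (\<Oplus>\<^bsub>K\<^esub>s\<in>{..t}. (if s = 0 then \<zero>\<^bsub>K\<^esub> else x (s - 1, w)) \<ominus>\<^bsub>K\<^esub> x (s, w))"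
      by (rule K.finsum_cong') (use h c in auto)
    also have "\<dots> = \<ominus>\<^bsub>K\<^esub> x (t, w)" by (rule K.finsum_telescope[of "\<lambda>s. x (s, w)"]) (rule c)
    also have "x (t, w) = \<zero>\<^bsub>K\<^esub>" by (rule c0) (use b in \<open>simp add: res_basis_iff g1\<close>)
    finally show ?thesis by simp
  next
    case False
    thus ?thesis by (simp add: y diff_coeff_def[of m])
  qed
qed

section \<open>The augmentation and the end of the resolution\<close>

abbreviation RB where "RB \<equiv> regular_bimodule K A"

lemma RB_bimodule: "bimodule K A A (\<lambda>b x a. b \<otimes>\<^bsub>A\<^esub> x \<otimes>\<^bsub>A\<^esub> a)"
  by (rule env_algebra.regular_bimodule[OF A_env])

sublocale RM: bimodule K A A "\<lambda>b x a. b \<otimes>\<^bsub>A\<^esub> x \<otimes>\<^bsub>A\<^esub> a"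
  by (rule RB_bimodule)

lemma RB_module: "left_module Env RB"
  unfolding regular_bimodule_eq by (rule RM.env_left_module)

lemma RB_simps: "carrier RB = carrier A" "\<zero>\<^bsub>RB\<^esub> = \<zero>\<^bsub>A\<^esub>" "x \<oplus>\<^bsub>RB\<^esub> y = x \<oplus>\<^bsub>A\<^esub> y"
  by (simp_all add: regular_bimodule_def)

text \<open>The multiplication map: in degree 0 the generators are vertices, so
  \<open>\<alpha> \<otimes> v \<otimes> \<beta>\<close> goes to
  \<open>\<alpha> \<beta>\<close>.\<close>

definition aug where "aug = BB.from_gens 0 RB path_elt"

lemma res_gens_short_paths: "\<gamma> \<in> res_gens 0 \<Longrightarrow> \<gamma> \<in> short_paths"
  using n2 by (simp add: res_gens_def short_paths_def gen_length_def)

lemma aug_hom: "aug \<in> lin_homs Env (BB.P 0) RB"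
  unfolding aug_def by (rule BB.from_gens_hom[OF RB_module]) (simp add: RB_simps BA.path_elt_closed res_gens_short_paths)

lemma aug_basis:
  assumes y: "(s, w) \<in> res_basis 0"
  shows "aug (basis_elt K (s, w)) = (if w \<in> short_paths then path_elt w else \<zero>\<^bsub>A\<^esub>)"
proof -
  note D = res_basis_decomp[OF y]
  let ?l = "lft (s, w)" and ?r = "rgt 0 (s, w)" and ?g = "mid 0 (s, w)"
  have len0: "snd ?g = []" using D(8) by (simp add: gen_length_def)
  have gS: "?g \<in> short_paths" using D(7,8) n2 by (simp add: short_paths_def gen_length_def)
  have tg: "trm ?g = fst ?g" using trm_Nil[of "fst ?g"] len0 by (cases ?g) simp
  have w: "pcat ?l ?r = w" using D(1) len0 by (simp add: pcat_def)
  have "aug (basis_elt K (s, w)) = BA.tens (path_elt ?r) (path_elt ?l) \<odot>\<^bsub>RB\<^esub> path_elt ?g"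
    unfolding aug_def by (rule BB.from_gens_basis[OF RB_module _ y]) (simp add: RB_simps BA.path_elt_closed res_gens_short_paths)
  also have "\<dots> = path_elt ?l \<otimes>\<^bsub>A\<^esub> path_elt ?g \<otimes>\<^bsub>A\<^esub> path_elt ?r"
    unfolding regular_bimodule_eq by (rule RM.tens_act) (use D gS in \<open>simp_all add: BA.path_elt_closed\<close>)
  also have "path_elt ?l \<otimes>\<^bsub>A\<^esub> path_elt ?g = path_elt ?l"
  proof -
    have "pcat ?l ?g = ?l" using len0 by (simp add: pcat_def)
    thus ?thesis using BA.path_elt_mult[OF D(5) gS] D(2,5) len0 by (simp add: pm_def short_paths_def)
  qed
  also have "path_elt ?l \<otimes>\<^bsub>A\<^esub> path_elt ?r = (if w \<in> short_paths then path_elt w else \<zero>\<^bsub>A\<^esub>)"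
  proof -
    have "path_length w = path_length ?l + path_length ?r" using w by (metis pcat_simps(2) length_append)
    moreover have "w \<in> paths Q" using y by (simp add: res_basis_iff)
    ultimately show ?thesis using BA.path_elt_mult[OF D(5,6)] D(2,3) tg w by (simp add: pm_def short_paths_def)
  qed
  finally show ?thesis .
qed

text \<open>The basis elements over a short word \<open>w\<close> in degree 0 are its cuts into two
  factors, and each of them multiplies to \<open>w\<close>; longer words vanish in
  \<open>A\<close>.\<close>

lemma co_aug:
  assumes "x \<in> carrier (BB.V 0)"
  shows "co (aug x) w = (if w \<in> short_paths then (\<Oplus>\<^bsub>K\<^esub>s\<in>{..<n}. x (s, w)) else \<zero>\<^bsub>K\<^esub>)"
  using assms
proof (induction rule: BB.V_induct)
  case zero
  have "aug \<zero>\<^bsub>BB.V 0\<^esub> = \<zero>\<^bsub>A\<^esub>"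
    using lin_homs_zero[OF BB.P_module RB_module aug_hom] by (simp add: RB_simps)
  thus ?case by (simp add: BA.co_zero BB.opsV)
next
  case (add f f')
  have e: "aug (f \<oplus>\<^bsub>BB.V 0\<^esub> f') = aug f \<oplus>\<^bsub>A\<^esub> aug f'"
    using lin_homs_add[OF aug_hom, of f f'] add by (simp add: RB_simps)
  have ac: "aug f \<in> carrier A" "aug f' \<in> carrier A"
    using lin_homs_closed[OF aug_hom] add by (simp_all add: RB_simps)
  have "(\<Oplus>\<^bsub>K\<^esub>s\<in>{..<n}. f (s, w) \<oplus>\<^bsub>K\<^esub> f' (s, w)) = (\<Oplus>\<^bsub>K\<^esub>s\<in>{..<n}. f (s, w)) \<oplus>\<^bsub>K\<^esub> (\<Oplus>\<^bsub>K\<^esub>s\<in>{..<n}. f' (s, w))"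
    by (rule K.finsum_addf) (use V_D(1)[OF add(1)] V_D(1)[OF add(2)] in auto)
  hence "(\<Oplus>\<^bsub>K\<^esub>s\<in>{..<n}. (f \<oplus>\<^bsub>BB.V 0\<^esub> f') (s, w)) =
      (\<Oplus>\<^bsub>K\<^esub>s\<in>{..<n}. f (s, w)) \<oplus>\<^bsub>K\<^esub> (\<Oplus>\<^bsub>K\<^esub>s\<in>{..<n}. f' (s, w))"
    by (simp add: BB.opsV)
  thus ?case unfolding e BA.co_add[OF ac] add(3,4) by simp
next
  case (basis c y)
  obtain s v where y: "y = (s, v)" by (cases y)
  have b: "basis_elt K y \<in> carrier (BB.V 0)" using BB.basisV basis by blast
  have yB: "(s, v) \<in> res_basis 0" using basis(2) by (simp add: y)
  have sn: "s < n" using yB by (simp add: res_basis_iff)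
  have "aug (c \<odot>\<^bsub>BB.V 0\<^esub> basis_elt K y) = (c \<odot>\<^bsub>Env\<^esub> \<one>\<^bsub>Env\<^esub>) \<odot>\<^bsub>RB\<^esub> aug (basis_elt K y)"
    by (rule BB.hom_scal[OF aug_hom basis(1) b])
  also have "\<dots> = c \<odot>\<^bsub>A\<^esub> aug (basis_elt K y)"
    unfolding regular_bimodule_eq
    by (rule RM.env_scalar[OF basis(1)]) (use lin_homs_closed[OF aug_hom, of "basis_elt K y"] b in \<open>simp add: RB_simps\<close>)
  finally have "co (aug (c \<odot>\<^bsub>BB.V 0\<^esub> basis_elt K y)) w = c \<otimes>\<^bsub>K\<^esub> (if v \<in> short_paths then basis_elt K v w else \<zero>\<^bsub>K\<^esub>)"
    using aug_basis[OF yB] basis(1)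
    by (simp add: y BA.co_smult BA.path_elt_closed BA.co_path_elt BA.co_zero)
  also have "\<dots> = (if w \<in> short_paths then (\<Oplus>\<^bsub>K\<^esub>r\<in>{..<n}. if s = r then c \<otimes>\<^bsub>K\<^esub> basis_elt K v w else \<zero>\<^bsub>K\<^esub>) else \<zero>\<^bsub>K\<^esub>)"
    using K.add.finprod_singleton[of s "{..<n}" "\<lambda>_. c \<otimes>\<^bsub>K\<^esub> basis_elt K v w"] sn basis(1)
    by (auto simp: basis_elt_def)
  also have "(\<Oplus>\<^bsub>K\<^esub>r\<in>{..<n}. if s = r then c \<otimes>\<^bsub>K\<^esub> basis_elt K v w else \<zero>\<^bsub>K\<^esub>) =
      (\<Oplus>\<^bsub>K\<^esub>r\<in>{..<n}. (c \<odot>\<^bsub>BB.V 0\<^esub> basis_elt K y) (r, w))"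
    by (rule K.finsum_cong') (use basis(1) in \<open>auto simp: BB.opsV y basis_elt_def\<close>)
  finally show ?case .
qed

text \<open>Over a short word the sum telescopes to the coefficient at position
  \<open>n - 1\<close>, where no arrow is left to serve as generator of degree 1.\<close>

lemma aug_diff_coeff:
  assumes x: "x \<in> carrier (BB.V (Suc 0))"
  shows "aug (bardzell_diff 0 x) = \<zero>\<^bsub>A\<^esub>"
proof -
  note c = V_D(1)[OF x] and c0 = V_D(2)[OF x]
  have dc: "bardzell_diff 0 x \<in> carrier (BB.V 0)" using lin_homs_closed[OF bardzell_diff_hom, of x 0] x by simp
  have "co (aug (bardzell_diff 0 x)) w = \<zero>\<^bsub>K\<^esub>" for w
  proof (cases "w \<in> short_paths")
    case True
    hence w: "w \<in> paths Q" "path_length w < n" by (auto simp: short_paths_def)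
    have h: "diff_coeff 0 x (s, w) = (if s = 0 then \<zero>\<^bsub>K\<^esub> else x (s - 1, w)) \<ominus>\<^bsub>K\<^esub> x (s, w)" if s: "s < n" for s
    proof (cases "(s, w) \<in> res_basis 0")
      case False
      have "x (s, w) = \<zero>\<^bsub>K\<^esub>" by (rule c0) (use False s w in \<open>auto simp: res_basis_iff gen_length_def\<close>)
      moreover have "x (s - 1, w) = \<zero>\<^bsub>K\<^esub>" if "s \<noteq> 0"
        by (rule c0) (use that False s w in \<open>auto simp: res_basis_iff gen_length_def\<close>)
      ultimately show ?thesis using False by (simp add: diff_coeff_def a_minus_def)
    qed (simp add: diff_coeff_def)
    have i: "{..<n} = {..n - 1}" using n2 by auto
    have "co (aug (bardzell_diff 0 x)) w = (\<Oplus>\<^bsub>K\<^esub>s\<in>{..n - 1}. diff_coeff 0 x (s, w))"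
      using co_aug[OF dc] True by (simp add: bardzell_diff_eq[OF x] i)
    also have "\<dots> = (\<Oplus>\<^bsub>K\<^esub>s\<in>{..n - 1}. (if s = 0 then \<zero>\<^bsub>K\<^esub> else x (s - 1, w)) \<ominus>\<^bsub>K\<^esub> x (s, w))"
      by (rule K.finsum_cong') (use h c n2 in auto)
    also have "\<dots> = \<ominus>\<^bsub>K\<^esub> x (n - 1, w)" by (rule K.finsum_telescope[of "\<lambda>s. x (s, w)"]) (rule c)
    also have "x (n - 1, w) = \<zero>\<^bsub>K\<^esub>" by (rule c0) (use w in \<open>simp add: res_basis_iff gen_length_def\<close>)
    finally show ?thesis by simp
  qed (simp add: co_aug[OF dc])
  hence "co (aug (bardzell_diff 0 x)) = co \<zero>\<^bsub>A\<^esub>" by (simp add: fun_eq_iff BA.co_zero)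
  moreover have "aug (bardzell_diff 0 x) \<in> carrier A" using lin_homs_closed[OF aug_hom, of "bardzell_diff 0 x"] dc by (simp add: RB_simps)
  ultimately show ?thesis using BA.co_eq by simp
qed

lemma aug_surj: "aug ` carrier (BB.P 0) = carrier RB"
proof (intro equalityI subsetI)
  fix a assume "a \<in> carrier RB"
  hence a: "a \<in> carrier A" by (simp add: RB_simps)
  \<comment> \<open>All coefficients are put at cut 0, so that \<open>a\<close> is lifted to
    \<open>1 \<otimes> a\<close>.\<close>
  let ?x = "\<lambda>(t, w). if t = 0 \<and> w \<in> short_paths then co a w else \<zero>\<^bsub>K\<^esub>"
  have x: "?x \<in> carrier (BB.V 0)"
    by (rule V_closedI) (use BA.co_carrier[OF a] n2 in \<open>auto simp: res_basis_iff short_paths_def gen_length_def split: prod.splits\<close>)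
  have "co (aug ?x) w = co a w" for w
  proof (cases "w \<in> short_paths")
    case True
    have "(\<Oplus>\<^bsub>K\<^esub>s\<in>{..<n}. ?x (s, w)) = (\<Oplus>\<^bsub>K\<^esub>s\<in>{..<n}. if 0 = s then co a w else \<zero>\<^bsub>K\<^esub>)"
      by (rule K.finsum_cong') (use BA.co_carrier[OF a] True in auto)
    also have "\<dots> = co a w" by (rule K.add.finprod_singleton) (use n2 BA.co_carrier[OF a] in auto)
    finally show ?thesis using True by (simp add: co_aug[OF x])
  next
    case False
    thus ?thesis using BA.co_closed[OF a] by (simp add: co_aug[OF x] finsupp_def)
  qed
  hence "co (aug ?x) = co a" by (simp add: fun_eq_iff)
  moreover have "aug ?x \<in> carrier A" using lin_homs_closed[OF aug_hom, of ?x] x by (simp add: RB_simps)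
  ultimately have e: "a = aug ?x" using BA.co_eq[of a "aug ?x"] a by simp
  show "a \<in> aug ` carrier (BB.P 0)" by (rule image_eqI[where f = aug and x = ?x, OF e]) (use x in simp)
qed (use lin_homs_closed[OF aug_hom] in blast)

text \<open>A word has a basis element at position 0 exactly if it is short, so the kernel of the
  augmentation provides just the vanishing sums that \<open>even_exact\<close> asks for.\<close>

lemma resolution_exact_0:
  "{x \<in> carrier (BB.P 0). aug x = \<zero>\<^bsub>RB\<^esub>} = bardzell_diff 0 ` carrier (BB.P (Suc 0))"
proof (intro equalityI subsetI)
  fix x assume "x \<in> {x \<in> carrier (BB.P 0). aug x = \<zero>\<^bsub>RB\<^esub>}"
  hence x: "x \<in> carrier (BB.V 0)" "aug x = \<zero>\<^bsub>A\<^esub>" by (simp_all add: RB_simps)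
  have "diff_coeff 0 (contraction 0 x) = x"
  proof (rule even_exact[OF _ x(1)])
    fix w assume "(0, w) \<in> res_basis 0"
    hence "w \<in> short_paths" by (simp add: res_basis_iff short_paths_def gen_length_def)
    thus "(\<Oplus>\<^bsub>K\<^esub>s\<in>{..<n}. x (s, w)) = \<zero>\<^bsub>K\<^esub>" using co_aug[OF x(1), of w] x(2) by (simp add: BA.co_zero)
  qed simp
  hence e: "x = bardzell_diff 0 (contraction 0 x)" using bardzell_diff_eq[OF contraction_closed[OF x(1)]] by simp
  show "x \<in> bardzell_diff 0 ` carrier (BB.P (Suc 0))" by (rule image_eqI[where f = "bardzell_diff 0" and x = "contraction 0 x", OF e]) (use contraction_closed[OF x(1)] in simp)
next
  fix x assume "x \<in> bardzell_diff 0 ` carrier (BB.P (Suc 0))"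
  then obtain y where y: "y \<in> carrier (BB.P (Suc 0))" "x = bardzell_diff 0 y" by (rule imageE)
  have "bardzell_diff 0 y \<in> carrier (BB.P 0)" by (rule lin_homs_closed[OF bardzell_diff_hom y(1)])
  moreover have "aug (bardzell_diff 0 y) = \<zero>\<^bsub>RB\<^esub>" using aug_diff_coeff[of y] y(1) by (simp add: RB_simps)
  ultimately show "x \<in> {x \<in> carrier (BB.P 0). aug x = \<zero>\<^bsub>RB\<^esub>}" unfolding y(2) by simp
qed

lemma resolution_exact_Suc:
  "{x \<in> carrier (BB.P (Suc k)). bardzell_diff k x = \<zero>\<^bsub>BB.P k\<^esub>} = bardzell_diff (Suc k) ` carrier (BB.P (Suc (Suc k)))"
proof (intro equalityI subsetI)
  fix x assume "x \<in> {x \<in> carrier (BB.P (Suc k)). bardzell_diff k x = \<zero>\<^bsub>BB.P k\<^esub>}"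
  hence x: "x \<in> carrier (BB.V (Suc k))" "bardzell_diff k x = \<zero>\<^bsub>BB.V k\<^esub>" by simp_all
  have "diff_coeff k x y = \<zero>\<^bsub>K\<^esub>" for y using x(2) by (simp add: bardzell_diff_eq[OF x(1)] BB.opsV)
  hence "diff_coeff (Suc k) (contraction (Suc k) x) = x"
    using exact_odd_index[OF _ x(1)] exact_even_index[OF _ x(1)] by (cases "even k") simp_all
  hence e: "x = bardzell_diff (Suc k) (contraction (Suc k) x)" using bardzell_diff_eq[OF contraction_closed[OF x(1)]] by simp
  show "x \<in> bardzell_diff (Suc k) ` carrier (BB.P (Suc (Suc k)))" by (rule image_eqI[where f = "bardzell_diff (Suc k)" and x = "contraction (Suc k) x", OF e]) (use contraction_closed[OF x(1)] in simp)
next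
  fix x assume "x \<in> bardzell_diff (Suc k) ` carrier (BB.P (Suc (Suc k)))"
  then obtain y where y: "y \<in> carrier (BB.P (Suc (Suc k)))" "x = bardzell_diff (Suc k) y" by (rule imageE)
  have xc: "bardzell_diff (Suc k) y \<in> carrier (BB.P (Suc k))" by (rule lin_homs_closed[OF bardzell_diff_hom y(1)])
  have yV: "y \<in> carrier (BB.V (Suc (Suc k)))" using y(1) by simp
  have "bardzell_diff k (bardzell_diff (Suc k) y) = diff_coeff k (diff_coeff (Suc k) y)"
    using bardzell_diff_eq[of "bardzell_diff (Suc k) y" k] xc bardzell_diff_eq[OF yV] by simp
  also have "\<dots> = (\<lambda>_. \<zero>\<^bsub>K\<^esub>)"
    by (rule ext) (cases "even k", simp_all add: diff_coeff_diff_coeff_even[OF _ yV] diff_coeff_diff_coeff_odd[OF _ yV])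
  finally have "bardzell_diff k (bardzell_diff (Suc k) y) = \<zero>\<^bsub>BB.P k\<^esub>" by (simp add: BB.opsV)
  thus "x \<in> {x \<in> carrier (BB.P (Suc k)). bardzell_diff k x = \<zero>\<^bsub>BB.P k\<^esub>}" using xc unfolding y(2) by simp
qed

lemma bardzell: "proj_res Env RB BB.P bardzell_diff aug"
proof (intro proj_res.intro proj_res_axioms.intro RB_module)
  show "projective_resolution Env RB (BB.P, bardzell_diff, aug)"
    unfolding projective_resolution_def prod.case
    using BB.P_projective bardzell_diff_hom aug_hom aug_surj resolution_exact_0 resolution_exact_Suc by simp
qed

end

text \<open>A space and the \<open>Env\<close>-module built on it have the same addition but are
  different records, so the derived operations, difference and finite sum, have to be
  transferred.\<close>

lemma abelian_group_ops_cong: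
  assumes G: "abelian_group G" and H: "abelian_group H" and car: "carrier G = carrier H"
    and add: "\<And>x y. x \<oplus>\<^bsub>G\<^esub> y = x \<oplus>\<^bsub>H\<^esub> y" and zero: "\<zero>\<^bsub>G\<^esub> = \<zero>\<^bsub>H\<^esub>"
  shows minus_cong: "x \<in> carrier H \<Longrightarrow> y \<in> carrier H \<Longrightarrow> x \<ominus>\<^bsub>G\<^esub> y = x \<ominus>\<^bsub>H\<^esub> y"
    and finsum_ops_cong: "finite J \<Longrightarrow> (\<And>j. j \<in> J \<Longrightarrow> f j \<in> carrier H) \<Longrightarrow> finsum G f J = finsum H f J"
proof -
  interpret G: abelian_group G by (rule G)
  interpret H: abelian_group H by (rule H)
  show "x \<ominus>\<^bsub>G\<^esub> y = x \<ominus>\<^bsub>H\<^esub> y" if "x \<in> carrier H" "y \<in> carrier H"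
  proof -
    have c: "x \<ominus>\<^bsub>G\<^esub> y \<in> carrier H" "x \<ominus>\<^bsub>H\<^esub> y \<in> carrier H"
      using G.minus_closed[of x y] H.minus_closed[of x y] that car by simp_all
    have "(x \<ominus>\<^bsub>G\<^esub> y) \<oplus>\<^bsub>H\<^esub> y = (x \<ominus>\<^bsub>H\<^esub> y) \<oplus>\<^bsub>H\<^esub> y"
      using G.minus_plus[of x y] H.minus_plus[of x y] that car add by simp
    thus ?thesis using c that by simp
  qed
  show "finsum G f J = finsum H f J" if "finite J" "\<And>j. j \<in> J \<Longrightarrow> f j \<in> carrier H"
    using that by (induction J) (simp_all add: Pi_def car add zero)
qed

context truncated_quiver begin

section \<open>Coordinates of the cochain complex\<close>

lemma RB_tens: "a \<in> carrier A \<Longrightarrow> b \<in> carrier A \<Longrightarrow> x \<in> carrier A \<Longrightarrow> BA.tens a b \<odot>\<^bsub>RB\<^esub> x = b \<otimes>\<^bsub>A\<^esub> x \<otimes>\<^bsub>A\<^esub> a"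
  unfolding regular_bimodule_eq by (rule RM.tens_act)

lemma RB_scal: "c \<in> carrier K \<Longrightarrow> x \<in> carrier A \<Longrightarrow> (c \<odot>\<^bsub>Env\<^esub> \<one>\<^bsub>Env\<^esub>) \<odot>\<^bsub>RB\<^esub> x = c \<odot>\<^bsub>A\<^esub> x"
  unfolding regular_bimodule_eq by (rule RM.env_scalar)

lemma ptake_all: "path_length p \<le> i \<Longrightarrow> ptake i p = p"
  by (simp add: ptake_def)

lemma ptake_0: "ptake 0 p = (fst p, [])"
  by (simp add: ptake_def)

lemma pdrop_all: "path_length p \<le> i \<Longrightarrow> pdrop i p = (trm p, [])"
  by (simp add: pdrop_def ptake_all)

lemma pdrop_0: "pdrop 0 p = p"
  by (simp add: pdrop_def ptake_0)

lemmas ptake_pdrop_trivial = ptake_all ptake_0 pdrop_all pdrop_0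

text \<open>The bound on lengths keeps prefix and suffix from overlapping; \<open>core\<close> is
  then the path between them.\<close>

definition inside where
  "inside p q z \<longleftrightarrow> z \<in> short_paths \<and> path_length p + path_length q \<le> path_length z \<and>
     ptake (path_length p) z = p \<and> pdrop (path_length z - path_length q) z = q"

definition core where "core i j z = ptake (path_length z - i - j) (pdrop i z)"

lemma pcat_ptake_core_pdrop:
  assumes z: "z \<in> paths Q" and le: "i + j \<le> path_length z"
  shows "pcat (ptake i z) (pcat (core i j z) (pdrop (path_length z - j) z)) = z"
    and "trm (ptake i z) = fst (core i j z)"
    and "trm (core i j z) = trm (ptake (path_length z - j) z)"
    and "core i j z \<in> paths Q"
proof -
  let ?k = "path_length z - i - j"
  have a: "take i (snd z) @ take ?k (drop i (snd z)) = take (path_length z - j) (snd z)"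
    using le by (simp add: take_add[symmetric])
  have "take i (snd z) @ take ?k (drop i (snd z)) @ drop (path_length z - j) (snd z) = snd z"
    unfolding append_assoc[symmetric] a by (rule append_take_drop_id)
  thus "pcat (ptake i z) (pcat (core i j z) (pdrop (path_length z - j) z)) = z"
    by (intro path_eqI) (simp_all add: core_def)
  show "trm (ptake i z) = fst (core i j z)" by (simp add: core_def)
  have "trm (core i j z) = trm (fst z, take i (snd z) @ take ?k (drop i (snd z)))"
    unfolding trm_append by (simp add: core_def ptake_def pdrop_def)
  thus "trm (core i j z) = trm (ptake (path_length z - j) z)" unfolding a by (simp add: ptake_def)
  show "core i j z \<in> paths Q" unfolding core_def by (rule ptake_paths[OF pdrop_paths[OF z]])
qed

lemma pcat_inside:
  assumes "inside p q z"
  shows "pcat p (pcat (core (path_length p) (path_length q) z) q) = z"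
    and "trm p = fst (core (path_length p) (path_length q) z)"
    and "trm (core (path_length p) (path_length q) z) = fst q"
proof -
  have z: "z \<in> paths Q" "path_length p + path_length q \<le> path_length z"
    and p: "ptake (path_length p) z = p" and q: "pdrop (path_length z - path_length q) z = q"
    using assms by (auto simp: inside_def short_paths_def)
  note C = pcat_ptake_core_pdrop[OF z]
  show "pcat p (pcat (core (path_length p) (path_length q) z) q) = z" using C(1) unfolding p q .
  show "trm p = fst (core (path_length p) (path_length q) z)" using C(2) unfolding p .
  have "trm (core (path_length p) (path_length q) z) = fst (pdrop (path_length z - path_length q) z)"
    unfolding C(3) by simp
  thus "trm (core (path_length p) (path_length q) z) = fst q" unfolding q .
qed

lemma inside_pcat:
  assumes "p \<in> paths Q" "u \<in> paths Q" "q \<in> paths Q" "trm p = fst u" "trm u = fst q"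
    and "path_length p + path_length u + path_length q < n"
  shows "inside p q (pcat p (pcat u q))" and "core (path_length p) (path_length q) (pcat p (pcat u q)) = u"
proof -
  have z: "pcat p (pcat u q) \<in> paths Q" using paths_pcat[of u q] paths_pcat[of p "pcat u q"] assms by simp
  have t: "ptake (path_length p) (pcat p (pcat u q)) = p" by (rule path_eqI) simp_all
  have "fst (pdrop (path_length p + path_length u) (pcat p (pcat u q))) = fst q"
    using assms(4,5) trm_append[of "fst p" "snd p" "snd u"] by (simp add: ptake_def)
  hence d: "pdrop (path_length p + path_length u) (pcat p (pcat u q)) = q"
    by (rule path_eqI) simp
  show "inside p q (pcat p (pcat u q))" using z assms(6) t d by (simp add: inside_def short_paths_def)
  show "core (path_length p) (path_length q) (pcat p (pcat u q)) = u"
    by (rule path_eqI) (use t assms(4) in \<open>simp_all add: core_def\<close>)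
qed

text \<open>Left and right multiplication by paths shifts coefficients: a short path occurs in
  \<open>p a q\<close> only if it begins with \<open>p\<close> and ends with \<open>q\<close>, and
  then its coefficient is that of the part between in \<open>a\<close>.\<close>

lemma co_sandwich:
  assumes "a \<in> carrier A" and p: "p \<in> short_paths" and q: "q \<in> short_paths"
  shows "co (path_elt p \<otimes>\<^bsub>A\<^esub> a \<otimes>\<^bsub>A\<^esub> path_elt q) z =
    (if inside p q z then co a (core (path_length p) (path_length q) z) else \<zero>\<^bsub>K\<^esub>)"
  using assms(1)
proof (induction rule: BA.A_induct)
  case zero
  thus ?case using p q by (simp add: BA.co_zero BA.path_elt_closed)
next
  case (add a b)
  have "path_elt p \<otimes>\<^bsub>A\<^esub> (a \<oplus>\<^bsub>A\<^esub> b) \<otimes>\<^bsub>A\<^esub> path_elt q = path_elt p \<otimes>\<^bsub>A\<^esub> a \<otimes>\<^bsub>A\<^esub> path_elt q \<oplus>\<^bsub>A\<^esub> path_elt p \<otimes>\<^bsub>A\<^esub> b \<otimes>\<^bsub>A\<^esub> path_elt q"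
    using add(1,2) p q by (simp add: BA.A.r_distr BA.A.l_distr BA.path_elt_closed)
  thus ?case using add p q by (simp add: BA.co_add BA.path_elt_closed)
next
  case (basis c u)
  have e: "path_elt p \<otimes>\<^bsub>A\<^esub> (c \<odot>\<^bsub>A\<^esub> path_elt u) \<otimes>\<^bsub>A\<^esub> path_elt q = c \<odot>\<^bsub>A\<^esub> (path_elt p \<otimes>\<^bsub>A\<^esub> path_elt u \<otimes>\<^bsub>A\<^esub> path_elt q)"
    using basis p q by (simp add: BA.smult_mult_l BA.smult_mult_r BA.path_elt_closed BA.KA.lsmult_closed)
  have u: "u \<in> paths Q" "p \<in> paths Q" "q \<in> paths Q" using basis(2) p q by (simp_all add: short_paths_def)
  let ?ok = "trm p = fst u \<and> trm u = fst q \<and> path_length p + path_length u + path_length q < n"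
  have m: "path_elt p \<otimes>\<^bsub>A\<^esub> path_elt u \<otimes>\<^bsub>A\<^esub> path_elt q = (if ?ok then path_elt (pcat p (pcat u q)) else \<zero>\<^bsub>A\<^esub>)"
  proof (cases "trm p = fst u \<and> path_length p + path_length u < n")
    case True
    have S: "pcat p u \<in> short_paths" using True paths_pcat u by (simp add: short_paths_def)
    have "pcat (pcat p u) q = pcat p (pcat u q)" by (simp add: pcat_def)
    thus ?thesis using True BA.path_elt_mult[OF p basis(2)] BA.path_elt_mult[OF S q] trm_pcat[of p u] by (auto simp: pm_def)
  next
    case False
    thus ?thesis using BA.path_elt_mult[OF p basis(2)] q by (auto simp: pm_def BA.path_elt_closed)
  qed
  have zc: "path_elt p \<otimes>\<^bsub>A\<^esub> path_elt u \<otimes>\<^bsub>A\<^esub> path_elt q \<in> carrier A" using p q basis by (simp add: BA.path_elt_closed)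
  have "co (path_elt p \<otimes>\<^bsub>A\<^esub> path_elt u \<otimes>\<^bsub>A\<^esub> path_elt q) z =
      (if inside p q z then basis_elt K u (core (path_length p) (path_length q) z) else \<zero>\<^bsub>K\<^esub>)"
  proof (cases ?ok)
    case True
    hence S: "pcat p (pcat u q) \<in> short_paths" using inside_pcat[of p u q] u by (simp add: inside_def)
    have "co (path_elt (pcat p (pcat u q))) z = basis_elt K (pcat p (pcat u q)) z" using BA.co_path_elt[OF S] by simp
    also have "\<dots> = (if inside p q z then basis_elt K u (core (path_length p) (path_length q) z) else \<zero>\<^bsub>K\<^esub>)"
    proof (cases "z = pcat p (pcat u q)")
      case z: True
      show ?thesis unfolding z using inside_pcat[of p u q] u True by (simp add: basis_elt_def)
    next
      case z: False
      have "core (path_length p) (path_length q) z \<noteq> u" if "inside p q z"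
        using pcat_inside(1)[OF that] z by auto
      thus ?thesis using z by (auto simp: basis_elt_def)
    qed
    finally show ?thesis using True m by simp
  next
    case False
    have "core (path_length p) (path_length q) z \<noteq> u" if i: "inside p q z"
    proof
      assume c: "core (path_length p) (path_length q) z = u"
      have "path_length z = path_length p + path_length u + path_length q"
        using arg_cong[OF pcat_inside(1)[OF i], of path_length] c by simp
      moreover have "path_length z < n" using i by (simp add: inside_def short_paths_def)
      ultimately show False using False pcat_inside(2,3)[OF i] c by simp
    qed
    moreover have "path_elt p \<otimes>\<^bsub>A\<^esub> path_elt u \<otimes>\<^bsub>A\<^esub> path_elt q = \<zero>\<^bsub>A\<^esub>" using m False by simp
    ultimately show ?thesis by (auto simp: BA.co_zero basis_elt_def)
  qed
  thus ?case unfolding e using basis zc by (simp add: BA.co_smult BA.co_path_elt BA.path_elt_closed)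
qed

section \<open>Cochains as functions on parallel pairs\<close>

definition cochain_basis where "cochain_basis m = {(p, \<gamma>). p \<in> short_paths \<and> \<gamma> \<in> res_gens m \<and> fst p = fst \<gamma> \<and> trm p = trm \<gamma>}"

lemma finite_res_gens: "finite (res_gens m)"
  by (rule finite_subset[OF _ finite_paths[of "gen_length m"]]) (auto simp: res_gens_def)

lemma finite_cochain_basis: "finite (cochain_basis m)"
  by (rule finite_subset[of _ "short_paths \<times> res_gens m"]) (auto simp: cochain_basis_def finite_short_paths finite_res_gens)

text \<open>The slice of \<open>c\<close> at \<open>\<gamma>\<close> read as an element of
  \<open>A\<close>: the value prescribed for the generator \<open>\<gamma>\<close>.\<close>

definition coeff_elt where "coeff_elt c \<gamma> = inv_into (carrier A) co (\<lambda>p. c (p, \<gamma>))"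

lemma coeff_elt:
  assumes c: "c \<in> finsupp K (cochain_basis m)"
  shows coeff_elt_closed: "coeff_elt c \<gamma> \<in> carrier A" and co_coeff_elt: "co (coeff_elt c \<gamma>) p = c (p, \<gamma>)"
proof -
  have "c (p, \<gamma>) = \<zero>\<^bsub>K\<^esub>" if "p \<notin> short_paths" for p using c that by (auto simp: finsupp_def cochain_basis_def)
  moreover from this have "finite {p. c (p, \<gamma>) \<noteq> \<zero>\<^bsub>K\<^esub>}" by (intro finite_subset[OF _ finite_short_paths]) blast
  ultimately have "(\<lambda>p. c (p, \<gamma>)) \<in> finsupp K short_paths" using c by (simp add: finsupp_def)
  hence im: "(\<lambda>p. c (p, \<gamma>)) \<in> co ` carrier A" using BA.co_bij by (simp add: bij_betw_def)
  show "coeff_elt c \<gamma> \<in> carrier A" unfolding coeff_elt_def by (rule inv_into_into[OF im])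
  show "co (coeff_elt c \<gamma>) p = c (p, \<gamma>)" using f_inv_into_f[OF im] by (simp add: coeff_elt_def)
qed

definition hom_of_cochain where "hom_of_cochain m c = BB.from_gens m RB (coeff_elt c)"

definition cochain_of_hom where
  "cochain_of_hom m f = (\<lambda>(p, \<gamma>). if \<gamma> \<in> res_gens m then co (f (basis_elt K (0, \<gamma>))) p else \<zero>\<^bsub>K\<^esub>)"

lemma hom_of_cochain_hom: "c \<in> finsupp K (cochain_basis m) \<Longrightarrow> hom_of_cochain m c \<in> lin_homs Env (BB.P m) RB"
  unfolding hom_of_cochain_def by (rule BB.from_gens_hom[OF RB_module]) (simp add: RB_simps coeff_elt_closed)

lemma gen_res_basis: "\<gamma> \<in> res_gens m \<Longrightarrow> (0, \<gamma>) \<in> res_basis m"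
  using n2 by (simp add: res_basis_def res_gens_def)

lemma hom_of_cochain_basis_vec:
  assumes c: "c \<in> finsupp K (cochain_basis m)" and y: "(s, w) \<in> res_basis m"
  shows "co (hom_of_cochain m c (basis_vec m (s, w))) z = (if inside (lft (s, w)) (rgt m (s, w)) z
    then c (core s (path_length w - s - gen_length m) z, mid m (s, w)) else \<zero>\<^bsub>K\<^esub>)"
proof -
  note D = res_basis_decomp[OF y]
  have r: "path_length (rgt m (s, w)) = path_length w - s - gen_length m" by (simp add: rgt_def)
  have "hom_of_cochain m c (basis_vec m (s, w)) = BA.tens (path_elt (rgt m (s, w))) (path_elt (lft (s, w))) \<odot>\<^bsub>RB\<^esub> coeff_elt c (mid m (s, w))"
    unfolding hom_of_cochain_def basis_vec_def using y
    by (simp add: BB.from_gens_basis[OF RB_module _ y] RB_simps coeff_elt_closed[OF c])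
  also have "\<dots> = path_elt (lft (s, w)) \<otimes>\<^bsub>A\<^esub> coeff_elt c (mid m (s, w)) \<otimes>\<^bsub>A\<^esub> path_elt (rgt m (s, w))"
    by (rule RB_tens) (use D coeff_elt_closed[OF c] in \<open>simp_all add: BA.path_elt_closed\<close>)
  finally show ?thesis
    using co_sandwich[OF coeff_elt_closed[OF c] D(5,6)] D(4) r by (simp add: co_coeff_elt[OF c])
qed

text \<open>A generator is fixed by the vertices at its two ends, hence so is its image, which
  leaves only paths parallel to \<open>\<gamma>\<close>. This is where the condition on endpoints in
  \<open>cochain_basis\<close> comes from.\<close>

lemma hom_gen_parallel:
  assumes f: "f \<in> lin_homs Env (BB.P m) RB" and \<gamma>: "\<gamma> \<in> res_gens m"
  shows "f (basis_elt K (0, \<gamma>)) \<in> carrier A"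
    and "(p, \<gamma>) \<notin> cochain_basis m \<Longrightarrow> co (f (basis_elt K (0, \<gamma>))) p = \<zero>\<^bsub>K\<^esub>"
proof -
  let ?a = "f (basis_elt K (0, \<gamma>))"
  note y = gen_res_basis[OF \<gamma>]
  note D = res_basis_decomp[OF y]
  have b: "basis_elt K (0, \<gamma>) \<in> carrier (BB.P m)" using BB.basisV[OF y] by simp
  show a: "?a \<in> carrier A" using lin_homs_closed[OF f b] by (simp add: RB_simps)
  have g: "path_length \<gamma> = gen_length m" "\<gamma> \<in> paths Q" using \<gamma> by (simp_all add: res_gens_def)
  have l: "lft (0, \<gamma>) = (fst \<gamma>, [])" by (simp add: lft_def ptake_0)
  have r: "rgt m (0, \<gamma>) = (trm \<gamma>, [])" using g by (simp add: rgt_def pdrop_all)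
  have mm: "mid m (0, \<gamma>) = \<gamma>" using g by (simp add: mid_def ptake_all pdrop_0)
  have "?a = BA.tens (path_elt (rgt m (0, \<gamma>))) (path_elt (lft (0, \<gamma>))) \<odot>\<^bsub>RB\<^esub> ?a"
    using BB.hom_basis[OF f y] by (simp add: mm)
  also have "\<dots> = path_elt (lft (0, \<gamma>)) \<otimes>\<^bsub>A\<^esub> ?a \<otimes>\<^bsub>A\<^esub> path_elt (rgt m (0, \<gamma>))"
    by (rule RB_tens) (use D a in \<open>simp_all add: BA.path_elt_closed\<close>)
  finally have e: "co ?a p = (if inside (lft (0, \<gamma>)) (rgt m (0, \<gamma>)) p then co ?a (core (path_length (lft (0, \<gamma>))) (path_length (rgt m (0, \<gamma>))) p) else \<zero>\<^bsub>K\<^esub>)" for p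
    using co_sandwich[OF a D(5,6), of p] by simp
  show "co ?a p = \<zero>\<^bsub>K\<^esub>" if "(p, \<gamma>) \<notin> cochain_basis m"
  proof -
    have "\<not> inside (lft (0, \<gamma>)) (rgt m (0, \<gamma>)) p"
    proof
      assume "inside (lft (0, \<gamma>)) (rgt m (0, \<gamma>)) p"
      hence "p \<in> short_paths" "ptake 0 p = (fst \<gamma>, [])" "pdrop (path_length p) p = (trm \<gamma>, [])" by (simp_all add: inside_def l r)
      hence "p \<in> short_paths" "fst p = fst \<gamma>" "trm p = trm \<gamma>" by (simp_all add: ptake_pdrop_trivial)
      thus False using that \<gamma> by (simp add: cochain_basis_def)
    qed
    thus ?thesis using e[of p] by simp
  qed
qed

lemma cochain_of_hom_closed: assumes f: "f \<in> lin_homs Env (BB.P m) RB" shows "cochain_of_hom m f \<in> finsupp K (cochain_basis m)"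
proof -
  have z: "cochain_of_hom m f x = \<zero>\<^bsub>K\<^esub>" if "x \<notin> cochain_basis m" for x
    using hom_gen_parallel(2)[OF f] that by (cases x) (auto simp: cochain_of_hom_def)
  have "cochain_of_hom m f x \<in> carrier K" for x
    using BA.co_carrier[OF hom_gen_parallel(1)[OF f]] by (cases x) (simp add: cochain_of_hom_def)
  moreover have "finite {x. cochain_of_hom m f x \<noteq> \<zero>\<^bsub>K\<^esub>}" by (rule finite_subset[OF _ finite_cochain_basis[of m]]) (use z in blast)
  ultimately show ?thesis using z by (simp add: finsupp_def)
qed

lemma hom_of_cochain_gen:
  assumes c: "c \<in> finsupp K (cochain_basis m)" and \<gamma>: "\<gamma> \<in> res_gens m"
  shows "hom_of_cochain m c (basis_elt K (0, \<gamma>)) = coeff_elt c \<gamma>"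
proof -
  note h = hom_gen_parallel[OF hom_of_cochain_hom[OF c] \<gamma>]
  have g: "path_length \<gamma> = gen_length m" using \<gamma> by (simp add: res_gens_def)
  have l: "lft (0, \<gamma>) = (fst \<gamma>, [])" by (simp add: lft_def ptake_0)
  have r: "rgt m (0, \<gamma>) = (trm \<gamma>, [])" using g by (simp add: rgt_def pdrop_all)
  have mm: "mid m (0, \<gamma>) = \<gamma>" using g by (simp add: mid_def ptake_all pdrop_0)
  have "co (hom_of_cochain m c (basis_elt K (0, \<gamma>))) p = c (p, \<gamma>)" for p
  proof (cases "(p, \<gamma>) \<in> cochain_basis m")
    case True
    hence "inside (fst \<gamma>, []) (trm \<gamma>, []) p" by (simp add: inside_def cochain_basis_def ptake_pdrop_trivial)
    moreover have "core 0 0 p = p" by (simp add: core_def ptake_pdrop_trivial)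
    ultimately show ?thesis using hom_of_cochain_basis_vec[OF c gen_res_basis[OF \<gamma>], of p] gen_res_basis[OF \<gamma>] g
      by (simp add: basis_vec_def l r mm)
  next
    case False
    thus ?thesis using h(2)[OF False] c by (simp add: finsupp_def)
  qed
  hence "co (hom_of_cochain m c (basis_elt K (0, \<gamma>))) = co (coeff_elt c \<gamma>)" by (simp add: fun_eq_iff co_coeff_elt[OF c])
  thus ?thesis using BA.co_eq[OF h(1) coeff_elt_closed[OF c]] by simp
qed

lemma cochain_of_hom_hom_of_cochain: assumes c: "c \<in> finsupp K (cochain_basis m)" shows "cochain_of_hom m (hom_of_cochain m c) = c"
proof
  fix x :: "('v \<times> 'e list) \<times> 'v \<times> 'e list"
  obtain p \<gamma> where x: "x = (p, \<gamma>)" by (cases x)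
  have "c (p, \<gamma>) = \<zero>\<^bsub>K\<^esub>" if "\<gamma> \<notin> res_gens m" using c that by (simp add: finsupp_def cochain_basis_def)
  thus "cochain_of_hom m (hom_of_cochain m c) x = c x" by (simp add: cochain_of_hom_def x hom_of_cochain_gen[OF c] co_coeff_elt[OF c])
qed

lemma hom_of_cochain_cochain_of_hom: assumes f: "f \<in> lin_homs Env (BB.P m) RB" shows "hom_of_cochain m (cochain_of_hom m f) = f"
proof (rule BB.hom_eqI[OF RB_module hom_of_cochain_hom[OF cochain_of_hom_closed[OF f]] f])
  fix \<gamma> assume \<gamma>: "\<gamma> \<in> res_gens m"
  have "co (coeff_elt (cochain_of_hom m f) \<gamma>) = co (f (basis_elt K (0, \<gamma>)))"
    by (rule ext) (unfold co_coeff_elt[OF cochain_of_hom_closed[OF f]], simp add: cochain_of_hom_def \<gamma>)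
  thus "hom_of_cochain m (cochain_of_hom m f) (basis_elt K (0, \<gamma>)) = f (basis_elt K (0, \<gamma>))"
    using BA.co_eq[OF coeff_elt_closed[OF cochain_of_hom_closed[OF f]] hom_gen_parallel(1)[OF f \<gamma>]]
    by (simp add: hom_of_cochain_gen[OF cochain_of_hom_closed[OF f] \<gamma>])
qed

lemma hom_of_cochain_bij: "bij_betw (hom_of_cochain m) (finsupp K (cochain_basis m)) (lin_homs Env (BB.P m) RB)"
  by (rule bij_betw_byWitness[where f' = "cochain_of_hom m"]) (use cochain_of_hom_hom_of_cochain hom_of_cochain_cochain_of_hom hom_of_cochain_hom cochain_of_hom_closed in auto)

lemma Env_kalgebra: "kalgebra K Env" by (rule BA.Env.kalgebra_axioms)

text \<open>Both sides are homomorphisms, so it is enough to compare them on generators, where the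
  values are the slices \<open>coeff_elt\<close>.\<close>

lemma hom_of_cochain_linear:
  assumes c: "c \<in> finsupp K (cochain_basis m)" and c': "c' \<in> finsupp K (cochain_basis m)" and k: "k \<in> carrier K"
    and x: "x \<in> carrier (BB.P m)"
  shows "hom_of_cochain m (\<lambda>z. c z \<oplus>\<^bsub>K\<^esub> c' z) x = hom_of_cochain m c x \<oplus>\<^bsub>RB\<^esub> hom_of_cochain m c' x"
    and "hom_of_cochain m (\<lambda>z. k \<otimes>\<^bsub>K\<^esub> c z) x = (k \<odot>\<^bsub>Env\<^esub> \<one>\<^bsub>Env\<^esub>) \<odot>\<^bsub>RB\<^esub> hom_of_cochain m c x"
proof -
  interpret F: left_module K "free_module K (cochain_basis m)" by (rule K.left_module_free)
  interpret H: left_module K "hom_space Env (BB.P m) RB"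
    by (rule kalgebra.hom_space_module[OF Env_kalgebra BB.P_module RB_module])
  have fa: "(\<lambda>z. c z \<oplus>\<^bsub>K\<^esub> c' z) \<in> finsupp K (cochain_basis m)" and fs: "(\<lambda>z. k \<otimes>\<^bsub>K\<^esub> c z) \<in> finsupp K (cochain_basis m)"
    using F.M.a_closed[of c c'] F.lsmult_closed[of k c] c c' k by (simp_all add: free_module_def)
  let ?a = "\<lambda>x\<in>carrier (BB.P m). hom_of_cochain m c x \<oplus>\<^bsub>RB\<^esub> hom_of_cochain m c' x"
  let ?s = "\<lambda>x\<in>carrier (BB.P m). (k \<odot>\<^bsub>Env\<^esub> \<one>\<^bsub>Env\<^esub>) \<odot>\<^bsub>RB\<^esub> hom_of_cochain m c x"
  have a: "?a \<in> lin_homs Env (BB.P m) RB" and s: "?s \<in> lin_homs Env (BB.P m) RB"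
    using H.M.a_closed[of "hom_of_cochain m c" "hom_of_cochain m c'"] H.lsmult_closed[of k "hom_of_cochain m c"] hom_of_cochain_hom[OF c] hom_of_cochain_hom[OF c'] k
    by (simp_all only: hom_space_def partial_object.simps ring_record_simps module.simps ring.simps)
  have "hom_of_cochain m (\<lambda>z. c z \<oplus>\<^bsub>K\<^esub> c' z) = ?a"
  proof (rule BB.hom_eqI[OF RB_module hom_of_cochain_hom[OF fa] a])
    fix \<gamma> assume \<gamma>: "\<gamma> \<in> res_gens m"
    have b: "basis_elt K (0, \<gamma>) \<in> carrier (BB.P m)" using BB.basisV[OF gen_res_basis[OF \<gamma>]] by simp
    have "co (coeff_elt (\<lambda>z. c z \<oplus>\<^bsub>K\<^esub> c' z) \<gamma>) = co (coeff_elt c \<gamma> \<oplus>\<^bsub>A\<^esub> coeff_elt c' \<gamma>)"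
      using co_coeff_elt[OF fa] co_coeff_elt[OF c] co_coeff_elt[OF c'] BA.co_add[OF coeff_elt_closed[OF c] coeff_elt_closed[OF c']]
      by (simp add: fun_eq_iff)
    hence "coeff_elt (\<lambda>z. c z \<oplus>\<^bsub>K\<^esub> c' z) \<gamma> = coeff_elt c \<gamma> \<oplus>\<^bsub>A\<^esub> coeff_elt c' \<gamma>"
      by (rule BA.co_eq[OF coeff_elt_closed[OF fa] BA.A.add.m_closed[OF coeff_elt_closed[OF c] coeff_elt_closed[OF c']]])
    thus "hom_of_cochain m (\<lambda>z. c z \<oplus>\<^bsub>K\<^esub> c' z) (basis_elt K (0, \<gamma>)) = ?a (basis_elt K (0, \<gamma>))"
      using b by (simp add: hom_of_cochain_gen[OF fa \<gamma>] hom_of_cochain_gen[OF c \<gamma>] hom_of_cochain_gen[OF c' \<gamma>] RB_simps)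
  qed
  thus "hom_of_cochain m (\<lambda>z. c z \<oplus>\<^bsub>K\<^esub> c' z) x = hom_of_cochain m c x \<oplus>\<^bsub>RB\<^esub> hom_of_cochain m c' x" using x by simp
  have "hom_of_cochain m (\<lambda>z. k \<otimes>\<^bsub>K\<^esub> c z) = ?s"
  proof (rule BB.hom_eqI[OF RB_module hom_of_cochain_hom[OF fs] s])
    fix \<gamma> assume \<gamma>: "\<gamma> \<in> res_gens m"
    have b: "basis_elt K (0, \<gamma>) \<in> carrier (BB.P m)" using BB.basisV[OF gen_res_basis[OF \<gamma>]] by simp
    have "co (coeff_elt (\<lambda>z. k \<otimes>\<^bsub>K\<^esub> c z) \<gamma>) = co (k \<odot>\<^bsub>A\<^esub> coeff_elt c \<gamma>)"
      using co_coeff_elt[OF fs] co_coeff_elt[OF c] BA.co_smult[OF k coeff_elt_closed[OF c]] by (simp add: fun_eq_iff)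
    hence "coeff_elt (\<lambda>z. k \<otimes>\<^bsub>K\<^esub> c z) \<gamma> = k \<odot>\<^bsub>A\<^esub> coeff_elt c \<gamma>"
      by (rule BA.co_eq[OF coeff_elt_closed[OF fs] BA.KA.lsmult_closed[OF k coeff_elt_closed[OF c]]])
    thus "hom_of_cochain m (\<lambda>z. k \<otimes>\<^bsub>K\<^esub> c z) (basis_elt K (0, \<gamma>)) = ?s (basis_elt K (0, \<gamma>))"
      using b by (simp add: hom_of_cochain_gen[OF fs \<gamma>] hom_of_cochain_gen[OF c \<gamma>] RB_scal[OF k coeff_elt_closed[OF c]])
  qed
  thus "hom_of_cochain m (\<lambda>z. k \<otimes>\<^bsub>K\<^esub> c z) x = (k \<odot>\<^bsub>Env\<^esub> \<one>\<^bsub>Env\<^esub>) \<odot>\<^bsub>RB\<^esub> hom_of_cochain m c x" using x by simp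
qed

lemma hom_of_cochain_add:
  assumes "c \<in> finsupp K (cochain_basis m)" "c' \<in> finsupp K (cochain_basis m)" "x \<in> carrier (BB.P m)"
  shows "hom_of_cochain m (\<lambda>z. c z \<oplus>\<^bsub>K\<^esub> c' z) x = hom_of_cochain m c x \<oplus>\<^bsub>RB\<^esub> hom_of_cochain m c' x"
  by (rule hom_of_cochain_linear(1)[OF assms(1,2) K.zero_closed assms(3)])

lemma hom_of_cochain_smult:
  assumes "c \<in> finsupp K (cochain_basis m)" "k \<in> carrier K" "x \<in> carrier (BB.P m)"
  shows "hom_of_cochain m (\<lambda>z. k \<otimes>\<^bsub>K\<^esub> c z) x = (k \<odot>\<^bsub>Env\<^esub> \<one>\<^bsub>Env\<^esub>) \<odot>\<^bsub>RB\<^esub> hom_of_cochain m c x"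
  by (rule hom_of_cochain_linear(2)[OF assms(1,1,2,3)])

definition cochain_diff where "cochain_diff m c = cochain_of_hom (Suc m) (\<lambda>x\<in>carrier (BB.P (Suc m)). hom_of_cochain m c (bardzell_diff m x))"

lemma comp_hom: "c \<in> finsupp K (cochain_basis m) \<Longrightarrow> (\<lambda>x\<in>carrier (BB.P (Suc m)). hom_of_cochain m c (bardzell_diff m x)) \<in> lin_homs Env (BB.P (Suc m)) RB"
  by (rule lin_homs_compose[OF BB.P_module bardzell_diff_hom hom_of_cochain_hom])

lemma cochain_diff_closed: "c \<in> finsupp K (cochain_basis m) \<Longrightarrow> cochain_diff m c \<in> finsupp K (cochain_basis (Suc m))"
  unfolding cochain_diff_def by (rule cochain_of_hom_closed[OF comp_hom])

lemma hom_of_cochain_cochain_diff: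
  assumes "c \<in> finsupp K (cochain_basis m)" "x \<in> carrier (BB.P (Suc m))"
  shows "hom_of_cochain (Suc m) (cochain_diff m c) x = hom_of_cochain m c (bardzell_diff m x)"
  unfolding cochain_diff_def hom_of_cochain_cochain_of_hom[OF comp_hom[OF assms(1)]] using assms(2) by simp

definition ker_dim where
  "ker_dim m = vectorspace.dim K ((free_module K (cochain_basis m))\<lparr>carrier := {c \<in> finsupp K (cochain_basis m). cochain_diff m c = (\<lambda>_. \<zero>\<^bsub>K\<^esub>)}\<rparr>)"

lemma ext_algebra_RB: "ext_algebra K Env RB RB"
  by (intro ext_algebra.intro Env_kalgebra RB_module)

lemma HH_dim:
  shows "vectorspace K (HH K A m)" and "vectorspace.fin_dim K (HH K A m)"
    and "vectorspace.dim K (HH K A 0) = ker_dim 0"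
    and "vectorspace.dim K (HH K A (Suc m)) + card (cochain_basis m) = ker_dim (Suc m) + ker_dim m"
proof -
  interpret E: ext_algebra K Env RB RB by (rule ext_algebra_RB)
  note E = E.Ext_dim[where X = cochain_basis and \<delta> = cochain_diff and \<Phi> = hom_of_cochain and P' = BB.P and d' = bardzell_diff and \<epsilon>' = aug,
      OF bardzell finite_cochain_basis cochain_diff_closed hom_of_cochain_bij hom_of_cochain_add hom_of_cochain_smult hom_of_cochain_cochain_diff]
  show "vectorspace K (HH K A m)" unfolding HH_def by (rule E(1))
  show "vectorspace.fin_dim K (HH K A m)" unfolding HH_def by (rule E(2))
  show "vectorspace.dim K (HH K A 0) = ker_dim 0" unfolding HH_def ker_dim_def by (rule E(3))
  show "vectorspace.dim K (HH K A (Suc m)) + card (cochain_basis m) = ker_dim (Suc m) + ker_dim m"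
    unfolding HH_def ker_dim_def by (rule E(4))
qed

section \<open>The differential in coordinates\<close>

lemma cochain_diff_eq: "(p, \<gamma>) \<in> cochain_basis (Suc m) \<Longrightarrow> c \<in> finsupp K (cochain_basis m) \<Longrightarrow> cochain_diff m c (p, \<gamma>) = co (hom_of_cochain m c (gen_diff m (0, \<gamma>))) p"
proof -
  assume x: "(p, \<gamma>) \<in> cochain_basis (Suc m)"
  hence g: "\<gamma> \<in> res_gens (Suc m)" by (simp add: cochain_basis_def)
  have b: "basis_elt K (0, \<gamma>) \<in> carrier (BB.P (Suc m))" using BB.basisV[OF gen_res_basis[OF g]] by simp
  show ?thesis using g b by (simp add: cochain_diff_def cochain_of_hom_def bardzell_diff_basis[OF gen_res_basis[OF g]])
qed

lemma co_minus:
  assumes a: "a \<in> carrier A" and b: "b \<in> carrier A"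
  shows "co (a \<ominus>\<^bsub>A\<^esub> b) p = co a p \<ominus>\<^bsub>K\<^esub> co b p"
proof -
  have "co (a \<ominus>\<^bsub>A\<^esub> b) p \<oplus>\<^bsub>K\<^esub> co b p = co ((a \<ominus>\<^bsub>A\<^esub> b) \<oplus>\<^bsub>A\<^esub> b) p"
    using BA.co_add[OF BA.A.minus_closed[OF a b] b] by simp
  also have "(a \<ominus>\<^bsub>A\<^esub> b) \<oplus>\<^bsub>A\<^esub> b = a" using a b by (simp add: a_minus_def BA.A.a_assoc BA.A.l_neg)
  finally have e: "co a p = co (a \<ominus>\<^bsub>A\<^esub> b) p \<oplus>\<^bsub>K\<^esub> co b p" by (rule sym)
  have "co (a \<ominus>\<^bsub>A\<^esub> b) p \<in> carrier K" "co b p \<in> carrier K"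
    using BA.co_carrier[OF BA.A.minus_closed[OF a b]] BA.co_carrier[OF b] by auto
  thus ?thesis unfolding e by (simp add: a_minus_def K.a_assoc K.r_neg)
qed

lemma P_minus: "x \<in> carrier (BB.V m) \<Longrightarrow> y \<in> carrier (BB.V m) \<Longrightarrow> x \<ominus>\<^bsub>BB.P m\<^esub> y = x \<ominus>\<^bsub>BB.V m\<^esub> y"
  by (rule minus_cong[OF left_module.axioms(2)[OF BB.P_module] left_module.axioms(2)[OF BB.V_module]]) simp_all

lemma P_finsum: "finite J \<Longrightarrow> (\<And>j. j \<in> J \<Longrightarrow> f j \<in> carrier (BB.V m)) \<Longrightarrow> finsum (BB.P m) f J = finsum (BB.V m) f J"
  by (rule finsum_ops_cong[OF left_module.axioms(2)[OF BB.P_module] left_module.axioms(2)[OF BB.V_module]]) simp_all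

lemma RB_minus: "x \<in> carrier A \<Longrightarrow> y \<in> carrier A \<Longrightarrow> x \<ominus>\<^bsub>RB\<^esub> y = x \<ominus>\<^bsub>A\<^esub> y"
  by (rule minus_cong[OF left_module.axioms(2)[OF RB_module] BA.A.abelian_group_axioms]) (simp_all add: RB_simps)

lemma RB_finsum: "finite J \<Longrightarrow> (\<And>j. j \<in> J \<Longrightarrow> f j \<in> carrier A) \<Longrightarrow> finsum RB f J = finsum A f J"
  by (rule finsum_ops_cong[OF left_module.axioms(2)[OF RB_module] BA.A.abelian_group_axioms]) (simp_all add: RB_simps)

text \<open>The term \<open>a \<otimes> \<gamma>'\<close> of the differential contributes to the
  coefficient of \<open>p\<close> only if \<open>p\<close> begins with \<open>a\<close>, the first
  arrow of \<open>\<gamma>\<close>, and dually for the last arrow. This is how starting and ending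
  together enter cohomology.\<close>

lemma cochain_diff_even:
  assumes m: "even m" and c: "c \<in> finsupp K (cochain_basis m)" and x: "(p, \<gamma>) \<in> cochain_basis (Suc m)"
  shows "cochain_diff m c (p, \<gamma>) =
    (if starts_together (p, \<gamma>) then c (pdrop 1 p, pdrop 1 \<gamma>) else \<zero>\<^bsub>K\<^esub>) \<ominus>\<^bsub>K\<^esub>
    (if ends_together (p, \<gamma>) then c (ptake (path_length p - 1) p, ptake (path_length \<gamma> - 1) \<gamma>) else \<zero>\<^bsub>K\<^esub>)"
proof -
  have h: "p \<in> short_paths" "\<gamma> \<in> paths Q" "path_length \<gamma> = gen_length m + 1" "fst p = fst \<gamma>" "trm p = trm \<gamma>"
    using x gen_length_even[OF m] by (simp_all add: cochain_basis_def res_gens_def)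
  have B: "(1, \<gamma>) \<in> res_basis m" "(0, \<gamma>) \<in> res_basis m" using h n2 by (simp_all add: res_basis_iff)
  have PE: "hom_of_cochain m c (basis_vec m y) \<in> carrier A" for y
    using lin_homs_closed[OF hom_of_cochain_hom[OF c], of "basis_vec m y"] basis_vec_closed by (simp add: RB_simps)
  have ne: "snd \<gamma> \<noteq> []" using h(3) by auto
  have i1: "inside (lft (1, \<gamma>)) (rgt m (1, \<gamma>)) p \<longleftrightarrow> starts_together (p, \<gamma>)"
  proof -
    have "rgt m (1, \<gamma>) = (trm \<gamma>, [])" using h(3) by (simp add: rgt_def pdrop_all)
    moreover have "pdrop (path_length p) p = (trm \<gamma>, [])" using h(5) by (simp add: pdrop_all)
    moreover have "Suc 0 \<le> path_length p \<and> ptake (Suc 0) p = ptake (Suc 0) \<gamma> \<longleftrightarrow> starts_together (p, \<gamma>)"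
      using h(4) ne by (cases "snd p"; cases "snd \<gamma>") (auto simp: starts_together_def ptake_def split_beta)
    moreover have "path_length (lft (1, \<gamma>)) = 1" "lft (1, \<gamma>) = ptake 1 \<gamma>" using h(3) by (simp_all add: lft_def)
    ultimately show ?thesis using h(1) by (simp add: inside_def)
  qed
  \<comment> \<open>Remainders record their starting vertex, so it has to be identified before
    equality of last pieces becomes equality of last arrows.\<close>
  have tl: "trm (ptake (path_length p - 1) p) = tail Q (last (snd p))" if "p \<in> paths Q" "snd p \<noteq> []" for p
  proof -
    have "snd p = butlast (snd p) @ [last (snd p)]" using that(2) by simp
    hence "(fst p, butlast (snd p) @ [last (snd p)]) \<in> paths Q" using that(1) by simp
    hence "(trm (fst p, butlast (snd p)), [last (snd p)]) \<in> paths Q" unfolding paths_append by blast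
    hence "trm (fst p, butlast (snd p)) = tail Q (last (snd p))"
      unfolding paths_iff by (simp add: Q.awalk_Cons_iff)
    thus ?thesis by (simp add: ptake_def butlast_conv_take)
  qed
  have i0: "inside (lft (0, \<gamma>)) (rgt m (0, \<gamma>)) p \<longleftrightarrow> ends_together (p, \<gamma>)"
  proof -
    have l: "lft (0, \<gamma>) = (fst \<gamma>, [])" by (simp add: lft_def ptake_0)
    have r: "rgt m (0, \<gamma>) = pdrop (path_length \<gamma> - 1) \<gamma>" "path_length (pdrop (path_length \<gamma> - 1) \<gamma>) = 1"
      using h(3) by (simp_all add: rgt_def)
    have lst: "drop (length as - 1) as = [last as]" if "as \<noteq> []" for as :: "'e list"
      using that by (cases as rule: rev_cases) auto
    have "1 \<le> path_length p \<and> pdrop (path_length p - 1) p = pdrop (path_length \<gamma> - 1) \<gamma> \<longleftrightarrow> ends_together (p, \<gamma>)"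
    proof (cases "snd p = []")
      case False
      hence l1: "1 \<le> path_length p" by (cases "snd p") auto
      have pP: "p \<in> paths Q" using h(1) by (simp add: short_paths_def)
      have "pdrop (path_length p - 1) p = (tail Q (last (snd p)), [last (snd p)])"
        "pdrop (path_length \<gamma> - 1) \<gamma> = (tail Q (last (snd \<gamma>)), [last (snd \<gamma>)])"
        using tl[OF pP False] tl[OF h(2) ne] lst[OF False] lst[OF ne] by (simp_all add: pdrop_def)
      thus ?thesis using False ne l1 by (auto simp: ends_together_def)
    qed (simp add: ends_together_def)
    moreover have "ptake 0 p = (fst \<gamma>, [])" using h(4) by (simp add: ptake_0)
    ultimately show ?thesis using h(1) unfolding inside_def l r by simp
  qed
  have m1: "mid m (1, \<gamma>) = pdrop 1 \<gamma>" using h(3) by (simp add: mid_def ptake_all)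
  have m0: "mid m (0, \<gamma>) = ptake (path_length \<gamma> - 1) \<gamma>" using h(3) by (simp add: mid_def pdrop_0)
  have c1: "core 1 (path_length \<gamma> - 1 - gen_length m) p = pdrop 1 p" using h(3) by (simp add: core_def ptake_all)
  have c0: "core 0 (path_length \<gamma> - 0 - gen_length m) p = ptake (path_length p - 1) p" using h(3) by (simp add: core_def pdrop_0)
  have "cochain_diff m c (p, \<gamma>) = co (hom_of_cochain m c (basis_vec m (1, \<gamma>) \<ominus>\<^bsub>BB.V m\<^esub> basis_vec m (0, \<gamma>))) p"
    using cochain_diff_eq[OF x c] m by (simp add: gen_diff_def)
  also have "hom_of_cochain m c (basis_vec m (1, \<gamma>) \<ominus>\<^bsub>BB.V m\<^esub> basis_vec m (0, \<gamma>)) = hom_of_cochain m c (basis_vec m (1, \<gamma>)) \<ominus>\<^bsub>A\<^esub> hom_of_cochain m c (basis_vec m (0, \<gamma>))"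
    using lin_homs_minus[OF BB.P_module RB_module hom_of_cochain_hom[OF c], of "basis_vec m (1, \<gamma>)" "basis_vec m (0, \<gamma>)"] basis_vec_closed
    by (simp add: P_minus RB_minus PE)
  also have "co \<dots> p = co (hom_of_cochain m c (basis_vec m (1, \<gamma>))) p \<ominus>\<^bsub>K\<^esub> co (hom_of_cochain m c (basis_vec m (0, \<gamma>))) p"
    by (rule co_minus[OF PE PE])
  finally show ?thesis unfolding hom_of_cochain_basis_vec[OF c B(1)] hom_of_cochain_basis_vec[OF c B(2)] i1 i0 m1 m0 c1 c0 .
qed

text \<open>The two outer factors of each term have total length \<open>n - 1\<close>. A path of
  length below \<open>n\<close> that contains both has length exactly \<open>n - 1\<close> and an
  empty middle, so \<open>c\<close> is evaluated only at pairs whose first path is a vertex.\<close>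

lemma cochain_diff_odd:
  assumes m: "odd m" and c: "c \<in> finsupp K (cochain_basis m)" and x: "(p, \<gamma>) \<in> cochain_basis (Suc m)"
  shows "cochain_diff m c (p, \<gamma>) = (\<Oplus>\<^bsub>K\<^esub>j\<in>{..<n}. if path_length p = n - 1 \<and> ptake j p = ptake j \<gamma> \<and> pdrop j p = pdrop (j + gen_length m) \<gamma>
    then c (ptake 0 (pdrop j p), ptake (gen_length m) (pdrop j \<gamma>)) else \<zero>\<^bsub>K\<^esub>)"
proof -
  have h: "p \<in> short_paths" "\<gamma> \<in> paths Q" "path_length \<gamma> = gen_length m + n - 1" "fst p = fst \<gamma>" "trm p = trm \<gamma>"
    using x gen_length_odd[OF m] by (simp_all add: cochain_basis_def res_gens_def)
  have pn: "path_length p < n" using h(1) by (simp add: short_paths_def)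
  have B: "(j, \<gamma>) \<in> res_basis m" if "j < n" for j using h(2,3) n2 that by (auto simp: res_basis_iff)
  have PE: "hom_of_cochain m c (basis_vec m y) \<in> carrier A" for y
    using lin_homs_closed[OF hom_of_cochain_hom[OF c], of "basis_vec m y"] basis_vec_closed by (simp add: RB_simps)
  have co_sum: "co (finsum A a J) p = (\<Oplus>\<^bsub>K\<^esub>j\<in>J. co (a j) p)" if "finite J" "\<And>j. a j \<in> carrier A" for a and J :: "nat set"
    using that(1) by (induction J) (use that(2) in \<open>simp_all add: BA.co_zero BA.co_add BA.co_carrier Pi_def\<close>)
  have e: "co (hom_of_cochain m c (basis_vec m (j, \<gamma>))) p = (if path_length p = n - 1 \<and> ptake j p = ptake j \<gamma> \<and> pdrop j p = pdrop (j + gen_length m) \<gamma>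
    then c (ptake 0 (pdrop j p), ptake (gen_length m) (pdrop j \<gamma>)) else \<zero>\<^bsub>K\<^esub>)" if j: "j < n" for j
  proof -
    have l: "lft (j, \<gamma>) = ptake j \<gamma>" "rgt m (j, \<gamma>) = pdrop (j + gen_length m) \<gamma>" "mid m (j, \<gamma>) = ptake (gen_length m) (pdrop j \<gamma>)"
      by (simp_all add: lft_def rgt_def mid_def)
    have len: "path_length (ptake j \<gamma>) = j" "path_length (pdrop (j + gen_length m) \<gamma>) = n - 1 - j" using h(3) j by auto
    have i: "inside (lft (j, \<gamma>)) (rgt m (j, \<gamma>)) p \<longleftrightarrow> path_length p = n - 1 \<and> ptake j p = ptake j \<gamma> \<and> pdrop j p = pdrop (j + gen_length m) \<gamma>"
    proof -
      have "j + (n - 1 - j) = n - 1" using j by simp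
      moreover have "path_length p - (n - 1 - j) = j" if "path_length p = n - 1" using that j by simp
      moreover have "n - 1 \<le> path_length p \<longleftrightarrow> path_length p = n - 1" using pn by auto
      ultimately show ?thesis using h(1) unfolding inside_def l len by metis
    qed
    have k: "core j (path_length \<gamma> - j - gen_length m) p = ptake 0 (pdrop j p)" if "path_length p = n - 1"
      using that h(3) j by (simp add: core_def)
    show ?thesis unfolding hom_of_cochain_basis_vec[OF c B[OF j]] i l(3) by (rule if_cong[OF refl _ refl]) (use k in simp)
  qed
  have "cochain_diff m c (p, \<gamma>) = co (hom_of_cochain m c (finsum (BB.P m) (\<lambda>j. basis_vec m (j, \<gamma>)) {..<n})) p"
    using cochain_diff_eq[OF x c] m basis_vec_closed by (simp add: gen_diff_def P_finsum)
  also have "hom_of_cochain m c (finsum (BB.P m) (\<lambda>j. basis_vec m (j, \<gamma>)) {..<n}) = finsum RB (\<lambda>j. hom_of_cochain m c (basis_vec m (j, \<gamma>))) {..<n}"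
    by (rule lin_homs_finsum[OF BB.P_module RB_module hom_of_cochain_hom[OF c]]) (use basis_vec_closed in simp_all)
  also have "\<dots> = finsum A (\<lambda>j. hom_of_cochain m c (basis_vec m (j, \<gamma>))) {..<n}"
    by (rule RB_finsum) (use PE in auto)
  also have "co \<dots> p = (\<Oplus>\<^bsub>K\<^esub>j\<in>{..<n}. co (hom_of_cochain m c (basis_vec m (j, \<gamma>))) p)" by (rule co_sum) (use PE in auto)
  also have "\<dots> = (\<Oplus>\<^bsub>K\<^esub>j\<in>{..<n}. if path_length p = n - 1 \<and> ptake j p = ptake j \<gamma> \<and> pdrop j p = pdrop (j + gen_length m) \<gamma>
    then c (ptake 0 (pdrop j p), ptake (gen_length m) (pdrop j \<gamma>)) else \<zero>\<^bsub>K\<^esub>)"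
    by (rule K.finsum_cong') (use e c in \<open>auto simp: finsupp_def\<close>)
  finally show ?thesis .
qed

section \<open>Closed walks\<close>

lemma trm_Cons: "trm (u, e # es) = trm (head Q e, es)"
  by (cases es) (simp_all add: terminus_def)

lemma paths_Cons: "(u, e # es) \<in> paths Q \<longleftrightarrow> e \<in> arcs Q \<and> u = tail Q e \<and> (head Q e, es) \<in> paths Q"
  unfolding paths_def by (auto simp: Q.awalk_Cons_iff)

lemma paths_Nil: "(u, []) \<in> paths Q \<longleftrightarrow> u \<in> verts Q"
  unfolding paths_def by (auto simp: Q.awalk_Nil_iff)

lemma arc_path: "e \<in> arcs Q \<Longrightarrow> (tail Q e, [e]) \<in> paths Q"
  by (simp add: paths_Cons paths_Nil)

text \<open>A closed walk unrolled over all natural numbers, which removes the arithmetic of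
  wrapping round. \<open>N\<close> is a period, not necessarily the least one.\<close>

definition periodic_walk where
  "periodic_walk g vt N \<longleftrightarrow> 0 < N \<and> (\<forall>s. g s \<in> arcs Q \<and> tail Q (g s) = vt s \<and> head Q (g s) = vt (Suc s) \<and>
     g (s + N) = g s \<and> vt (s + N) = vt s)"

definition segment where "segment g vt s l = (vt s, map g [s..<s + l])"

lemma pwD:
  assumes "periodic_walk g vt N"
  shows "0 < N" "g s \<in> arcs Q" "tail Q (g s) = vt s" "head Q (g s) = vt (Suc s)"
    "g (s + N) = g s" "vt (s + N) = vt s" "vt s \<in> verts Q"
  using assms Q.tail_in_verts[of "g s"] by (auto simp: periodic_walk_def)

lemma periodic_walk_periodic: "periodic_walk g vt N \<Longrightarrow> g (s + N * k) = g s \<and> vt (s + N * k) = vt s"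
proof (induction k)
  case (Suc k)
  thus ?case using pwD(5,6)[of g vt N "s + N * k"] by (simp add: add.assoc[symmetric] add.commute add.left_commute)
qed simp

lemma segment_path:
  assumes "periodic_walk g vt N"
  shows "segment g vt s l \<in> paths Q \<and> trm (segment g vt s l) = vt (s + l)"
proof (induction l)
  case 0
  thus ?case using pwD(7)[OF assms] by (simp add: segment_def paths_Nil)
next
  case (Suc l)
  have e: "segment g vt s (Suc l) = (vt s, map g [s..<s + l] @ [g (s + l)])" by (simp add: segment_def)
  show ?case using Suc arc_path[OF pwD(2)[OF assms, of "s + l"]] pwD(3,4)[OF assms, of "s + l"]
    unfolding e paths_append trm_append by (simp add: segment_def trm_Cons)
qed

lemma segment_simps [simp]: "fst (segment g vt s l) = vt s" "snd (segment g vt s l) = map g [s..<s + l]"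
  by (simp_all add: segment_def)

lemma ptake_segment: "j \<le> l \<Longrightarrow> ptake j (segment g vt s l) = segment g vt s j"
  by (simp add: ptake_def take_map segment_def)

lemma pdrop_segment:
  assumes "periodic_walk g vt N" "j \<le> l"
  shows "pdrop j (segment g vt s l) = segment g vt (s + j) (l - j)"
  using segment_path[OF assms(1), of s j] ptake_segment[OF assms(2), of g vt s] assms(2)
  by (intro path_eqI) (simp_all add: drop_map drop_upt)

lemma segment_shift: "periodic_walk g vt N \<Longrightarrow> segment g vt (s + N) l = segment g vt s l"
proof -
  assume p: "periodic_walk g vt N"
  have "g (s + N + i) = g (s + i)" for i using pwD(5)[OF p, of "s + i"] by (simp add: add.commute add.left_commute)
  hence "map g [s + N..<s + N + l] = map g [s..<s + l]" by (intro nth_equalityI) simp_all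
  thus ?thesis using pwD(6)[OF p] by (simp add: segment_def)
qed

lemma ptake_pcat_le: "j \<le> path_length u \<Longrightarrow> ptake j (pcat u w) = ptake j u"
  by (rule path_eqI) simp_all

lemma pdrop_pcat_le: "j \<le> path_length u \<Longrightarrow> pdrop j (pcat u w) = pcat (pdrop j u) w"
  by (rule path_eqI) (simp_all add: ptake_pcat_le)

lemma ptake_pcat_Cons: "ptake (Suc i) (pcat (v, [b]) w) = pcat (v, [b]) (ptake i w)"
  by (rule path_eqI) simp_all

lemma pdrop_pcat_Cons: "head Q b = fst w \<Longrightarrow> pdrop (Suc i) (pcat (v, [b]) w) = pdrop i w"
  by (rule path_eqI) (simp_all add: ptake_def trm_Cons)

lemma closed_walk_periodic_walk:
  assumes w: "(v, as) \<in> paths Q" and c: "trm (v, as) = v" and ne: "as \<noteq> []"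
  obtains g vt where "periodic_walk g vt (length as)" "segment g vt 0 (length as) = (v, as)"
proof
  let ?N = "length as"
  define g where "g s = as ! (s mod ?N)" for s
  define vt where "vt s = tail Q (g s)" for s
  have N: "0 < ?N" using ne by simp
  have ar: "g s \<in> arcs Q" for s
  proof -
    have "set as \<subseteq> arcs Q" using w by (auto simp: paths_def Q.awalk_def)
    thus ?thesis using N nth_mem[of "s mod ?N" as] by (auto simp: g_def)
  qed
  have hd0: "tail Q (as ! 0) = v" using w ne by (cases as) (simp_all add: paths_Cons)
  have cons: "head Q (as ! i) = tail Q (as ! Suc i)" if "Suc i < ?N" for i
  proof -
    have "as = take i as @ as ! i # as ! Suc i # drop (Suc (Suc i)) as"
      using that by (simp add: Cons_nth_drop_Suc)
    hence "(v, take i as @ as ! i # as ! Suc i # drop (Suc (Suc i)) as) \<in> paths Q" using w by simp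
    thus ?thesis by (simp add: paths_append paths_Cons)
  qed
  have lst: "head Q (as ! (?N - 1)) = v"
  proof -
    have "as = butlast as @ [as ! (?N - 1)]" using append_butlast_last_id[OF ne] last_conv_nth[OF ne] by simp
    hence "trm (v, butlast as @ [as ! (?N - 1)]) = v" using c by simp
    thus ?thesis by (simp add: trm_append trm_Cons)
  qed
  have "head Q (g s) = vt (Suc s)" for s
  proof (cases "Suc (s mod ?N) = ?N")
    case True
    hence "Suc s mod ?N = 0" "s mod ?N = ?N - 1" by (simp_all add: mod_Suc)
    thus ?thesis using lst hd0 by (simp add: vt_def g_def)
  next
    case False
    have "s mod ?N < ?N" using N by simp
    hence "Suc (s mod ?N) < ?N" using False by simp
    thus ?thesis using cons[of "s mod ?N"] False by (simp add: vt_def g_def mod_Suc)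
  qed
  thus "periodic_walk g vt ?N" using N ar by (simp add: periodic_walk_def vt_def g_def)
  have "map g [0..<?N] = as" by (rule nth_equalityI) (simp_all add: g_def)
  thus "segment g vt 0 ?N = (v, as)" using hd0 N by (simp add: segment_def vt_def g_def)
qed

text \<open>A step in the symmetrised digraph cannot leave a set that contains both ends of an arc
  or neither.\<close>

lemma connected_closed:
  assumes con: "connected Q" and V: "V \<subseteq> verts Q" "V \<noteq> {}"
    and cl: "\<And>e. e \<in> arcs Q \<Longrightarrow> tail Q e \<in> V \<longleftrightarrow> head Q e \<in> V"
  shows "V = verts Q"
proof
  show "verts Q \<subseteq> V"
  proof
    fix v assume v: "v \<in> verts Q"
    obtain u where u: "u \<in> V" using V by blast
    have vS: "verts (with_proj (mk_symmetric Q)) = verts Q" by (simp add: mk_symmetric_def)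
    have "u \<rightarrow>\<^sup>*\<^bsub>with_proj (mk_symmetric Q)\<^esub> v"
      using con u v V unfolding connected_def strongly_connected_def vS by blast
    hence "(u, v) \<in> rtrancl_on (verts Q) (arcs_ends (with_proj (mk_symmetric Q)))"
      unfolding reachable_def vS .
    thus "v \<in> V"
    proof (induction rule: rtrancl_on_induct)
      case (step y z)
      thus ?case using cl by (auto simp: arcs_ends_def arc_to_ends_def mk_symmetric_def)
    qed (rule u)
  qed
qed (rule V)

text \<open>If the walk meets no foreign arc, its set of vertices is closed under adjacency in both
  directions.\<close>

lemma periodic_walk_all:
  assumes con: "connected Q" and p: "periodic_walk g vt N"
    and na: "\<And>k b. b \<in> arcs Q \<Longrightarrow> tail Q b = vt k \<or> head Q b = vt (Suc k) \<Longrightarrow> b = g k"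
  shows "range vt = verts Q" and "range g = arcs Q"
proof -
  show V: "range vt = verts Q"
  proof (rule connected_closed[OF con])
    fix e assume e: "e \<in> arcs Q"
    have "head Q e \<in> range vt" if "tail Q e = vt k" for k
      using na[OF e, of k] that pwD(4)[OF p, of k] by auto
    moreover have "tail Q e \<in> range vt" if "head Q e = vt k" for k
    proof -
      \<comment> \<open>One period is added before stepping back, so that the predecessor exists
        also for \<open>k = 0\<close>.\<close>
      have "vt k = vt (Suc (k + N - 1))" using pwD(1)[OF p] pwD(6)[OF p, of k] by simp
      hence "e = g (k + N - 1)" using na[OF e, of "k + N - 1"] that by simp
      thus ?thesis using pwD(3)[OF p] by simp
    qed
    ultimately show "tail Q e \<in> range vt \<longleftrightarrow> head Q e \<in> range vt" by blast
  qed (use pwD(7)[OF p] in auto)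
  have "e \<in> range g" if e: "e \<in> arcs Q" for e
  proof -
    have "tail Q e \<in> range vt" using e V Q.tail_in_verts by simp
    then obtain k where "tail Q e = vt k" by blast
    thus ?thesis using na[OF e, of k] by blast
  qed
  thus "range g = arcs Q" using pwD(2)[OF p] by blast
qed

text \<open>Without such an arc the walk covers the quiver, and each arrow is determined by its tail
  as well as by its head. The walk may revisit vertices or wind round several times, so a cycle
  without self-intersection is extracted, and by the same covering argument it is the whole
  quiver.\<close>

lemma alternate_arc:
  assumes con: "connected Q" and nb: "\<not> is_basic_cycle Q" and p: "periodic_walk g vt N"
  obtains k b where "b \<in> arcs Q" "b \<noteq> g k" "tail Q b = vt k \<or> head Q b = vt (Suc k)"
proof (rule ccontr)
  assume no: "\<not> thesis"
  note main = that
  have na: "b = g k" if "b \<in> arcs Q" "tail Q b = vt k \<or> head Q b = vt (Suc k)" for k b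
    using main[of b k] no that by blast
  have ra: "range g = arcs Q" by (rule periodic_walk_all(2)[OF con p]) (rule na)
  \<comment> \<open>This determinacy no longer mentions the walk, so it passes on to the extracted
    cycle.\<close>
  have ut: "b = b'" if bb: "b \<in> arcs Q" "b' \<in> arcs Q" "tail Q b = tail Q b' \<or> head Q b = head Q b'" for b b'
  proof -
    have "b \<in> range g" unfolding ra by (rule bb(1))
    then obtain k where k: "b = g k" by blast
    have "b' = g k" by (rule na[OF bb(2)]) (use bb(3) k pwD(3,4)[OF p, of k] in auto)
    thus ?thesis using k by simp
  qed
  have S: "segment g vt 0 N \<in> paths Q" "trm (segment g vt 0 N) = vt N" using segment_path[OF p, of 0 N] by simp_all
  have "Q.awalk (vt 0) (map g [0..<N]) (vt N)" using S(1) unfolding paths_iff S(2) by simp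
  hence "Q.closed_w (map g [0..<N])"
    unfolding Q.closed_w_def using pwD(1)[OF p] pwD(6)[OF p, of 0] by (intro exI[of _ "vt 0"]) simp
  then obtain c where c: "Q.cycle c" using Q.closed_w_imp_cycle by blast
  then obtain u where u: "Q.awalk u c u" "c \<noteq> []" unfolding Q.cycle_def by blast
  have uc: "(u, c) \<in> paths Q" unfolding paths_def using u(1) by blast
  have tu: "trm (u, c) = u" using u(1) by (auto simp: terminus_def)
  obtain g' vt' where p': "periodic_walk g' vt' (length c)" and sc: "segment g' vt' 0 (length c) = (u, c)"
    by (rule closed_walk_periodic_walk[OF uc tu u(2)])
  have na': "b = g' k" if "b \<in> arcs Q" "tail Q b = vt' k \<or> head Q b = vt' (Suc k)" for k b
    using ut[OF that(1) pwD(2)[OF p', of k]] that(2) pwD(3,4)[OF p', of k] by auto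
  have ra': "range g' = arcs Q" by (rule periodic_walk_all(2)[OF con p']) (rule na')
  have rv': "range vt' = verts Q" by (rule periodic_walk_all(1)[OF con p']) (rule na')
  have cm: "map g' [0..<length c] = c" using arg_cong[OF sc, of snd] by simp
  have nth: "c ! i = g' i" if "i < length c" for i
  proof -
    have "map g' [0..<length c] ! i = g' i" using that by simp
    thus ?thesis unfolding cm .
  qed
  have gc: "g' s \<in> set c" for s
  proof -
    have "g' s = g' (s mod length c)" using conjunct1[OF periodic_walk_periodic[OF p', of "s mod length c" "s div length c"]]
      unfolding mod_mult_div_eq .
    also have "\<dots> = c ! (s mod length c)" using nth u(2) by simp
    finally have e: "g' s = c ! (s mod length c)" .
    show ?thesis unfolding e by (rule nth_mem) (use u(2) in simp)
  qed
  have "range g' \<subseteq> set c" using gc by (rule image_subsetI)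
  hence "arcs Q \<subseteq> set c" unfolding ra' .
  moreover have "set c \<subseteq> arcs Q" using u(1) by (simp add: Q.awalk_def)
  ultimately have sa: "set c = arcs Q" by (simp only: set_eq_subset)
  have "hd c = g' 0" using u(2) nth[of 0] by (simp add: hd_conv_nth)
  hence hu: "tail Q (hd c) = u" using pwD(3)[OF p', of 0] arg_cong[OF sc, of fst] by simp
  have "set (Q.awalk_verts u c) = set (map (tail Q) c) \<union> set (map (head Q) c)"
    by (rule Q.set_awalk_verts_not_Nil_cas[where v = u]) (use u in \<open>auto simp: Q.awalk_def\<close>)
  moreover have "tail Q ` set c = verts Q"
  proof -
    have "tail Q ` range g' = range vt'" unfolding image_image pwD(3)[OF p'] by (rule refl)
    thus ?thesis unfolding sa ra' rv' .
  qed
  moreover have "head Q ` set c \<subseteq> verts Q" unfolding sa using Q.head_in_verts by blast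
  ultimately have vs: "set (Q.awalk_verts u c) = verts Q" by (simp only: set_map) blast
  have "is_basic_cycle Q" unfolding is_basic_cycle_def
  proof (intro exI[of _ c] conjI)
    show "set (Q.awalk_verts (tail Q (hd c)) c) = verts Q" unfolding hu by (rule vs)
  qed (rule c, rule sa)
  thus False using nb by simp
qed

section \<open>Cocycles on pairs of a vertex and a closed path\<close>

lemma gen_length_eqs: "even m \<Longrightarrow> gen_length m = n * (m div 2)" "odd m \<Longrightarrow> gen_length m = n * (m div 2) + 1"
  by (simp_all add: gen_length_def odd_iff_mod_2_eq_one)

lemma cochain_basis_I:
  assumes "p \<in> paths Q" "\<gamma> \<in> paths Q" "path_length p < n" "path_length \<gamma> = gen_length m" "fst p = fst \<gamma>" "trm p = trm \<gamma>"
  shows "(p, \<gamma>) \<in> cochain_basis m"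
  using assms by (simp add: cochain_basis_def short_paths_def res_gens_def)

context
  fixes g :: "nat \<Rightarrow> 'e" and vt :: "nat \<Rightarrow> 'v" and m :: nat and c :: "('v \<times> 'e list) \<times> ('v \<times> 'e list) \<Rightarrow> 'k"
  assumes p: "periodic_walk g vt (gen_length m)" and c: "c \<in> finsupp K (cochain_basis m)" and d: "cochain_diff m c = (\<lambda>_. \<zero>\<^bsub>K\<^esub>)"
begin

text \<open>The values of the cocycle at the rotations of one closed walk, each rotation being
  paired with its base vertex.\<close>

definition walk_coeff where "walk_coeff s = c ((vt s, []), segment g vt s (gen_length m))"

lemma walk_coeff_closed: "walk_coeff s \<in> carrier K"
  using c by (simp add: walk_coeff_def finsupp_def)

lemma walk_coeff_shift: "walk_coeff (s + gen_length m) = walk_coeff s"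
  using segment_shift[OF p] pwD(6)[OF p] by (simp add: walk_coeff_def)

text \<open>The cocycle condition at \<open>(b, \<gamma> b)\<close>, with \<open>\<gamma>\<close>
  the rotation based at \<open>vt s\<close>: this pair ends together, and it starts together exactly
  if \<open>b = g s\<close>, in which case the other term is the next rotation.\<close>

lemma walk_coeff_out:
  assumes m: "even m" and b: "b \<in> arcs Q" "tail Q b = vt s"
  shows "(if b = g s then walk_coeff (Suc s) else \<zero>\<^bsub>K\<^esub>) = walk_coeff s"
proof -
  let ?p = "(vt s, [b])" and ?\<gamma> = "pcat (segment g vt s (gen_length m)) (vt s, [b])"
  have S: "segment g vt s (gen_length m) \<in> paths Q" "trm (segment g vt s (gen_length m)) = vt s"
    using segment_path[OF p, of s "gen_length m"] pwD(6)[OF p] by simp_all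
  have bp: "(vt s, [b]) \<in> paths Q" using arc_path[OF b(1)] b(2) by simp
  have x: "(?p, ?\<gamma>) \<in> cochain_basis (Suc m)"
    by (rule cochain_basis_I) (use bp paths_pcat[OF S(1) bp] trm_pcat[of "segment g vt s (gen_length m)" "(vt s, [b])"] S n2 in
      \<open>simp_all add: gen_length_even[OF m]\<close>)
  have ne: "[s..<s + gen_length m] = s # [Suc s..<s + gen_length m]" using pwD(1)[OF p] by (simp add: upt_conv_Cons)
  have st: "starts_together (?p, ?\<gamma>) \<longleftrightarrow> b = g s" unfolding starts_together_def by (simp add: ne)
  have et: "ends_together (?p, ?\<gamma>)" unfolding ends_together_def by simp
  have L: "ptake (path_length ?p - 1) ?p = (vt s, [])" "ptake (path_length ?\<gamma> - 1) ?\<gamma> = segment g vt s (gen_length m)"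
    by (simp_all add: ptake_0 ptake_pcat_le ptake_segment)
  have R: "c (pdrop 1 ?p, pdrop 1 ?\<gamma>) = walk_coeff (Suc s)" if "b = g s"
  proof -
    have "?\<gamma> = segment g vt s (Suc (gen_length m))" using that pwD(5)[OF p] by (intro path_eqI) simp_all
    hence "pdrop 1 ?\<gamma> = segment g vt (Suc s) (gen_length m)" using pdrop_segment[OF p, of 1 "Suc (gen_length m)" s] by simp
    moreover have "pdrop 1 ?p = (vt (Suc s), [])" using that pwD(4)[OF p, of s] by (simp add: pdrop_all trm_Cons)
    ultimately show ?thesis by (simp add: walk_coeff_def)
  qed
  have "(if b = g s then walk_coeff (Suc s) else \<zero>\<^bsub>K\<^esub>) \<ominus>\<^bsub>K\<^esub> walk_coeff s = cochain_diff m c (?p, ?\<gamma>)"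
    unfolding cochain_diff_even[OF m c x] L using st et R by (simp add: walk_coeff_def)
  also have "\<dots> = \<zero>\<^bsub>K\<^esub>" by (simp add: d)
  finally show ?thesis using walk_coeff_closed by (simp split: if_splits)
qed

text \<open>The mirror image: the pair \<open>(b, b \<gamma>)\<close> starts together but does not
  end together, because the rotation based at \<open>vt (Suc s)\<close> ends with
  \<open>g s\<close>.\<close>

lemma walk_coeff_in:
  assumes m: "even m" and b: "b \<in> arcs Q" "head Q b = vt (Suc s)" "b \<noteq> g s"
  shows "walk_coeff (Suc s) = \<zero>\<^bsub>K\<^esub>"
proof -
  let ?v = "tail Q b"
  let ?p = "(?v, [b])" and ?\<gamma> = "pcat (?v, [b]) (segment g vt (Suc s) (gen_length m))"
  have S: "segment g vt (Suc s) (gen_length m) \<in> paths Q" "trm (segment g vt (Suc s) (gen_length m)) = vt (Suc s)"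
    using segment_path[OF p, of "Suc s" "gen_length m"] pwD(6)[OF p, of "Suc s"] by simp_all
  have tb: "trm (?v, [b]) = vt (Suc s)" using b by (simp add: trm_Cons)
  have x: "(?p, ?\<gamma>) \<in> cochain_basis (Suc m)"
    by (rule cochain_basis_I) (use arc_path[OF b(1)] paths_pcat[OF arc_path[OF b(1)] S(1)] trm_pcat[of "(?v, [b])" "segment g vt (Suc s) (gen_length m)"] S tb n2 in
      \<open>simp_all add: gen_length_even[OF m]\<close>)
  have st: "starts_together (?p, ?\<gamma>)" unfolding starts_together_def by simp
  have "last (map g [Suc s..<Suc s + gen_length m]) = g (s + gen_length m)" using pwD(1)[OF p] by (simp add: last_map)
  hence et: "\<not> ends_together (?p, ?\<gamma>)" unfolding ends_together_def using b(3) pwD(1)[OF p] pwD(5)[OF p, of s] by simp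
  have R: "pdrop 1 ?p = (vt (Suc s), [])" "pdrop 1 ?\<gamma> = segment g vt (Suc s) (gen_length m)"
    using tb b(2) pdrop_pcat_Cons[of b "segment g vt (Suc s) (gen_length m)" 0 ?v] by (simp_all add: pdrop_all pdrop_0)
  have "walk_coeff (Suc s) \<ominus>\<^bsub>K\<^esub> \<zero>\<^bsub>K\<^esub> = cochain_diff m c (?p, ?\<gamma>)"
    unfolding cochain_diff_even[OF m c x] R using st et by (simp add: walk_coeff_def)
  also have "\<dots> = \<zero>\<^bsub>K\<^esub>" by (simp add: d)
  finally show ?thesis using walk_coeff_closed by (simp add: a_minus_def)
qed

text \<open>Evaluate at a subwalk of length \<open>n - 1\<close> against the subwalk with the same
  start that is longer by one turn: all \<open>n\<close> comparisons succeed, and they return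
  consecutive rotations.\<close>

lemma walk_coeff_sum:
  assumes m: "odd m"
  shows "(\<Oplus>\<^bsub>K\<^esub>j\<in>{..<n}. walk_coeff (t + j)) = \<zero>\<^bsub>K\<^esub>"
proof -
  define l where "l = n - 1"
  have ln: "n - 1 = l" "\<And>j. j < n \<longleftrightarrow> j \<le> l" using n2 by (auto simp: l_def)
  have gS: "gen_length (Suc m) = l + gen_length m" using gen_length_odd[OF m] n2 by (simp add: l_def)
  let ?p = "segment g vt t l" and ?\<gamma> = "segment g vt t (l + gen_length m)"
  have P: "?p \<in> paths Q" "?\<gamma> \<in> paths Q" "trm ?p = vt (t + l)" "trm ?\<gamma> = vt (t + l + gen_length m)"
    using segment_path[OF p, of t "l"] segment_path[OF p, of t "l + gen_length m"] by (simp_all add: add.assoc)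
  have x: "(?p, ?\<gamma>) \<in> cochain_basis (Suc m)"
    by (rule cochain_basis_I) (use P pwD(6)[OF p] in \<open>simp_all add: gS ln\<close>)
  have t: "(path_length ?p = l \<and> ptake j ?p = ptake j ?\<gamma> \<and> pdrop j ?p = pdrop (j + gen_length m) ?\<gamma>) \<and>
      c (ptake 0 (pdrop j ?p), ptake (gen_length m) (pdrop j ?\<gamma>)) = walk_coeff (t + j)" if "j < n" for j
  proof -
    have j: "j \<le> l" "j \<le> l + gen_length m" "j + gen_length m \<le> l + gen_length m" "gen_length m \<le> l + gen_length m - j" using that ln by auto
    have "l + gen_length m - (j + gen_length m) = l - j" by simp
    hence "pdrop (j + gen_length m) ?\<gamma> = segment g vt (t + j) (l - j)"
      unfolding pdrop_segment[OF p j(3)] using segment_shift[OF p, of "t + j" "l - j"] by (simp add: add.assoc)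
    thus ?thesis using j by (simp add: ptake_segment pdrop_segment[OF p] walk_coeff_def ptake_0 del: One_nat_def)
  qed
  have "(\<Oplus>\<^bsub>K\<^esub>j\<in>{..<n}. walk_coeff (t + j)) = cochain_diff m c (?p, ?\<gamma>)"
    unfolding cochain_diff_odd[OF m c x] ln(1)
  proof (rule K.finsum_cong'[OF refl])
    fix j assume "j \<in> {..<n}"
    hence T: "(path_length ?p = l \<and> ptake j ?p = ptake j ?\<gamma> \<and> pdrop j ?p = pdrop (j + gen_length m) ?\<gamma>) \<and>
      c (ptake 0 (pdrop j ?p), ptake (gen_length m) (pdrop j ?\<gamma>)) = walk_coeff (t + j)" by (intro t) simp
    show "walk_coeff (t + j) = (if path_length ?p = l \<and> ptake j ?p = ptake j ?\<gamma> \<and> pdrop j ?p = pdrop (j + gen_length m) ?\<gamma>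
      then c (ptake 0 (pdrop j ?p), ptake (gen_length m) (pdrop j ?\<gamma>)) else \<zero>\<^bsub>K\<^esub>)"
      unfolding if_P[OF conjunct1[OF T]] conjunct2[OF T] by (rule refl)
  qed (use c in \<open>auto simp: finsupp_def\<close>)
  also have "\<dots> = \<zero>\<^bsub>K\<^esub>" by (simp add: d)
  finally show ?thesis .
qed

text \<open>Two overlapping sums of \<open>n\<close> consecutive values both vanish, so the values
  have period \<open>n\<close>. They also have period \<open>gen_length m\<close>, which is a
  multiple of \<open>n\<close> plus 1, and hence period 1.\<close>

lemma walk_coeff_const_odd: assumes m: "odd m" shows "walk_coeff t = walk_coeff 0"
proof -
  have per: "walk_coeff (t + n) = walk_coeff t" for t
  proof -
    have "(\<Oplus>\<^bsub>K\<^esub>j\<in>{..<Suc (n - 1)}. walk_coeff (t + j)) = walk_coeff t \<oplus>\<^bsub>K\<^esub> (\<Oplus>\<^bsub>K\<^esub>j\<in>{..<n - 1}. walk_coeff (t + Suc j))"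
      using K.finsum_Suc2[of "\<lambda>j. walk_coeff (t + j)" "n - 2"] walk_coeff_closed n2
      by (simp add: lessThan_Suc_atMost[symmetric] Suc_diff_Suc numeral_2_eq_2 K.a_comm Pi_def)
    moreover have "(\<Oplus>\<^bsub>K\<^esub>j\<in>{..<Suc (n - 1)}. walk_coeff (Suc t + j)) = walk_coeff (Suc t + (n - 1)) \<oplus>\<^bsub>K\<^esub> (\<Oplus>\<^bsub>K\<^esub>j\<in>{..<n - 1}. walk_coeff (Suc t + j))"
      unfolding lessThan_Suc using walk_coeff_closed by (subst K.finsum_insert) auto
    moreover have "Suc (n - 1) = n" using n2 by simp
    moreover have "Suc t + (n - 1) = t + n" using n2 by simp
    moreover have S: "(\<Oplus>\<^bsub>K\<^esub>j\<in>{..<n - 1}. walk_coeff (Suc t + j)) \<in> carrier K" by (rule K.finsum_closed) (use walk_coeff_closed in auto)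
    ultimately have "walk_coeff (t + n) \<oplus>\<^bsub>K\<^esub> (\<Oplus>\<^bsub>K\<^esub>j\<in>{..<n - 1}. walk_coeff (Suc t + j)) = walk_coeff t \<oplus>\<^bsub>K\<^esub> (\<Oplus>\<^bsub>K\<^esub>j\<in>{..<n - 1}. walk_coeff (Suc t + j))"
      using walk_coeff_sum[OF m, of t] walk_coeff_sum[OF m, of "Suc t"] by simp
    thus ?thesis using S walk_coeff_closed by simp
  qed
  have perk: "walk_coeff (t + n * k) = walk_coeff t" for t k
  proof (induction k)
    case (Suc k)
    have "t + n * Suc k = (t + n * k) + n" by simp
    thus ?case using per[of "t + n * k"] Suc by metis
  qed simp
  show ?thesis
  proof (induction t)
    case (Suc t)
    have "walk_coeff (Suc t) = walk_coeff (Suc t + n * (m div 2))" using perk[of "Suc t" "m div 2"] by (rule sym)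
    also have "Suc t + n * (m div 2) = t + gen_length m" by (simp add: gen_length_eqs(2)[OF m])
    also have "walk_coeff (t + gen_length m) = walk_coeff t" by (rule walk_coeff_shift)
    finally show ?case using Suc by simp
  qed simp
qed

text \<open>The values along a closed walk are all equal, and both \<open>n\<close> and \<open>n - 1\<close> copies of them add up to zero;
  this makes the result independent of the characteristic.\<close>

lemma walk_coeff_drop_one:
  assumes m: "odd m" and j0: "j0 < n"
    and z: "(\<Oplus>\<^bsub>K\<^esub>j\<in>{..<n}. if j = j0 then \<zero>\<^bsub>K\<^esub> else walk_coeff 0) = \<zero>\<^bsub>K\<^esub>"
  shows "walk_coeff 0 = \<zero>\<^bsub>K\<^esub>"
proof -
  let ?S = "\<Oplus>\<^bsub>K\<^esub>j\<in>{..<n} - {j0}. walk_coeff 0"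
  have i: "{..<n} = insert j0 ({..<n} - {j0})" using j0 by auto
  have Sc: "?S \<in> carrier K" by (rule K.finsum_closed) (use walk_coeff_closed in auto)
  have "(\<Oplus>\<^bsub>K\<^esub>j\<in>{..<n}. if j = j0 then \<zero>\<^bsub>K\<^esub> else walk_coeff 0) =
      \<zero>\<^bsub>K\<^esub> \<oplus>\<^bsub>K\<^esub> (\<Oplus>\<^bsub>K\<^esub>j\<in>{..<n} - {j0}. if j = j0 then \<zero>\<^bsub>K\<^esub> else walk_coeff 0)"
    by (subst i, subst K.finsum_insert) (use walk_coeff_closed in auto)
  also have "(\<Oplus>\<^bsub>K\<^esub>j\<in>{..<n} - {j0}. if j = j0 then \<zero>\<^bsub>K\<^esub> else walk_coeff 0) = ?S"
    by (rule K.finsum_cong') (use walk_coeff_closed in auto)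
  finally have S: "?S = \<zero>\<^bsub>K\<^esub>" using z Sc by simp
  have "(\<Oplus>\<^bsub>K\<^esub>j\<in>{..<n}. walk_coeff 0) = walk_coeff 0 \<oplus>\<^bsub>K\<^esub> ?S"
    by (subst i, subst K.finsum_insert) (use walk_coeff_closed in auto)
  moreover have "(\<Oplus>\<^bsub>K\<^esub>j\<in>{..<n}. walk_coeff 0) = \<zero>\<^bsub>K\<^esub>"
    proof -
    have "(\<Oplus>\<^bsub>K\<^esub>j\<in>{..<n}. walk_coeff 0) = (\<Oplus>\<^bsub>K\<^esub>j\<in>{..<n}. walk_coeff (0 + j))"
      by (rule K.finsum_cong'[OF refl _ walk_coeff_const_odd[OF m, symmetric]]) (use walk_coeff_closed in auto)
    thus ?thesis using walk_coeff_sum[OF m, of 0] by simp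
  qed
  ultimately show ?thesis using S walk_coeff_closed by simp
qed

text \<open>Let both subwalks of \<open>walk_coeff_sum\<close> leave the walk through
  \<open>b\<close> at their last arrow. Only the last of the \<open>n\<close> comparisons then
  fails, and \<open>n - 1\<close> equal values add up to zero.\<close>

lemma walk_coeff_odd_out:
  assumes m: "odd m" and b: "b \<in> arcs Q" "tail Q b = vt k" "b \<noteq> g k"
  shows "walk_coeff 0 = \<zero>\<^bsub>K\<^esub>"
proof -
  define e where "e = n - 2"
  have en: "n - 1 = Suc e" "\<And>j. j < n \<longleftrightarrow> j \<le> Suc e" using n2 by (auto simp: e_def)
  have gS: "gen_length (Suc m) = Suc (e + gen_length m)" using gen_length_odd[OF m] n2 by (simp add: e_def)
  \<comment> \<open>Moving \<open>k\<close> forward by whole turns makes room for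
    \<open>n - 2\<close> arrows of the walk in front of \<open>b\<close>.\<close>
  define k' where "k' = k + gen_length m * n"
  have per: "vt k' = vt k" "g k' = g k" using periodic_walk_periodic[OF p, of k n] by (simp_all add: k'_def)
  have "1 * n \<le> gen_length m * n" by (rule mult_le_mono1) (use pwD(1)[OF p] in simp)
  hence nk: "e \<le> k'" unfolding k'_def e_def by linarith
  define t where "t = k' - e"
  have tk': "t + e = k'" using nk by (simp add: t_def)
  let ?e = "(tail Q b, [b])"
  let ?u = "segment g vt t e" and ?U = "segment g vt t (e + gen_length m)"
  let ?p = "pcat ?u ?e" and ?\<gamma> = "pcat ?U ?e"
  have S: "?u \<in> paths Q" "?U \<in> paths Q" "trm ?u = tail Q b" "trm ?U = tail Q b"
    using segment_path[OF p, of t "e"] segment_path[OF p, of t "e + gen_length m"] tk' per b(2) pwD(6)[OF p, of k']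
    by (simp_all add: add.assoc[symmetric])
  have x: "(?p, ?\<gamma>) \<in> cochain_basis (Suc m)"
    by (rule cochain_basis_I) (use paths_pcat[OF S(1) arc_path[OF b(1)]] paths_pcat[OF S(2) arc_path[OF b(1)]]
      trm_pcat[of ?u ?e] trm_pcat[of ?U ?e] S in \<open>simp_all add: gS en\<close>)
  have t1: "(path_length ?p = Suc e \<and> ptake j ?p = ptake j ?\<gamma> \<and> pdrop j ?p = pdrop (j + gen_length m) ?\<gamma>) \<and>
      c (ptake 0 (pdrop j ?p), ptake (gen_length m) (pdrop j ?\<gamma>)) = walk_coeff (t + j)" if "j \<le> e" for j
  proof -
    have j: "j \<le> e + gen_length m" "j + gen_length m \<le> e + gen_length m" "gen_length m \<le> e + gen_length m - j" using that by auto
    have "e + gen_length m - (j + gen_length m) = e - j" by simp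
    hence "pdrop (j + gen_length m) ?U = segment g vt (t + j) (e - j)"
      unfolding pdrop_segment[OF p j(2)] using segment_shift[OF p, of "t + j" "e - j"] by (simp add: add.assoc)
    moreover have "pdrop (j + gen_length m) ?\<gamma> = pcat (pdrop (j + gen_length m) ?U) ?e" by (rule pdrop_pcat_le) (use that in simp)
    moreover have "pdrop j ?p = pcat (segment g vt (t + j) (e - j)) ?e"
      using pdrop_pcat_le[of j ?u ?e] that by (simp add: pdrop_segment[OF p])
    moreover have "ptake j ?p = segment g vt t j" "ptake j ?\<gamma> = segment g vt t j"
      using ptake_pcat_le[of j ?u ?e] ptake_pcat_le[of j ?U ?e] that by (simp_all add: ptake_segment)
    moreover have "ptake (gen_length m) (pdrop j ?\<gamma>) = segment g vt (t + j) (gen_length m)"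
      using pdrop_pcat_le[of j ?U ?e] ptake_pcat_le[of "gen_length m" "segment g vt (t + j) (e + gen_length m - j)" ?e] j
      by (simp add: pdrop_segment[OF p] ptake_segment)
    moreover have "path_length ?p = Suc e" using en by simp
    ultimately show ?thesis by (simp add: walk_coeff_def ptake_0)
  qed
  \<comment> \<open>At index \<open>n - 2\<close> the first path has \<open>b\<close>, whereas the
    second still follows the walk and has \<open>g k'\<close>.\<close>
  have t2: "ptake (Suc e) ?p \<noteq> ptake (Suc e) ?\<gamma>"
  proof
    assume eq: "ptake (Suc e) ?p = ptake (Suc e) ?\<gamma>"
    have "snd (ptake (Suc e) ?p) ! e = b" using en by (simp add: nth_append)
    moreover have "snd (ptake (Suc e) ?\<gamma>) ! e = g k'" using en pwD(1)[OF p] tk' by (simp add: nth_append)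
    ultimately show False using eq per(2) b(3) by simp
  qed
  have "(\<Oplus>\<^bsub>K\<^esub>j\<in>{..<n}. if j = Suc e then \<zero>\<^bsub>K\<^esub> else walk_coeff 0) = cochain_diff m c (?p, ?\<gamma>)"
    unfolding cochain_diff_odd[OF m c x] en(1)
  proof (rule K.finsum_cong')
    fix j assume "j \<in> {..<n}"
    show "(if j = Suc e then \<zero>\<^bsub>K\<^esub> else walk_coeff 0) = (if path_length ?p = Suc e \<and> ptake j ?p = ptake j ?\<gamma> \<and> pdrop j ?p = pdrop (j + gen_length m) ?\<gamma>
      then c (ptake 0 (pdrop j ?p), ptake (gen_length m) (pdrop j ?\<gamma>)) else \<zero>\<^bsub>K\<^esub>)"
    proof (cases "j = Suc e")
      case True
      thus ?thesis using t2 by simp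
    next
      case False
      have i: "j \<le> e" using False \<open>j \<in> {..<n}\<close> en(2) by simp
      show ?thesis unfolding if_P[OF conjunct1[OF t1[OF i]]] conjunct2[OF t1[OF i]]
        using False walk_coeff_const_odd[OF m, of "t + j"] by simp
    qed
  qed (use c in \<open>auto simp: finsupp_def\<close>)
  also have "\<dots> = \<zero>\<^bsub>K\<^esub>" by (simp add: d)
  finally show ?thesis by (intro walk_coeff_drop_one[OF m, of "Suc e"]) (use en in auto)
qed

text \<open>Here both subwalks enter the walk through \<open>b\<close>, and it is the first
  comparison that fails.\<close>

lemma walk_coeff_odd_in:
  assumes m: "odd m" and b: "b \<in> arcs Q" "head Q b = vt (Suc k)" "b \<noteq> g k"
  shows "walk_coeff 0 = \<zero>\<^bsub>K\<^esub>"
proof -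
  define e where "e = n - 2"
  have en: "n - 1 = Suc e" "\<And>j. j < n \<longleftrightarrow> j \<le> Suc e" using n2 by (auto simp: e_def)
  have gS: "gen_length (Suc m) = Suc (e + gen_length m)" using gen_length_odd[OF m] n2 by (simp add: e_def)
  let ?e = "(tail Q b, [b])"
  let ?u = "segment g vt (Suc k) e" and ?U = "segment g vt (Suc k) (gen_length m + e)"
  let ?p = "pcat ?e ?u" and ?\<gamma> = "pcat ?e ?U"
  have te: "trm ?e = vt (Suc k)" using b by (simp add: trm_Cons)
  have S: "?u \<in> paths Q" "?U \<in> paths Q" "trm ?u = trm ?U"
    using segment_path[OF p, of "Suc k" "e"] segment_path[OF p, of "Suc k" "gen_length m + e"]
      pwD(6)[OF p, of "Suc k + e"] by (simp_all add: ac_simps)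
  have x: "(?p, ?\<gamma>) \<in> cochain_basis (Suc m)"
    by (rule cochain_basis_I) (use paths_pcat[OF arc_path[OF b(1)] S(1)] paths_pcat[OF arc_path[OF b(1)] S(2)]
      trm_pcat[of ?e ?u] trm_pcat[of ?e ?U] S te in \<open>simp_all add: gS en, arith\<close>)
  have t1: "(path_length ?p = Suc e \<and> ptake (Suc i) ?p = ptake (Suc i) ?\<gamma> \<and> pdrop (Suc i) ?p = pdrop (Suc i + gen_length m) ?\<gamma>) \<and>
      c (ptake 0 (pdrop (Suc i) ?p), ptake (gen_length m) (pdrop (Suc i) ?\<gamma>)) = walk_coeff (Suc k + i)" if i: "i \<le> e" for i
  proof -
    have j: "i \<le> gen_length m + e" "i + gen_length m \<le> gen_length m + e" "gen_length m \<le> gen_length m + e - i" using i by auto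
    have "gen_length m + e - (i + gen_length m) = e - i" by simp
    hence "pdrop (i + gen_length m) ?U = segment g vt (Suc k + i) (e - i)"
      unfolding pdrop_segment[OF p j(2)] using segment_shift[OF p, of "Suc k + i" "e - i"] by (simp add: add.assoc)
    moreover have "pdrop (Suc i + gen_length m) ?\<gamma> = pdrop (i + gen_length m) ?U"
      using pdrop_pcat_Cons[of b ?U "i + gen_length m"] b(2) by simp
    moreover have "pdrop (Suc i) ?p = segment g vt (Suc k + i) (e - i)" "pdrop (Suc i) ?\<gamma> = segment g vt (Suc k + i) (gen_length m + e - i)"
      using pdrop_pcat_Cons[of b ?u i] pdrop_pcat_Cons[of b ?U i] b(2) i j by (simp_all add: pdrop_segment[OF p])
    moreover have "ptake (Suc i) ?p = ptake (Suc i) ?\<gamma>"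
      using i j by (simp add: ptake_pcat_Cons ptake_segment)
    moreover have "path_length ?p = Suc e" using en by simp
    ultimately show ?thesis using j by (simp add: walk_coeff_def ptake_0 ptake_segment)
  qed
  \<comment> \<open>After one turn the second path continues with the walk's own arrow
    \<open>g k\<close>, while the first begins with \<open>b\<close>.\<close>
  have t2: "pdrop 0 ?p \<noteq> pdrop (0 + gen_length m) ?\<gamma>"
  proof
    assume eq: "pdrop 0 ?p = pdrop (0 + gen_length m) ?\<gamma>"
    obtain N where N: "gen_length m = Suc N" using pwD(1)[OF p] by (cases "gen_length m") auto
    have "pdrop (gen_length m) ?\<gamma> = pdrop N ?U" using pdrop_pcat_Cons[of b ?U N] b(2) N by simp
    also have "\<dots> = segment g vt (Suc k + N) (gen_length m + e - N)" by (rule pdrop_segment[OF p]) (simp add: N)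
    finally have "snd ?p = map g [Suc k + N..<Suc k + N + (gen_length m + e - N)]" using eq by (simp add: pdrop_0)
    moreover have "[Suc k + N..<Suc k + N + (gen_length m + e - N)] = (Suc k + N) # [Suc (Suc k + N)..<Suc k + N + (gen_length m + e - N)]"
      by (rule upt_conv_Cons) (simp add: N)
    ultimately have "b = g (Suc k + N)" by simp
    thus False using b(3) pwD(5)[OF p, of k] N by simp
  qed
  have "(\<Oplus>\<^bsub>K\<^esub>j\<in>{..<n}. if j = 0 then \<zero>\<^bsub>K\<^esub> else walk_coeff 0) = cochain_diff m c (?p, ?\<gamma>)"
    unfolding cochain_diff_odd[OF m c x] en(1)
  proof (rule K.finsum_cong')
    fix j assume "j \<in> {..<n}"
    show "(if j = 0 then \<zero>\<^bsub>K\<^esub> else walk_coeff 0) = (if path_length ?p = Suc e \<and> ptake j ?p = ptake j ?\<gamma> \<and> pdrop j ?p = pdrop (j + gen_length m) ?\<gamma>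
      then c (ptake 0 (pdrop j ?p), ptake (gen_length m) (pdrop j ?\<gamma>)) else \<zero>\<^bsub>K\<^esub>)"
    proof (cases j)
      case 0
      thus ?thesis using t2 by auto
    next
      case (Suc i)
      have i: "i \<le> e" using Suc \<open>j \<in> {..<n}\<close> en(2) by simp
      show ?thesis unfolding Suc if_P[OF conjunct1[OF t1[OF i]]] conjunct2[OF t1[OF i]]
        using walk_coeff_const_odd[OF m, of "Suc k + i"] by simp
    qed
  qed (use c in \<open>auto simp: finsupp_def\<close>)
  also have "\<dots> = \<zero>\<^bsub>K\<^esub>" by (simp add: d)
  finally show ?thesis by (intro walk_coeff_drop_one[OF m, of 0]) (use en in auto)
qed

lemma walk_coeff_zero:
  assumes con: "connected Q" and nb: "\<not> is_basic_cycle Q"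
  shows "walk_coeff 0 = \<zero>\<^bsub>K\<^esub>"
proof -
  obtain k b where b: "b \<in> arcs Q" "b \<noteq> g k" "tail Q b = vt k \<or> head Q b = vt (Suc k)"
    by (rule alternate_arc[OF con nb p])
  show ?thesis
  proof (cases "even m")
    case True
    \<comment> \<open>Taking \<open>b\<close> to be the arrow \<open>g s\<close> of the walk shows
      that neighbouring rotations have equal values.\<close>
    have const: "walk_coeff s = walk_coeff 0" for s
    proof (induction s)
      case (Suc s)
      thus ?case using walk_coeff_out[OF True pwD(2,3)[OF p], of s] by simp
    qed simp
    show ?thesis using b(3)
    proof
      assume "tail Q b = vt k"
      thus ?thesis using walk_coeff_out[OF True b(1)] b(2) const[of k] by metis
    next
      assume "head Q b = vt (Suc k)"
      thus ?thesis using walk_coeff_in[OF True b(1) _ b(2)] const[of "Suc k"] by simp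
    qed
  next
    case False
    thus ?thesis using b(3) walk_coeff_odd_out[OF _ b(1) _ b(2)] walk_coeff_odd_in[OF _ b(1) _ b(2)] by blast
  qed
qed

end

text \<open>A pair with a vertex in front has a closed walk behind, of positive length because the
  degree is positive. In what follows, connectedness and the exclusion of basic cycles act only
  through this lemma.\<close>

lemma cocycle_vertex_zero:
  assumes con: "connected Q" and nb: "\<not> is_basic_cycle Q" and m: "0 < m"
    and c: "c \<in> finsupp K (cochain_basis m)" and d: "cochain_diff m c = (\<lambda>_. \<zero>\<^bsub>K\<^esub>)" and p0: "path_length p = 0"
  shows "c (p, \<gamma>) = \<zero>\<^bsub>K\<^esub>"
proof (cases "(p, \<gamma>) \<in> cochain_basis m")
  case True
  have m2: "even m \<Longrightarrow> 0 < m div 2" using m by (auto elim!: evenE)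
  have gm: "0 < gen_length m" using m2 n2 gen_length_eqs[of m] by (cases "even m") auto
  have \<gamma>: "\<gamma> \<in> paths Q" "path_length \<gamma> = gen_length m" "p = (fst \<gamma>, [])" "trm \<gamma> = fst \<gamma>"
  proof -
    show "\<gamma> \<in> paths Q" "path_length \<gamma> = gen_length m" using True by (simp_all add: cochain_basis_def res_gens_def)
    show p: "p = (fst \<gamma>, [])" using True p0 by (intro path_eqI) (simp_all add: cochain_basis_def)
    show "trm \<gamma> = fst \<gamma>" using True p by (simp add: cochain_basis_def)
  qed
  obtain g vt where w: "periodic_walk g vt (length (snd \<gamma>))" "segment g vt 0 (length (snd \<gamma>)) = (fst \<gamma>, snd \<gamma>)"
    by (rule closed_walk_periodic_walk[of "fst \<gamma>" "snd \<gamma>"]) (use \<gamma> gm in auto)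
  have pg: "periodic_walk g vt (gen_length m)" using w(1) \<gamma>(2) by simp
  have "walk_coeff g vt m c 0 = \<zero>\<^bsub>K\<^esub>" by (rule walk_coeff_zero[OF pg c d con nb])
  moreover have "vt 0 = fst \<gamma>" using arg_cong[OF w(2), of fst] by simp
  ultimately show ?thesis using w(2) \<gamma>(2) unfolding \<gamma>(3) by (simp add: walk_coeff_def[OF pg c d])
next
  case False
  thus ?thesis using c by (simp add: finsupp_def)
qed

section \<open>Movements and extremes\<close>

abbreviation PP where "PP \<equiv> parallel_paths Q"

lemma PP_iff: "(p, q) \<in> PP i j \<longleftrightarrow> p \<in> paths Q \<and> q \<in> paths Q \<and> path_length p = i \<and> path_length q = j \<and>
    fst p = fst q \<and> trm p = trm q"
  by (simp add: parallel_paths_def)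

lemma finite_PP: "finite (PP i j)"
proof (rule finite_subset)
  show "PP i j \<subseteq> {p \<in> paths Q. path_length p \<le> i} \<times> {p \<in> paths Q. path_length p \<le> j}"
    by (auto simp: parallel_paths_def)
  show "finite ({p \<in> paths Q. path_length p \<le> i} \<times> {p \<in> paths Q. path_length p \<le> j})"
    using finite_paths by blast
qed

lemma cochain_basis_PP: "(p, q) \<in> cochain_basis m \<longleftrightarrow> (p, q) \<in> PP (path_length p) (gen_length m) \<and> path_length p < n"
  by (auto simp: PP_iff cochain_basis_def short_paths_def res_gens_def)

lemma card_PP_Union:
  assumes "\<And>j. j \<in> J \<Longrightarrow> j < n" "finite J"
  shows "card {x \<in> cochain_basis m. path_length (fst x) \<in> J} = (\<Sum>j\<in>J. card (PP j (gen_length m)))"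
proof -
  have "{x \<in> cochain_basis m. path_length (fst x) \<in> J} = (\<Union>j\<in>J. PP j (gen_length m))"
  proof (rule Set.set_eqI)
    fix x :: "('v \<times> 'e list) \<times> 'v \<times> 'e list"
    obtain p q where x: "x = (p, q)" by (cases x)
    show "x \<in> {x \<in> cochain_basis m. path_length (fst x) \<in> J} \<longleftrightarrow> x \<in> (\<Union>j\<in>J. PP j (gen_length m))"
      unfolding x using assms(1) by (auto simp: cochain_basis_PP PP_iff)
  qed
  moreover have "card (\<Union>j\<in>J. PP j (gen_length m)) = (\<Sum>j\<in>J. card (PP j (gen_length m)))"
    by (rule card_UN_disjoint) (use assms(2) finite_PP in \<open>auto simp: parallel_paths_def\<close>)
  ultimately show ?thesis by simp
qed

lemma card_cochain_basis: "card (cochain_basis m) = (\<Sum>j=0..n-1. card (PP j (gen_length m)))"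
proof -
  have "{x \<in> cochain_basis m. path_length (fst x) \<in> {0..n-1}} = cochain_basis m" using n2 by (auto simp: cochain_basis_def short_paths_def)
  moreover have "card {x \<in> cochain_basis m. path_length (fst x) \<in> {0..n-1}} = (\<Sum>j=0..n-1. card (PP j (gen_length m)))"
    by (rule card_PP_Union) (use n2 in auto)
  ultimately show ?thesis by simp
qed

section \<open>Movements as the two shortenings of a longer pair\<close>

definition drop_last where "drop_last z = (ptake (path_length (fst z) - 1) (fst z), ptake (path_length (snd z) - 1) (snd z))"
definition drop_first where "drop_first z = (pdrop 1 (fst z), pdrop 1 (snd z))"

definition "movements = plus_movements Q \<union> minus_movements Q"

text \<open>A pair, together with the arrow added by the movement, forms a longer pair
  \<open>z\<close> that starts and ends together; the movement exchanges its two shortenings. These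
  are the two arguments which the even differential compares at \<open>z\<close>.\<close>

lemma mv_step:
  assumes x: "x \<in> PP j l" and m: "(x, y) \<in> movements"
  obtains z where "z \<in> PP (Suc j) (Suc l)" "starts_together z" "ends_together z" "0 < j" "0 < l"
    "x = drop_last z \<and> y = drop_first z \<or> x = drop_first z \<and> y = drop_last z"
proof -
  consider "(x, y) \<in> plus_movements Q" | "(x, y) \<in> minus_movements Q" using m by (auto simp: movements_def)
  thus thesis
  proof cases
    case 1
    then obtain u a p b q where e: "x = ((u, a # p), (u, a # q))" "y = ((head Q a, p @ [b]), (head Q a, q @ [b]))"
        "b \<in> out_arcs Q (trm (u, a # p))"
      unfolding plus_movements_def by blast
    have b: "b \<in> arcs Q" "tail Q b = trm (u, a # p)" using e(3) by simp_all
    let ?z = "((u, (a # p) @ [b]), (u, (a # q) @ [b]))"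
    have xp: "(u, a # p) \<in> paths Q" "(u, a # q) \<in> paths Q" "trm (u, a # p) = trm (u, a # q)" "length p + 1 = j" "length q + 1 = l"
      using x unfolding e(1) PP_iff by simp_all
    have bp: "(trm (u, a # p), [b]) \<in> paths Q" using arc_path[OF b(1)] b(2) by simp
    have "(u, (a # p) @ [b]) \<in> paths Q" "(u, (a # q) @ [b]) \<in> paths Q"
      unfolding paths_append using xp(1,2,3) bp by simp_all
    moreover have "trm (u, (a # p) @ [b]) = trm (u, (a # q) @ [b])" unfolding trm_append xp(3) by (rule refl)
    ultimately have "?z \<in> PP (Suc j) (Suc l)" using xp(4,5) by (simp add: PP_iff)
    moreover have "x = drop_last ?z" by (simp add: drop_last_def e(1) ptake_def)
    moreover have "y = drop_first ?z" by (simp add: drop_first_def e(2) pdrop_def ptake_def trm_Cons)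
    ultimately show thesis using xp(4,5) by (intro that[of ?z]) (auto simp: starts_together_def ends_together_def)
  next
    case 2
    then obtain u p a q b where e: "x = ((u, p @ [a]), (u, q @ [a]))" "y = ((tail Q b, b # p), (tail Q b, b # q))"
        "b \<in> in_arcs Q u"
      unfolding minus_movements_def by blast
    have b: "b \<in> arcs Q" "head Q b = u" using e(3) by simp_all
    let ?z = "((tail Q b, b # p @ [a]), (tail Q b, b # q @ [a]))"
    have xp: "(u, p @ [a]) \<in> paths Q" "(u, q @ [a]) \<in> paths Q" "trm (u, p @ [a]) = trm (u, q @ [a])" "length p + 1 = j" "length q + 1 = l"
      using x unfolding e(1) PP_iff by simp_all
    have "?z \<in> PP (Suc j) (Suc l)" using xp b by (simp add: PP_iff paths_Cons trm_Cons)
    moreover have "x = drop_first ?z" using b by (simp add: drop_first_def e(1) pdrop_def ptake_def trm_Cons)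
    moreover have "y = drop_last ?z" by (simp add: drop_last_def e(2) ptake_def)
    ultimately show thesis using xp(4,5) by (intro that[of ?z]) (auto simp: starts_together_def ends_together_def)
  qed
qed

lemma mv_PP:
  assumes z: "z \<in> PP (Suc j) (Suc l)" and "starts_together z" "ends_together z" "0 < j" "0 < l"
  shows "drop_last z \<in> PP j l" "drop_first z \<in> PP j l" "(drop_last z, drop_first z) \<in> movements" "(drop_first z, drop_last z) \<in> movements"
proof -
  obtain P G where zz: "z = (P, G)" by (cases z)
  have PG: "P \<in> paths Q" "G \<in> paths Q" "path_length P = Suc j" "path_length G = Suc l" "fst P = fst G" "trm P = trm G"
    using z unfolding zz PP_iff by simp_all
  obtain a as where P1: "snd P = a # as" "length as = j" using PG(3) by (cases "snd P") auto
  obtain a' bs where G1: "snd G = a' # bs" "length bs = l" using PG(4) by (cases "snd G") auto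
  obtain p b where P2: "as = p @ [b]" using P1 assms(4) by (cases as rule: rev_cases) auto
  obtain q b' where G2: "bs = q @ [b']" using G1 assms(5) by (cases bs rule: rev_cases) auto
  have e: "a' = a" "b' = b" using assms(2,3) P1 P2 G1 G2 by (simp_all add: zz starts_together_def ends_together_def)
  define u where "u = fst P"
  have P: "P = (u, a # p @ [b])" and G: "G = (u, a # q @ [b])"
    using P1 P2 G1 G2 PG(5) e by (simp_all add: u_def prod_eq_iff)
  have L: "drop_last z = ((u, a # p), (u, a # q))" by (simp add: zz P G drop_last_def ptake_def)
  have R: "drop_first z = ((head Q a, p @ [b]), (head Q a, q @ [b]))" by (simp add: zz P G drop_first_def pdrop_def ptake_def trm_Cons)
  have len: "Suc (length p) = j" "Suc (length q) = l" using P1 P2 G1 G2 by simp_all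
  have a: "a \<in> arcs Q" "u = tail Q a" "(head Q a, p @ [b]) \<in> paths Q" "(head Q a, q @ [b]) \<in> paths Q"
    using PG(1,2) unfolding P G paths_Cons by simp_all
  have b: "b \<in> arcs Q" "tail Q b = trm (u, a # p)" "tail Q b = trm (u, a # q)" "(head Q a, p) \<in> paths Q" "(head Q a, q) \<in> paths Q"
    using a(3,4) unfolding paths_append by (simp_all add: paths_Cons trm_Cons)
  show "drop_last z \<in> PP j l" unfolding L PP_iff using a b len by (simp add: paths_Cons)
  show "drop_first z \<in> PP j l" unfolding R PP_iff using a PG(6) len by (simp add: P G trm_Cons)
  have "(drop_last z, drop_first z) \<in> plus_movements Q"
    unfolding L R plus_movements_def using b by simp
  thus "(drop_last z, drop_first z) \<in> movements" by (simp add: movements_def)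
  have "(drop_first z, drop_last z) \<in> minus_movements Q"
    unfolding L R minus_movements_def a(2) using a(1) by simp
  thus "(drop_first z, drop_last z) \<in> movements" by (simp add: movements_def)
qed

text \<open>A \<open>+\<close>movement and the \<open>-\<close>movement undoing it share the same
  longer pair, with the shortenings in exchanged roles. Hence the reflexive transitive closure is
  symmetric.\<close>

lemma mv_sym:
  assumes "x \<in> PP j l" "(x, y) \<in> movements"
  shows "y \<in> PP j l" "(y, x) \<in> movements"
proof -
  obtain z where z: "z \<in> PP (Suc j) (Suc l)" "starts_together z" "ends_together z" "0 < j" "0 < l"
    "x = drop_last z \<and> y = drop_first z \<or> x = drop_first z \<and> y = drop_last z"
    by (rule mv_step[OF assms])
  note M = mv_PP[OF z(1-5)]
  show "y \<in> PP j l" "(y, x) \<in> movements" using z(6) M by auto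
qed

abbreviation "mveq \<equiv> movement_equiv Q"

lemma mveq_iff: "(x, y) \<in> mveq j l \<longleftrightarrow> x \<in> PP j l \<and> y \<in> PP j l \<and> (x, y) \<in> movements\<^sup>*"
  by (simp add: movement_equiv_def movements_def)

lemma mv_rtrancl: "(x, y) \<in> movements\<^sup>* \<Longrightarrow> x \<in> PP j l \<Longrightarrow> y \<in> PP j l \<and> (y, x) \<in> movements\<^sup>*"
proof (induction rule: rtrancl_induct)
  case (step y z)
  hence "y \<in> PP j l" "(y, x) \<in> movements\<^sup>*" by simp_all
  thus ?case using mv_sym[of y j l z] step(2) converse_rtrancl_into_rtrancl[of z y movements x] by blast
qed simp

lemma mveq_equiv: "equiv (PP j l) (mveq j l)"
proof (rule equivI)
  show "mveq j l \<subseteq> PP j l \<times> PP j l" by (auto simp: movement_equiv_def)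
  show "refl_on (PP j l) (mveq j l)" by (rule refl_onI) (simp_all add: mveq_iff)
  show "sym (mveq j l)"
  proof (rule symI)
    fix x y assume "(x, y) \<in> mveq j l"
    thus "(y, x) \<in> mveq j l" using mv_rtrancl[of x y j l] by (simp add: mveq_iff)
  qed
  show "trans (mveq j l)"
  proof (rule transI)
    fix x y z assume "(x, y) \<in> mveq j l" "(y, z) \<in> mveq j l"
    thus "(x, z) \<in> mveq j l" using rtrancl_trans[of x y movements z] by (simp add: mveq_iff)
  qed
qed

lemma mveq_LR:
  assumes "z \<in> PP (Suc j) (Suc l)" "starts_together z" "ends_together z" "0 < j" "0 < l"
  shows "(drop_last z, drop_first z) \<in> mveq j l"
  using mv_PP[OF assms] by (simp add: mveq_iff r_into_rtrancl)

section \<open>Classes and their extremes\<close>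

lemma extremes_PP: "C \<in> extremes Q n i j \<Longrightarrow> x \<in> C \<Longrightarrow> x \<in> PP j (n * i) \<and> 0 < j"
  using in_quotient_imp_subset[OF mveq_equiv] by (auto simp: extremes_def split: if_splits)

lemma extremes_nonempty: "C \<in> extremes Q n i j \<Longrightarrow> C \<noteq> {}"
  using in_quotient_imp_non_empty[OF mveq_equiv] by (auto simp: extremes_def split: if_splits)

text \<open>The length of the first path recovers \<open>j\<close>, so families for different
  \<open>j\<close> never meet; within one family the classes come from an equivalence relation or
  are singletons.\<close>

lemma extremes_disjoint:
  assumes "C \<in> extremes Q n i j" "D \<in> extremes Q n i j'" "x \<in> C" "x \<in> D"
  shows "j = j' \<and> C = D"
proof -
  have j: "j = j'" using extremes_PP[OF assms(1,3)] extremes_PP[OF assms(2,4)] by (auto simp: parallel_paths_def)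
  have "C = D"
  proof (cases "j = n - 1")
    case True
    thus ?thesis using assms j by (auto simp: extremes_def split: if_splits)
  next
    case False
    hence "C \<in> PP j (n * i) // mveq j (n * i)" "D \<in> PP j (n * i) // mveq j (n * i)"
      using assms(1,2) j by (auto simp: extremes_def split: if_splits)
    thus ?thesis using quotient_disj[OF mveq_equiv] assms(3,4) by blast
  qed
  thus ?thesis using j by simp
qed

lemma extremes_closed:
  assumes C: "C \<in> extremes Q n i j" and x: "x \<in> C" and j: "j \<noteq> n - 1" and y: "(x, y) \<in> mveq j (n * i) \<or> (y, x) \<in> mveq j (n * i)"
  shows "y \<in> C"
proof -
  have q: "C \<in> PP j (n * i) // mveq j (n * i)" using C j by (auto simp: extremes_def split: if_splits)
  have "(x, y) \<in> mveq j (n * i)" using y mveq_equiv[of j "n * i"] by (meson equivE symE)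
  thus ?thesis using in_quotient_imp_closed[OF mveq_equiv q x] by simp
qed

lemma card_extremes_Union: "card (\<Union>j\<in>{1..n-1}. extremes Q n i j) = (\<Sum>j=1..n-1. card (extremes Q n i j))"
proof -
  have fin: "finite (extremes Q n i j)" for j
  proof -
    have "extremes Q n i j \<subseteq> Pow (PP j (n * i))" using extremes_PP[of _ i j] by blast
    thus ?thesis using finite_PP finite_subset by blast
  qed
  have dis: "extremes Q n i j \<inter> extremes Q n i j' = {}" if "j \<noteq> j'" for j j'
    using extremes_disjoint[of _ i j _ j'] extremes_nonempty[of _ i j] that by blast
  show ?thesis by (rule card_UN_disjoint) (use fin dis in auto)
qed

section \<open>Dimensions of the kernels\<close>

text \<open>Cocycles vanish at pairs with a vertex in front. Conversely the odd differential reads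
  only such values, so every function vanishing there is a cocycle. The remaining pairs are made
  into singleton classes to fit \<open>dim_class_functions\<close>.\<close>

lemma ker_dim_odd:
  assumes con: "connected Q" and nb: "\<not> is_basic_cycle Q" and m: "odd m"
  shows "ker_dim m = (\<Sum>j=1..n-1. card (PP j (gen_length m)))"
proof -
  let ?Y = "{x \<in> cochain_basis m. path_length (fst x) \<in> {1..n-1}}"
  let ?E = "(\<lambda>x. {x}) ` ?Y"
  have eq: "{c \<in> finsupp K (cochain_basis m). cochain_diff m c = (\<lambda>_. \<zero>\<^bsub>K\<^esub>)} =
      {c \<in> finsupp K (cochain_basis m). (\<forall>C\<in>?E. \<forall>x\<in>C. \<forall>y\<in>C. c x = c y) \<and> (\<forall>x. x \<notin> \<Union>?E \<longrightarrow> c x = \<zero>\<^bsub>K\<^esub>)}"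
    (is "?L = ?R")
  proof (intro equalityI subsetI)
    fix c assume "c \<in> ?L"
    hence c: "c \<in> finsupp K (cochain_basis m)" and d: "cochain_diff m c = (\<lambda>_. \<zero>\<^bsub>K\<^esub>)" by simp_all
    have "c x = \<zero>\<^bsub>K\<^esub>" if "x \<notin> \<Union>?E" for x
    proof (cases "x \<in> cochain_basis m")
      case True
      obtain p q where x: "x = (p, q)" by (cases x)
      have "path_length p < n" using True by (simp add: x cochain_basis_def short_paths_def)
      moreover have "path_length (fst x) \<notin> {1..n-1}" using that True by blast
      ultimately have "path_length p = 0" unfolding x fst_conv atLeastAtMost_iff by linarith
      thus ?thesis unfolding x by (intro cocycle_vertex_zero[OF con nb _ c d]) (use m in \<open>auto elim!: oddE\<close>)
    next
      case False
      thus ?thesis using c by (simp add: finsupp_def)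
    qed
    moreover have "\<forall>C\<in>?E. \<forall>x\<in>C. \<forall>y\<in>C. c x = c y" by blast
    ultimately show "c \<in> ?R" using c by blast
  next
    fix c assume "c \<in> ?R"
    hence c: "c \<in> finsupp K (cochain_basis m)" and z: "\<And>x. x \<notin> \<Union>?E \<Longrightarrow> c x = \<zero>\<^bsub>K\<^esub>" by blast+
    have "cochain_diff m c x = \<zero>\<^bsub>K\<^esub>" for x
    proof (cases "x \<in> cochain_basis (Suc m)")
      case True
      obtain p q where x: "x = (p, q)" by (cases x)
      have v: "c (ptake 0 r', r) = \<zero>\<^bsub>K\<^esub>" for r' r by (rule z) (simp add: ptake_0)
      show ?thesis unfolding x cochain_diff_odd[OF m c True[unfolded x]]
        by (rule K.add.finprod_one_eqI) (simp add: v)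
    next
      case False
      thus ?thesis using cochain_diff_closed[OF c] by (simp add: finsupp_def)
    qed
    thus "c \<in> ?L" using c by (simp add: fun_eq_iff)
  qed
  have "ker_dim m = card ?E" unfolding ker_dim_def eq
    by (rule dim_class_functions[OF K.field_axioms finite_cochain_basis]) auto
  also have "\<dots> = card ?Y" by (rule card_image) (simp add: inj_on_def)
  also have "\<dots> = (\<Sum>j=1..n-1. card (PP j (gen_length m)))" by (rule card_PP_Union) (use n2 in auto)
  finally show ?thesis .
qed

lemma cochain_diff_even':
  assumes m: "even m" and c: "c \<in> finsupp K (cochain_basis m)" and z: "z \<in> cochain_basis (Suc m)"
  shows "cochain_diff m c z = (if starts_together z then c (drop_first z) else \<zero>\<^bsub>K\<^esub>) \<ominus>\<^bsub>K\<^esub> (if ends_together z then c (drop_last z) else \<zero>\<^bsub>K\<^esub>)"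
proof -
  obtain p q where x: "z = (p, q)" by (cases z)
  show ?thesis unfolding x cochain_diff_even[OF m c z[unfolded x]] by (simp add: drop_first_def drop_last_def)
qed

text \<open>A class that is not an extreme contains a \<open>+\<close>extreme \<open>y\<close> not
  ending at a sink, or the dual. If \<open>b\<close> leaves its end, the pair \<open>y b\<close>
  ends together without starting together, and the cocycle condition there reads
  \<open>c y = 0\<close>; constancy on the class spreads the zero. For \<open>j = n - 1\<close> the
  longer pair exceeds the truncation and imposes nothing, which matches the convention that all
  those pairs are extremes.\<close>

lemma even_kernel:
  assumes con: "connected Q" and nb: "\<not> is_basic_cycle Q" and m: "even m" "0 < m"
    and c: "c \<in> finsupp K (cochain_basis m)" and d: "cochain_diff m c = (\<lambda>_. \<zero>\<^bsub>K\<^esub>)"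
  defines "i \<equiv> m div 2"
  shows mveq_const: "(x, y) \<in> mveq j (n * i) \<Longrightarrow> Suc j < n \<Longrightarrow> c x = c y"
    and zero_off_extremes: "(\<And>j. j \<in> {1..n-1} \<Longrightarrow> x \<notin> \<Union>(extremes Q n i j)) \<Longrightarrow> c x = \<zero>\<^bsub>K\<^esub>"
proof -
  have cc: "c x \<in> carrier K" for x using c by (simp add: finsupp_def)
  have gm: "gen_length m = n * i" using gen_length_eqs(1)[OF m(1)] by (simp add: i_def)
  have ni: "0 < n * i" using m n2 by (auto simp: i_def elim!: evenE)
  have zX: "z \<in> cochain_basis (Suc m)" if "z \<in> PP (Suc j) (Suc (n * i))" "Suc j < n" for z j
    using that gen_length_even[OF m(1)] gm by (cases z) (auto simp: cochain_basis_PP PP_iff)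
  have de: "(if starts_together z then c (drop_first z) else \<zero>\<^bsub>K\<^esub>) \<ominus>\<^bsub>K\<^esub> (if ends_together z then c (drop_last z) else \<zero>\<^bsub>K\<^esub>) = \<zero>\<^bsub>K\<^esub>"
    if "z \<in> PP (Suc j) (Suc (n * i))" "Suc j < n" for z j
    using cochain_diff_even'[OF m(1) c zX[OF that]] by (simp add: d)
  have const: "c x = c y" if xy: "(x, y) \<in> mveq j (n * i)" and j: "Suc j < n" for x y j
  proof -
    have x: "x \<in> PP j (n * i)" and r: "(x, y) \<in> movements\<^sup>*" using xy by (simp_all add: mveq_iff)
    from r show ?thesis
    proof (induction rule: rtrancl_induct)
      case (step y w)
      have y: "y \<in> PP j (n * i)" using mv_rtrancl[OF step(1) x] by simp
      obtain z where z: "z \<in> PP (Suc j) (Suc (n * i))" "starts_together z" "ends_together z" "0 < j" "0 < n * i"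
        "y = drop_last z \<and> w = drop_first z \<or> y = drop_first z \<and> w = drop_last z"
        by (rule mv_step[OF y step(2)])
      have "c (drop_first z) = c (drop_last z)" using de[OF z(1) j] z(2,3) cc by simp
      thus ?case using z(6) step(3) by auto
    qed simp
  qed
  show "(x, y) \<in> mveq j (n * i) \<Longrightarrow> Suc j < n \<Longrightarrow> c x = c y" by (rule const)
  assume off: "\<And>j. j \<in> {1..n-1} \<Longrightarrow> x \<notin> \<Union>(extremes Q n i j)"
  show "c x = \<zero>\<^bsub>K\<^esub>"
  proof (cases "x \<in> cochain_basis m")
    case False
    thus ?thesis using c by (simp add: finsupp_def)
  next
    case X: True
    obtain p q where x: "x = (p, q)" by (cases x)
    define j where "j = path_length p"
    have xP: "x \<in> PP j (n * i)" "j < n" using X gm unfolding x cochain_basis_PP by (simp_all add: j_def)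
    show ?thesis
    proof (cases "j = 0")
      case True
      thus ?thesis unfolding x by (intro cocycle_vertex_zero[OF con nb m(2) c d]) (simp add: j_def)
    next
      case j0: False
      have jm: "j \<in> {1..n-1}" unfolding atLeastAtMost_iff using j0 xP(2) by linarith
      have jn: "j \<noteq> n - 1"
      proof
        assume "j = n - 1"
        hence "{x} \<in> extremes Q n i j" using xP n2 by (simp add: extremes_def)
        thus False using off[OF jm] by blast
      qed
      hence Sj: "Suc j < n" using xP by simp
      let ?C = "mveq j (n * i) `` {x}"
      have xC: "x \<in> ?C" using xP by (simp add: mveq_iff)
      have "?C \<in> PP j (n * i) // mveq j (n * i)" by (rule quotientI[OF xP(1)])
      moreover have "?C \<notin> extremes Q n i j" using off[OF jm] xC by blast
      ultimately obtain y where y: "y \<in> ?C"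
        "plus_extreme Q y \<and> \<not> ends_at_sink Q y \<or> minus_extreme Q y \<and> \<not> starts_at_source Q y"
        using j0 jn unfolding extremes_def by auto
      obtain p' q' where yy: "y = (p', q')" by (cases y)
      have yP: "p' \<in> paths Q" "q' \<in> paths Q" "path_length p' = j" "path_length q' = n * i" "fst p' = fst q'" "trm p' = trm q'"
        using y(1) unfolding yy by (auto simp: mveq_iff PP_iff)
      have ne: "snd p' \<noteq> []" "snd q' \<noteq> []" using yP(3,4) j0 ni by auto
      have "c y = \<zero>\<^bsub>K\<^esub>" using y(2)
      proof
        assume h: "plus_extreme Q y \<and> \<not> ends_at_sink Q y"
        hence st: "hd (snd p') \<noteq> hd (snd q')" using ne by (auto simp: yy plus_extreme_def starts_together_def)
        have "trm p' \<in> verts Q" using vertex_paths(2)[OF yP(1)] by (simp add: paths_Nil)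
        then obtain b where b: "b \<in> arcs Q" "tail Q b = trm p'"
          using h by (auto simp: yy ends_at_sink_def is_sink_def)
        let ?e = "(tail Q b, [b])"
        let ?z = "(pcat p' ?e, pcat q' ?e)"
        have z: "?z \<in> PP (Suc j) (Suc (n * i))"
          using paths_pcat[OF yP(1) arc_path[OF b(1)]] paths_pcat[OF yP(2) arc_path[OF b(1)]] b yP
            trm_pcat[of p' ?e] trm_pcat[of q' ?e] by (simp add: PP_iff)
        have "\<not> starts_together ?z" using st ne by (simp add: starts_together_def)
        moreover have "ends_together ?z" by (simp add: ends_together_def)
        moreover have "drop_last ?z = y" by (simp add: drop_last_def yy ptake_pcat_le ptake_all)
        ultimately show ?thesis using de[OF z Sj] cc by (simp add: a_minus_def)
      next
        assume h: "minus_extreme Q y \<and> \<not> starts_at_source Q y"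
        hence st: "last (snd p') \<noteq> last (snd q')" using ne by (auto simp: yy minus_extreme_def ends_together_def)
        have "fst p' \<in> verts Q" using vertex_paths(1)[OF yP(1)] by (simp add: paths_Nil)
        then obtain b where b: "b \<in> arcs Q" "head Q b = fst p'"
          using h by (auto simp: yy starts_at_source_def is_source_def)
        let ?e = "(tail Q b, [b])"
        let ?z = "(pcat ?e p', pcat ?e q')"
        have te: "trm ?e = fst p'" using b(2) by (simp add: trm_Cons)
        have z: "?z \<in> PP (Suc j) (Suc (n * i))"
          using paths_pcat[OF arc_path[OF b(1)] yP(1)] paths_pcat[OF arc_path[OF b(1)] yP(2)] te yP
            trm_pcat[of ?e p'] trm_pcat[of ?e q'] by (simp add: PP_iff)
        have "\<not> ends_together ?z" using st ne by (simp add: ends_together_def)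
        moreover have "starts_together ?z" by (simp add: starts_together_def)
        moreover have "drop_first ?z = y"
          using pdrop_pcat_Cons[of b p' 0 "tail Q b"] pdrop_pcat_Cons[of b q' 0 "tail Q b"] b(2) yP(5)
          by (simp add: drop_first_def yy pdrop_0)
        ultimately show ?thesis using de[OF z Sj] cc by (simp add: a_minus_def)
      qed
      moreover have "c x = c y" by (rule const[OF _ Sj]) (use y(1) in simp)
      ultimately show ?thesis by simp
    qed
  qed
qed

text \<open>If \<open>z\<close> starts and ends together, its shortenings are one movement apart and
  lie in the same class. If it only starts together, \<open>drop_first z\<close> is a
  \<open>-\<close>extreme, but the removed arrow ends at its origin, which is therefore no source:
  it belongs to no extreme, and \<open>c\<close> vanishes there. The other side is dual.\<close>

lemma even_kernel_conv:
  assumes m: "even m" "0 < m" and c: "c \<in> finsupp K (cochain_basis m)"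
  defines "i \<equiv> m div 2"
  assumes const: "\<And>j C x y. j \<in> {1..n-1} \<Longrightarrow> C \<in> extremes Q n i j \<Longrightarrow> x \<in> C \<Longrightarrow> y \<in> C \<Longrightarrow> c x = c y"
    and off: "\<And>x. (\<And>j. j \<in> {1..n-1} \<Longrightarrow> x \<notin> \<Union>(extremes Q n i j)) \<Longrightarrow> c x = \<zero>\<^bsub>K\<^esub>"
  shows "cochain_diff m c z = \<zero>\<^bsub>K\<^esub>"
proof (cases "z \<in> cochain_basis (Suc m)")
  case False
  thus ?thesis using cochain_diff_closed[OF c] by (simp add: finsupp_def)
next
  case zX: True
  have cc: "c x \<in> carrier K" for x using c by (simp add: finsupp_def)
  have gm: "gen_length m = n * i" using gen_length_eqs(1)[OF m(1)] by (simp add: i_def)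
  have ni: "0 < n * i" using m n2 by (auto simp: i_def elim!: evenE)
  obtain P G where z: "z = (P, G)" by (cases z)
  have zP: "z \<in> PP (path_length P) (Suc (n * i))" "path_length P < n"
    using zX gen_length_even[OF m(1)] gm unfolding z cochain_basis_PP by simp_all
  hence PG: "P \<in> paths Q" "G \<in> paths Q" "path_length G = Suc (n * i)" "fst P = fst G" "trm P = trm G"
    unfolding z PP_iff by simp_all
  have len: "path_length (fst (drop_first z)) = path_length P - 1" "path_length (fst (drop_last z)) = path_length P - 1"
    by (simp_all add: drop_first_def drop_last_def z)
  \<comment> \<open>Extremes for \<open>j\<close> contain only pairs whose first path has length
    \<open>j\<close>, so a single family has to be tested.\<close>
  have offI: "c x = \<zero>\<^bsub>K\<^esub>" if no: "\<And>C. C \<in> extremes Q n i (path_length (fst x)) \<Longrightarrow> x \<notin> C" for x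
  proof (rule off)
    fix j assume "j \<in> {1..n-1}"
    show "x \<notin> \<Union>(extremes Q n i j)"
    proof
      assume "x \<in> \<Union>(extremes Q n i j)"
      then obtain C where C: "C \<in> extremes Q n i j" "x \<in> C" by blast
      have "path_length (fst x) = j" using extremes_PP[OF C] by (auto simp: parallel_paths_def)
      thus False using no[of C] C by simp
    qed
  qed
  have dz: "cochain_diff m c z = (if starts_together z then c (drop_first z) else \<zero>\<^bsub>K\<^esub>) \<ominus>\<^bsub>K\<^esub> (if ends_together z then c (drop_last z) else \<zero>\<^bsub>K\<^esub>)"
    by (rule cochain_diff_even'[OF m(1) c zX])
  show ?thesis
  proof (cases "path_length P \<le> 1")
    case True
    \<comment> \<open>Both shortenings have a vertex in front, and there are no 0-extremes.\<close>
    have "c (drop_first z) = \<zero>\<^bsub>K\<^esub>" "c (drop_last z) = \<zero>\<^bsub>K\<^esub>"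
      by (rule offI, use len True in \<open>simp add: extremes_def\<close>)+
    thus ?thesis unfolding dz by (simp add: a_minus_def)
  next
    case False
    define j where "j = path_length P - 1"
    have j: "path_length P = Suc j" "0 < j" "Suc j < n" "j \<noteq> n - 1" "j \<in> {1..n-1}" using False zP(2) by (auto simp: j_def)
    have zj: "z \<in> PP (Suc j) (Suc (n * i))" using zP(1) j(1) by simp
    have lj: "path_length (fst (drop_first z)) = j" "path_length (fst (drop_last z)) = j" using len j(1) by simp_all
    have ex: "(\<forall>x\<in>C. plus_extreme Q x \<longrightarrow> ends_at_sink Q x) \<and> (\<forall>x\<in>C. minus_extreme Q x \<longrightarrow> starts_at_source Q x)"
      if "C \<in> extremes Q n i j" for C
      using that j by (auto simp: extremes_def split: if_splits)
    obtain a p where P1: "snd P = a # p" "length p = j" using j(1) by (cases "snd P") auto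
    obtain a' q where G1: "snd G = a' # q" "length q = n * i" using PG(3) by (cases "snd G") auto
    have aP: "(fst P, a # p) \<in> paths Q" using PG(1) P1(1) by (metis prod.collapse)
    have ne: "p \<noteq> []" "q \<noteq> []" using P1 G1 j(2) ni by auto
    show ?thesis
    proof (cases "starts_together z \<and> ends_together z")
      case True
      have eqv: "(drop_last z, drop_first z) \<in> mveq j (n * i)" by (rule mveq_LR[OF zj]) (use True j ni in auto)
      have "c (drop_first z) = c (drop_last z)"
      proof (cases "\<exists>C\<in>extremes Q n i j. drop_last z \<in> C")
        case True
        then obtain C where C: "C \<in> extremes Q n i j" "drop_last z \<in> C" by blast
        have "drop_first z \<in> C" by (rule extremes_closed[OF C j(4)]) (use eqv in simp)
        thus ?thesis by (rule const[OF j(5) C(1) _ C(2)])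
      next
        case F: False
        have "drop_first z \<notin> C" if C: "C \<in> extremes Q n i j" for C
        proof
          assume "drop_first z \<in> C"
          hence "drop_last z \<in> C" by (rule extremes_closed[OF C _ j(4)]) (use eqv in simp)
          thus False using F C by blast
        qed
        hence "c (drop_first z) = \<zero>\<^bsub>K\<^esub>" by (intro offI) (simp add: lj)
        moreover have "c (drop_last z) = \<zero>\<^bsub>K\<^esub>" by (intro offI) (use F in \<open>auto simp: lj\<close>)
        ultimately show ?thesis by simp
      qed
      thus ?thesis unfolding dz using True cc by (simp add: a_minus_def K.r_neg)
    next
      case False
      have R0: "c (drop_first z) = \<zero>\<^bsub>K\<^esub>" if "starts_together z"
      proof (rule offI, unfold lj, rule notI)
        fix C assume C: "C \<in> extremes Q n i j" "drop_first z \<in> C"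
        have "last (snd P) \<noteq> last (snd G)" using that False P1 G1 by (simp add: z ends_together_def)
        hence "minus_extreme Q (drop_first z)" using P1 G1 ne by (simp add: minus_extreme_def ends_together_def drop_first_def z)
        hence "starts_at_source Q (drop_first z)" using ex[OF C(1)] C(2) by blast
        moreover have "a \<in> arcs Q" "fst (fst (drop_first z)) = head Q a"
          using aP P1(1) trm_Cons[of "fst P" a "[]"] by (simp_all add: paths_Cons drop_first_def z ptake_def)
        ultimately show False by (auto simp: starts_at_source_def is_source_def)
      qed
      have L0: "c (drop_last z) = \<zero>\<^bsub>K\<^esub>" if "ends_together z"
      proof (rule offI, unfold lj, rule notI)
        fix C assume C: "C \<in> extremes Q n i j" "drop_last z \<in> C"
        have "hd (snd P) \<noteq> hd (snd G)" using that False P1 G1 by (simp add: z starts_together_def)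
        hence "plus_extreme Q (drop_last z)" using P1 G1 ne by (simp add: plus_extreme_def starts_together_def drop_last_def z take_Cons')
        hence "ends_at_sink Q (drop_last z)" using ex[OF C(1)] C(2) by blast
        moreover obtain b p' where pb: "p = p' @ [b]" using ne(1) by (cases p rule: rev_cases) auto
        have "(fst P, (a # p') @ [b]) \<in> paths Q" using aP pb by simp
        hence "b \<in> arcs Q" "trm (fst P, a # p') = tail Q b" unfolding paths_append paths_Cons by blast+
        moreover have "fst (drop_last z) = (fst P, a # p')" using P1(1) pb by (simp add: drop_last_def z ptake_def)
        ultimately show False by (auto simp: ends_at_sink_def is_sink_def split_beta)
      qed
      show ?thesis unfolding dz using False R0 L0 by (auto simp: a_minus_def)
    qed
  qed
qed

lemma ker_dim_even:
  assumes con: "connected Q" and nb: "\<not> is_basic_cycle Q" and m: "even m" "0 < m"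
  shows "ker_dim m = (\<Sum>j=1..n-1. card (extremes Q n (m div 2) j))"
proof -
  let ?i = "m div 2"
  let ?E = "\<Union>j\<in>{1..n-1}. extremes Q n ?i j"
  have gm: "gen_length m = n * ?i" using gen_length_eqs(1)[OF m(1)] .
  have eq: "{c \<in> finsupp K (cochain_basis m). cochain_diff m c = (\<lambda>_. \<zero>\<^bsub>K\<^esub>)} =
      {c \<in> finsupp K (cochain_basis m). (\<forall>C\<in>?E. \<forall>x\<in>C. \<forall>y\<in>C. c x = c y) \<and> (\<forall>x. x \<notin> \<Union>?E \<longrightarrow> c x = \<zero>\<^bsub>K\<^esub>)}"
    (is "?L = ?R")
  proof (intro equalityI subsetI)
    fix c assume "c \<in> ?L"
    hence c: "c \<in> finsupp K (cochain_basis m)" and d: "cochain_diff m c = (\<lambda>_. \<zero>\<^bsub>K\<^esub>)" by simp_all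
    have "c x = c y" if C: "j \<in> {1..n-1}" "C \<in> extremes Q n ?i j" "x \<in> C" "y \<in> C" for j C x y
    proof (cases "j = n - 1")
      case True
      thus ?thesis using C n2 by (auto simp: extremes_def split: if_splits)
    next
      case False
      hence "C \<in> PP j (n * ?i) // mveq j (n * ?i)" using C by (auto simp: extremes_def split: if_splits)
      hence "(x, y) \<in> mveq j (n * ?i)" using in_quotient_imp_in_rel[OF mveq_equiv] C(3,4) by blast
      thus ?thesis by (rule mveq_const[OF con nb m c d]) (use False C(1) in auto)
    qed
    moreover have "c x = \<zero>\<^bsub>K\<^esub>" if "x \<notin> \<Union>?E" for x
      by (rule zero_off_extremes[OF con nb m c d]) (use that in blast)
    ultimately show "c \<in> ?R" using c by blast
  next
    fix c assume "c \<in> ?R"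
    hence c: "c \<in> finsupp K (cochain_basis m)" and k: "\<And>C x y. C \<in> ?E \<Longrightarrow> x \<in> C \<Longrightarrow> y \<in> C \<Longrightarrow> c x = c y"
      and z: "\<And>x. x \<notin> \<Union>?E \<Longrightarrow> c x = \<zero>\<^bsub>K\<^esub>" by blast+
    have "cochain_diff m c x = \<zero>\<^bsub>K\<^esub>" for x
    proof (rule even_kernel_conv[OF m c])
      show "c x = c y" if "j \<in> {1..n-1}" "C \<in> extremes Q n ?i j" "x \<in> C" "y \<in> C" for j C x y
        by (rule k[OF _ that(3,4)]) (use that(1,2) in blast)
      show "c x = \<zero>\<^bsub>K\<^esub>" if "\<And>j. j \<in> {1..n-1} \<Longrightarrow> x \<notin> \<Union>(extremes Q n ?i j)" for x
        by (rule z) (use that in blast)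
    qed
    thus "c \<in> ?L" using c by (simp add: fun_eq_iff)
  qed
  have "ker_dim m = card ?E" unfolding ker_dim_def eq
  proof (rule dim_class_functions[OF K.field_axioms finite_cochain_basis])
    fix C assume "C \<in> ?E"
    then obtain j where j: "j \<in> {1..n-1}" "C \<in> extremes Q n ?i j" by blast
    have "C \<subseteq> cochain_basis m"
    proof
      fix x assume x: "x \<in> C"
      obtain p q where pq: "x = (p, q)" by (cases x)
      have "x \<in> PP j (gen_length m)" using extremes_PP[OF j(2) x] gm by simp
      moreover from this have "path_length p = j" by (simp add: pq PP_iff)
      moreover have "j < n" using j(1) n2 by auto
      ultimately show "x \<in> cochain_basis m" unfolding pq cochain_basis_PP by simp
    qed
    thus "C \<subseteq> cochain_basis m \<and> C \<noteq> {}" using extremes_nonempty[OF j(2)] by simp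
  next
    fix C D x assume "C \<in> ?E" "D \<in> ?E" "x \<in> C" "x \<in> D"
    thus "C = D" using extremes_disjoint[of C ?i _ D _ x] by blast
  qed
  also have "\<dots> = (\<Sum>j=1..n-1. card (extremes Q n ?i j))" by (rule card_extremes_Union)
  finally show ?thesis .
qed

section \<open>Degree zero\<close>

lemma center_closed: "z \<in> center A \<Longrightarrow> z \<in> carrier A"
  and center_comm: "z \<in> center A \<Longrightarrow> a \<in> carrier A \<Longrightarrow> z \<otimes>\<^bsub>A\<^esub> a = a \<otimes>\<^bsub>A\<^esub> z"
  by (simp_all add: center_def)

lemma center_submod: "submod K (center A) A"
  unfolding submod_def center_def
  by (auto simp: BA.A.l_distr BA.A.r_distr BA.KA.lsmult_closed BA.smult_mult_l BA.smult_mult_r)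

lemma center_module: "left_module K (center_space A)"
  by (rule left_module.submod_module[OF BA.KA.left_module_axioms center_submod])

text \<open>Centrality is what lets \<open>z\<close> pass the left factor \<open>b\<close>; the
  right factor needs associativity alone.\<close>

lemma center_mult_hom:
  assumes z: "z \<in> center A"
  shows "(\<lambda>x\<in>carrier A. z \<otimes>\<^bsub>A\<^esub> x) \<in> lin_homs Env RB RB"
proof -
  note zc = center_closed[OF z]
  have "(\<lambda>x\<in>carrier A. z \<otimes>\<^bsub>A\<^esub> x) \<in> lin_homs Env (env_module K A (\<lambda>b x a. b \<otimes>\<^bsub>A\<^esub> x \<otimes>\<^bsub>A\<^esub> a)) RB"
  proof (rule RM.env_lin_homsI[OF RB_module])
    fix a b x assume h: "a \<in> carrier A" "b \<in> carrier A" "x \<in> carrier A"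
    have "z \<otimes>\<^bsub>A\<^esub> (b \<otimes>\<^bsub>A\<^esub> x \<otimes>\<^bsub>A\<^esub> a) = (z \<otimes>\<^bsub>A\<^esub> b) \<otimes>\<^bsub>A\<^esub> x \<otimes>\<^bsub>A\<^esub> a" using h zc by (simp add: BA.A.m_assoc)
    also have "\<dots> = b \<otimes>\<^bsub>A\<^esub> (z \<otimes>\<^bsub>A\<^esub> x) \<otimes>\<^bsub>A\<^esub> a" unfolding center_comm[OF z h(2)] using h zc by (simp add: BA.A.m_assoc)
    finally show "z \<otimes>\<^bsub>A\<^esub> (b \<otimes>\<^bsub>A\<^esub> x \<otimes>\<^bsub>A\<^esub> a) = BA.tens a b \<odot>\<^bsub>RB\<^esub> (z \<otimes>\<^bsub>A\<^esub> x)"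
      using h zc by (simp add: RB_tens)
  qed (use zc in \<open>simp_all add: RB_simps BA.A.r_distr\<close>)
  thus ?thesis by (simp only: regular_bimodule_eq)
qed

context
  fixes P :: "nat \<Rightarrow> ((('v \<times> 'e list \<Rightarrow> 'k) set \<times> ('v \<times> 'e list \<Rightarrow> 'k) set \<Rightarrow> 'k) set, 'p) module" and d \<epsilon>
  assumes PR: "proj_res Env RB P d \<epsilon>"
begin

text \<open>The cocycle behind \<open>center_to_HH0\<close>, formed for an arbitrary projective
  resolution.\<close>

definition zeta where "zeta z = (\<lambda>x\<in>carrier (P 0). z \<otimes>\<^bsub>A\<^esub> \<epsilon> x)"

lemma res_facts:
  shows "projective Env (P m)" and "left_module Env (P m)" and "d m \<in> lin_homs Env (P (Suc m)) (P m)"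
    and eps_hom: "\<epsilon> \<in> lin_homs Env (P 0) RB"
    and eps_surj: "\<epsilon> ` carrier (P 0) = carrier A"
    and eps_ker: "{x \<in> carrier (P 0). \<epsilon> x = \<zero>\<^bsub>A\<^esub>} = d 0 ` carrier (P 1)"
  using proj_res.res[OF PR] by (simp_all add: projective_resolution_def projective_def RB_simps)

lemma eps_closed: "x \<in> carrier (P 0) \<Longrightarrow> \<epsilon> x \<in> carrier A"
  using lin_homs_closed[OF eps_hom] by (simp add: RB_simps)

lemma zeta_cocyc: assumes z: "z \<in> center A" shows "zeta z \<in> cocyc Env P d RB 0"
proof -
  have "(\<lambda>x\<in>carrier (P 0). (\<lambda>x\<in>carrier A. z \<otimes>\<^bsub>A\<^esub> x) (\<epsilon> x)) \<in> lin_homs Env (P 0) RB"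
    by (rule lin_homs_compose[OF res_facts(2) eps_hom center_mult_hom[OF z]])
  moreover have "(\<lambda>x\<in>carrier (P 0). (\<lambda>x\<in>carrier A. z \<otimes>\<^bsub>A\<^esub> x) (\<epsilon> x)) = zeta z"
    unfolding zeta_def by (rule restrict_ext) (simp add: eps_closed)
  ultimately have h: "zeta z \<in> lin_homs Env (P 0) RB" by simp
  have "zeta z (d 0 x) = \<zero>\<^bsub>RB\<^esub>" if x: "x \<in> carrier (P (Suc 0))" for x
  proof -
    have "d 0 x \<in> {x \<in> carrier (P 0). \<epsilon> x = \<zero>\<^bsub>A\<^esub>}" unfolding eps_ker using x by simp
    thus ?thesis using center_closed[OF z] by (simp add: zeta_def RB_simps)
  qed
  thus ?thesis using h by (simp add: cocyc_def)
qed

lemma unit_lift: obtains e where "e \<in> carrier (P 0)" "\<epsilon> e = \<one>\<^bsub>A\<^esub>"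
proof -
  have "\<one>\<^bsub>A\<^esub> \<in> \<epsilon> ` carrier (P 0)" unfolding eps_surj by (rule BA.A.one_closed)
  thus thesis by (rule imageE) (use that in simp)
qed

text \<open>A cocycle of degree 0 kills the kernel of the augmentation, so its value at
  \<open>x\<close> depends on \<open>\<epsilon> x\<close> only. With \<open>e\<close> lifting the
  unit, such a cocycle is determined by \<open>z = f e\<close>.\<close>

lemma zeta_bij: "bij_betw zeta (center A) (cocyc Env P d RB 0)"
proof -
  obtain e where e: "e \<in> carrier (P 0)" "\<epsilon> e = \<one>\<^bsub>A\<^esub>" by (rule unit_lift)
  have ze: "zeta z e = z" if "z \<in> center A" for z
    using center_closed[OF that] e by (simp add: zeta_def)
  have inj: "inj_on zeta (center A)"
  proof (rule inj_onI)
    fix z z' assume h: "z \<in> center A" "z' \<in> center A" "zeta z = zeta z'"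
    have "zeta z e = zeta z' e" using h(3) by simp
    thus "z = z'" using ze h(1,2) by simp
  qed
  have surj: "\<exists>z\<in>center A. f = zeta z" if "f \<in> cocyc Env P d RB 0" for f
  proof -
    have f: "f \<in> lin_homs Env (P 0) RB" and fd: "\<And>x. x \<in> carrier (P (Suc 0)) \<Longrightarrow> f (d 0 x) = \<zero>\<^bsub>A\<^esub>"
      using that by (simp_all add: cocyc_def RB_simps)
    define z where "z = f e"
    have zc: "z \<in> carrier A" using lin_homs_closed[OF f e(1)] by (simp add: z_def RB_simps)
    interpret P0: left_module Env "P 0" by (rule res_facts(2))
    \<comment> \<open>\<open>x\<close> and the multiple of \<open>e\<close> by
      \<open>a \<otimes> b\<close> have the same augmentation, so they differ by an element in the
      image of \<open>d 0\<close>, which \<open>f\<close> annihilates.\<close>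
    have val: "f x = b \<otimes>\<^bsub>A\<^esub> z \<otimes>\<^bsub>A\<^esub> a"
      if x: "x \<in> carrier (P 0)" and ab: "a \<in> carrier A" "b \<in> carrier A" "\<epsilon> x = b \<otimes>\<^bsub>A\<^esub> a" for x a b
    proof -
      let ?y = "BA.tens a b \<odot>\<^bsub>P 0\<^esub> e"
      have t: "BA.tens a b \<in> carrier Env" using ab by (simp add: BA.tens_closed)
      have y: "?y \<in> carrier (P 0)" by (rule P0.lsmult_closed[OF t e(1)])
      have ey: "\<epsilon> ?y = \<epsilon> x"
        using lin_homs_smult[OF eps_hom t e(1)] ab by (simp add: e(2) RB_tens)
      have "\<epsilon> (x \<ominus>\<^bsub>P 0\<^esub> ?y) = \<epsilon> x \<ominus>\<^bsub>RB\<^esub> \<epsilon> ?y" by (rule lin_homs_minus[OF res_facts(2) RB_module eps_hom x y])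
      also have "\<dots> = \<zero>\<^bsub>A\<^esub>" unfolding ey using RB_minus eps_closed[OF x] by (simp add: a_minus_def BA.A.r_neg)
      finally have "x \<ominus>\<^bsub>P 0\<^esub> ?y \<in> d 0 ` carrier (P 1)"
        unfolding eps_ker[symmetric] using P0.M.minus_closed[OF x y] by simp
      hence 0: "f (x \<ominus>\<^bsub>P 0\<^esub> ?y) = \<zero>\<^bsub>A\<^esub>" by (rule imageE) (simp add: fd)
      have "f x = f ((x \<ominus>\<^bsub>P 0\<^esub> ?y) \<oplus>\<^bsub>P 0\<^esub> ?y)" using P0.M.minus_plus[OF x y] by simp
      also have "\<dots> = f (x \<ominus>\<^bsub>P 0\<^esub> ?y) \<oplus>\<^bsub>A\<^esub> f ?y"
        using lin_homs_add[OF f P0.M.minus_closed[OF x y] y] by (simp add: RB_simps)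
      also have "f ?y = b \<otimes>\<^bsub>A\<^esub> z \<otimes>\<^bsub>A\<^esub> a"
        using lin_homs_smult[OF f t e(1)] ab zc by (simp add: z_def[symmetric] RB_tens)
      finally show ?thesis using ab zc by (simp add: 0)
    qed
    \<comment> \<open>The two trivial factorisations of \<open>\<epsilon> x\<close>, with the unit
      on the left or on the right, give both expressions; comparing them makes \<open>z\<close>
      central.\<close>
    have fz: "f x = z \<otimes>\<^bsub>A\<^esub> \<epsilon> x" "f x = \<epsilon> x \<otimes>\<^bsub>A\<^esub> z" if x: "x \<in> carrier (P 0)" for x
      using val[OF x eps_closed[OF x] BA.A.one_closed] val[OF x BA.A.one_closed eps_closed[OF x]] eps_closed[OF x] zc by simp_all
    have "z \<otimes>\<^bsub>A\<^esub> a = a \<otimes>\<^bsub>A\<^esub> z" if "a \<in> carrier A" for a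
    proof -
      have "a \<in> \<epsilon> ` carrier (P 0)" unfolding eps_surj by (rule that)
      then obtain x where x: "x \<in> carrier (P 0)" "a = \<epsilon> x" by (rule imageE) 
      show ?thesis unfolding x(2) fz(1)[OF x(1), symmetric] by (rule fz(2)[OF x(1)])
    qed
    hence "z \<in> center A" using zc by (simp add: center_def)
    moreover have "f = zeta z"
      by (rule lin_homs_ext[OF f]) (use zeta_cocyc[OF \<open>z \<in> center A\<close>] fz in \<open>simp_all add: cocyc_def zeta_def\<close>)
    ultimately show ?thesis by blast
  qed
  show ?thesis unfolding bij_betw_def
  proof
    show "zeta ` center A = cocyc Env P d RB 0"
    proof (intro equalityI subsetI)
      fix f assume "f \<in> cocyc Env P d RB 0"
      then obtain z where "z \<in> center A" "f = zeta z" by (rule bexE[OF surj])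
      thus "f \<in> zeta ` center A" by simp
    qed (use zeta_cocyc in blast)
  qed (rule inj)
qed

lemma zeta_add:
  assumes "z \<in> center A" "z' \<in> center A"
  shows "zeta (z \<oplus>\<^bsub>A\<^esub> z') = zeta z \<oplus>\<^bsub>hom_space Env (P 0) RB\<^esub> zeta z'"
  using assms unfolding zeta_def hom_space_def
  by (auto simp: RB_simps center_closed eps_closed BA.A.l_distr intro!: restrict_ext)

lemma zeta_smult:
  assumes "z \<in> center A" "c \<in> carrier K"
  shows "zeta (c \<odot>\<^bsub>A\<^esub> z) = c \<odot>\<^bsub>hom_space Env (P 0) RB\<^esub> zeta z"
  using assms unfolding zeta_def hom_space_def
  by (auto simp: RB_scal center_closed eps_closed BA.smult_mult_l intro!: restrict_ext)

end

lemma center_HH0: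
  shows "linear_map K (center_space A) (HH K A 0) (center_to_HH0 K A)"
    and "bij_betw (center_to_HH0 K A) (center A) (carrier (HH K A 0))"
proof -
  interpret E: ext_algebra K Env RB RB by (rule ext_algebra_RB)
  let ?P = "res_module Env RB" and ?d = "res_diff Env RB" and ?\<epsilon> = "res_aug Env RB"
  let ?Z = "cocycles Env RB RB 0" and ?B = "coboundaries Env RB RB 0"
  have PR: "proj_res Env RB ?P ?d ?\<epsilon>" by (rule proj_res_resolution[OF RB_module])
  define ze where "ze = zeta ?P ?\<epsilon>"
  note bij = zeta_bij[OF PR, folded ze_def]
  note add = zeta_add[OF PR, folded ze_def] and sm = zeta_smult[OF PR, folded ze_def]
  have c0: "center_to_HH0 K A z = ?B +>\<^bsub>?Z\<^esub> ze z" for z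
    unfolding center_to_HH0_def Let_def ze_def zeta_def[OF PR] by (rule refl)
  have car: "carrier ?Z = cocyc Env ?P ?d RB 0" unfolding E.cocycles_eq by simp
  have zc: "ze z \<in> carrier ?Z" if "z \<in> center A" for z
    unfolding car using bij_betwE[OF bij] that by blast
  interpret Z: left_module K ?Z by (rule E.cocycles_module)
  \<comment> \<open>No coboundaries in degree 0: distinct cocycles have distinct classes.\<close>
  have B: "?B = {\<zero>\<^bsub>?Z\<^esub>}"
    unfolding coboundaries_def cocycles_def by simp
  have HH: "HH K A 0 = Ext Env RB RB 0" by (simp add: HH_def)
  have T: "center_to_HH0 K A z \<in> carrier (HH K A 0)" if "z \<in> center A" for z
    unfolding c0 HH E.Ext_facts(2) by (rule imageI[OF zc[OF that]])
  show "linear_map K (center_space A) (HH K A 0) (center_to_HH0 K A)"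
  proof (rule linear_mapI[OF K.field_axioms center_module])
    show "left_module K (HH K A 0)" unfolding HH by (rule E.Ext_facts(1))
    fix z assume z: "z \<in> carrier (center_space A)"
    thus "center_to_HH0 K A z \<in> carrier (HH K A 0)" using T by simp
    show "center_to_HH0 K A (z \<oplus>\<^bsub>center_space A\<^esub> z') = center_to_HH0 K A z \<oplus>\<^bsub>HH K A 0\<^esub> center_to_HH0 K A z'"
      if "z' \<in> carrier (center_space A)" for z'
    proof -
      have zz: "z \<in> center A" "z' \<in> center A" using z that by simp_all
      have "ze (z \<oplus>\<^bsub>A\<^esub> z') = ze z \<oplus>\<^bsub>?Z\<^esub> ze z'" using add[OF zz] unfolding E.cocycles_eq by simp
      thus ?thesis unfolding c0 HH E.Ext_facts(3)[OF zc[OF zz(1)] zc[OF zz(2)]] by simp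
    qed
    show "center_to_HH0 K A (r \<odot>\<^bsub>center_space A\<^esub> z) = r \<odot>\<^bsub>HH K A 0\<^esub> center_to_HH0 K A z" if r: "r \<in> carrier K" for r
    proof -
      have zz: "z \<in> center A" using z by simp
      have "ze (r \<odot>\<^bsub>A\<^esub> z) = r \<odot>\<^bsub>?Z\<^esub> ze z" using sm[OF zz r] unfolding E.cocycles_eq by simp
      thus ?thesis unfolding c0 HH E.Ext_facts(4)[OF r zc[OF zz]] by simp
    qed
  qed
  show "bij_betw (center_to_HH0 K A) (center A) (carrier (HH K A 0))"
    unfolding bij_betw_def
  proof
    show "inj_on (center_to_HH0 K A) (center A)"
    proof (rule inj_onI)
      fix z z' assume h: "z \<in> center A" "z' \<in> center A" "center_to_HH0 K A z = center_to_HH0 K A z'"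
      have "ze z \<ominus>\<^bsub>?Z\<^esub> ze z' \<in> ?B"
        using h(3) E.Ext_facts(6)[OF zc[OF h(1)] zc[OF h(2)]] unfolding c0 by simp
      hence "ze z \<ominus>\<^bsub>?Z\<^esub> ze z' = \<zero>\<^bsub>?Z\<^esub>" unfolding B by simp
      hence "ze z = ze z'" using Z.M.minus_plus[OF zc[OF h(1)] zc[OF h(2)]] zc[OF h(2)] by simp
      thus "z = z'" using bij_betw_imp_inj_on[OF bij] h(1,2) by (simp add: inj_on_def)
    qed
    have "carrier (HH K A 0) = (\<lambda>f. ?B +>\<^bsub>?Z\<^esub> f) ` ze ` center A"
      unfolding HH E.Ext_facts(2) car using bij by (simp add: bij_betw_def)
    thus "center_to_HH0 K A ` center A = carrier (HH K A 0)" by (simp add: image_image c0)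
  qed
qed

text \<open>\<open>dim_eq\<close> asks for finite dimension of the source, which is known for
  \<open>HH K A 0\<close>. Hence the inverse of the canonical map is shown to be linear and used
  instead of the map itself.\<close>

lemma dim_center: "vectorspace.dim K (center_space A) = ker_dim 0"
proof -
  have bij: "bij_betw (center_to_HH0 K A) (carrier (center_space A)) (carrier (HH K A 0))"
    using center_HH0(2) by simp
  interpret L: linear_map K "center_space A" "HH K A 0" "center_to_HH0 K A" by (rule center_HH0(1))
  let ?g = "inv_into (carrier (center_space A)) (center_to_HH0 K A)"
  have bg: "bij_betw ?g (carrier (HH K A 0)) (carrier (center_space A))" by (rule bij_betw_inv_into[OF bij])
  interpret G: linear_map K "HH K A 0" "center_space A" ?g
  proof (rule linear_mapI[OF K.field_axioms _ center_module])
    interpret E: ext_algebra K Env RB RB by (rule ext_algebra_RB)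
    show "left_module K (HH K A 0)" unfolding HH_def by (rule E.Ext_facts(1))
    have gc: "?g x \<in> carrier (center_space A)" if "x \<in> carrier (HH K A 0)" for x using bij_betwE[OF bg] that by blast
    have fg: "center_to_HH0 K A (?g x) = x" if "x \<in> carrier (HH K A 0)" for x
      by (rule bij_betw_inv_into_right[OF bij that])
    have gf: "?g (center_to_HH0 K A z) = z" if "z \<in> carrier (center_space A)" for z
      by (rule bij_betw_inv_into_left[OF bij that])
    fix x assume x: "x \<in> carrier (HH K A 0)"
    show "?g x \<in> carrier (center_space A)" by (rule gc[OF x])
    show "?g (x \<oplus>\<^bsub>HH K A 0\<^esub> y) = ?g x \<oplus>\<^bsub>center_space A\<^esub> ?g y" if y: "y \<in> carrier (HH K A 0)" for y
    proof -
      have "center_to_HH0 K A (?g x \<oplus>\<^bsub>center_space A\<^esub> ?g y) = x \<oplus>\<^bsub>HH K A 0\<^esub> y"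
        using L.T_add[OF gc[OF x] gc[OF y]] unfolding fg[OF x] fg[OF y] .
      moreover have "?g x \<oplus>\<^bsub>center_space A\<^esub> ?g y \<in> carrier (center_space A)"
        by (rule abelian_monoid.a_closed[OF _ gc[OF x] gc[OF y]])
          (rule abelian_group.axioms(1)[OF left_module.axioms(2)[OF center_module]])
      ultimately show ?thesis using gf by metis
    qed
    show "?g (r \<odot>\<^bsub>HH K A 0\<^esub> x) = r \<odot>\<^bsub>center_space A\<^esub> ?g x" if r: "r \<in> carrier K" for r
    proof -
      have "center_to_HH0 K A (r \<odot>\<^bsub>center_space A\<^esub> ?g x) = r \<odot>\<^bsub>HH K A 0\<^esub> x"
        using L.T_smult[OF r gc[OF x]] unfolding fg[OF x] .
      moreover have "r \<odot>\<^bsub>center_space A\<^esub> ?g x \<in> carrier (center_space A)"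
        by (rule left_module.lsmult_closed[OF center_module r gc[OF x]])
      ultimately show ?thesis using gf by metis
    qed
  qed
  have "vectorspace.dim K (HH K A 0) = vectorspace.dim K (center_space A)"
    by (rule G.dim_eq[OF HH_dim(2)]) (use bg in \<open>simp_all add: bij_betw_def\<close>)
  thus ?thesis using HH_dim(3) by simp
qed

text \<open>In each positive degree the dimension is the sum of two consecutive kernel dimensions
  minus the size of the lower cochain basis, and the closed forms come from cancelling these three
  quantities.\<close>

lemma HH_dim_formulas:
  assumes con: "connected Q" and nb: "\<not> is_basic_cycle Q"
  shows "int (vectorspace.dim K (HH K A 1)) = int (vectorspace.dim K (center_space A))
       - (\<Sum>j = 0..n-1. int (card (PP j 0))) + (\<Sum>j = 1..n-1. int (card (PP j 1)))"
    and "1 \<le> i \<Longrightarrow> int (vectorspace.dim K (HH K A (2 * i + 1))) =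
         (\<Sum>j = 1..n-1. int (card (PP j (n * i + 1))))
         - (\<Sum>j = 0..n-2. (int (card (PP j (n * i))) - int (card (extremes Q n i j))))"
    and "1 \<le> i \<Longrightarrow> int (vectorspace.dim K (HH K A (2 * i))) =
         (\<Sum>j = 1..n-1. int (card (extremes Q n i j))) - int (card (PP 0 (n * (i - 1) + 1)))"
proof -
  have gle: "gen_length (2 * i) = n * i" "gen_length (Suc (2 * i)) = n * i + 1" for i by (simp_all add: gen_length_def)
  have ko: "ker_dim (Suc (2 * i)) = (\<Sum>j=1..n-1. card (PP j (n * i + 1)))" for i
    using ker_dim_odd[OF con nb, of "Suc (2 * i)"] unfolding gle by simp
  have ke: "ker_dim (2 * i) = (\<Sum>j=1..n-1. card (extremes Q n i j))" if "1 \<le> i" for i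
    using ker_dim_even[OF con nb, of "2 * i"] that by simp
  have xe: "card (cochain_basis (2 * i)) = (\<Sum>j=0..n-1. card (PP j (n * i)))" for i
    using card_cochain_basis[of "2 * i"] unfolding gle .
  have xo: "card (cochain_basis (Suc (2 * i))) = card (PP 0 (n * i + 1)) + (\<Sum>j=1..n-1. card (PP j (n * i + 1)))" for i
    using card_cochain_basis[of "Suc (2 * i)"] unfolding gle by (simp add: sum.atLeast_Suc_atMost)
  have d1: "vectorspace.dim K (HH K A (Suc 0)) + (\<Sum>j=0..n-1. card (PP j 0)) = (\<Sum>j=1..n-1. card (PP j 1)) + ker_dim 0"
    using HH_dim(4)[of 0] ko[of 0] xe[of 0] by simp
  show "int (vectorspace.dim K (HH K A 1)) = int (vectorspace.dim K (center_space A))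
       - (\<Sum>j = 0..n-1. int (card (PP j 0))) + (\<Sum>j = 1..n-1. int (card (PP j 1)))"
    using arg_cong[OF d1, of int] by (simp add: dim_center)
  show "int (vectorspace.dim K (HH K A (2 * i + 1))) =
         (\<Sum>j = 1..n-1. int (card (PP j (n * i + 1))))
         - (\<Sum>j = 0..n-2. (int (card (PP j (n * i))) - int (card (extremes Q n i j))))" if i: "1 \<le> i"
  proof -
    obtain e where e: "n - 1 = Suc e" "n - 2 = e" using n2 by (intro that[of "n - 2"]) auto
    have d: "vectorspace.dim K (HH K A (Suc (2 * i))) + (\<Sum>j=0..n-1. card (PP j (n * i)))
        = (\<Sum>j=1..n-1. card (PP j (n * i + 1))) + (\<Sum>j=1..n-1. card (extremes Q n i j))"
      using HH_dim(4)[of "2 * i"] ko[of i] ke[OF i] xe[of i] by simp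
    \<comment> \<open>At \<open>j = n - 1\<close> every pair counts as an extreme, so this summand
      cancels against the cochain basis; at \<open>j = 0\<close> there are none, so both remaining
      sums can run from 0 to \<open>n - 2\<close>.\<close>
    have top: "card (extremes Q n i (Suc e)) = card (PP (Suc e) (n * i))"
      using e by (simp add: extremes_def card_image inj_on_def)
    have bot: "card (extremes Q n i 0) = 0" by (simp add: extremes_def)
    have "(\<Sum>j=0..n-1. card (PP j (n * i))) = card (PP (Suc e) (n * i)) + (\<Sum>j=0..e. card (PP j (n * i)))"
      unfolding e by simp
    moreover have "(\<Sum>j=1..n-1. card (extremes Q n i j)) = card (PP (Suc e) (n * i)) + (\<Sum>j=0..e. card (extremes Q n i j))"
    proof -
      have "(\<Sum>j=0..Suc e. card (extremes Q n i j)) = card (extremes Q n i 0) + (\<Sum>j=1..Suc e. card (extremes Q n i j))"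
        by (simp add: sum.atLeast_Suc_atMost del: sum.atLeast0_atMost_Suc)
      thus ?thesis unfolding e using top bot by simp
    qed
    ultimately show ?thesis using arg_cong[OF d, of int] unfolding e by (simp add: sum_subtractf)
  qed
  show "int (vectorspace.dim K (HH K A (2 * i))) =
         (\<Sum>j = 1..n-1. int (card (extremes Q n i j))) - int (card (PP 0 (n * (i - 1) + 1)))" if i: "1 \<le> i"
  proof -
    \<comment> \<open>The preceding odd degree is \<open>2 k + 1\<close>, and its kernel cancels the
      whole cochain basis except the pairs with a vertex in front.\<close>
    obtain k where k: "i = Suc k" using i by (cases i) auto
    have "2 * i = Suc (Suc (2 * k))" by (simp add: k)
    hence d: "vectorspace.dim K (HH K A (2 * i)) + card (cochain_basis (Suc (2 * k))) = ker_dim (2 * i) + ker_dim (Suc (2 * k))"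
      using HH_dim(4)[of "Suc (2 * k)"] by simp
    show ?thesis using arg_cong[OF d, of int] ko[of k] ke[OF i] xo[of k] k by simp
  qed
qed

end

theorem theorem2:
  fixes K :: "('k, 'c) ring_scheme"
    and Q :: "('v, 'a) pre_digraph"
    and n :: nat
    and A :: "('k, ('v \<times> 'a list \<Rightarrow> 'k) set) module"
  assumes "field K"
    and "fin_digraph Q"
    and "Digraph_Component.connected Q"
    and "n \<ge> 2"
    and "A = truncated_quiver_algebra K Q n"
    and "\<not> is_basic_cycle Q"
  shows
    "linear_map K (center_space A) (HH K A 0) (center_to_HH0 K A) \<and>
     bij_betw (center_to_HH0 K A) (center A) (carrier (HH K A 0)) \<and>
     (\<forall>m. vectorspace K (HH K A m) \<and> vectorspace.fin_dim K (HH K A m)) \<and>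
     int (vectorspace.dim K (HH K A 1)) =
       int (vectorspace.dim K (center_space A))
       - (\<Sum>j = 0..n-1. int (card (parallel_paths Q j 0)))
       + (\<Sum>j = 1..n-1. int (card (parallel_paths Q j 1))) \<and>
     (\<forall>i \<ge> 1.
       int (vectorspace.dim K (HH K A (2 * i + 1))) =
         (\<Sum>j = 1..n-1. int (card (parallel_paths Q j (n * i + 1))))
         - (\<Sum>j = 0..n-2. (int (card (parallel_paths Q j (n * i))) - int (card (extremes Q n i j)))) \<and>
       int (vectorspace.dim K (HH K A (2 * i))) =
         (\<Sum>j = 1..n-1. int (card (extremes Q n i j)))
         - int (card (parallel_paths Q 0 (n * (i - 1) + 1))))"
proof -
  interpret truncated_quiver Q K n
    using assms(1,2,4) by (intro truncated_quiver.intro truncated_quiver_axioms.intro)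
  show ?thesis
    unfolding assms(5) using center_HH0 HH_dim(1,2) HH_dim_formulas[OF assms(3,6)] by simp
qed

end
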